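(* Let $Y=Y(\Omega')$ be a UMD lattice, $1<p<\infty$, and $(\Omega,\mu)$ a $\sigma$-finite measure space. Let $A=A_0\otimes\mathrm{Id}_Y$ have a bounded $\mathcal H^\alpha_2$ calculus on $L^p(Y)$ for some $\alpha>\frac12$, and let $A_0$ generate a lattice positive and contractive semigroup $(e^{-tA_0})_{t\ge0}$ on $L^p(\Omega)$. Let $$\delta>\alpha+\max\Big(\tfrac12,\tfrac1{\mathrm{type}\,L^p(Y)}-\tfrac1{\mathrm{cotype}\,L^p(Y)}\Big)+\tfrac32 .$$ Then for any $f\in D(A^\delta)$, for a.e. $(x,\omega)\in\Omega\times\Omega'$ the function $(0,\infty)\to\mathbb C$, $t\mapsto\exp(itA)f(x,\omega)$, is continuous. Similarly, for a.e. $x\in\Omega$ the function $(0,\infty)\to Y$, $t\mapsto\exp(itA)f(x,\cdot)$, is continuous.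
   Context: UMD lattice: $Y=Y(\Omega')$ is a Banach space with the UMD property that is a Köthe function space over a $\sigma$-finite measure space $(\Omega',\mu')$: a Banach lattice of equivalence classes of locally integrable functions $\Omega'\to\mathbb C$ such that (i) if $f$ is measurable and $|f|\le|g|$ a.e. with $g\in Y$, then $f\in Y$ and $\|f\|_Y\le\|g\|_Y$; (ii) $1_B\in Y$ whenever $\mu'(B)<\infty$; (iii) ($\sigma$-Fatou) if $0\le f_k\nearrow f$ a.e. with $f_k \in Y$ and $\sup_k\|f_k\|_Y<\infty$, then $f\in Y$ and $\|f\|_Y=\lim_k\|f_k\|_Y$. $L^p(Y)=L^p(\Omega,Y)$, whose elements are regarded as functions of $(x,\omega)\in\Omega\times\Omega'$. A Banach space $X$ has type $r\in[1,2]$ if $\mathbb E\|\sum_n\epsilon_nx_n\|\le c(\sum_n\|x_n\|^r)^{1/r}$ and cotype $s\in[2,\infty]$ if $(\sum_n\|x_n\|^s)^{1/s}\le c\,\mathbb E\|\sum_n\epsilon_nx_n\|$ for all finite families ($\epsilon_n$ independent Rademacher variables); $\mathrm{type}\,X$, $\mathrm{cotype}\,X$ denote any fixed such exponents. For $\alpha>\frac12$, $\mathcal H^\alpha_2$ is the space of bounded $f:[0,\infty)\to\mathbb C$, continuous on $(0,\infty)$, with $\|f\|_{\mathcal H^\alpha_2}=|f(0)|+\sup_{R>0}\|\phi f(R\,\cdot)\|_{W^\alpha_2(\mathbb R)}<\infty$, $\phi\in C_c^\infty(0,\infty)$ any fixed nonzero function, $W^\alpha_2(\mathbb R)$ the usual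 $L^2$-Sobolev space. $\Sigma_\theta=\{z\ne0:|\arg z|<\theta\}$; $H^\infty(\Sigma_\theta)$ is the space of bounded analytic functions on $\Sigma_\theta$. $A$ is $0$-sectorial on $X$ if it is closed and densely defined, $\sigma(A)\subseteq[0,\infty)$, and $\sup_{\lambda\in\mathbb C\setminus\overline{\Sigma_\theta}}\|\lambda(\lambda-A)^{-1}\|<\infty$ for all $\theta\in(0,\pi)$. The holomorphic functional calculus is defined by Cauchy integrals as usual; for reflexive $X=\overline{R(A)}\oplus N(A)$ one sets $f(A)=f(A|_{\overline{R(A)}})\oplus f(0)\mathrm{Id}_{N(A)}$. A $0$-sectorial operator $A$ has a bounded $\mathcal H^\alpha_2$ calculus if for some $\theta\in(0,\pi)$, $\|f(A)\|\le C\|f\|_{\mathcal H^\alpha_2}$ for all $f\in H^\infty(\Sigma_\theta)$ (with $f(0)$ well defined); the calculus then extends to a bounded algebra homomorphism $\mathcal H^\alpha_2\to B(X)$, $m\mapsto m(A)$. Lattice positive: the operators map nonnegative functions to nonnegative functions. For $f\in D(A^\delta)$, $\exp(itA)f:=[(1+\lambda)^{-\delta}e^{it\lambda}](A)\,(1+A)^\delta f$, where $\lambda\mapsto(1+\lambda)^{-\delta}e^{it\lambda}$ belongs to $\mathcal H^\alpha_2$. The continuity statement means that for each $t$ one can choose a representative of $\exp(itA)f\in L^p(Y)$ such that for a.e. $(x,\omega)$ (resp. a.e. $x$) the stated function of $t$ is continuous. *)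

theory Defs
  imports "HOL-Probability.Conditional_Expectation"
begin

text \<open>
  Spaces of equivalence classes of complex functions are handled through representatives: a space
  consists of a set of functions (with pointwise operations) and a seminorm on it, and two elements
  are identified when their difference has seminorm 0.  Accordingly, operators are given by their
  graphs, which are relations on representatives.
\<close>

record 'a fspace =
  elems :: "('a \<Rightarrow> complex) set"
  nrm :: "('a \<Rightarrow> complex) \<Rightarrow> real"

definition ndist :: "'a fspace \<Rightarrow> ('a \<Rightarrow> complex) \<Rightarrow> ('a \<Rightarrow> complex) \<Rightarrow> real" where
  "ndist X f g = nrm X (\<lambda>a. f a - g a)"

definition banach_fspace :: "'a fspace \<Rightarrow> bool" where
  "banach_fspace X \<longleftrightarrow>
     (\<lambda>_. 0) \<in> elems X \<and>
     (\<forall>f\<in>elems X. \<forall>g\<in>elems X. (\<lambda>a. f a + g a) \<in> elems X \<and> nrm X (\<lambda>a. f a + g a) \<le> nrm X f + nrm X g) \<and>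
     (\<forall>c. \<forall>f\<in>elems X. (\<lambda>a. c * f a) \<in> elems X \<and> nrm X (\<lambda>a. c * f a) = cmod c * nrm X f) \<and>
     (\<forall>f\<in>elems X. 0 \<le> nrm X f) \<and>
     (\<forall>F. (\<forall>n::nat. F n \<in> elems X) \<longrightarrow>
          (\<forall>e>0. \<exists>n0. \<forall>m\<ge>n0. \<forall>n\<ge>n0. ndist X (F m) (F n) < e) \<longrightarrow>
          (\<exists>f\<in>elems X. (\<lambda>n. ndist X (F n) f) \<longlonglongrightarrow> 0))"

definition closure_in :: "'a fspace \<Rightarrow> ('a \<Rightarrow> complex) set \<Rightarrow> ('a \<Rightarrow> complex) set" where
  "closure_in X S = {f \<in> elems X. \<forall>e>0. \<exists>s\<in>S. ndist X f s < e}"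


section \<open>Concrete function spaces and Bochner integration\<close>

definition Lp :: "'x measure \<Rightarrow> real \<Rightarrow> 'x fspace" where
  "Lp M p = \<lparr> elems = {f \<in> borel_measurable M. (\<integral>\<^sup>+x. ennreal (cmod (f x) powr p) \<partial>M) < \<infinity>},
              nrm = (\<lambda>f. enn2real (\<integral>\<^sup>+x. ennreal (cmod (f x) powr p) \<partial>M) powr (1 / p)) \<rparr>"

definition koethe_space :: "'w measure \<Rightarrow> 'w fspace \<Rightarrow> bool" where
  "koethe_space N Y \<longleftrightarrow>
     banach_fspace Y \<and>
     (\<forall>f\<in>elems Y. f \<in> borel_measurable N \<and>
        (\<forall>B\<in>sets N. emeasure N B < \<infinity> \<longrightarrow> set_integrable N B f) \<and>
        (nrm Y f = 0 \<longrightarrow> (AE w in N. f w = 0))) \<and>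
     (\<forall>f\<in>borel_measurable N. \<forall>g\<in>elems Y. (AE w in N. cmod (f w) \<le> cmod (g w)) \<longrightarrow>
        f \<in> elems Y \<and> nrm Y f \<le> nrm Y g) \<and>
     (\<forall>B\<in>sets N. emeasure N B < \<infinity> \<longrightarrow> (\<lambda>w. indicator B w) \<in> elems Y) \<and>
     (\<forall>(F :: nat \<Rightarrow> 'w \<Rightarrow> real) (f :: 'w \<Rightarrow> real).
        f \<in> borel_measurable N \<longrightarrow>
        (\<forall>k. (\<lambda>w. complex_of_real (F k w)) \<in> elems Y) \<longrightarrow>
        (AE w in N. (\<forall>k. 0 \<le> F k w \<and> F k w \<le> F (Suc k) w) \<and> (\<lambda>k. F k w) \<longlonglongrightarrow> f w) \<longrightarrow>
        bdd_above (range (\<lambda>k. nrm Y (\<lambda>w. complex_of_real (F k w)))) \<longrightarrow>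
        (\<lambda>w. complex_of_real (f w)) \<in> elems Y \<and>
        (\<lambda>k. nrm Y (\<lambda>w. complex_of_real (F k w))) \<longlonglongrightarrow> nrm Y (\<lambda>w. complex_of_real (f w)))"

definition simple_fun :: "'s measure \<Rightarrow> 'a fspace \<Rightarrow> ('s \<Rightarrow> 'a \<Rightarrow> complex) \<Rightarrow> bool" where
  "simple_fun M X s \<longleftrightarrow> (\<exists>(n::nat) E v.
     (\<forall>i<n. E i \<in> sets M \<and> emeasure M (E i) < \<infinity> \<and> v i \<in> elems X) \<and>
     s = (\<lambda>t a. \<Sum>i<n. indicator (E i) t * v i a))"

definition strongly_measurable :: "'s measure \<Rightarrow> 'a fspace \<Rightarrow> ('s \<Rightarrow> 'a \<Rightarrow> complex) \<Rightarrow> bool" where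
  "strongly_measurable M X F \<longleftrightarrow>
     (AE t in M. F t \<in> elems X) \<and>
     (\<exists>s. (\<forall>n. simple_fun M X (s n)) \<and> (AE t in M. (\<lambda>n. ndist X (s n t) (F t)) \<longlonglongrightarrow> 0))"

text \<open>The Bochner integral, following the definition of \<^const>\<open>has_bochner_integral\<close>; the
  integral of an approximating simple function is the finite sum of measures times values.\<close>

definition has_integral_in ::
    "'a fspace \<Rightarrow> 's measure \<Rightarrow> ('s \<Rightarrow> 'a \<Rightarrow> complex) \<Rightarrow> ('a \<Rightarrow> complex) \<Rightarrow> bool" where
  "has_integral_in X M F y \<longleftrightarrow>
     y \<in> elems X \<and> strongly_measurable M X F \<and>
     (\<exists>n E v.
        (\<forall>j. \<forall>i < (n j :: nat). E j i \<in> sets M \<and> emeasure M (E j i) < \<infinity> \<and> v j i \<in> elems X) \<and>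
        (\<lambda>j::nat. \<integral>\<^sup>+t. ennreal (ndist X (F t) (\<lambda>a. \<Sum>i<n j. indicator (E j i) t * v j i a)) \<partial>M) \<longlonglongrightarrow> 0 \<and>
        (\<lambda>j. ndist X (\<lambda>a. \<Sum>i<n j. complex_of_real (measure M (E j i)) * v j i a) y) \<longlonglongrightarrow> 0)"

text \<open>\<open>L\<^sup>p(M, Y)\<close> for a Koethe space \<open>Y\<close> over \<open>N\<close>.  Every strongly measurable \<open>Y\<close>-valued function
  has a jointly measurable version, and only such representatives are admitted.\<close>

definition Lp_bochner :: "'x measure \<Rightarrow> 'w measure \<Rightarrow> 'w fspace \<Rightarrow> real \<Rightarrow> ('x \<times> 'w) fspace" where
  "Lp_bochner M N Y p = \<lparr>
     elems = {f \<in> borel_measurable (M \<Otimes>\<^sub>M N). strongly_measurable M Y (\<lambda>x w. f (x, w)) \<and>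
                (\<integral>\<^sup>+x. ennreal (nrm Y (\<lambda>w. f (x, w)) powr p) \<partial>M) < \<infinity>},
     nrm = (\<lambda>f. enn2real (\<integral>\<^sup>+x. ennreal (nrm Y (\<lambda>w. f (x, w)) powr p) \<partial>M) powr (1 / p)) \<rparr>"


section \<open>UMD, type and cotype\<close>

text \<open>Unconditionality of \<open>Y\<close>-valued martingale differences \<open>d\<^sub>1, \<dots>, d\<^sub>n\<close>.  Restricting to probability
  measures on the line is harmless: a strongly measurable finite martingale lives in a separable
  space, hence its law can be realised on the real line, with the filtration it generates.\<close>

definition UMD :: "'w measure \<Rightarrow> 'w fspace \<Rightarrow> bool" where
  "UMD N Y \<longleftrightarrow> (\<exists>q>1. \<exists>c. \<forall>(P :: real measure) (F :: nat \<Rightarrow> real measure) n d (\<epsilon> :: nat \<Rightarrow> complex).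
     prob_space P \<longrightarrow>
     (\<forall>k. subalgebra P (F k) \<and> subalgebra (F (Suc k)) (F k)) \<longrightarrow>
     (\<forall>k\<in>{1..n}. d k \<in> elems (Lp_bochner (restr_to_subalg P (F k)) N Y q) \<and>
        (\<forall>B\<in>sets (F (k - 1)). has_integral_in Y P (\<lambda>s w. indicator B s * d k (s, w)) (\<lambda>_. 0))) \<longrightarrow>
     (\<forall>k\<in>{1..n}. \<epsilon> k \<in> {-1, 1}) \<longrightarrow>
     nrm (Lp_bochner P N Y q) (\<lambda>z. \<Sum>k=1..n. \<epsilon> k * d k z)
       \<le> c * nrm (Lp_bochner P N Y q) (\<lambda>z. \<Sum>k=1..n. d k z))"

text \<open>The expectation of the norm of a Rademacher sum: \<open>S\<close> is the set of indices with sign \<open>+1\<close>.\<close>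

definition rademacher_mean :: "'a fspace \<Rightarrow> nat \<Rightarrow> (nat \<Rightarrow> 'a \<Rightarrow> complex) \<Rightarrow> real" where
  "rademacher_mean X n x =
     (\<Sum>S\<in>Pow {..<n}. nrm X (\<lambda>a. \<Sum>i<n. (if i \<in> S then 1 else -1) * x i a)) / 2 ^ n"

definition has_type :: "'a fspace \<Rightarrow> real \<Rightarrow> bool" where
  "has_type X r \<longleftrightarrow> 1 \<le> r \<and> r \<le> 2 \<and> (\<exists>c. \<forall>n x. (\<forall>i<n. x i \<in> elems X) \<longrightarrow>
     rademacher_mean X n x \<le> c * (\<Sum>i<n. nrm X (x i) powr r) powr (1 / r))"

definition has_cotype :: "'a fspace \<Rightarrow> ereal \<Rightarrow> bool" where
  "has_cotype X s \<longleftrightarrow> 2 \<le> s \<and> (\<exists>c. \<forall>n x. (\<forall>i<n. x i \<in> elems X) \<longrightarrow>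
     (if s = \<infinity> then (\<forall>i<n. nrm X (x i) \<le> c * rademacher_mean X n x)
      else (\<Sum>i<n. nrm X (x i) powr real_of_ereal s) powr (1 / real_of_ereal s)
             \<le> c * rademacher_mean X n x))"


section \<open>Operators and semigroups\<close>

type_synonym 'a graph = "(('a \<Rightarrow> complex) \<times> ('a \<Rightarrow> complex)) set"

definition linear_op :: "'a fspace \<Rightarrow> 'a graph \<Rightarrow> bool" where
  "linear_op X A \<longleftrightarrow> A \<subseteq> elems X \<times> elems X \<and> ((\<lambda>_. 0), (\<lambda>_. 0)) \<in> A \<and>
     (\<forall>(f, g)\<in>A. \<forall>(f', g')\<in>A. \<forall>c. ((\<lambda>a. c * f a + f' a), (\<lambda>a. c * g a + g' a)) \<in> A) \<and>
     (\<forall>(f, g)\<in>A. nrm X f = 0 \<longrightarrow> nrm X g = 0)"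

definition closed_op :: "'a fspace \<Rightarrow> 'a graph \<Rightarrow> bool" where
  "closed_op X A \<longleftrightarrow> (\<forall>F G f g. (\<forall>n::nat. (F n, G n) \<in> A) \<longrightarrow> f \<in> elems X \<longrightarrow> g \<in> elems X \<longrightarrow>
     (\<lambda>n. ndist X (F n) f) \<longlonglongrightarrow> 0 \<longrightarrow> (\<lambda>n. ndist X (G n) g) \<longlonglongrightarrow> 0 \<longrightarrow> (f, g) \<in> A)"

definition resolvent_set :: "'a fspace \<Rightarrow> 'a graph \<Rightarrow> complex set" where
  "resolvent_set X A = {\<zeta>.
     (\<forall>h\<in>elems X. \<exists>(f, g)\<in>A. ndist X (\<lambda>a. \<zeta> * f a - g a) h = 0) \<and>
     (\<exists>C. \<forall>(f, g)\<in>A. nrm X f \<le> C * nrm X (\<lambda>a. \<zeta> * f a - g a))}"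

definition resolvent :: "'a fspace \<Rightarrow> 'a graph \<Rightarrow> complex \<Rightarrow> 'a graph" where
  "resolvent X A \<zeta> = {(h, f). h \<in> elems X \<and> (\<exists>g. (f, g) \<in> A \<and> ndist X (\<lambda>a. \<zeta> * f a - g a) h = 0)}"

definition sector :: "real \<Rightarrow> complex set" where
  "sector \<theta> = {z. z \<noteq> 0 \<and> \<bar>Arg z\<bar> < \<theta>}"

definition zero_sectorial :: "'a fspace \<Rightarrow> 'a graph \<Rightarrow> bool" where
  "zero_sectorial X A \<longleftrightarrow>
     linear_op X A \<and> closed_op X A \<and> closure_in X (Domain A) = elems X \<and>
     - resolvent_set X A \<subseteq> complex_of_real ` {0..} \<and>
     (\<forall>\<theta>\<in>{0<..<pi}. \<exists>K. \<forall>\<zeta> \<in> - closure (sector \<theta>).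
        \<forall>(h, f)\<in>resolvent X A \<zeta>. cmod \<zeta> * nrm X f \<le> K * nrm X h)"

definition C0_semigroup ::
    "'a fspace \<Rightarrow> (real \<Rightarrow> ('a \<Rightarrow> complex) \<Rightarrow> ('a \<Rightarrow> complex)) \<Rightarrow> bool" where
  "C0_semigroup X T \<longleftrightarrow>
     (\<forall>t\<ge>0. \<forall>f\<in>elems X. T t f \<in> elems X) \<and>
     (\<forall>t\<ge>0. \<forall>f\<in>elems X. \<forall>g\<in>elems X. \<forall>c.
        ndist X (T t (\<lambda>a. c * f a + g a)) (\<lambda>a. c * T t f a + T t g a) = 0) \<and>
     (\<forall>t\<ge>0. \<exists>C. \<forall>f\<in>elems X. nrm X (T t f) \<le> C * nrm X f) \<and>
     (\<forall>f\<in>elems X. ndist X (T 0 f) f = 0) \<and>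
     (\<forall>s\<ge>0. \<forall>t\<ge>0. \<forall>f\<in>elems X. ndist X (T (s + t) f) (T s (T t f)) = 0) \<and>
     (\<forall>f\<in>elems X. ((\<lambda>t. ndist X (T t f) f) \<longlongrightarrow> 0) (at_right 0))"

definition contractive ::
    "'a fspace \<Rightarrow> (real \<Rightarrow> ('a \<Rightarrow> complex) \<Rightarrow> ('a \<Rightarrow> complex)) \<Rightarrow> bool" where
  "contractive X T \<longleftrightarrow> (\<forall>t\<ge>0. \<forall>f\<in>elems X. nrm X (T t f) \<le> nrm X f)"

definition lattice_positive ::
    "'a measure \<Rightarrow> 'a fspace \<Rightarrow> (real \<Rightarrow> ('a \<Rightarrow> complex) \<Rightarrow> ('a \<Rightarrow> complex)) \<Rightarrow> bool" where
  "lattice_positive M X T \<longleftrightarrow> (\<forall>t\<ge>0. \<forall>f\<in>elems X.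
     (AE x in M. f x \<in> \<real>\<^sub>\<ge>\<^sub>0) \<longrightarrow> (AE x in M. T t f x \<in> \<real>\<^sub>\<ge>\<^sub>0))"

text \<open>The operator \<open>A\<close> with \<open>T t = e\<^sup>-\<^sup>t\<^sup>A\<close>.\<close>

definition neg_generator ::
    "'a fspace \<Rightarrow> (real \<Rightarrow> ('a \<Rightarrow> complex) \<Rightarrow> ('a \<Rightarrow> complex)) \<Rightarrow> 'a graph" where
  "neg_generator X T = {(f, g). f \<in> elems X \<and> g \<in> elems X \<and>
     ((\<lambda>t. ndist X (\<lambda>a. (f a - T t f a) / complex_of_real t) g) \<longlongrightarrow> 0) (at_right 0)}"

text \<open>\<open>A\<^sub>0 \<otimes> Id\<^sub>Y\<close>: the closure in \<open>L\<^sup>p(Y)\<close> of the operator \<open>\<Sum> a\<^sub>i \<otimes> v\<^sub>i \<mapsto> \<Sum> A\<^sub>0 a\<^sub>i \<otimes> v\<^sub>i\<close> on the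
  algebraic tensor product of \<open>D(A\<^sub>0)\<close> and \<open>Y\<close>.\<close>

definition alg_tensor_id :: "'w fspace \<Rightarrow> 'x graph \<Rightarrow> ('x \<times> 'w) graph" where
  "alg_tensor_id Y A0 = {(F, G). \<exists>(n::nat) a b v.
     (\<forall>i<n. (a i, b i) \<in> A0 \<and> v i \<in> elems Y) \<and>
     F = (\<lambda>(x, w). \<Sum>i<n. a i x * v i w) \<and> G = (\<lambda>(x, w). \<Sum>i<n. b i x * v i w)}"

definition tensor_id ::
    "'x measure \<Rightarrow> 'w measure \<Rightarrow> 'w fspace \<Rightarrow> real \<Rightarrow> 'x graph \<Rightarrow> ('x \<times> 'w) graph" where
  "tensor_id M N Y p A0 = (let X = Lp_bochner M N Y p in
     {(f, g). f \<in> elems X \<and> g \<in> elems X \<and> (\<exists>F G. (\<forall>n::nat. (F n, G n) \<in> alg_tensor_id Y A0) \<and>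
        (\<lambda>n. ndist X (F n) f) \<longlonglongrightarrow> 0 \<and> (\<lambda>n. ndist X (G n) g) \<longlonglongrightarrow> 0)})"


section \<open>Holomorphic functional calculus\<close>

text \<open>Bounded holomorphic functions on the sector for which \<open>f(0)\<close> is well defined, as the limit
  at 0.\<close>

definition Hinf :: "real \<Rightarrow> (complex \<Rightarrow> complex) set" where
  "Hinf \<theta> = {f. f holomorphic_on sector \<theta> \<and> bounded (f ` sector \<theta>) \<and>
               (f \<longlongrightarrow> f 0) (at 0 within sector \<theta>)}"

text \<open>\<open>f(A)h = (2\<pi>i)\<^sup>-\<^sup>1 \<integral> f(\<lambda>) (\<lambda> - A)\<^sup>-\<^sup>1 h d\<lambda>\<close> over the boundary of the sector of half-angle
  \<open>\<omega> = \<theta>/2\<close>, oriented so that the positive axis is on its left: inwards on the ray of argument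
  \<open>\<omega>\<close>, outwards on that of argument \<open>-\<omega>\<close>.  By Cauchy's theorem any other angle in \<open>(0, \<theta>)\<close> gives the
  same operator.  The function \<open>r\<close> selects representatives of \<open>(\<lambda> - A)\<^sup>-\<^sup>1 h\<close>.\<close>

definition cauchy_calc :: "'a fspace \<Rightarrow> 'a graph \<Rightarrow> real \<Rightarrow> (complex \<Rightarrow> complex) \<Rightarrow> 'a graph" where
  "cauchy_calc X A \<theta> f = {(h, y). h \<in> elems X \<and> (\<exists>r.
     (\<forall>t>0. \<forall>\<sigma>\<in>{-1, 1}. (h, r (rcis t (\<sigma> * \<theta> / 2))) \<in> resolvent X A (rcis t (\<sigma> * \<theta> / 2))) \<and>
     has_integral_in X (restrict_space lborel {0<..})
       (\<lambda>t a. (f (rcis t (-\<theta> / 2)) * r (rcis t (-\<theta> / 2)) a * cis (-\<theta> / 2)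
               - f (rcis t (\<theta> / 2)) * r (rcis t (\<theta> / 2)) a * cis (\<theta> / 2)) / (2 * pi * \<i>)) y)}"

definition ker_op :: "'a fspace \<Rightarrow> 'a graph \<Rightarrow> ('a \<Rightarrow> complex) set" where
  "ker_op X A = {f. \<exists>g. (f, g) \<in> A \<and> nrm X g = 0}"

definition cl_range :: "'a fspace \<Rightarrow> 'a graph \<Rightarrow> ('a \<Rightarrow> complex) set" where
  "cl_range X A = closure_in X (Range A)"

definition regul :: "complex \<Rightarrow> complex" where
  "regul z = z / (1 + z)\<^sup>2"

text \<open>Given a relation \<open>R\<close> standing for \<open>(\<rho> f)(A)\<close>, where \<open>\<rho>\<close> is the regulariser above, form
  \<open>f(A) = \<rho>(A)\<^sup>-\<^sup>1 (\<rho> f)(A)\<close> on the closure of the range of \<open>A\<close> and add \<open>f(0) Id\<close> on the kernel;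
  \<open>\<rho>(A)\<close> is injective on the closure of the range.\<close>

definition regularised ::
    "'a fspace \<Rightarrow> 'a graph \<Rightarrow> real \<Rightarrow> 'a graph \<Rightarrow> complex \<Rightarrow> 'a graph" where
  "regularised X A \<theta> R c = {(x, y). x \<in> elems X \<and> y \<in> elems X \<and>
     (\<exists>x0\<in>cl_range X A. \<exists>x1\<in>ker_op X A. \<exists>y0\<in>cl_range X A. \<exists>w.
        ndist X x (\<lambda>a. x0 a + x1 a) = 0 \<and> ndist X y (\<lambda>a. y0 a + c * x1 a) = 0 \<and>
        (x0, w) \<in> R \<and> (y0, w) \<in> cauchy_calc X A \<theta> regul)}"

definition hol_calc :: "'a fspace \<Rightarrow> 'a graph \<Rightarrow> real \<Rightarrow> (complex \<Rightarrow> complex) \<Rightarrow> 'a graph" where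
  "hol_calc X A \<theta> f = regularised X A \<theta> (cauchy_calc X A \<theta> (\<lambda>z. regul z * f z)) (f 0)"

text \<open>Extension to holomorphic functions of polynomial growth at infinity:
  \<open>F(A) = ((1+A)\<^sup>-\<^sup>k)\<^sup>-\<^sup>1 [F(\<lambda>) (1+\<lambda>)\<^sup>-\<^sup>k](A)\<close> for any sufficiently large \<open>k\<close>.\<close>

definition ext_hol_calc :: "'a fspace \<Rightarrow> 'a graph \<Rightarrow> real \<Rightarrow> (complex \<Rightarrow> complex) \<Rightarrow> 'a graph" where
  "ext_hol_calc X A \<theta> F = {(x, y). \<exists>(k::nat) w. (\<lambda>z. F z / (1 + z) ^ k) \<in> Hinf \<theta> \<and>
     (x, w) \<in> hol_calc X A \<theta> (\<lambda>z. F z / (1 + z) ^ k) \<and>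
     (y, w) \<in> hol_calc X A \<theta> (\<lambda>z. 1 / (1 + z) ^ k)}"

definition frac_pow :: "'a fspace \<Rightarrow> 'a graph \<Rightarrow> real \<Rightarrow> real \<Rightarrow> 'a graph" where
  "frac_pow X A \<theta> \<delta> = ext_hol_calc X A \<theta> (\<lambda>z. z powr complex_of_real \<delta>)"

definition one_plus_frac_pow :: "'a fspace \<Rightarrow> 'a graph \<Rightarrow> real \<Rightarrow> real \<Rightarrow> 'a graph" where
  "one_plus_frac_pow X A \<theta> \<delta> = ext_hol_calc X A \<theta> (\<lambda>z. (1 + z) powr complex_of_real \<delta>)"


section \<open>Hoermander calculus\<close>

definition test_function :: "(real \<Rightarrow> complex) \<Rightarrow> bool" where
  "test_function \<phi> \<longleftrightarrow>
     (\<exists>D. D 0 = \<phi> \<and> (\<forall>(k::nat) x. (D k has_vector_derivative D (Suc k) x) (at x))) \<and>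
     (\<exists>a b. 0 < a \<and> a < b \<and> (\<forall>x. x \<notin> {a..b} \<longrightarrow> \<phi> x = 0)) \<and>
     (\<exists>x. \<phi> x \<noteq> 0)"

definition fourier :: "(real \<Rightarrow> complex) \<Rightarrow> real \<Rightarrow> complex" where
  "fourier g \<xi> = (\<integral>x. g x * cis (- (x * \<xi>)) \<partial>lborel)"

text \<open>The square of the Sobolev norm of order \<open>\<alpha>\<close>.  It is only applied to bounded functions with
  compact support, whose Fourier transform is given by an absolutely convergent integral.\<close>

definition sobolev_sq :: "real \<Rightarrow> (real \<Rightarrow> complex) \<Rightarrow> ennreal" where
  "sobolev_sq \<alpha> g = (\<integral>\<^sup>+\<xi>. ennreal ((1 + \<xi>\<^sup>2) powr \<alpha> * (cmod (fourier g \<xi>))\<^sup>2) \<partial>lborel)"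

text \<open>Elements are functions on \<open>[0, \<infinity>)\<close>; values at negative arguments are irrelevant.\<close>

definition hoermander :: "(real \<Rightarrow> complex) \<Rightarrow> real \<Rightarrow> (real \<Rightarrow> complex) set" where
  "hoermander \<phi> \<alpha> = {f. bounded (f ` {0..}) \<and> continuous_on {0<..} f \<and>
     (\<exists>B::real. \<forall>R>0. sobolev_sq \<alpha> (\<lambda>x. \<phi> x * f (R * x)) \<le> ennreal B)}"

definition hoermander_norm :: "(real \<Rightarrow> complex) \<Rightarrow> real \<Rightarrow> (real \<Rightarrow> complex) \<Rightarrow> real" where
  "hoermander_norm \<phi> \<alpha> f =
     cmod (f 0) + (SUP R\<in>{0<..}. sqrt (enn2real (sobolev_sq \<alpha> (\<lambda>x. \<phi> x * f (R * x)))))"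

text \<open>Restrictions of elements of \<^const>\<open>Hinf\<close> to the half-line are in the Hoermander class by
  Cauchy's estimates, so that the norm on the right is a genuine one.\<close>

definition bounded_hoermander_calc ::
    "'a fspace \<Rightarrow> 'a graph \<Rightarrow> (real \<Rightarrow> complex) \<Rightarrow> real \<Rightarrow> real \<Rightarrow> bool" where
  "bounded_hoermander_calc X A \<phi> \<alpha> \<theta> \<longleftrightarrow> zero_sectorial X A \<and>
     (\<exists>C. \<forall>f\<in>Hinf \<theta>. \<forall>x\<in>elems X. \<exists>y. (x, y) \<in> hol_calc X A \<theta> f \<and>
        nrm X y \<le> C * hoermander_norm \<phi> \<alpha> (\<lambda>t. f (complex_of_real t)) * nrm X x)"

text \<open>The extension of a bounded Hoermander calculus to a bounded algebra homomorphism.  By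
  continuity it is first determined on limits of \<^const>\<open>Hinf\<close> functions in the Hoermander norm
  (\<open>limit_calc\<close>).  These are not all Hoermander functions, but they contain \<open>\<rho> m\<close> for every
  Hoermander function \<open>m\<close> and the regulariser \<open>\<rho>\<close>, so that \<open>m(A)\<close> is determined by
  multiplicativity, \<open>\<rho>(A) m(A) = (\<rho> m)(A)\<close>, on the closure of the range, and by \<open>m(0)\<close> on the
  kernel.\<close>

definition limit_calc ::
    "'a fspace \<Rightarrow> 'a graph \<Rightarrow> (real \<Rightarrow> complex) \<Rightarrow> real \<Rightarrow> real \<Rightarrow> (real \<Rightarrow> complex) \<Rightarrow> 'a graph" where
  "limit_calc X A \<phi> \<alpha> \<theta> m = {(x, y). y \<in> elems X \<and> (\<exists>f Z.
     (\<forall>n::nat. f n \<in> Hinf \<theta> \<and> (x, Z n) \<in> hol_calc X A \<theta> (f n)) \<and>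
     (\<lambda>n. hoermander_norm \<phi> \<alpha> (\<lambda>t. f n (complex_of_real t) - m t)) \<longlonglongrightarrow> 0 \<and>
     (\<lambda>n. ndist X (Z n) y) \<longlonglongrightarrow> 0)}"

definition hoermander_calc ::
    "'a fspace \<Rightarrow> 'a graph \<Rightarrow> (real \<Rightarrow> complex) \<Rightarrow> real \<Rightarrow> real \<Rightarrow> (real \<Rightarrow> complex) \<Rightarrow> 'a graph" where
  "hoermander_calc X A \<phi> \<alpha> \<theta> m = {(x, y). m \<in> hoermander \<phi> \<alpha> \<and>
     (x, y) \<in> regularised X A \<theta>
        (limit_calc X A \<phi> \<alpha> \<theta> (\<lambda>t. regul (complex_of_real t) * m t)) (m 0)}"

text \<open>\<open>exp(itA) f = [(1+\<lambda>)\<^sup>-\<^sup>\<delta> e\<^sup>i\<^sup>t\<^sup>\<lambda>](A) (1+A)\<^sup>\<delta> f\<close>.\<close>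

definition exp_itA ::
    "'a fspace \<Rightarrow> 'a graph \<Rightarrow> (real \<Rightarrow> complex) \<Rightarrow> real \<Rightarrow> real \<Rightarrow> real \<Rightarrow> real \<Rightarrow> 'a graph" where
  "exp_itA X A \<phi> \<alpha> \<theta> \<delta> t = one_plus_frac_pow X A \<theta> \<delta> O
     hoermander_calc X A \<phi> \<alpha> \<theta> (\<lambda>l. complex_of_real ((1 + l) powr (- \<delta>)) * cis (t * l))"

end

theory Submission
  imports Defs "HOL-Complex_Analysis.Complex_Analysis" "HOL-Probability.Probability" "HOL-Real_Asymp.Real_Asymp"
begin

text \<open>
  Since \<open>\<delta> > \<alpha> + 2\<close>, the multiplier \<open>m\<^sub>t(z) = (1 + z)\<^sup>-\<^sup>\<delta> e\<^sup>i\<^sup>t\<^sup>z\<close> and the second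
  differences in \<open>t\<close> of its holomorphic truncations, which are \<open>O(h\<^sup>3\<^sup>/\<^sup>2 (1 + |z|)\<^sup>3\<^sup>/\<^sup>2\<^sup>-\<^sup>\<delta>)\<close> on a neighbourhood of
  the half-line, are controlled in the Hoermander norm of order \<open>\<alpha>\<close> by Cauchy's estimates.  Hence the
  path \<open>u(t) = exp(itA)f\<close> is locally Lipschitz in \<open>L\<^sup>p(Y)\<close> with second differences \<open>O(h\<^sup>3\<^sup>/\<^sup>2)\<close>.  The
  successive piecewise linear interpolations of \<open>u\<close> at dyadic points of order \<open>n\<close> then differ by at most the sum of
  \<open>O(2\<^sup>n)\<close> second differences of norm \<open>O(2\<^sup>-\<^sup>3\<^sup>n\<^sup>/\<^sup>2)\<close>.  The sum over \<open>n\<close> of these majorants converges in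
  \<open>L\<^sup>p(Y)\<close>, so the interpolations converge locally uniformly in \<open>t\<close> at almost every point, and in \<open>Y\<close> at almost every \<open>x\<close>.
  The functional calculus is handled weakly, through the scalar functions \<open>\<lambda> \<mapsto> l((\<lambda> - A)\<^sup>-\<^sup>1x)\<close>
  for bounded functionals \<open>l\<close>; these separate the points of \<open>L\<^sup>p(Y)\<close>.
\<close>

section \<open>Cauchy integrals over the boundary of a sector\<close>

text \<open>First differences of the path are only O(h), and 2^n of them at h = 2^-n do not sum; an
  exponent above 1 is needed, and second differences reach 3/2. This fixes the decay budget.
  Cauchy's estimates bound the Hoermander norm of order \<alpha> once a symbol decays like (1 +
  |z|)^-(\<alpha> + 1/2), while h^(3/2) costs |z|^(3/2): together \<alpha> + 2. The truncations are
  forced because e^(itz) is unbounded on every sector.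

  Elements are representatives and operators are graphs, so a law such as f(A)g(A) = (fg)(A) is
  proved as an identity between scalar contour integrals, by Fubini and Cauchy's theorem. The
  coordinate w = log z turns both rays into horizontal lines, on which all integrands decay like
  e^-|u|. An element y = F(A)x is pinned down by \<rho>(A)y = (\<rho> F)(A)x, because \<rho>(A) is
  injective on the closure of the range; that such a y exists is the content of the bounded
  calculus. On the kernel of A a multiplier acts by its value at 0.\<close>

lemma contour_integral_linepath_same_Im:
  assumes "a < b"
  shows "contour_integral (linepath (Complex a c) (Complex b c)) f
           = integral {a..b} (\<lambda>x. f (Complex x c))"
proof -
  have "contour_integral (linepath (Complex a c) (Complex b c)) f
      = contour_integral (linepath (of_real a) (of_real b)) (\<lambda>z. f (z + Complex 0 c))"
  proof -
    have "f (linepath (Complex a c) (Complex b c) x) = f (linepath (of_real a) (of_real b) x + Complex 0 c)" for x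
      by (rule arg_cong[of _ _ f]) (auto simp: linepath_def complex_eq_iff algebra_simps)
    moreover have "Complex b c - Complex a c = of_real b - of_real a"
      by (simp add: complex_eq_iff)
    ultimately show ?thesis
      by (simp add: contour_integral_integral)
  qed
  also have "\<dots> = integral {a..b} (\<lambda>x. f (of_real x + Complex 0 c))"
    using assms by (subst contour_integral_linepath_Reals_eq) auto
  finally show ?thesis
    by (simp add: Complex_eq mult.commute)
qed

lemma integrable_exp_minus_abs: "integrable lborel (\<lambda>u::real. exp (- \<bar>u\<bar>))"
proof -
  define f where "f u = exp (- u) * indicator {0..} u" for u :: real
  have "(\<integral>\<^sup>+u. ennreal (f u) \<partial>lborel) = 1"
    using nn_intergal_power_times_exp_Ici[of 0]
    by (simp add: f_def ennreal_mult'' flip: ennreal_indicator)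
  hence f: "integrable lborel f"
    by (intro integrableI_bounded) (auto simp: f_def[abs_def] abs_mult)
  have "integrable lborel (\<lambda>u. f (0 + (- 1) * u))"
    using f by (subst lborel_integrable_real_affine_iff) auto
  hence "integrable lborel (\<lambda>u. f u + f (- u))"
    using f by simp
  thus ?thesis
    by (rule Bochner_Integration.integrable_bound) (auto simp: f_def indicator_def intro!: AE_I2)
qed

text \<open>Rectangles of growing width exhaust the strip, and their vertical sides contribute
  O(e^-N). Assumptions are made only on the two lines and at the far ends, so singularities in the
  middle are allowed; their contribution \<open>k\<close> stays abstract because it is a residue in
  one application and comes from a double pole, evaluated by parts, in another.\<close>

lemma strip_integral_difference:
  fixes G :: "complex \<Rightarrow> complex"
  defines "S \<equiv> \<lambda>a b L. {w. a \<le> Im w \<and> Im w \<le> b \<and> (Im w = a \<or> Im w = b \<or> \<bar>Re w\<bar> \<ge> L)}"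
  assumes "a < b" "L > 0" and cont: "continuous_on (S a b L) G"
    and bound: "\<And>w. w \<in> S a b L \<Longrightarrow> cmod (G w) \<le> C * exp (- \<bar>Re w\<bar>)"
    and cint: "\<And>N. N > L \<Longrightarrow> contour_integral (rectpath (Complex (- N) a) (Complex N b)) G = k"
  shows "integrable lborel (\<lambda>u. G (Complex u a))" "integrable lborel (\<lambda>u. G (Complex u b))"
    "(\<integral>u. G (Complex u a) \<partial>lborel) - (\<integral>u. G (Complex u b) \<partial>lborel) = k"
proof -
  have dom: "integrable lborel (\<lambda>u::real. C * exp (- \<bar>u\<bar>))"
    using integrable_exp_minus_abs by simp
  have contl: "continuous_on UNIV (\<lambda>u. G (Complex u y))" if "y \<in> {a, b}" for y
    by (rule continuous_on_compose2[OF cont]) (use that \<open>a < b\<close> in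
        \<open>auto simp: S_def Complex_eq intro!: continuous_intros\<close>)
  have meas [measurable]: "(\<lambda>u. G (Complex u y)) \<in> borel_measurable borel" if "y \<in> {a, b}" for y
    using contl[OF that] by (rule borel_measurable_continuous_onI)
  have bl: "cmod (G (Complex u y)) \<le> C * exp (- \<bar>u\<bar>)" if "y \<in> {a, b}" for u y
    using bound[of "Complex u y"] that \<open>a < b\<close> by (auto simp: S_def)
  have int: "integrable lborel (\<lambda>u. G (Complex u y))" if "y \<in> {a, b}" for y
    by (rule Bochner_Integration.integrable_bound[OF dom])
       (use meas[OF that] bl[OF that] in \<open>auto intro!: AE_I2 order.trans[OF bl[OF that]]\<close>)
  show "integrable lborel (\<lambda>u. G (Complex u a))" "integrable lborel (\<lambda>u. G (Complex u b))"
    using int by auto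
  define N where "N n = L + 1 + real n" for n
  have N: "N n > L" "N n > 0" for n
    using \<open>L > 0\<close> by (auto simp: N_def)
  have lim: "(\<lambda>n. integral {- N n..N n} (\<lambda>u. G (Complex u y)))
              \<longlonglongrightarrow> (\<integral>u. G (Complex u y) \<partial>lborel)" if "y \<in> {a, b}" for y
  proof -
    have "integral {- N n..N n} (\<lambda>u. G (Complex u y))
            = (\<integral>u. indicator {- N n..N n} u *\<^sub>R G (Complex u y) \<partial>lborel)" for n
    proof -
      have "set_integrable lborel {- N n..N n} (\<lambda>u. G (Complex u y))"
        using int[OF that] by (simp add: set_integrable_def integrable_mult_indicator)
      thus ?thesis
        using set_borel_integral_eq_integral(2)[of "{- N n..N n}" "\<lambda>u. G (Complex u y)"]
        by (simp add: set_lebesgue_integral_def)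
    qed
    moreover have "(\<lambda>n. \<integral>u. indicator {- N n..N n} u *\<^sub>R G (Complex u y) \<partial>lborel)
                     \<longlonglongrightarrow> (\<integral>u. G (Complex u y) \<partial>lborel)"
    proof (rule integral_dominated_convergence[OF _ _ dom])
      show "AE u in lborel. (\<lambda>n. indicator {- N n..N n} u *\<^sub>R G (Complex u y)) \<longlonglongrightarrow> G (Complex u y)"
      proof (intro AE_I2 tendsto_eventually)
        fix u :: real
        obtain n0 where "real n0 > \<bar>u\<bar>"
          using reals_Archimedean2 by blast
        hence "\<forall>n\<ge>n0. u \<in> {- N n..N n}"
          using \<open>L > 0\<close> by (auto simp: N_def)
        thus "\<forall>\<^sub>F n in sequentially. indicator {- N n..N n} u *\<^sub>R G (Complex u y) = G (Complex u y)"
          by (auto simp: eventually_sequentially intro!: exI[of _ n0])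
      qed
      show "AE u in lborel. cmod (indicator {- N n..N n} u *\<^sub>R G (Complex u y)) \<le> C * exp (- \<bar>u\<bar>)" for n
        using bl[OF that] by (auto intro!: AE_I2 simp: indicator_def intro: order.trans[OF norm_ge_zero])
    qed (use meas[OF that] in auto)
    ultimately show ?thesis by simp
  qed
  \<comment> \<open>The two vertical sides; the horizontal ones converge to the two line
    integrals.\<close>
  define V where "V n = contour_integral (linepath (Complex (N n) a) (Complex (N n) b)) G
                      + contour_integral (linepath (Complex (- N n) b) (Complex (- N n) a)) G" for n
  have seg: "closed_segment (Complex x1 y1) (Complex x2 y2) \<subseteq> S a b L"
    if "(x1 = x2 \<and> \<bar>x1\<bar> \<ge> L \<and> y1 \<in> {a..b} \<and> y2 \<in> {a..b}) \<or> (y1 = y2 \<and> y1 \<in> {a, b})"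
    for x1 x2 y1 y2
    using that \<open>a < b\<close>
    by (auto simp: S_def closed_segment_same_Re closed_segment_same_Im closed_segment_eq_real_ivl
          split: if_splits)
  have ci: "G contour_integrable_on linepath (Complex x1 y1) (Complex x2 y2)"
    if "(x1 = x2 \<and> \<bar>x1\<bar> \<ge> L \<and> y1 \<in> {a..b} \<and> y2 \<in> {a..b}) \<or> (y1 = y2 \<and> y1 \<in> {a, b})"
    for x1 x2 y1 y2
    by (intro contour_integrable_continuous_linepath continuous_on_subset[OF cont] seg that)
  have rect: "integral {- N n..N n} (\<lambda>u. G (Complex u a))
                 - integral {- N n..N n} (\<lambda>u. G (Complex u b)) + V n = k" for n
  proof -
    have "k = contour_integral (rectpath (Complex (- N n) a) (Complex (N n) b)) G"
      using cint[OF N(1)] by simp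
    also have "\<dots> = contour_integral (linepath (Complex (- N n) a) (Complex (N n) a)) G
        + (contour_integral (linepath (Complex (N n) a) (Complex (N n) b)) G
        + (contour_integral (linepath (Complex (N n) b) (Complex (- N n) b)) G
        + contour_integral (linepath (Complex (- N n) b) (Complex (- N n) a)) G))"
      unfolding rectpath_def Let_def using N[of n] \<open>a < b\<close> \<open>L > 0\<close>
      by (simp add: contour_integral_join ci contour_integrable_joinI valid_path_join)
    also have "contour_integral (linepath (Complex (N n) b) (Complex (- N n) b)) G
        = - contour_integral (linepath (Complex (- N n) b) (Complex (N n) b)) G"
      by (metis contour_integral_reversepath reversepath_linepath valid_path_linepath)
    finally show ?thesis
      using N[of n] by (simp add: contour_integral_linepath_same_Im V_def)
  qed
  have Vb: "cmod (V n) \<le> 2 * (C * exp (- N n)) * (b - a)" for n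
  proof -
    have C0: "0 \<le> C * exp (- N n)"
      using order.trans[OF norm_ge_zero bl[of a "N n"]] N[of n] by simp
    have 1: "cmod (contour_integral (linepath (Complex x y1) (Complex x y2)) G)
             \<le> (C * exp (- N n)) * cmod (Complex x y2 - Complex x y1)"
      if "\<bar>x\<bar> = N n" "y1 \<in> {a..b}" "y2 \<in> {a..b}" for x y1 y2
    proof (rule contour_integral_bound_linepath[OF ci C0])
      fix w assume w: "w \<in> closed_segment (Complex x y1) (Complex x y2)"
      hence "w \<in> S a b L"
        using seg[of x x y1 y2] that N[of n] by auto
      moreover have "\<bar>Re w\<bar> = N n"
        using w that by (simp add: closed_segment_same_Re)
      ultimately show "cmod (G w) \<le> C * exp (- N n)"
        using bound[of w] by simp
    qed (use that N[of n] in auto)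
    have "cmod (V n) \<le> (C * exp (- N n)) * (b - a) + (C * exp (- N n)) * (b - a)"
      unfolding V_def
      using 1[of "N n" a b] 1[of "- N n" b a] \<open>a < b\<close> N[of n]
      by (intro order.trans[OF norm_triangle_ineq] add_mono) (auto simp: cmod_def)
    thus ?thesis by (simp add: algebra_simps)
  qed
  have "V \<longlonglongrightarrow> 0"
  proof (rule Lim_null_comparison)
    show "\<forall>\<^sub>F n in sequentially. cmod (V n) \<le> 2 * (C * exp (- N n)) * (b - a)"
      using Vb by simp
    show "(\<lambda>n. 2 * (C * exp (- N n)) * (b - a)) \<longlonglongrightarrow> 0"
      unfolding N_def by real_asymp
  qed
  hence "(\<lambda>n. integral {- N n..N n} (\<lambda>u. G (Complex u a))
                 - integral {- N n..N n} (\<lambda>u. G (Complex u b)) + V n)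
           \<longlonglongrightarrow> (\<integral>u. G (Complex u a) \<partial>lborel) - (\<integral>u. G (Complex u b) \<partial>lborel) + 0"
    by (intro tendsto_intros lim) auto
  thus "(\<integral>u. G (Complex u a) \<partial>lborel) - (\<integral>u. G (Complex u b) \<partial>lborel) = k"
    unfolding rect by (simp add: LIMSEQ_const_iff)
qed

lemma open_strip: "open {w. c < Im w \<and> Im w < d}"
  by (intro open_Collect_conj open_halfspace_Im_gt open_halfspace_Im_lt)

lemma convex_strip: "convex {w. c < Im w \<and> Im w < d}"
  using convex_Int[OF convex_halfspace_Im_gt[of c] convex_halfspace_Im_lt[of d]]
  by (simp add: Collect_conj_eq)

text \<open>The condition \<open>L > \<bar>Re w0\<bar>\<close> keeps the pole out of the region
  where the decay estimate is required.\<close>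

lemma strip_residue:
  fixes G :: "complex \<Rightarrow> complex"
  assumes "c < a" "a < Im w0" "Im w0 < b" "b < d" "L > \<bar>Re w0\<bar>"
    and hol: "G holomorphic_on {w. c < Im w \<and> Im w < d} - {w0}"
    and bound: "\<And>w. a \<le> Im w \<Longrightarrow> Im w \<le> b \<Longrightarrow> Im w = a \<or> Im w = b \<or> \<bar>Re w\<bar> \<ge> L
        \<Longrightarrow> cmod (G w) \<le> C * exp (- \<bar>Re w\<bar>)"
  shows "integrable lborel (\<lambda>u. G (Complex u a))" "integrable lborel (\<lambda>u. G (Complex u b))"
    "(\<integral>u. G (Complex u a) \<partial>lborel) - (\<integral>u. G (Complex u b) \<partial>lborel) = 2 * pi * \<i> * residue G w0"
proof -
  have "a < b" "L > 0" using assms by linarith+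
  have cont: "continuous_on {w. a \<le> Im w \<and> Im w \<le> b \<and> (Im w = a \<or> Im w = b \<or> \<bar>Re w\<bar> \<ge> L)} G"
    by (rule continuous_on_subset[OF holomorphic_on_imp_continuous_on[OF hol]]) (use assms in auto)
  have cint: "contour_integral (rectpath (Complex (- N) a) (Complex N b)) G = 2 * pi * \<i> * residue G w0"
    if "N > L" for N
  proof -
    have w0: "w0 \<in> box (Complex (- N) a) (Complex N b)"
      using assms that by (auto simp: in_box_complex_iff)
    have "contour_integral (rectpath (Complex (- N) a) (Complex N b)) G = 2 * pi * \<i> *
       (\<Sum>p\<in>{w0}. winding_number (rectpath (Complex (- N) a) (Complex N b)) p * residue G p)"
    proof (rule Residue_theorem[OF open_strip[of c d] convex_connected[OF convex_strip]])
      show "path_image (rectpath (Complex (- N) a) (Complex N b)) \<subseteq> {w. c < Im w \<and> Im w < d} - {w0}"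
        using assms that w0 by (auto simp: path_image_rectpath_cbox_minus_box in_cbox_complex_iff)
      show "\<forall>z. z \<notin> {w. c < Im w \<and> Im w < d} \<longrightarrow>
              winding_number (rectpath (Complex (- N) a) (Complex N b)) z = 0"
        using assms that \<open>L > 0\<close>
        by (auto intro!: winding_number_rectpath_outside simp: in_cbox_complex_iff)
    qed (use hol in auto)
    thus ?thesis
      using winding_number_rectpath[OF w0] by simp
  qed
  note * = strip_integral_difference[OF \<open>a < b\<close> \<open>L > 0\<close> cont _ cint, of C]
  show "integrable lborel (\<lambda>u. G (Complex u a))" "integrable lborel (\<lambda>u. G (Complex u b))"
    "(\<integral>u. G (Complex u a) \<partial>lborel) - (\<integral>u. G (Complex u b) \<partial>lborel) = 2 * pi * \<i> * residue G w0"
    by (rule *; use bound in auto)+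
qed

lemma strip_shift:
  fixes G :: "complex \<Rightarrow> complex"
  assumes "c < a" "a < b" "b < d"
    and hol: "G holomorphic_on {w. c < Im w \<and> Im w < d}"
    and bound: "\<And>w. a \<le> Im w \<Longrightarrow> Im w \<le> b \<Longrightarrow> cmod (G w) \<le> C * exp (- \<bar>Re w\<bar>)"
  shows "(\<integral>u. G (Complex u a) \<partial>lborel) = (\<integral>u. G (Complex u b) \<partial>lborel)"
proof -
  \<comment> \<open>Any point between the two lines serves as a removable singularity with residue
    0.\<close>
  define w0 where "w0 = Complex 0 ((a + b) / 2)"
  have "residue G w0 = 0"
    by (rule residue_holo[OF open_strip _ hol]) (use assms in \<open>auto simp: w0_def\<close>)
  moreover have "(\<integral>u. G (Complex u a) \<partial>lborel) - (\<integral>u. G (Complex u b) \<partial>lborel)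
                  = 2 * pi * \<i> * residue G w0"
    by (rule strip_residue(3)[of c a w0 b d 1])
       (use assms in \<open>auto simp: w0_def intro!: holomorphic_on_subset[OF hol]\<close>)
  ultimately show ?thesis by simp
qed

lemma strip_integrable:
  fixes G :: "complex \<Rightarrow> complex"
  assumes "continuous_on UNIV (\<lambda>u. G (Complex u a))"
    and bound: "\<And>u. cmod (G (Complex u a)) \<le> C * exp (- \<bar>u\<bar>)"
  shows "integrable lborel (\<lambda>u. G (Complex u a))"
  by (rule Bochner_Integration.integrable_bound[of lborel "\<lambda>u. C * exp (- \<bar>u\<bar>)"])
     (use assms integrable_exp_minus_abs in \<open>auto intro!: AE_I2 order.trans[OF bound]
        borel_measurable_continuous_onI\<close>)

lemma exp_in_sector: "exp w \<in> sector \<theta>" if "\<bar>Im w\<bar> < \<theta>" "\<theta> \<le> pi"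
proof -
  have "Arg (exp w) = Im w"
    using that by (intro Arg_exp) auto
  thus ?thesis using that by (simp add: sector_def)
qed

lemma exp_notin_halfline: "exp w \<notin> complex_of_real ` {0..}" if "0 < Im w" "Im w < 2 * pi"
proof
  assume "exp w \<in> complex_of_real ` {0..}"
  then obtain r where r: "exp w = of_real r" "r \<ge> 0" by auto
  hence "r > 0" by (metis exp_not_eq_zero less_eq_real_def of_real_0)
  have "Arg2pi (exp w) = Im w"
    using that by (intro Arg2pi_exp) auto
  moreover have "Arg2pi (exp w) = 0"
    using r by (simp add: Arg2pi_eq_0)
  ultimately show False using that by simp
qed

text \<open>Law of cosines, followed by a^2 + b^2 - 2abc = (1-c)/2 (a+b)^2 + (1+c)/2 (a-b)^2, whose
  last term is dropped. The bound is proportional to both moduli, which makes kernels such as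
  \<open>exp w / (exp w - exp w0)\<close> bounded uniformly along whole lines.\<close>

lemma cmod_exp_diff_ge:
  assumes "cos (Im w - Im w0) \<le> c" "- 1 \<le> c" "c \<le> 1"
  shows "cmod (exp w - exp w0) \<ge> sqrt ((1 - c) / 2) * (cmod (exp w) + cmod (exp w0))"
proof -
  define a b where "a = exp (Re w)" and "b = exp (Re w0)"
  have ab: "a > 0" "b > 0" by (auto simp: a_def b_def)
  have "(cmod (exp w - exp w0))\<^sup>2 = a\<^sup>2 + b\<^sup>2 - 2 * a * b * cos (Im w - Im w0)"
  proof -
    have "(cmod (exp w - exp w0))\<^sup>2 = (a * cos (Im w) - b * cos (Im w0))\<^sup>2 + (a * sin (Im w) - b * sin (Im w0))\<^sup>2"
      by (simp add: cmod_power2 Re_exp Im_exp a_def b_def)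
    also have "\<dots> = a\<^sup>2 * ((sin (Im w))\<^sup>2 + (cos (Im w))\<^sup>2) + b\<^sup>2 * ((sin (Im w0))\<^sup>2 + (cos (Im w0))\<^sup>2)
        - 2 * a * b * cos (Im w - Im w0)"
      unfolding cos_diff by (simp only: power2_eq_square) algebra
    finally show ?thesis by simp
  qed
  also have "\<dots> \<ge> a\<^sup>2 + b\<^sup>2 - 2 * a * b * c"
    using assms ab by simp
  also have "a\<^sup>2 + b\<^sup>2 - 2 * a * b * c = (1 - c) / 2 * (a + b)\<^sup>2 + (1 + c) / 2 * (a - b)\<^sup>2"
    by (simp add: power2_eq_square field_simps)
  finally have "(1 - c) / 2 * (a + b)\<^sup>2 \<le> (cmod (exp w - exp w0))\<^sup>2"
    using assms by (smt (verit) mult_nonneg_nonneg zero_le_power2 divide_nonneg_pos)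
  hence "sqrt ((1 - c) / 2 * (a + b)\<^sup>2) \<le> cmod (exp w - exp w0)"
    by (intro real_le_lsqrt) auto
  moreover have "sqrt ((1 - c) / 2 * (a + b)\<^sup>2) = sqrt ((1 - c) / 2) * (a + b)"
    using ab by (subst real_sqrt_mult) auto
  ultimately show ?thesis
    by (simp add: a_def b_def)
qed

lemma cos_le_of_separated:
  assumes "\<delta> \<le> \<bar>x\<bar>" "\<bar>x\<bar> \<le> 2 * pi - \<delta>" "0 \<le> \<delta>" "\<delta> \<le> pi"
  shows "cos x \<le> cos \<delta>"
proof (cases "\<bar>x\<bar> \<le> pi")
  case True
  thus ?thesis using assms cos_monotone_0_pi_le[of \<delta> "\<bar>x\<bar>"] by simp
next
  case False
  have "cos (2 * pi - \<bar>x\<bar>) \<le> cos \<delta>"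
    using assms False by (intro cos_monotone_0_pi_le) auto
  thus ?thesis by (simp add: cos_diff)
qed

text \<open>The two conditions mean that the arguments are at distance at least \<delta> modulo 2
  pi; the upper one excludes an approach from the other side of the circle.\<close>

lemma exp_ratio_bound:
  assumes "\<delta> \<le> \<bar>Im w - Im w0\<bar>" "\<bar>Im w - Im w0\<bar> \<le> 2 * pi - \<delta>" "0 < \<delta>" "\<delta> \<le> pi"
  shows "cmod (exp w) + cmod (exp w0) \<le> cmod (exp w - exp w0) / sqrt ((1 - cos \<delta>) / 2)"
    "exp w \<noteq> exp w0" "0 < (1 - cos \<delta>) / 2"
proof -
  have "cos \<delta> < cos 0"
    using assms by (intro cos_monotone_0_pi) auto
  thus pos: "0 < (1 - cos \<delta>) / 2" by simp
  have "cmod (exp w - exp w0) \<ge> sqrt ((1 - cos \<delta>) / 2) * (cmod (exp w) + cmod (exp w0))"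
    using assms by (intro cmod_exp_diff_ge cos_le_of_separated) auto
  thus 1: "cmod (exp w) + cmod (exp w0) \<le> cmod (exp w - exp w0) / sqrt ((1 - cos \<delta>) / 2)"
    using pos by (simp add: field_simps)
  show "exp w \<noteq> exp w0"
  proof
    assume "exp w = exp w0"
    hence "cmod (exp w) + cmod (exp w0) \<le> 0" using 1 by simp
    thus False by (metis add_le_same_cancel2 add_nonneg_pos exp_not_eq_zero norm_ge_zero not_le zero_less_norm_iff)
  qed
qed

text \<open>Where the arguments may coincide, moduli that differ by a factor e >= 2 do the same
  service: the difference is at least half the larger modulus, the sum at most twice it.\<close>

lemma exp_ratio_bound_far:
  assumes "\<bar>Re w - Re w0\<bar> \<ge> 1"
  shows "cmod (exp w) + cmod (exp w0) \<le> 4 * cmod (exp w - exp w0)"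
proof -
  have e: "exp 1 \<ge> (2::real)" using exp_ge_add_one_self[of 1] by simp
  have *: "cmod (exp a) \<ge> 2 * cmod (exp b)" if "Re a - Re b \<ge> 1" for a b :: complex
  proof -
    have "2 * exp (Re b) \<le> exp 1 * exp (Re b)" using e by simp
    also have "\<dots> \<le> exp (Re a)" using that by (simp flip: exp_add)
    finally show ?thesis by simp
  qed
  show ?thesis
  proof (cases "Re w - Re w0 \<ge> 1")
    case True
    show ?thesis using *[OF True] norm_triangle_ineq2[of "exp w" "exp w0"] norm_ge_zero[of "exp w"] by linarith
  next
    case False
    hence "Re w0 - Re w \<ge> 1" using assms by linarith
    from *[OF this] show ?thesis
      using norm_triangle_ineq2[of "exp w0" "exp w"] norm_ge_zero[of "exp w0"]
        norm_minus_commute[of "exp w" "exp w0"] by linarith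
  qed
qed

text \<open>Against a resolvent of size O(1/|z|) this weight makes the contour integral absolutely
  convergent both at 0 and at infinity; at z = e^w it is at most e^-|Re w|. On sectors of half-angle
  below pi the class contains the products of the regulariser with bounded holomorphic
  functions.\<close>

definition decaying :: "real \<Rightarrow> (complex \<Rightarrow> complex) \<Rightarrow> bool" where
  "decaying \<theta> g \<longleftrightarrow> g holomorphic_on sector \<theta> \<and>
     (\<exists>C. \<forall>z\<in>sector \<theta>. cmod (g z) \<le> C * (cmod z / (1 + cmod z)\<^sup>2))"

lemma log_weight_le: "exp u / (1 + exp u)\<^sup>2 \<le> exp (- \<bar>u\<bar>)" for u :: real
proof -
have nz: "1 + exp u \<noteq> 0" by (smt (verit) exp_gt_zero)
show ?thesis
proof (cases "u \<ge> 0")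
  case True
  have "exp u / (1 + exp u)\<^sup>2 \<le> exp u / (exp u)\<^sup>2"
    by (intro divide_left_mono power_mono) (use nz in auto)
  also have "\<dots> = exp (- \<bar>u\<bar>)"
    using True by (simp add: exp_minus power2_eq_square field_simps)
  finally show ?thesis .
next
  case False
  have "exp u / (1 + exp u)\<^sup>2 \<le> exp u / 1"
    using nz by (intro divide_left_mono) (auto simp: one_le_power)
  thus ?thesis using False by simp
qed
qed

lemma decaying_exp_bound:
  assumes "decaying \<theta> g" "\<theta> \<le> pi"
  obtains C where "C \<ge> 0" "\<And>w. \<bar>Im w\<bar> < \<theta> \<Longrightarrow> cmod (g (exp w)) \<le> C * exp (- \<bar>Re w\<bar>)"
proof -
  from assms obtain C where C: "\<And>z. z \<in> sector \<theta> \<Longrightarrow> cmod (g z) \<le> C * (cmod z / (1 + cmod z)\<^sup>2)"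
    by (auto simp: decaying_def)
  show ?thesis
  proof (rule that[of "\<bar>C\<bar>"])
    fix w assume "\<bar>Im w\<bar> < \<theta>"
    hence "cmod (g (exp w)) \<le> C * (exp (Re w) / (1 + exp (Re w))\<^sup>2)"
      using C[OF exp_in_sector] assms by simp
    also have "\<dots> \<le> \<bar>C\<bar> * exp (- \<bar>Re w\<bar>)"
      by (intro mult_mono log_weight_le) auto
    finally show "cmod (g (exp w)) \<le> \<bar>C\<bar> * exp (- \<bar>Re w\<bar>)" .
  qed auto
qed

lemma decaying_exp_holomorphic:
  assumes "decaying \<theta> g" "\<theta> \<le> pi"
  shows "(\<lambda>w. g (exp w)) holomorphic_on {w. - \<theta> < Im w \<and> Im w < \<theta>}"
proof -
  have "(g \<circ> exp) holomorphic_on {w. - \<theta> < Im w \<and> Im w < \<theta>}"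
    by (rule holomorphic_on_compose_gen[of _ _ _ "sector \<theta>"])
       (use assms exp_in_sector[of _ \<theta>] in \<open>auto simp: decaying_def intro!: holomorphic_intros\<close>)
  thus ?thesis by (simp add: o_def)
qed

text \<open>The integral \<open>(2\<pi>i)\<^sup>-\<^sup>1 \<integral> h(log z) dz/z\<close> over the boundary of the sector of half-angle \<open>\<omega>\<close>, in
  the logarithmic coordinate \<open>w = log z\<close>.\<close>

definition sector_int :: "real \<Rightarrow> (complex \<Rightarrow> complex) \<Rightarrow> complex" where
  "sector_int \<omega> h =
     ((\<integral>u. h (Complex u (- \<omega>)) \<partial>lborel) - (\<integral>u. h (Complex u \<omega>) \<partial>lborel)) / (2 * pi * \<i>)"

text \<open>In the strip |Im w| < \<theta> <= pi the map \<open>exp\<close> is injective, so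
  \<open>w0\<close> is the only pole of the kernel inside the contour. The residue is
  \<open>g (exp w0)\<close> because the factor \<open>exp w\<close> cancels the derivative of
  \<open>exp\<close>.\<close>

lemma sector_Cauchy_inside:
  assumes g: "decaying \<theta> g" and "\<bar>Im w0\<bar> < \<omega>" "\<omega> < \<theta>" "\<theta> \<le> pi"
  shows "sector_int \<omega> (\<lambda>w. g (exp w) * exp w / (exp w - exp w0)) = g (exp w0)"
proof -
  define G where "G w = g (exp w) * exp w / (exp w - exp w0)" for w
  obtain C where C: "C \<ge> 0" "\<And>w. \<bar>Im w\<bar> < \<theta> \<Longrightarrow> cmod (g (exp w)) \<le> C * exp (- \<bar>Re w\<bar>)"
    using decaying_exp_bound[OF g \<open>\<theta> \<le> pi\<close>] by blast
  have ne: "exp w \<noteq> exp w0" if "\<bar>Im w\<bar> < \<theta>" "w \<noteq> w0" for w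
    using that assms exp_complex_eqI[of w w0] by fastforce
  have hol: "G holomorphic_on {w. - \<theta> < Im w \<and> Im w < \<theta>} - {w0}"
    unfolding G_def using ne
    by (intro holomorphic_intros holomorphic_on_subset[OF decaying_exp_holomorphic[OF g \<open>\<theta> \<le> pi\<close>]])
       (auto simp: abs_less_iff)
  define \<delta> where "\<delta> = \<omega> - \<bar>Im w0\<bar>"
  \<comment> \<open>The value 4 serves the far ends, the other entry the two lines, where only the
    arguments are known to differ.\<close>
  define K where "K = max 4 (1 / sqrt ((1 - cos \<delta>) / 2))"
  have bound: "cmod (G w) \<le> (C * K) * exp (- \<bar>Re w\<bar>)"
    if w: "- \<omega> \<le> Im w" "Im w \<le> \<omega>" "Im w = - \<omega> \<or> Im w = \<omega> \<or> \<bar>Re w\<bar> \<ge> \<bar>Re w0\<bar> + 1" for w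
  proof -
    have ratio: "cmod (exp w) + cmod (exp w0) \<le> K * cmod (exp w - exp w0)"
    proof (cases "\<bar>Re w\<bar> \<ge> \<bar>Re w0\<bar> + 1")
      case True
      hence "cmod (exp w) + cmod (exp w0) \<le> 4 * cmod (exp w - exp w0)"
        by (intro exp_ratio_bound_far) linarith
      also have "\<dots> \<le> K * cmod (exp w - exp w0)"
        by (intro mult_right_mono) (auto simp: K_def)
      finally show ?thesis .
    next
      case False
      hence "\<delta> \<le> \<bar>Im w - Im w0\<bar>" "\<bar>Im w - Im w0\<bar> \<le> 2 * pi - \<delta>" "0 < \<delta>" "\<delta> \<le> pi"
        using w assms by (auto simp: \<delta>_def)
      from exp_ratio_bound(1)[OF this]
      have "cmod (exp w) + cmod (exp w0) \<le> 1 / sqrt ((1 - cos \<delta>) / 2) * cmod (exp w - exp w0)"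
        by simp
      also have "\<dots> \<le> K * cmod (exp w - exp w0)"
        by (intro mult_right_mono) (auto simp: K_def)
      finally show ?thesis .
    qed
    have "cmod (exp w) / cmod (exp w - exp w0) \<le> K"
    proof (cases "exp w = exp w0")
      case True thus ?thesis by (simp add: K_def)
    next
      case False
      thus ?thesis using ratio norm_ge_zero[of "exp w0"]
        by (simp add: divide_le_eq del: norm_exp_eq_Re norm_ge_zero)
    qed
    moreover have "cmod (g (exp w)) \<le> C * exp (- \<bar>Re w\<bar>)"
      using w assms by (intro C) auto
    ultimately have "cmod (g (exp w)) * (cmod (exp w) / cmod (exp w - exp w0)) \<le> (C * exp (- \<bar>Re w\<bar>)) * K"
      using C(1) by (intro mult_mono) auto
    thus ?thesis by (simp add: G_def norm_mult norm_divide mult_ac)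
  qed
  have "residue G w0 = g (exp w0)"
  proof (rule residue_simple'[OF open_strip _ hol])
    have "((\<lambda>w. (exp w - exp w0) / (w - w0)) \<longlongrightarrow> exp w0) (at w0)"
      using DERIV_exp[of w0] by (simp add: has_field_derivative_iff)
    moreover have "((\<lambda>w. g (exp w) * exp w) \<longlongrightarrow> g (exp w0) * exp w0) (at w0)"
    proof -
      have "(\<lambda>w. g (exp w)) holomorphic_on {w. - \<theta> < Im w \<and> Im w < \<theta>}"
        by (rule decaying_exp_holomorphic[OF g \<open>\<theta> \<le> pi\<close>])
      hence "isCont (\<lambda>w. g (exp w)) w0"
        using assms continuous_on_eq_continuous_at[OF open_strip[of "- \<theta>" \<theta>], of "\<lambda>w. g (exp w)"]
        by (simp add: holomorphic_on_imp_continuous_on abs_less_iff)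
      thus ?thesis by (intro tendsto_intros) (auto simp: isCont_def)
    qed
    ultimately have "((\<lambda>w. g (exp w) * exp w / ((exp w - exp w0) / (w - w0))) \<longlongrightarrow> g (exp w0) * exp w0 / exp w0) (at w0)"
      by (intro tendsto_divide) auto
    thus "((\<lambda>w. G w * (w - w0)) \<longlongrightarrow> g (exp w0)) (at w0)"
      by (simp add: G_def)
  qed (use assms in auto)
  moreover have "(\<integral>u. G (Complex u (- \<omega>)) \<partial>lborel) - (\<integral>u. G (Complex u \<omega>) \<partial>lborel) = 2 * pi * \<i> * residue G w0"
    by (rule strip_residue(3)[OF _ _ _ _ _ hol bound]) (use assms in auto)
  ultimately show ?thesis
    unfolding sector_int_def G_def[symmetric] by simp
qed

text \<open>Here the pole lies beyond the contour: for |Im w| < |Im w0| < pi the arguments of e^w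
  and e^w0 never agree modulo 2 pi, so the integrand is holomorphic between the two lines and one
  line can be pushed onto the other.\<close>

lemma sector_Cauchy_outside:
  assumes g: "decaying \<theta> g" and "0 < \<omega>" "\<omega> < \<bar>Im w0\<bar>" "\<bar>Im w0\<bar> < \<theta>" "\<theta> \<le> pi"
  shows "sector_int \<omega> (\<lambda>w. g (exp w) * exp w / (exp w - exp w0)) = 0"
proof -
  define G where "G w = g (exp w) * exp w / (exp w - exp w0)" for w
  obtain C where C: "C \<ge> 0" "\<And>w. \<bar>Im w\<bar> < \<theta> \<Longrightarrow> cmod (g (exp w)) \<le> C * exp (- \<bar>Re w\<bar>)"
    using decaying_exp_bound[OF g \<open>\<theta> \<le> pi\<close>] by blast
  have sep: "\<delta> \<le> \<bar>Im w - Im w0\<bar>" "\<bar>Im w - Im w0\<bar> \<le> 2 * pi - \<delta>" if "\<bar>Im w\<bar> \<le> \<bar>Im w0\<bar> - \<delta>" for w \<delta>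
    using that assms by linarith+
  have hol: "G holomorphic_on {w. - \<bar>Im w0\<bar> < Im w \<and> Im w < \<bar>Im w0\<bar>}"
    unfolding G_def
  proof (intro holomorphic_intros holomorphic_on_subset[OF decaying_exp_holomorphic[OF g \<open>\<theta> \<le> pi\<close>]])
    fix w assume w: "w \<in> {w. - \<bar>Im w0\<bar> < Im w \<and> Im w < \<bar>Im w0\<bar>}"
    define \<delta> where "\<delta> = \<bar>Im w0\<bar> - \<bar>Im w\<bar>"
    have "exp w \<noteq> exp w0"
      by (rule exp_ratio_bound(2)[of \<delta>]) (use w assms sep[of w \<delta>] in \<open>auto simp: \<delta>_def abs_less_iff\<close>)
    thus "exp w - exp w0 \<noteq> 0" by simp
  qed (use assms in auto)
  define \<delta> where "\<delta> = \<bar>Im w0\<bar> - \<omega>"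
  define K where "K = 1 / sqrt ((1 - cos \<delta>) / 2)"
  have bound: "cmod (G w) \<le> (C * K) * exp (- \<bar>Re w\<bar>)" if w: "- \<omega> \<le> Im w" "Im w \<le> \<omega>" for w
  proof -
    note s = sep[of w \<delta>]
    have s': "\<delta> \<le> \<bar>Im w - Im w0\<bar>" "\<bar>Im w - Im w0\<bar> \<le> 2 * pi - \<delta>" "0 < \<delta>" "\<delta> \<le> pi"
      using s w assms by (auto simp: \<delta>_def)
    have ratio: "cmod (exp w) + cmod (exp w0) \<le> K * cmod (exp w - exp w0)"
      using exp_ratio_bound(1)[OF s'] by (simp add: K_def)
    have "cmod (exp w) / cmod (exp w - exp w0) \<le> K"
      using ratio norm_ge_zero[of "exp w0"] exp_ratio_bound(2)[OF s']
      by (simp add: divide_le_eq del: norm_exp_eq_Re norm_ge_zero)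
    moreover have "cmod (g (exp w)) \<le> C * exp (- \<bar>Re w\<bar>)"
      using w assms by (intro C) auto
    ultimately have "cmod (g (exp w)) * (cmod (exp w) / cmod (exp w - exp w0)) \<le> (C * exp (- \<bar>Re w\<bar>)) * K"
      using C(1) by (intro mult_mono) auto
    thus ?thesis by (simp add: G_def norm_mult norm_divide mult_ac)
  qed
  have "(\<integral>u. G (Complex u (- \<omega>)) \<partial>lborel) = (\<integral>u. G (Complex u \<omega>) \<partial>lborel)"
    by (rule strip_shift[OF _ _ _ hol bound]) (use assms in auto)
  thus ?thesis
    unfolding sector_int_def G_def[symmetric] by simp
qed

lemma open_halfline_complement: "open (- complex_of_real ` {0..})"
proof -
  have "complex_of_real ` {0..} = \<real>\<^sub>\<ge>\<^sub>0"
    by (auto simp: nonneg_Reals_def)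
  thus ?thesis using closed_nonneg_Reals_complex by (simp add: open_closed)
qed

text \<open>Between consecutive multiples of 2 pi the exponential stays in the slit plane. One of
  the two strips contains the upper ray of the contour, the other the lower one.\<close>

lemma halfline_complement_exp_holomorphic:
  assumes "\<psi> holomorphic_on - complex_of_real ` {0..}" "c = 0 \<and> d = 2 * pi \<or> c = - 2 * pi \<and> d = 0"
  shows "(\<lambda>w. \<psi> (exp w)) holomorphic_on {w. c < Im w \<and> Im w < d}"
proof -
  have "exp w \<in> - complex_of_real ` {0..}" if "c < Im w" "Im w < d" for w
    using exp_notin_halfline[of w] exp_notin_halfline[of "w + 2 * pi * \<i>"] that assms(2)
    by (auto simp: exp_add)
  hence "(\<psi> \<circ> exp) holomorphic_on {w. c < Im w \<and> Im w < d}"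
    by (intro holomorphic_on_compose_gen[OF _ assms(1)]) (auto intro!: holomorphic_intros)
  thus ?thesis by (simp add: o_def)
qed

text \<open>The function \<psi> is given only off the half-line, so each ray is rotated on its own,
  the upper one within 0 < Im w < \<theta> and the lower one within the mirror image.\<close>

lemma sector_int_independent:
  assumes g: "decaying \<theta> g" and "0 < \<omega>" "\<omega> < \<omega>'" "\<omega>' < \<theta>" "\<theta> \<le> pi"
    and \<psi>: "\<psi> holomorphic_on - complex_of_real ` {0..}"
    and K: "\<And>w. \<omega> \<le> \<bar>Im w\<bar> \<Longrightarrow> \<bar>Im w\<bar> \<le> pi \<Longrightarrow> cmod (exp w * \<psi> (exp w)) \<le> K"
  shows "sector_int \<omega> (\<lambda>w. g (exp w) * (exp w * \<psi> (exp w)))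
       = sector_int \<omega>' (\<lambda>w. g (exp w) * (exp w * \<psi> (exp w)))"
proof -
  define G where "G w = g (exp w) * (exp w * \<psi> (exp w))" for w
  obtain C where C: "C \<ge> 0" "\<And>w. \<bar>Im w\<bar> < \<theta> \<Longrightarrow> cmod (g (exp w)) \<le> C * exp (- \<bar>Re w\<bar>)"
    using decaying_exp_bound[OF g \<open>\<theta> \<le> pi\<close>] by blast
  have bound: "cmod (G w) \<le> (C * K) * exp (- \<bar>Re w\<bar>)" if "\<omega> \<le> \<bar>Im w\<bar>" "\<bar>Im w\<bar> \<le> \<omega>'" for w
  proof -
    have "cmod (G w) \<le> (C * exp (- \<bar>Re w\<bar>)) * K"
      unfolding G_def norm_mult[of "g (exp w)"] by (intro mult_mono C K) (use that assms C(1) in auto)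
    thus ?thesis by (simp add: mult_ac)
  qed
  have hol1: "G holomorphic_on {w. 0 < Im w \<and> Im w < \<theta>}"
    unfolding G_def using assms
    by (intro holomorphic_intros holomorphic_on_subset[OF decaying_exp_holomorphic[OF g \<open>\<theta> \<le> pi\<close>]]
         holomorphic_on_subset[OF halfline_complement_exp_holomorphic[OF \<psi>, of 0 "2 * pi"]])
       auto
  have hol2: "G holomorphic_on {w. - \<theta> < Im w \<and> Im w < 0}"
    unfolding G_def using assms
    by (intro holomorphic_intros holomorphic_on_subset[OF decaying_exp_holomorphic[OF g \<open>\<theta> \<le> pi\<close>]]
         holomorphic_on_subset[OF halfline_complement_exp_holomorphic[OF \<psi>, of "- 2 * pi" 0]])
       auto
  have "(\<integral>u. G (Complex u \<omega>) \<partial>lborel) = (\<integral>u. G (Complex u \<omega>') \<partial>lborel)"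
    by (rule strip_shift[OF _ _ _ hol1 bound]) (use assms in auto)
  moreover have "(\<integral>u. G (Complex u (- \<omega>')) \<partial>lborel) = (\<integral>u. G (Complex u (- \<omega>)) \<partial>lborel)"
    by (rule strip_shift[OF _ _ _ hol2 bound]) (use assms in auto)
  ultimately show ?thesis
    unfolding sector_int_def G_def[symmetric] by simp
qed

lemma sector_int_Fubini:
  fixes K :: "complex \<Rightarrow> complex \<Rightarrow> complex"
  assumes cont: "\<And>y y'. y \<in> {-\<omega>, \<omega>} \<Longrightarrow> y' \<in> {-\<omega>', \<omega>'} \<Longrightarrow>
      continuous_on UNIV (\<lambda>(u, v). K (Complex u y) (Complex v y'))"
    and bound: "\<And>y y' u v. y \<in> {-\<omega>, \<omega>} \<Longrightarrow> y' \<in> {-\<omega>', \<omega>'} \<Longrightarrow>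
      cmod (K (Complex u y) (Complex v y')) \<le> C * (exp (- \<bar>u\<bar>) * exp (- \<bar>v\<bar>))"
  shows "sector_int \<omega> (\<lambda>w. sector_int \<omega>' (K w)) = sector_int \<omega>' (\<lambda>v. sector_int \<omega> (\<lambda>w. K w v))"
proof -
  have int: "integrable (lborel \<Otimes>\<^sub>M lborel) (\<lambda>(u, v). K (Complex u y) (Complex v y'))"
    if "y \<in> {-\<omega>, \<omega>}" "y' \<in> {-\<omega>', \<omega>'}" for y y'
  proof (rule Bochner_Integration.integrable_bound)
    have "integrable (lborel \<Otimes>\<^sub>M lborel) (\<lambda>(u::real, v::real). exp (- \<bar>u\<bar>) * exp (- \<bar>v\<bar>))"
      using lborel_pair.Fubini_integrable[of "\<lambda>(u::real, v::real). exp (- \<bar>u\<bar>) * exp (- \<bar>v\<bar>)"]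
        integrable_exp_minus_abs by (simp add: abs_mult)
    thus "integrable (lborel \<Otimes>\<^sub>M lborel) (\<lambda>(u::real, v::real). C * (exp (- \<bar>u\<bar>) * exp (- \<bar>v\<bar>)))"
      unfolding case_prod_unfold by (rule integrable_mult_right)
    have "(\<lambda>(u, v). K (Complex u y) (Complex v y')) \<in> borel_measurable borel"
      by (rule borel_measurable_continuous_onI[OF cont[OF that]])
    thus "(\<lambda>(u, v). K (Complex u y) (Complex v y')) \<in> borel_measurable (lborel \<Otimes>\<^sub>M lborel)"
      by (simp add: lborel_prod)
    show "AE x in lborel \<Otimes>\<^sub>M lborel. cmod (case x of (u, v) \<Rightarrow> K (Complex u y) (Complex v y'))
       \<le> norm (case x of (u, v) \<Rightarrow> C * (exp (- \<bar>u\<bar>) * exp (- \<bar>v\<bar>)))"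
      using bound[OF that] by (auto intro!: AE_I2 order.trans[OF bound[OF that]])
  qed
  define F where "F y y' = (\<integral>u. (\<integral>v. K (Complex u y) (Complex v y') \<partial>lborel) \<partial>lborel)" for y y'
  have swap: "(\<integral>v. (\<integral>u. K (Complex u y) (Complex v y') \<partial>lborel) \<partial>lborel) = F y y'"
    if "y \<in> {-\<omega>, \<omega>}" "y' \<in> {-\<omega>', \<omega>'}" for y y'
    unfolding F_def using lborel_pair.Fubini_integral[OF int[OF that]] .
  have i1: "integrable lborel (\<lambda>u. \<integral>v. K (Complex u y) (Complex v y') \<partial>lborel)"
    if "y \<in> {-\<omega>, \<omega>}" "y' \<in> {-\<omega>', \<omega>'}" for y y'
    using lborel_pair.integrable_fst'[OF int[OF that]] by simp
  have i2: "integrable lborel (\<lambda>v. \<integral>u. K (Complex u y) (Complex v y') \<partial>lborel)"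
    if "y \<in> {-\<omega>, \<omega>}" "y' \<in> {-\<omega>', \<omega>'}" for y y'
    using lborel_pair.integrable_snd[OF int[OF that]] by simp
  have "sector_int \<omega> (\<lambda>w. sector_int \<omega>' (K w)) =
     ((F (-\<omega>) (-\<omega>') - F (-\<omega>) \<omega>') - (F \<omega> (-\<omega>') - F \<omega> \<omega>')) / (2 * pi * \<i>)\<^sup>2"
    unfolding sector_int_def F_def using i1
    by (simp add: Bochner_Integration.integral_diff diff_divide_distrib[symmetric] power2_eq_square)
  moreover have "sector_int \<omega>' (\<lambda>v. sector_int \<omega> (\<lambda>w. K w v)) =
     ((F (-\<omega>) (-\<omega>') - F \<omega> (-\<omega>')) - (F (-\<omega>) \<omega>' - F \<omega> \<omega>')) / (2 * pi * \<i>)\<^sup>2"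
    unfolding sector_int_def using i2 swap
    by (simp add: Bochner_Integration.integral_diff diff_divide_distrib[symmetric] power2_eq_square)
  ultimately show ?thesis by (simp add: algebra_simps)
qed

lemma sector_int_cong:
  assumes "\<And>w. \<bar>Im w\<bar> = \<bar>\<omega>\<bar> \<Longrightarrow> h w = h' w"
  shows "sector_int \<omega> h = sector_int \<omega> h'"
  using assms unfolding sector_int_def by simp

lemma sector_int_cmult: "sector_int \<omega> (\<lambda>w. c * h w) = c * sector_int \<omega> h"
  unfolding sector_int_def by (simp add: right_diff_distrib diff_divide_distrib)

lemma sector_int_add:
  assumes "\<And>y. y \<in> {-\<omega>, \<omega>} \<Longrightarrow> integrable lborel (\<lambda>u. h (Complex u y))"
    "\<And>y. y \<in> {-\<omega>, \<omega>} \<Longrightarrow> integrable lborel (\<lambda>u. h' (Complex u y))"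
  shows "sector_int \<omega> (\<lambda>w. h w + h' w) = sector_int \<omega> h + sector_int \<omega> h'"
  unfolding sector_int_def using assms by (simp add: add_divide_distrib diff_divide_distrib)

lemma continuous_decaying_line:
  assumes g: "decaying \<theta> g" "\<theta> \<le> pi" "\<bar>y\<bar> < \<theta>"
  shows "continuous_on UNIV (\<lambda>u. g (exp (Complex u y)))"
  by (rule continuous_on_compose2[OF holomorphic_on_imp_continuous_on[OF decaying_exp_holomorphic[OF g(1,2)]]])
     (use g in \<open>auto simp: Complex_eq intro!: continuous_intros\<close>)

text \<open>The scalar core of the multiplicativity of the Cauchy calculus, where \<open>a(w) = e\<^sup>w \<psi>(e\<^sup>w)\<close> for
  \<open>\<psi>(\<lambda>) = l((\<lambda> - A)\<^sup>-\<^sup>1x)\<close>; the quotient comes from the resolvent identity.\<close>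

lemma sector_int_mult:
  assumes f: "decaying \<theta> f" and g: "decaying \<theta> g" and \<omega>: "0 < \<omega>" "\<omega> < \<omega>'" "\<omega>' < \<theta>" "\<theta> \<le> pi"
    and \<psi>: "\<And>y. y \<in> {-\<omega>, \<omega>} \<Longrightarrow> continuous_on UNIV (\<lambda>u. \<psi> (exp (Complex u y)))"
    and K: "\<And>y u. y \<in> {-\<omega>, \<omega>} \<Longrightarrow> cmod (exp (Complex u y) * \<psi> (exp (Complex u y))) \<le> K"
  shows "sector_int \<omega>' (\<lambda>w. f (exp w) * (exp w * sector_int \<omega> (\<lambda>v. g (exp v) * (exp v *
            ((\<psi> (exp v) - \<psi> (exp w)) / (exp w - exp v))))))
       = sector_int \<omega> (\<lambda>v. f (exp v) * g (exp v) * (exp v * \<psi> (exp v)))"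
proof -
  obtain Cf where Cf: "Cf \<ge> 0" "\<And>w. \<bar>Im w\<bar> < \<theta> \<Longrightarrow> cmod (f (exp w)) \<le> Cf * exp (- \<bar>Re w\<bar>)"
    using decaying_exp_bound[OF f \<open>\<theta> \<le> pi\<close>] by blast
  obtain Cg where Cg: "Cg \<ge> 0" "\<And>w. \<bar>Im w\<bar> < \<theta> \<Longrightarrow> cmod (g (exp w)) \<le> Cg * exp (- \<bar>Re w\<bar>)"
    using decaying_exp_bound[OF g \<open>\<theta> \<le> pi\<close>] by blast
  have K0: "K \<ge> 0" using order.trans[OF norm_ge_zero K[of \<omega>]] by simp
  define \<delta> where "\<delta> = \<omega>' - \<omega>"
  define D where "D = 1 / sqrt ((1 - cos \<delta>) / 2)"
  have sep: "\<delta> \<le> \<bar>Im w - Im v\<bar>" "\<bar>Im w - Im v\<bar> \<le> 2 * pi - \<delta>" "0 < \<delta>" "\<delta> \<le> pi"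
    if "\<bar>Im w\<bar> = \<omega>'" "\<bar>Im v\<bar> = \<omega>" for v w
    unfolding \<delta>_def using that \<omega> by linarith+
  have ne: "exp w \<noteq> exp v" if "\<bar>Im w\<bar> = \<omega>'" "\<bar>Im v\<bar> = \<omega>" for v w
    by (rule exp_ratio_bound(2)[OF sep[OF that]])
  have D0: "D \<ge> 0" by (simp add: D_def)
  have ratio: "cmod (exp w / (exp w - exp v)) \<le> D" "cmod (exp v / (exp w - exp v)) \<le> D"
    if "\<bar>Im w\<bar> = \<omega>'" "\<bar>Im v\<bar> = \<omega>" for v w
    using exp_ratio_bound(1)[OF sep[OF that]] ne[OF that] norm_ge_zero[of "exp v"] norm_ge_zero[of "exp w"]
    by (auto simp: norm_divide divide_le_eq D_def simp del: norm_exp_eq_Re norm_ge_zero)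
  have wt: "exp (- \<bar>u\<bar>) * exp (- \<bar>v\<bar>) \<ge> 0" for u v :: real by simp
  have cont_line: "continuous_on UNIV (\<lambda>u. exp (Complex u y))" for y
    by (auto simp: Complex_eq intro!: continuous_intros)
  have a: "\<bar>Im v\<bar> = \<omega> \<Longrightarrow> cmod (exp v * \<psi> (exp v)) \<le> K" for v
    using K[of "Im v" "Re v"] by (auto simp: abs_if split: if_splits)
  \<comment> \<open>The quotient splits into a part with \<psi>(e^v) and one with \<psi>(e^w). In
    the latter \<psi>(e^w) is a constant factor of a Cauchy kernel whose pole e^w lies outside the
    smaller sector, so that part integrates to 0.\<close>
  have inner: "sector_int \<omega> (\<lambda>v. g (exp v) * (exp v * ((\<psi> (exp v) - \<psi> (exp w)) / (exp w - exp v))))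
             = sector_int \<omega> (\<lambda>v. g (exp v) * (exp v * \<psi> (exp v)) / (exp w - exp v))"
    if w: "\<bar>Im w\<bar> = \<omega>'" for w
  proof -
    define h1 where "h1 v = g (exp v) * (exp v * \<psi> (exp v)) / (exp w - exp v)" for v
    define h2 where "h2 v = g (exp v) * exp v / (exp v - exp w)" for v
    have "sector_int \<omega> (\<lambda>v. g (exp v) * (exp v * ((\<psi> (exp v) - \<psi> (exp w)) / (exp w - exp v))))
        = sector_int \<omega> (\<lambda>v. h1 v + \<psi> (exp w) * h2 v)"
    proof (rule sector_int_cong)
      fix v assume "\<bar>Im v\<bar> = \<bar>\<omega>\<bar>"
      with ne[of w v] w \<omega> have "exp w - exp v \<noteq> 0" "exp v - exp w \<noteq> 0" by auto
      thus "g (exp v) * (exp v * ((\<psi> (exp v) - \<psi> (exp w)) / (exp w - exp v))) = h1 v + \<psi> (exp w) * h2 v"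
        using minus_divide_right[of "\<psi> (exp w) * g (exp v) * exp v" "exp w - exp v"]
        by (simp add: h1_def h2_def right_diff_distrib diff_divide_distrib mult_ac)
    qed
    also have "\<dots> = sector_int \<omega> h1 + sector_int \<omega> (\<lambda>v. \<psi> (exp w) * h2 v)"
    proof (rule sector_int_add)
      fix y assume y: "y \<in> {-\<omega>, \<omega>}"
      hence y': "\<bar>y\<bar> = \<omega>" "\<bar>y\<bar> < \<theta>" using \<omega> by auto
      have nz: "exp w - exp (Complex u y) \<noteq> 0" "exp (Complex u y) - exp w \<noteq> 0" for u
        using ne[of w "Complex u y"] w y' by auto
      show "integrable lborel (\<lambda>u. h1 (Complex u y))"
      proof (rule strip_integrable)
        show "continuous_on UNIV (\<lambda>u. h1 (Complex u y))"
          unfolding h1_def using nz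
          by (intro continuous_intros continuous_decaying_line[OF g \<omega>(4) y'(2)] \<psi>[OF y] cont_line) auto
        show "cmod (h1 (Complex u y)) \<le> (Cg * K * (D / exp (Re w))) * exp (- \<bar>u\<bar>)" for u
        proof -
          have "cmod (exp w / (exp w - exp (Complex u y))) \<le> D"
            using ratio(1)[of w "Complex u y"] w y' by simp
          hence "cmod (1 / (exp w - exp (Complex u y))) \<le> D / exp (Re w)"
            by (simp add: norm_divide field_simps)
          moreover have "cmod (g (exp (Complex u y))) \<le> Cg * exp (- \<bar>u\<bar>)"
            using Cg(2)[of "Complex u y"] y' by simp
          ultimately have "cmod (g (exp (Complex u y))) * cmod (exp (Complex u y) * \<psi> (exp (Complex u y)))
              * cmod (1 / (exp w - exp (Complex u y))) \<le> Cg * exp (- \<bar>u\<bar>) * K * (D / exp (Re w))"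
            using Cg(1) K0 D0 y' by (intro mult_mono a) auto
          thus ?thesis by (simp add: h1_def norm_mult norm_divide mult_ac)
        qed
      qed
      show "integrable lborel (\<lambda>u. \<psi> (exp w) * h2 (Complex u y))"
      proof (rule integrable_mult_right, rule strip_integrable)
        show "continuous_on UNIV (\<lambda>u. h2 (Complex u y))"
          unfolding h2_def using nz
          by (intro continuous_intros continuous_decaying_line[OF g \<omega>(4) y'(2)] cont_line) auto
        show "cmod (h2 (Complex u y)) \<le> (Cg * D) * exp (- \<bar>u\<bar>)" for u
        proof -
          have "cmod (exp (Complex u y) / (exp w - exp (Complex u y))) \<le> D"
            using ratio(2)[of w "Complex u y"] w y' by simp
          moreover have "cmod (g (exp (Complex u y))) \<le> Cg * exp (- \<bar>u\<bar>)"
            using Cg(2)[of "Complex u y"] y' by simp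
          ultimately have "cmod (g (exp (Complex u y))) * cmod (exp (Complex u y) / (exp w - exp (Complex u y)))
             \<le> Cg * exp (- \<bar>u\<bar>) * D"
            using Cg(1) by (intro mult_mono) auto
          thus ?thesis by (simp add: h2_def norm_mult norm_divide mult_ac norm_minus_commute)
        qed
      qed
    qed
    also have "sector_int \<omega> (\<lambda>v. \<psi> (exp w) * h2 v) = 0"
      unfolding sector_int_cmult unfolding h2_def
      by (subst sector_Cauchy_outside[OF g]) (use w \<omega> in auto)
    finally show ?thesis by (simp add: h1_def[abs_def])
  qed
  \<comment> \<open>Once the order of integration is exchanged, the integral over the larger contour
    is Cauchy's formula for \<open>f\<close> at the point e^v inside it.\<close>
  define Kr where "Kr w v = f (exp w) * g (exp v) * (exp v * \<psi> (exp v)) * (exp w / (exp w - exp v))" for w v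
  have "sector_int \<omega>' (\<lambda>w. f (exp w) * (exp w * sector_int \<omega> (\<lambda>v. g (exp v) * (exp v *
            ((\<psi> (exp v) - \<psi> (exp w)) / (exp w - exp v))))))
      = sector_int \<omega>' (\<lambda>w. sector_int \<omega> (Kr w))"
  proof (rule sector_int_cong)
    fix w assume "\<bar>Im w\<bar> = \<bar>\<omega>'\<bar>"
    hence w: "\<bar>Im w\<bar> = \<omega>'" using \<omega> by simp
    show "f (exp w) * (exp w * sector_int \<omega> (\<lambda>v. g (exp v) * (exp v *
            ((\<psi> (exp v) - \<psi> (exp w)) / (exp w - exp v))))) = sector_int \<omega> (Kr w)"
      unfolding inner[OF w] sector_int_cmult[symmetric] by (simp add: Kr_def[abs_def] mult_ac)
  qed
  also have "\<dots> = sector_int \<omega> (\<lambda>v. sector_int \<omega>' (\<lambda>w. Kr w v))"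
  proof (rule sector_int_Fubini)
    fix y y' assume y: "y \<in> {-\<omega>', \<omega>'}" "y' \<in> {-\<omega>, \<omega>}"
    hence yy: "\<bar>y\<bar> = \<omega>'" "\<bar>y'\<bar> = \<omega>" "\<bar>y\<bar> < \<theta>" "\<bar>y'\<bar> < \<theta>" using \<omega> by auto
    have nz: "exp (Complex u y) - exp (Complex v y') \<noteq> 0" for u v
      using ne[of "Complex u y" "Complex v y'"] yy by auto
    have fst: "continuous_on UNIV (\<lambda>x::real \<times> real. h (fst x))" and snd: "continuous_on UNIV (\<lambda>x::real \<times> real. h (snd x))"
      if "continuous_on UNIV h" for h :: "real \<Rightarrow> complex"
      by (rule continuous_on_compose2[OF that]; auto intro!: continuous_intros)+
    show "continuous_on UNIV (\<lambda>(u, v). Kr (Complex u y) (Complex v y'))"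
      unfolding Kr_def case_prod_unfold using nz
      by (intro continuous_intros fst[OF continuous_decaying_line[OF f \<omega>(4) yy(3)]]
           snd[OF continuous_decaying_line[OF g \<omega>(4) yy(4)]] snd[OF \<psi>[OF y(2)]] fst[OF cont_line] snd[OF cont_line])
         auto
    fix u v
    have "cmod (f (exp (Complex u y))) * cmod (g (exp (Complex v y'))) * cmod (exp (Complex v y') * \<psi> (exp (Complex v y')))
       * cmod (exp (Complex u y) / (exp (Complex u y) - exp (Complex v y')))
       \<le> (Cf * exp (- \<bar>u\<bar>)) * (Cg * exp (- \<bar>v\<bar>)) * K * D"
      using Cf(2)[of "Complex u y"] Cg(2)[of "Complex v y'"] a[of "Complex v y'"] ratio(1)[of "Complex u y" "Complex v y'"]
        yy Cf(1) Cg(1) K0 D0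
      by (intro mult_mono) auto
    thus "cmod (Kr (Complex u y) (Complex v y')) \<le> (Cf * Cg * K * D) * (exp (- \<bar>u\<bar>) * exp (- \<bar>v\<bar>))"
      unfolding Kr_def norm_mult by (simp add: mult_ac)
  qed
  also have "\<dots> = sector_int \<omega> (\<lambda>v. f (exp v) * g (exp v) * (exp v * \<psi> (exp v)))"
  proof (rule sector_int_cong)
    fix v assume v: "\<bar>Im v\<bar> = \<bar>\<omega>\<bar>"
    have "sector_int \<omega>' (\<lambda>w. Kr w v) = (g (exp v) * (exp v * \<psi> (exp v))) *
             sector_int \<omega>' (\<lambda>w. f (exp w) * exp w / (exp w - exp v))"
      unfolding sector_int_cmult[symmetric] by (simp add: Kr_def mult_ac)
    also have "sector_int \<omega>' (\<lambda>w. f (exp w) * exp w / (exp w - exp v)) = f (exp v)"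
      by (rule sector_Cauchy_inside[OF f]) (use v \<omega> in auto)
    finally show "sector_int \<omega>' (\<lambda>w. Kr w v) = f (exp v) * g (exp v) * (exp v * \<psi> (exp v))"
      by (simp add: mult_ac)
  qed
  finally show ?thesis .
qed

text \<open>The regulariser decays at 0 and at infinity and its only pole is -1, so the contour can
  be closed through the complement of the sector, where \<psi> is holomorphic. In the logarithmic
  coordinate that region is the strip between \<omega> and 2 pi - \<omega>, with a double pole at i
  pi.\<close>

lemma sector_int_regul:
  assumes \<psi>: "\<psi> holomorphic_on - complex_of_real ` {0..}" and \<omega>: "0 < \<omega>" "\<omega> < pi"
    and K: "\<And>w. \<omega> \<le> Im w \<Longrightarrow> Im w \<le> 2 * pi - \<omega> \<Longrightarrow> cmod (exp w * \<psi> (exp w)) \<le> K"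
  shows "sector_int \<omega> (\<lambda>w. regul (exp w) * (exp w * \<psi> (exp w))) = deriv \<psi> (- 1) - \<psi> (- 1)"
proof -
  define S where "S = {w. 0 < Im w \<and> Im w < 2 * pi}"
  define w0 where "w0 = Complex 0 pi"
  define a where "a w = exp w * \<psi> (exp w)" for w
  define G where "G w = regul (exp w) * a w" for w
  have Sopen: "open S" unfolding S_def by (rule open_strip)
  have w0: "exp w0 = - 1" "w0 \<in> S"
    using pi_gt_zero by (auto simp: w0_def S_def exp_eq_polar cis_conv_exp[symmetric] complex_eq_iff)
  have ne: "exp w + 1 \<noteq> 0" if "w \<in> S" "w \<noteq> w0" for w
  proof
    assume "exp w + 1 = 0"
    hence "exp w = exp w0" unfolding w0 by (rule eq_neg_iff_add_eq_0[THEN iffD2])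
    moreover have "\<bar>Im w - Im w0\<bar> < 2 * pi"
      using that by (auto simp: S_def w0_def)
    ultimately have "w = w0" by (rule exp_complex_eqI[rotated])
    thus False using that by simp
  qed
  have hol_a: "a holomorphic_on S"
    unfolding a_def S_def by (intro holomorphic_intros halfline_complement_exp_holomorphic[OF \<psi>]) auto
  have hol_G: "G holomorphic_on S - {w0}"
    unfolding G_def regul_def using ne
    by (intro holomorphic_intros holomorphic_on_subset[OF hol_a]) (auto simp: add.commute)
  have K0: "K \<ge> 0" using order.trans[OF norm_ge_zero K[of w0]] \<omega> by (simp add: w0_def)
  define \<delta> where "\<delta> = pi - \<omega>"
  define D where "D = max 4 (1 / sqrt ((1 - cos \<delta>) / 2))"
  have bound: "cmod (G w) \<le> (D\<^sup>2 * K) * exp (- \<bar>Re w\<bar>)"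
    if w: "\<omega> \<le> Im w" "Im w \<le> 2 * pi - \<omega>" "Im w = \<omega> \<or> Im w = 2 * pi - \<omega> \<or> \<bar>Re w\<bar> \<ge> 1" for w
  proof -
    have "cmod (exp w) + cmod (exp w0) \<le> D * cmod (exp w - exp w0)"
    proof (cases "\<bar>Re w\<bar> \<ge> 1")
      case True
      hence "cmod (exp w) + cmod (exp w0) \<le> 4 * cmod (exp w - exp w0)"
        by (intro exp_ratio_bound_far) (auto simp: w0_def)
      also have "\<dots> \<le> D * cmod (exp w - exp w0)"
        by (intro mult_right_mono) (auto simp: D_def)
      finally show ?thesis .
    next
      case False
      hence "\<delta> \<le> \<bar>Im w - Im w0\<bar>" "\<bar>Im w - Im w0\<bar> \<le> 2 * pi - \<delta>" "0 < \<delta>" "\<delta> \<le> pi"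
        using w \<omega> by (auto simp: \<delta>_def w0_def)
      from exp_ratio_bound(1)[OF this]
      have "cmod (exp w) + cmod (exp w0) \<le> 1 / sqrt ((1 - cos \<delta>) / 2) * cmod (exp w - exp w0)"
        by simp
      also have "\<dots> \<le> D * cmod (exp w - exp w0)"
        by (intro mult_right_mono) (auto simp: D_def)
      finally show ?thesis .
    qed
    hence 1: "1 + exp (Re w) \<le> D * cmod (1 + exp w)"
      by (simp add: w0(1) add.commute)
    have pos: "1 + exp (Re w) > 0" by (intro add_pos_pos) auto
    have "(1 + exp (Re w))\<^sup>2 \<le> (D * cmod (1 + exp w))\<^sup>2"
      using 1 pos by (intro power_mono) auto
    hence 2: "1 / (cmod (1 + exp w))\<^sup>2 \<le> D\<^sup>2 / (1 + exp (Re w))\<^sup>2"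
    proof -
      have "cmod (1 + exp w) \<noteq> 0" using 1 pos by auto
      thus ?thesis using \<open>(1 + exp (Re w))\<^sup>2 \<le> (D * cmod (1 + exp w))\<^sup>2\<close> pos
        by (simp add: divide_simps power_mult_distrib)
    qed
    have "cmod (regul (exp w)) = exp (Re w) * (1 / (cmod (1 + exp w))\<^sup>2)"
      by (simp add: regul_def norm_divide norm_power)
    also have "\<dots> \<le> exp (Re w) * (D\<^sup>2 / (1 + exp (Re w))\<^sup>2)"
      using 2 by (intro mult_left_mono) auto
    also have "\<dots> = D\<^sup>2 * (exp (Re w) / (1 + exp (Re w))\<^sup>2)" by simp
    also have "\<dots> \<le> D\<^sup>2 * exp (- \<bar>Re w\<bar>)"
      by (intro mult_left_mono log_weight_le) auto
    finally have "cmod (regul (exp w)) * cmod (a w) \<le> (D\<^sup>2 * exp (- \<bar>Re w\<bar>)) * K"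
      unfolding a_def using w by (intro mult_mono K) auto
    thus ?thesis by (simp add: G_def norm_mult mult_ac)
  qed
  have cint: "contour_integral (rectpath (Complex (- N) \<omega>) (Complex N (2 * pi - \<omega>))) G
                = - (2 * pi * \<i> * deriv a w0)" if "N > 1" for N
  proof -
    define p where "p = rectpath (Complex (- N) \<omega>) (Complex N (2 * pi - \<omega>))"
    have w0box: "w0 \<in> box (Complex (- N) \<omega>) (Complex N (2 * pi - \<omega>))"
      using \<omega> that by (auto simp: in_box_complex_iff w0_def)
    have img: "path_image p \<subseteq> S - {w0}"
      using \<omega> that w0box
      by (auto simp: p_def S_def path_image_rectpath_cbox_minus_box in_cbox_complex_iff)
    \<comment> \<open>A primitive of \<open>regul (exp w)\<close>. Up to the exact derivative of the
      product of \<open>P\<close> and \<open>a\<close>, the double pole of \<open>G\<close> becomes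
      the simple pole of \<open>P w * deriv a w\<close>, with a change of sign.\<close>
    define P where "P w = - (1 / (1 + exp w))" for w :: complex
    have hol_da: "deriv a holomorphic_on S"
      by (rule holomorphic_deriv[OF hol_a Sopen])
    have dP: "((\<lambda>w. P w * a w) has_field_derivative (G w + P w * deriv a w)) (at w)"
      if "w \<in> S - {w0}" for w
    proof -
      have "1 + exp w \<noteq> 0" using ne that by (auto simp: add.commute)
      hence "(P has_field_derivative exp w / (1 + exp w)\<^sup>2) (at w)"
        unfolding P_def by (auto intro!: derivative_eq_intros simp: power2_eq_square)
      moreover have "(a has_field_derivative deriv a w) (at w)"
        using holomorphic_derivI[OF hol_a Sopen] that by auto
      ultimately show ?thesis
        unfolding G_def regul_def by (auto dest: DERIV_mult simp: mult_ac)
    qed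
    have "((\<lambda>w. G w + P w * deriv a w) has_contour_integral
             (P (pathfinish p) * a (pathfinish p) - P (pathstart p) * a (pathstart p))) p"
    proof (rule contour_integral_primitive)
      show "((\<lambda>w. P w * a w) has_field_derivative G w + P w * deriv a w) (at w within S - {w0})"
        if "w \<in> S - {w0}" for w
        using dP[OF that] by (rule has_field_derivative_at_within)
    qed (use img in \<open>auto simp: p_def\<close>)
    hence 1: "((\<lambda>w. G w + P w * deriv a w) has_contour_integral 0) p"
      by (simp add: p_def)
    have holQ: "(\<lambda>w. P w * deriv a w) holomorphic_on S - {w0}"
      unfolding P_def using ne
      by (intro holomorphic_intros holomorphic_on_subset[OF hol_da]) (auto simp: add.commute)
    have 2: "contour_integral p (\<lambda>w. P w * deriv a w) = 2 * pi * \<i> * deriv a w0"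
    proof -
      have "contour_integral p (\<lambda>w. P w * deriv a w) = 2 * pi * \<i> *
              (\<Sum>q\<in>{w0}. winding_number p q * residue (\<lambda>w. P w * deriv a w) q)"
      proof (rule Residue_theorem[OF Sopen])
        show "connected S" unfolding S_def by (rule convex_connected[OF convex_strip])
        show "\<forall>z. z \<notin> S \<longrightarrow> winding_number p z = 0"
          unfolding p_def using \<omega> that
          by (auto intro!: winding_number_rectpath_outside simp: in_cbox_complex_iff S_def)
      qed (use holQ img in \<open>auto simp: p_def\<close>)
      moreover have "residue (\<lambda>w. P w * deriv a w) w0 = deriv a w0"
      proof (rule residue_simple'[OF Sopen w0(2) holQ])
        have "((\<lambda>w. (exp w - exp w0) / (w - w0)) \<longlongrightarrow> exp w0) (at w0)"
          using DERIV_exp[of w0] by (simp add: has_field_derivative_iff)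
        moreover have "isCont (deriv a) w0"
          using hol_da w0 continuous_on_eq_continuous_at[OF Sopen, of "deriv a"]
          by (simp add: holomorphic_on_imp_continuous_on)
        ultimately have "((\<lambda>w. - deriv a w / ((exp w - exp w0) / (w - w0))) \<longlongrightarrow> - deriv a w0 / exp w0) (at w0)"
          by (intro tendsto_divide tendsto_minus) (auto simp: isCont_def)
        thus "((\<lambda>w. P w * deriv a w * (w - w0)) \<longlongrightarrow> deriv a w0) (at w0)"
          by (simp add: P_def w0(1) add.commute)
      qed
      ultimately show ?thesis
        using winding_number_rectpath[OF w0box] by (simp add: p_def)
    qed
    have "(\<lambda>w. P w * deriv a w) contour_integrable_on p" "G contour_integrable_on p"
      by (rule contour_integrable_holomorphic_simple[OF _ open_delete[OF Sopen] _ img];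
          use holQ hol_G in \<open>auto simp: p_def\<close>)+
    hence "contour_integral p G + contour_integral p (\<lambda>w. P w * deriv a w) = 0"
      using contour_integral_unique[OF 1] by (subst contour_integral_add[symmetric]) auto
    thus ?thesis using 2 by (metis add_eq_0_iff2 p_def)
  qed
  have contG: "continuous_on {w. \<omega> \<le> Im w \<and> Im w \<le> 2 * pi - \<omega> \<and>
                 (Im w = \<omega> \<or> Im w = 2 * pi - \<omega> \<or> \<bar>Re w\<bar> \<ge> 1)} G"
    by (rule continuous_on_subset[OF holomorphic_on_imp_continuous_on[OF hol_G]])
       (use \<omega> in \<open>auto simp: S_def w0_def\<close>)
  have "(\<integral>u. G (Complex u \<omega>) \<partial>lborel) - (\<integral>u. G (Complex u (2 * pi - \<omega>)) \<partial>lborel)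
          = - (2 * pi * \<i> * deriv a w0)"
    by (rule strip_integral_difference(3)[OF _ _ contG bound cint]) (use \<omega> in auto)
  \<comment> \<open>By periodicity the upper edge of this strip is the lower ray of the
    sector.\<close>
  moreover have "G (Complex u (2 * pi - \<omega>)) = G (Complex u (- \<omega>))" for u
  proof -
    have "exp (Complex u (2 * pi - \<omega>)) = exp (Complex u (- \<omega>))"
      by (simp add: exp_eq_polar complex_eq_iff)
    thus ?thesis by (simp add: G_def a_def)
  qed
  ultimately have "sector_int \<omega> G = deriv a w0"
    unfolding sector_int_def by (simp add: field_simps add_eq_0_iff)
  moreover have "deriv a w0 = deriv \<psi> (- 1) - \<psi> (- 1)"
  proof -
    have "open (- complex_of_real ` {0..})"
      by (rule open_halfline_complement)
    moreover have "(- 1 :: complex) \<in> - complex_of_real ` {0..}"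
      by (auto simp: complex_eq_iff)
    ultimately have d: "(\<psi> has_field_derivative deriv \<psi> (- 1)) (at (exp w0))"
      using holomorphic_derivI[OF \<psi>] w0(1) by simp
    have "(a has_field_derivative exp w0 * \<psi> (exp w0) + (deriv \<psi> (- 1) * exp w0) * exp w0) (at w0)"
      unfolding a_def by (auto intro!: derivative_eq_intros DERIV_chain2[where f = \<psi> and g = exp and x = w0, OF d])
    thus ?thesis using w0(1) by (simp add: DERIV_imp_deriv)
  qed
  ultimately show ?thesis by (simp add: G_def[abs_def] a_def[abs_def])
qed

section \<open>Function spaces with a separating family of functionals\<close>

definition bfun :: "'a fspace \<Rightarrow> (('a \<Rightarrow> complex) \<Rightarrow> complex) \<Rightarrow> bool" where
  "bfun X l \<longleftrightarrow>
     (\<forall>f\<in>elems X. \<forall>g\<in>elems X. \<forall>c. l (\<lambda>a. c * f a + g a) = c * l f + l g) \<and>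
     (\<exists>C. \<forall>f\<in>elems X. cmod (l f) \<le> C * nrm X f)"

text \<open>The functionals stand in for the dual space: by \<open>separating\<close>, equality
  modulo null functions is decided on scalars, and boundedness makes a functional blind to the
  choice of representatives.\<close>

locale separated_fspace =
  fixes X :: "'a fspace"
  assumes zero_in: "(\<lambda>_. 0) \<in> elems X"
    and add_in: "f \<in> elems X \<Longrightarrow> g \<in> elems X \<Longrightarrow> (\<lambda>a. f a + g a) \<in> elems X"
    and scale_in: "f \<in> elems X \<Longrightarrow> (\<lambda>a. c * f a) \<in> elems X"
    and nrm_add: "f \<in> elems X \<Longrightarrow> g \<in> elems X \<Longrightarrow> nrm X (\<lambda>a. f a + g a) \<le> nrm X f + nrm X g"
    and nrm_scale: "f \<in> elems X \<Longrightarrow> nrm X (\<lambda>a. c * f a) = cmod c * nrm X f"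
    and nrm_nonneg: "f \<in> elems X \<Longrightarrow> 0 \<le> nrm X f"
    and separating: "f \<in> elems X \<Longrightarrow> (\<And>l. bfun X l \<Longrightarrow> l f = 0) \<Longrightarrow> nrm X f = 0"
begin

lemma lin_in: "f \<in> elems X \<Longrightarrow> g \<in> elems X \<Longrightarrow> (\<lambda>a. c * f a + g a) \<in> elems X"
  by (rule add_in[OF scale_in])

lemma minus_in: "f \<in> elems X \<Longrightarrow> (\<lambda>a. - f a) \<in> elems X"
  using scale_in[of f "- 1"] by simp

lemma diff_in: "f \<in> elems X \<Longrightarrow> g \<in> elems X \<Longrightarrow> (\<lambda>a. f a - g a) \<in> elems X"
  using lin_in[of g f "- 1"] by simp

lemma divide_in: "f \<in> elems X \<Longrightarrow> (\<lambda>a. f a / c) \<in> elems X"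
  using scale_in[of f "1 / c"] by simp

lemma sum_in: "(\<And>i. i \<in> I \<Longrightarrow> f i \<in> elems X) \<Longrightarrow> (\<lambda>a. \<Sum>i\<in>I. f i a) \<in> elems X"
  by (induction I rule: infinite_finite_induct) (auto intro: zero_in add_in)

lemma bfun_lin: "bfun X l \<Longrightarrow> f \<in> elems X \<Longrightarrow> g \<in> elems X \<Longrightarrow> l (\<lambda>a. c * f a + g a) = c * l f + l g"
  by (simp add: bfun_def)

lemma bfun_add: "bfun X l \<Longrightarrow> f \<in> elems X \<Longrightarrow> g \<in> elems X \<Longrightarrow> l (\<lambda>a. f a + g a) = l f + l g"
  using bfun_lin[of l f g 1] by simp

lemma bfun_zero: "bfun X l \<Longrightarrow> l (\<lambda>_. 0) = 0"
  using bfun_add[of l "\<lambda>_. 0" "\<lambda>_. 0"] zero_in by simp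

lemma bfun_scale: "bfun X l \<Longrightarrow> f \<in> elems X \<Longrightarrow> l (\<lambda>a. c * f a) = c * l f"
  using bfun_lin[of l f "\<lambda>_. 0" c] zero_in by (simp add: bfun_zero)

lemma bfun_diff: "bfun X l \<Longrightarrow> f \<in> elems X \<Longrightarrow> g \<in> elems X \<Longrightarrow> l (\<lambda>a. f a - g a) = l f - l g"
  using bfun_lin[of l g f "- 1"] by simp

lemma bfun_minus: "bfun X l \<Longrightarrow> f \<in> elems X \<Longrightarrow> l (\<lambda>a. - f a) = - l f"
  using bfun_scale[of l f "- 1"] by simp

lemma bfun_divide: "bfun X l \<Longrightarrow> f \<in> elems X \<Longrightarrow> l (\<lambda>a. f a / c) = l f / c"
  using bfun_scale[of l f "1 / c"] by simp

lemma bfun_sum: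
  assumes "bfun X l" "\<And>i. i \<in> I \<Longrightarrow> f i \<in> elems X"
  shows "l (\<lambda>a. \<Sum>i\<in>I. f i a) = (\<Sum>i\<in>I. l (f i))"
  using assms(2)
proof (induction I rule: infinite_finite_induct)
  case (insert i I)
  thus ?case using bfun_add[OF assms(1), of "f i" "\<lambda>a. \<Sum>i\<in>I. f i a"] sum_in[of I f] by simp
qed (simp_all add: bfun_zero assms(1))

lemma bfun_bound:
  assumes "bfun X l"
  obtains C where "C \<ge> 0" "\<And>f. f \<in> elems X \<Longrightarrow> cmod (l f) \<le> C * nrm X f"
proof -
  from assms obtain C where C: "\<forall>f\<in>elems X. cmod (l f) \<le> C * nrm X f"
    by (auto simp: bfun_def)
  show ?thesis
  proof (rule that[of "\<bar>C\<bar>"])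
    fix f assume "f \<in> elems X"
    with C have "cmod (l f) \<le> C * nrm X f" by blast
    also have "\<dots> \<le> \<bar>C\<bar> * nrm X f"
      using \<open>f \<in> elems X\<close> by (intro mult_right_mono nrm_nonneg) auto
    finally show "cmod (l f) \<le> \<bar>C\<bar> * nrm X f" .
  qed auto
qed

lemma bfun_null: "bfun X l \<Longrightarrow> f \<in> elems X \<Longrightarrow> nrm X f = 0 \<Longrightarrow> l f = 0"
  by (auto simp: bfun_def)

lemma nrm_zero: "nrm X (\<lambda>_. 0) = 0"
  using nrm_scale[OF zero_in, of 0] by simp

lemma nrm_eq_0_iff: "f \<in> elems X \<Longrightarrow> nrm X f = 0 \<longleftrightarrow> (\<forall>l. bfun X l \<longrightarrow> l f = 0)"
  using bfun_null separating by blast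

lemma ndist_eq_0_iff:
  "f \<in> elems X \<Longrightarrow> g \<in> elems X \<Longrightarrow> ndist X f g = 0 \<longleftrightarrow> (\<forall>l. bfun X l \<longrightarrow> l f = l g)"
  unfolding ndist_def by (subst nrm_eq_0_iff) (auto simp: diff_in bfun_diff)

lemma ndist_nonneg: "f \<in> elems X \<Longrightarrow> g \<in> elems X \<Longrightarrow> 0 \<le> ndist X f g"
  unfolding ndist_def by (intro nrm_nonneg diff_in)

lemma nrm_minus: "f \<in> elems X \<Longrightarrow> nrm X (\<lambda>a. - f a) = nrm X f"
  using nrm_scale[of f "- 1"] by simp

lemma ndist_commute: "f \<in> elems X \<Longrightarrow> g \<in> elems X \<Longrightarrow> ndist X f g = ndist X g f"
  unfolding ndist_def using nrm_minus[of "\<lambda>a. f a - g a"] by (simp add: diff_in)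

lemma ndist_triangle:
  "f \<in> elems X \<Longrightarrow> g \<in> elems X \<Longrightarrow> h \<in> elems X \<Longrightarrow> ndist X f h \<le> ndist X f g + ndist X g h"
  unfolding ndist_def using nrm_add[of "\<lambda>a. f a - g a" "\<lambda>a. g a - h a"] by (simp add: diff_in)

lemma nrm_triangle_ndist: "f \<in> elems X \<Longrightarrow> g \<in> elems X \<Longrightarrow> nrm X f \<le> ndist X f g + nrm X g"
  unfolding ndist_def using nrm_add[of "\<lambda>a. f a - g a" g] by (simp add: diff_in)

lemma nrm_cong: "f \<in> elems X \<Longrightarrow> g \<in> elems X \<Longrightarrow> ndist X f g = 0 \<Longrightarrow> nrm X f = nrm X g"
  using nrm_triangle_ndist[of f g] nrm_triangle_ndist[of g f] by (simp add: ndist_commute)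

text \<open>A bounded functional maps the approximating simple functions to scalar ones that
  approximate \<open>l (F t)\<close> in \<open>L^1\<close>, so integrability and value both come
  from the limit. Strong measurability of \<open>F\<close> holds up to null sets only, hence the
  separate measurability hypothesis on \<open>l (F t)\<close>.\<close>

lemma bfun_has_integral_in:
  assumes l: "bfun X l" and F: "has_integral_in X M F y" "\<And>t. t \<in> space M \<Longrightarrow> F t \<in> elems X"
    and [measurable]: "(\<lambda>t. l (F t)) \<in> borel_measurable M"
  shows "integrable M (\<lambda>t. l (F t))" "(\<integral>t. l (F t) \<partial>M) = l y"
proof -
  obtain C where C: "C \<ge> 0" "\<And>f. f \<in> elems X \<Longrightarrow> cmod (l f) \<le> C * nrm X f"
    using bfun_bound[OF l] by blast
  from F(1) obtain n :: "nat \<Rightarrow> nat" and E v where y: "y \<in> elems X"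
    and E: "\<And>j i. i < n j \<Longrightarrow> E j i \<in> sets M" "\<And>j i. i < n j \<Longrightarrow> emeasure M (E j i) < \<infinity>"
      "\<And>j i. i < n j \<Longrightarrow> v j i \<in> elems X"
    and l1: "(\<lambda>j::nat. \<integral>\<^sup>+t. ennreal (ndist X (F t) (\<lambda>a. \<Sum>i<n j. indicator (E j i) t * v j i a)) \<partial>M) \<longlonglongrightarrow> 0"
    and l2: "(\<lambda>j. ndist X (\<lambda>a. \<Sum>i<n j. complex_of_real (measure M (E j i)) * v j i a) y) \<longlonglongrightarrow> 0"
    unfolding has_integral_in_def
    apply (elim conjE exE)
    subgoal for n E v
      by (rule that[of n E v]; (assumption | blast))
    done
  define s where "s j t = (\<Sum>i<n j. indicator (E j i) t * l (v j i))" for j t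
  define S where "S j t = (\<lambda>a. \<Sum>i<n j. (indicator (E j i) t :: complex) * v j i a)" for j t
  have S_in: "S j t \<in> elems X" for j t
    unfolding S_def by (rule sum_in) (auto intro: scale_in E)
  have lS: "l (S j t) = s j t" for j t
  proof -
    have "l (S j t) = (\<Sum>i<n j. l (\<lambda>a. indicator (E j i) t * v j i a))"
      unfolding S_def by (rule bfun_sum[OF l]) (rule scale_in[OF E(3)], simp)
    also have "\<dots> = s j t"
      unfolding s_def by (rule sum.cong[OF refl]) (rule bfun_scale[OF l E(3)], simp)
    finally show ?thesis .
  qed
  have s_hbi: "has_bochner_integral M (\<lambda>t. indicator (E j i) t * l (v j i))
      (complex_of_real (measure M (E j i)) * l (v j i))" if "i < n j" for i j
  proof -
    have "(\<lambda>t. indicator (E j i) t * l (v j i)) = (\<lambda>t. indicator (E j i) t *\<^sub>R l (v j i))"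
      by (auto simp: indicator_def)
    moreover have "has_bochner_integral M (\<lambda>t. indicator (E j i) t *\<^sub>R l (v j i)) (measure M (E j i) *\<^sub>R l (v j i))"
      using E[OF that] by (intro has_bochner_integral_indicator) auto
    ultimately show ?thesis by (simp add: scaleR_conv_of_real)
  qed
  have s_hb: "has_bochner_integral M (s j) (\<Sum>i<n j. complex_of_real (measure M (E j i)) * l (v j i))" for j
    unfolding s_def[abs_def] by (rule has_bochner_integral_sum) (use s_hbi in auto)
  have int_s: "integrable M (s j)" for j
    using s_hb by (rule integrable.intros)
  hence s_meas [measurable]: "s j \<in> borel_measurable M" for j
    by (rule borel_measurable_integrable)
  have "(\<integral>t. s j t \<partial>M) = (\<Sum>i<n j. complex_of_real (measure M (E j i)) * l (v j i))" for j
    using s_hb by (rule has_bochner_integral_integral_eq)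
  also have "\<dots> j = l (\<lambda>a. \<Sum>i<n j. complex_of_real (measure M (E j i)) * v j i a)" for j
    by (subst bfun_sum[OF l]) (auto intro!: scale_in E sum.cong bfun_scale[symmetric] l)
  finally have int_eq: "(\<integral>t. s j t \<partial>M) = l (\<lambda>a. \<Sum>i<n j. complex_of_real (measure M (E j i)) * v j i a)" for j .
  have lim1: "(\<lambda>j. \<integral>t. s j t \<partial>M) \<longlonglongrightarrow> l y"
  proof (rule Lim_transform2[OF tendsto_const], rule Lim_null_comparison)
    show "\<forall>\<^sub>F j in sequentially. norm (l y - (\<integral>t. s j t \<partial>M))
        \<le> C * ndist X (\<lambda>a. \<Sum>i<n j. complex_of_real (measure M (E j i)) * v j i a) y"
    proof (intro always_eventually allI)
      fix j
      have "(\<lambda>a. \<Sum>i<n j. complex_of_real (measure M (E j i)) * v j i a) \<in> elems X" (is "?S \<in> _")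
        by (rule sum_in) (auto intro: scale_in E)
      thus "norm (l y - (\<integral>t. s j t \<partial>M)) \<le> C * ndist X ?S y"
        using C(2)[OF diff_in[of ?S y]] y
        by (simp add: int_eq ndist_def bfun_diff[OF l] norm_minus_commute)
    qed
    show "(\<lambda>j. C * ndist X (\<lambda>a. \<Sum>i<n j. complex_of_real (measure M (E j i)) * v j i a) y) \<longlonglongrightarrow> 0"
      using tendsto_mult_right_zero[OF l2] by simp
  qed
  \<comment> \<open>Dividing by \<open>C + 1\<close> keeps the scaled error below the vector-valued
    one even when \<open>C = 0\<close>.\<close>
  define e where "e j = (\<integral>\<^sup>+t. ennreal (cmod (l (F t) - s j t) / (C + 1)) \<partial>M)" for j
  have e_lim: "e \<longlonglongrightarrow> 0"
  proof (rule tendsto_sandwich[OF _ _ tendsto_const l1])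
    show "\<forall>\<^sub>F j in sequentially. e j \<le> (\<integral>\<^sup>+t. ennreal (ndist X (F t)
            (\<lambda>a. \<Sum>i<n j. indicator (E j i) t * v j i a)) \<partial>M)"
      unfolding e_def
    proof (intro always_eventually allI nn_integral_mono ennreal_leI)
      fix j t assume t: "t \<in> space M"
      have "cmod (l (F t) - s j t) \<le> C * ndist X (F t) (S j t)"
        using C(2)[OF diff_in[OF F(2)[OF t] S_in]] F(2)[OF t] S_in
        by (simp add: ndist_def bfun_diff[OF l] lS)
      also have "\<dots> \<le> (C + 1) * ndist X (F t) (S j t)"
        by (intro mult_right_mono ndist_nonneg F t S_in) auto
      finally show "cmod (l (F t) - s j t) / (C + 1) \<le> ndist X (F t) (\<lambda>a. \<Sum>i<n j. indicator (E j i) t * v j i a)"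
        using C(1) by (simp add: S_def divide_le_eq mult.commute)
    qed
  qed auto
  have lF: "integrable M (\<lambda>t. l (F t))"
  proof -
    have "\<forall>\<^sub>F j in sequentially. e j < 1"
      using e_lim by (rule order_tendstoD) simp
    then obtain j where "e j < 1" by (auto simp: eventually_sequentially)
    have "integrable M (\<lambda>t. (l (F t) - s j t) / of_real (C + 1))"
    proof (rule integrableI_bounded)
      have "(\<integral>\<^sup>+t. ennreal (norm ((l (F t) - s j t) / of_real (C + 1))) \<partial>M) = e j"
        using C(1) unfolding e_def by (simp add: norm_divide del: of_real_add)
      thus "(\<integral>\<^sup>+t. ennreal (norm ((l (F t) - s j t) / of_real (C + 1))) \<partial>M) < \<infinity>"
        using order.strict_trans[OF \<open>e j < 1\<close>, of \<top>] by simp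
    qed measurable
    hence "integrable M (\<lambda>t. (l (F t) - s j t) / of_real (C + 1) * of_real (C + 1) + s j t)"
      using int_s by (intro Bochner_Integration.integrable_add integrable_mult_left)
    moreover have "complex_of_real (C + 1) \<noteq> 0"
      using C(1) by (simp del: of_real_add)
    ultimately show ?thesis by (simp del: of_real_add)
  qed
  thus "integrable M (\<lambda>t. l (F t))" .
  have lim2: "(\<lambda>j. \<integral>t. s j t \<partial>M) \<longlonglongrightarrow> (\<integral>t. l (F t) \<partial>M)"
  proof (rule Lim_transform2[OF tendsto_const], rule Lim_null_comparison)
    have int_d: "integrable M (\<lambda>t. cmod (l (F t) - s j t) / (C + 1))" for j
      using lF int_s by auto
    have "ennreal (\<integral>t. cmod (l (F t) - s j t) / (C + 1) \<partial>M) = e j" for j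
      unfolding e_def using C(1) by (intro nn_integral_eq_integral[symmetric] int_d) auto
    hence "(\<lambda>j. ennreal (\<integral>t. cmod (l (F t) - s j t) / (C + 1) \<partial>M)) \<longlonglongrightarrow> ennreal 0"
      using e_lim by simp
    hence "(\<lambda>j. \<integral>t. cmod (l (F t) - s j t) / (C + 1) \<partial>M) \<longlonglongrightarrow> 0"
      using C(1) by (subst (asm) tendsto_ennreal_iff) (auto intro!: always_eventually)
    thus "(\<lambda>j. (C + 1) * (\<integral>t. cmod (l (F t) - s j t) / (C + 1) \<partial>M)) \<longlonglongrightarrow> 0"
      by (rule tendsto_mult_right_zero)
    show "\<forall>\<^sub>F j in sequentially. norm ((\<integral>t. l (F t) \<partial>M) - (\<integral>t. s j t \<partial>M))
        \<le> (C + 1) * (\<integral>t. cmod (l (F t) - s j t) / (C + 1) \<partial>M)"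
    proof (intro always_eventually allI)
      fix j
      have "norm ((\<integral>t. l (F t) \<partial>M) - (\<integral>t. s j t \<partial>M)) = norm (\<integral>t. l (F t) - s j t \<partial>M)"
        using lF int_s by simp
      also have "\<dots> \<le> (\<integral>t. cmod (l (F t) - s j t) \<partial>M)"
        by (rule integral_norm_bound)
      finally show "norm ((\<integral>t. l (F t) \<partial>M) - (\<integral>t. s j t \<partial>M))
        \<le> (C + 1) * (\<integral>t. cmod (l (F t) - s j t) / (C + 1) \<partial>M)"
        using C(1) by simp
    qed
  qed
  show "(\<integral>t. l (F t) \<partial>M) = l y"
    by (rule LIMSEQ_unique[OF lim2 lim1])
qed

end

section \<open>Resolvents and the Cauchy calculus\<close>

text \<open>\<open>Arg\<close> jumps on the negative axis, so the bound on the argument is first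
  traded for a closed inequality, by monotonicity of the cosine.\<close>

lemma closure_sector_subset:
  assumes "0 < \<theta>" "\<theta> < pi"
  shows "closure (sector \<theta>) \<subseteq> {z. cmod z * cos \<theta> \<le> Re z}"
proof (rule closure_minimal)
  show "sector \<theta> \<subseteq> {z. cmod z * cos \<theta> \<le> Re z}"
  proof
    fix z assume z: "z \<in> sector \<theta>"
    hence "cos \<theta> \<le> cos \<bar>Arg z\<bar>"
      using assms by (intro cos_monotone_0_pi_le) (auto simp: sector_def)
    moreover have "Re z = cmod z * cos (Arg z)"
      by (metis Re_rcis rcis_cmod_Arg)
    ultimately show "z \<in> {z. cmod z * cos \<theta> \<le> Re z}"
      by (simp add: mult_left_mono)
  qed
  show "closed {z. cmod z * cos \<theta> \<le> Re z}"
    by (intro closed_Collect_le continuous_intros)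
qed

text \<open>The substitution t = e^u is made on the compact intervals [e^-n, e^n]; absolute
  integrability on either side then allows n to tend to infinity.\<close>

lemma lborel_integral_exp_substitution:
  fixes f :: "real \<Rightarrow> complex"
  assumes cont: "continuous_on {0<..} f"
    and int: "integrable (restrict_space lborel {0<..}) f"
    and int': "integrable lborel (\<lambda>u. of_real (exp u) * f (exp u))"
  shows "(\<integral>t. f t \<partial>restrict_space lborel {0<..}) = (\<integral>u. of_real (exp u) * f (exp u) \<partial>lborel)"
proof -
  have set_int: "set_integrable lborel {0<..} f"
    using int by (simp add: integrable_restrict_space set_integrable_def)
  define A where "A n = {exp (- real n)..exp (real n)}" for n
  define B where "B n = {- real n..real n}" for n
  have UA: "(\<Union>n. A n) = {0<..}"
  proof (intro equalityI subsetI)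
    fix t :: real assume "t \<in> {0<..}"
    hence t: "t > 0" by simp
    obtain n where "real n \<ge> \<bar>ln t\<bar>" using real_arch_simple by blast
    hence "- real n \<le> ln t" "ln t \<le> real n" by auto
    hence "exp (- real n) \<le> exp (ln t)" "exp (ln t) \<le> exp (real n)" by simp_all
    hence "t \<in> A n" using t by (simp add: A_def)
    thus "t \<in> (\<Union>n. A n)" by blast
  qed (auto simp: A_def intro: less_le_trans[OF exp_gt_zero])
  have UB: "(\<Union>n. B n) = UNIV"
  proof (intro equalityI subsetI)
    fix u :: real
    obtain n where "real n \<ge> \<bar>u\<bar>" using real_arch_simple by blast
    thus "u \<in> (\<Union>n. B n)" by (auto simp: B_def intro!: exI[of _ n])
  qed auto
  have lim1: "(\<lambda>n. LINT t:A n|lborel. f t) \<longlonglongrightarrow> (LINT t:(\<Union>n. A n)|lborel. f t)"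
    by (rule set_integral_cont_up)
       (use set_int in \<open>auto simp: UA[symmetric] A_def incseq_def intro: order.trans\<close>)
  have lim2: "(\<lambda>n. LINT u:B n|lborel. of_real (exp u) * f (exp u)) \<longlonglongrightarrow> (LINT u:(\<Union>n. B n)|lborel. of_real (exp u) * f (exp u))"
  proof (rule set_integral_cont_up)
    show "set_integrable lborel (\<Union>n. B n) (\<lambda>u. of_real (exp u) * f (exp u))"
      unfolding UB using int' by (simp only: set_integrable_def indicator_UNIV scaleR_one)
  qed (auto simp: B_def incseq_def)
  have eq: "(LINT t:A n|lborel. f t) = (LINT u:B n|lborel. of_real (exp u) * f (exp u))" for n
  proof -
    have sA: "set_integrable lborel (A n) f"
      by (rule set_integrable_subset[OF set_int]) (auto simp: UA[symmetric] A_def)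
    have sB: "set_integrable lborel (B n) (\<lambda>u. of_real (exp u) * f (exp u))"
      using int' by (auto simp: set_integrable_def B_def intro: integrable_mult_indicator)
    have "((\<lambda>u. exp u *\<^sub>R f (exp u)) has_integral
             (integral {exp (- real n)..exp (real n)} f - integral {exp (real n)..exp (- real n)} f)) {- real n..real n}"
    proof (rule has_integral_substitution_general[of "{}" _ _ exp "exp (- real n)" "exp (real n)"])
      show "continuous_on {exp (- real n)..exp (real n)} f"
        by (rule continuous_on_subset[OF cont]) (auto intro: less_le_trans[OF exp_gt_zero])
    qed (auto intro!: continuous_intros has_field_derivative_at_within DERIV_exp
           simp flip: has_real_derivative_iff_has_vector_derivative)
    moreover have "integral {exp (real n)..exp (- real n)} f = 0"
    proof (cases "n = 0")
      case False
      hence "{exp (real n)..exp (- real n)} = {}" by simp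
      thus ?thesis by simp
    qed auto
    ultimately have "integral (B n) (\<lambda>u. of_real (exp u) * f (exp u)) = integral (A n) f"
      by (simp add: A_def B_def integral_unique scaleR_conv_of_real exp_of_real)
    thus ?thesis
      using set_borel_integral_eq_integral(2)[OF sA] set_borel_integral_eq_integral(2)[OF sB] by simp
  qed
  have "(LINT t:{0<..}|lborel. f t) = (LINT u:UNIV|lborel. of_real (exp u) * f (exp u))"
    using LIMSEQ_unique[OF lim1] lim2 unfolding eq UA UB by blast
  thus ?thesis
    by (simp add: integral_restrict_space set_lebesgue_integral_def)
qed

locale sectorial_operator = separated_fspace +
  fixes A :: "'a graph"
  assumes zero_sectorial: "zero_sectorial X A"
begin

text \<open>A chosen representative of the resolvent, determined only up to null functions; its
  values are therefore compared through functionals.\<close>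

definition Rs :: "complex \<Rightarrow> ('a \<Rightarrow> complex) \<Rightarrow> ('a \<Rightarrow> complex)" where
  "Rs \<zeta> x = (SOME f. (x, f) \<in> resolvent X A \<zeta>)"

abbreviation V :: "complex set" where "V \<equiv> - complex_of_real ` {0..}"

lemma linear: "linear_op X A" and closed: "closed_op X A"
  using zero_sectorial by (auto simp: zero_sectorial_def)

lemma graph_in: "(f, g) \<in> A \<Longrightarrow> f \<in> elems X" "(f, g) \<in> A \<Longrightarrow> g \<in> elems X"
  using linear by (auto simp: linear_op_def)

lemma graph_lin:
  "(f, g) \<in> A \<Longrightarrow> (f', g') \<in> A \<Longrightarrow> ((\<lambda>a. c * f a + f' a), (\<lambda>a. c * g a + g' a)) \<in> A"
  using linear unfolding linear_op_def by fast

lemma graph_scale: "(f, g) \<in> A \<Longrightarrow> ((\<lambda>a. c * f a), (\<lambda>a. c * g a)) \<in> A"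
  using graph_lin[of f g "\<lambda>_. 0" "\<lambda>_. 0" c] linear by (auto simp: linear_op_def)

lemma graph_null: "(f, g) \<in> A \<Longrightarrow> nrm X f = 0 \<Longrightarrow> nrm X g = 0"
  using linear by (auto simp: linear_op_def)

text \<open>Closedness applied to constant sequences: the graph is saturated under a change of
  representatives.\<close>

lemma graph_cong:
  assumes "(f, g) \<in> A" "f' \<in> elems X" "g' \<in> elems X" "ndist X f f' = 0" "ndist X g g' = 0"
  shows "(f', g') \<in> A"
proof -
  have "(f', g') \<in> A"
    if "\<forall>F G f g. (\<forall>n::nat. (F n, G n) \<in> A) \<longrightarrow> f \<in> elems X \<longrightarrow> g \<in> elems X \<longrightarrow>
     (\<lambda>n. ndist X (F n) f) \<longlonglongrightarrow> 0 \<longrightarrow> (\<lambda>n. ndist X (G n) g) \<longlonglongrightarrow> 0 \<longrightarrow> (f, g) \<in> A"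
    using that[rule_format, of "\<lambda>_. f" "\<lambda>_. g" f' g'] assms by simp
  thus ?thesis using closed by (simp add: closed_op_def)
qed

text \<open>Tested by functionals, the resolvent equation becomes a family of linear scalar
  identities, which combine by plain algebra.\<close>

lemma resolvent_iff:
  "(h, f) \<in> resolvent X A \<zeta> \<longleftrightarrow> h \<in> elems X \<and> f \<in> elems X \<and>
     (\<exists>g. (f, g) \<in> A \<and> (\<forall>l. bfun X l \<longrightarrow> \<zeta> * l f - l g = l h))"
proof -
  have "ndist X (\<lambda>a. \<zeta> * f a - g a) h = 0 \<longleftrightarrow> (\<forall>l. bfun X l \<longrightarrow> \<zeta> * l f - l g = l h)"
    if "(f, g) \<in> A" "h \<in> elems X" for g
  proof -
    note [simp] = graph_in[OF that(1)] that(2)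
    have "l (\<lambda>a. \<zeta> * f a - g a) = \<zeta> * l f - l g" if "bfun X l" for l
      by (simp add: bfun_diff[OF that] bfun_scale[OF that] scale_in)
    thus ?thesis by (subst ndist_eq_0_iff) (auto simp: diff_in scale_in)
  qed
  thus ?thesis using graph_in unfolding resolvent_def by fast
qed

lemma V_resolvent_set: "\<zeta> \<in> V \<Longrightarrow> \<zeta> \<in> resolvent_set X A"
  using zero_sectorial by (auto simp: zero_sectorial_def)

lemma Rs_resolvent: 
  assumes "\<zeta> \<in> V" "x \<in> elems X"
  shows "(x, Rs \<zeta> x) \<in> resolvent X A \<zeta>"
proof -
  have "\<exists>(f, g)\<in>A. ndist X (\<lambda>a. \<zeta> * f a - g a) x = 0"
    using V_resolvent_set[OF assms(1)] assms(2) by (auto simp: resolvent_set_def)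
  hence "\<exists>f. (x, f) \<in> resolvent X A \<zeta>"
    using assms(2) by (auto simp: resolvent_def)
  thus ?thesis unfolding Rs_def by (rule someI_ex)
qed

lemma Rs_in: "\<zeta> \<in> V \<Longrightarrow> x \<in> elems X \<Longrightarrow> Rs \<zeta> x \<in> elems X"
  using Rs_resolvent resolvent_iff by blast

lemma resolvent_unique:
  assumes \<zeta>: "\<zeta> \<in> V" and 1: "(x, f) \<in> resolvent X A \<zeta>" and 2: "(x', f') \<in> resolvent X A \<zeta>"
    and eq: "\<And>l. bfun X l \<Longrightarrow> l x = l x'" and l: "bfun X l"
  shows "l f = l f'"
proof -
  from 1 obtain g where g: "(f, g) \<in> A" "\<And>l. bfun X l \<Longrightarrow> \<zeta> * l f - l g = l x"
    by (auto simp: resolvent_iff)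
  from 2 obtain g' where g': "(f', g') \<in> A" "\<And>l. bfun X l \<Longrightarrow> \<zeta> * l f' - l g' = l x'"
    by (auto simp: resolvent_iff)
  note [simp] = graph_in[OF g(1)] graph_in[OF g'(1)]
  define F G where "F = (\<lambda>a. (- 1) * f' a + f a)" and "G = (\<lambda>a. (- 1) * g' a + g a)"
  have FG: "(F, G) \<in> A" unfolding F_def G_def by (rule graph_lin[OF g'(1) g(1)])
  note [simp] = graph_in[OF FG]
  obtain C where "\<forall>(f, g)\<in>A. nrm X f \<le> C * nrm X (\<lambda>a. \<zeta> * f a - g a)"
    using V_resolvent_set[OF \<zeta>] by (auto simp: resolvent_set_def)
  hence "nrm X F \<le> C * nrm X (\<lambda>a. \<zeta> * F a - G a)"
    using FG by blast
  also have "nrm X (\<lambda>a. \<zeta> * F a - G a) = 0"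
  proof (rule separating)
    fix l assume l: "bfun X l"
    have "l (\<lambda>a. \<zeta> * F a - G a) = \<zeta> * l F - l G"
      by (simp add: bfun_diff[OF l] bfun_scale[OF l] scale_in)
    also have "\<dots> = (\<zeta> * l f - l g) - (\<zeta> * l f' - l g')"
      unfolding F_def G_def by (simp add: bfun_lin[OF l, of _ _ "- 1", simplified] algebra_simps)
    finally show "l (\<lambda>a. \<zeta> * F a - G a) = 0"
      using g(2)[OF l] g'(2)[OF l] eq[OF l] by simp
  qed (simp add: diff_in scale_in)
  finally have "nrm X F = 0" using nrm_nonneg[of F] by simp
  hence "l F = 0" using bfun_null[OF l] by simp
  thus ?thesis unfolding F_def by (simp add: bfun_lin[OF l, of _ _ "- 1", simplified])
qed

lemma Rs_unique:
  assumes "\<zeta> \<in> V" "(x, f) \<in> resolvent X A \<zeta>" "bfun X l"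
  shows "l f = l (Rs \<zeta> x)"
  by (rule resolvent_unique[OF assms(1,2) Rs_resolvent]) (use assms in \<open>auto simp: resolvent_iff\<close>)

lemma Rs_lin:
  assumes \<zeta>: "\<zeta> \<in> V" and x: "x \<in> elems X" and y: "y \<in> elems X" and l: "bfun X l"
  shows "l (Rs \<zeta> (\<lambda>a. c * x a + y a)) = c * l (Rs \<zeta> x) + l (Rs \<zeta> y)"
proof -
  from Rs_resolvent[OF \<zeta> x] obtain g where g: "(Rs \<zeta> x, g) \<in> A" "\<And>l. bfun X l \<Longrightarrow> \<zeta> * l (Rs \<zeta> x) - l g = l x"
    by (auto simp: resolvent_iff)
  from Rs_resolvent[OF \<zeta> y] obtain g' where g': "(Rs \<zeta> y, g') \<in> A" "\<And>l. bfun X l \<Longrightarrow> \<zeta> * l (Rs \<zeta> y) - l g' = l y"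
    by (auto simp: resolvent_iff)
  note [simp] = graph_in[OF g(1)] graph_in[OF g'(1)]
  have "((\<lambda>a. c * x a + y a), (\<lambda>a. c * Rs \<zeta> x a + Rs \<zeta> y a)) \<in> resolvent X A \<zeta>"
    unfolding resolvent_iff
  proof (intro conjI exI allI impI)
    show "((\<lambda>a. c * Rs \<zeta> x a + Rs \<zeta> y a), (\<lambda>a. c * g a + g' a)) \<in> A"
      by (rule graph_lin[OF g(1) g'(1)])
    fix l assume l: "bfun X l"
    show "\<zeta> * l (\<lambda>a. c * Rs \<zeta> x a + Rs \<zeta> y a) - l (\<lambda>a. c * g a + g' a) = l (\<lambda>a. c * x a + y a)"
    proof -
      have "\<zeta> * (c * l (Rs \<zeta> x) + l (Rs \<zeta> y)) - (c * l g + l g')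
          = c * (\<zeta> * l (Rs \<zeta> x) - l g) + (\<zeta> * l (Rs \<zeta> y) - l g')" by (simp add: algebra_simps)
      thus ?thesis using g(2)[OF l] g'(2)[OF l] x y by (simp add: bfun_lin[OF l])
    qed
  qed (use x y in \<open>auto intro: lin_in\<close>)
  from Rs_unique[OF \<zeta> this l] show ?thesis
    by (simp add: bfun_lin[OF l])
qed

lemma Rs_cong:
  assumes "\<zeta> \<in> V" "x \<in> elems X" "y \<in> elems X" "\<And>l. bfun X l \<Longrightarrow> l x = l y" "bfun X l"
  shows "l (Rs \<zeta> x) = l (Rs \<zeta> y)"
  by (rule resolvent_unique[OF assms(1) Rs_resolvent Rs_resolvent]) (use assms in auto)

lemma resolvent_identity:
  assumes \<zeta>: "\<zeta> \<in> V" and \<mu>: "\<mu> \<in> V" and x: "x \<in> elems X" and l: "bfun X l"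
  shows "l (Rs \<zeta> x) - l (Rs \<mu> x) = (\<mu> - \<zeta>) * l (Rs \<zeta> (Rs \<mu> x))"
proof -
  define f where "f = Rs \<mu> x"
  from Rs_resolvent[OF \<mu> x] obtain g where g: "(f, g) \<in> A" "\<And>l. bfun X l \<Longrightarrow> \<mu> * l f - l g = l x"
    by (auto simp: resolvent_iff f_def)
  note [simp] = graph_in[OF g(1)]
  define k where "k = Rs \<zeta> f"
  from Rs_resolvent[OF \<zeta>, of f] obtain h where h: "(k, h) \<in> A" "\<And>l. bfun X l \<Longrightarrow> \<zeta> * l k - l h = l f"
    by (auto simp: resolvent_iff k_def)
  note [simp] = graph_in[OF h(1)]
  \<comment> \<open>With f = R(\<mu>)x and k = R(\<zeta>)f, the element (\<mu> - \<zeta>)k + f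
    solves the resolvent equation at \<zeta> with right side x.\<close>
  have "(x, (\<lambda>a. (\<mu> - \<zeta>) * k a + f a)) \<in> resolvent X A \<zeta>"
    unfolding resolvent_iff
  proof (intro conjI exI allI impI)
    show "((\<lambda>a. (\<mu> - \<zeta>) * k a + f a), (\<lambda>a. (\<mu> - \<zeta>) * h a + g a)) \<in> A"
      by (rule graph_lin[OF h(1) g(1)])
    fix l assume l: "bfun X l"
    have "\<zeta> * ((\<mu> - \<zeta>) * l k + l f) - ((\<mu> - \<zeta>) * l h + l g)
          = (\<mu> - \<zeta>) * (\<zeta> * l k - l h) + (\<zeta> * l f - l g)" by (simp add: algebra_simps)
    also have "\<dots> = \<mu> * l f - l g" unfolding h(2)[OF l] by (simp add: algebra_simps)
    finally show "\<zeta> * l (\<lambda>a. (\<mu> - \<zeta>) * k a + f a) - l (\<lambda>a. (\<mu> - \<zeta>) * h a + g a) = l x"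
      using g(2)[OF l] by (simp add: bfun_lin[OF l])
  qed (use x in \<open>auto intro: lin_in\<close>)
  from Rs_unique[OF \<zeta> this l] have "(\<mu> - \<zeta>) * l k + l f = l (Rs \<zeta> x)"
    by (simp add: bfun_lin[OF l])
  thus ?thesis
    unfolding f_def[symmetric] k_def[symmetric] by (metis add_diff_cancel_right')
qed

lemma sectorial_bound:
  assumes "0 < \<theta>" "\<theta> < pi"
  obtains K where "K \<ge> 0" "\<And>\<zeta> h f. Re \<zeta> < cmod \<zeta> * cos \<theta> \<Longrightarrow> (h, f) \<in> resolvent X A \<zeta> \<Longrightarrow>
     cmod \<zeta> * nrm X f \<le> K * nrm X h"
proof -
  obtain K where K: "\<forall>\<zeta> \<in> - closure (sector \<theta>). \<forall>(h, f)\<in>resolvent X A \<zeta>. cmod \<zeta> * nrm X f \<le> K * nrm X h"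
    using zero_sectorial[unfolded zero_sectorial_def, THEN conjunct2, THEN conjunct2,
        THEN conjunct2, THEN conjunct2, THEN bspec[of _ _ \<theta>]] assms by fastforce
  show ?thesis
  proof (rule that[of "\<bar>K\<bar>"])
    fix \<zeta> h f assume *: "Re \<zeta> < cmod \<zeta> * cos \<theta>" "(h, f) \<in> resolvent X A \<zeta>"
    hence "\<zeta> \<in> - closure (sector \<theta>)" using closure_sector_subset[OF assms] by auto
    hence "cmod \<zeta> * nrm X f \<le> K * nrm X h" using K *(2) by blast
    also have "\<dots> \<le> \<bar>K\<bar> * nrm X h"
      using *(2) by (intro mult_right_mono nrm_nonneg) (auto simp: resolvent_iff)
    finally show "cmod \<zeta> * nrm X f \<le> \<bar>K\<bar> * nrm X h" .
  qed auto
qed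

lemma V_I: "Re \<zeta> < cmod \<zeta> * cos \<theta> \<Longrightarrow> \<zeta> \<in> V"
proof -
  assume *: "Re \<zeta> < cmod \<zeta> * cos \<theta>"
  moreover have "cmod \<zeta> * cos \<theta> \<le> cmod \<zeta> * 1" by (intro mult_left_mono) auto
  ultimately show ?thesis by auto
qed

text \<open>The functionals are closed under composition with resolvents. A weak identity valid for
  all functionals may therefore be used behind a resolvent as well.\<close>

lemma bfun_Rs:
  assumes "\<zeta> \<in> V" "bfun X l"
  shows "bfun X (\<lambda>x. l (Rs \<zeta> x))"
proof -
  obtain C where C: "C \<ge> 0" "\<And>f. f \<in> elems X \<Longrightarrow> cmod (l f) \<le> C * nrm X f"
    using bfun_bound[OF assms(2)] by blast
  obtain D where D: "\<forall>(f, g)\<in>A. nrm X f \<le> D * nrm X (\<lambda>a. \<zeta> * f a - g a)"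
    using V_resolvent_set[OF assms(1)] by (auto simp: resolvent_set_def)
  have "cmod (l (Rs \<zeta> x)) \<le> (C * D) * nrm X x" if x: "x \<in> elems X" for x
  proof -
    obtain g where g: "(Rs \<zeta> x, g) \<in> A" "ndist X (\<lambda>a. \<zeta> * Rs \<zeta> x a - g a) x = 0"
      using Rs_resolvent[OF assms(1) x] by (auto simp: resolvent_def)
    have "nrm X (Rs \<zeta> x) \<le> D * nrm X (\<lambda>a. \<zeta> * Rs \<zeta> x a - g a)" using D g by blast
    also have "nrm X (\<lambda>a. \<zeta> * Rs \<zeta> x a - g a) = nrm X x"
      by (rule nrm_cong) (use g(2) graph_in[OF g(1)] x in \<open>auto intro: diff_in scale_in\<close>)
    finally have "C * nrm X (Rs \<zeta> x) \<le> C * (D * nrm X x)" using C(1) by (rule mult_left_mono)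
    thus ?thesis using C(2)[OF Rs_in[OF assms(1) x]] by (simp add: mult_ac)
  qed
  thus ?thesis using Rs_lin[OF assms(1)] assms(2) unfolding bfun_def by blast
qed

lemma local_bound:
  assumes "\<zeta> \<in> V"
  obtains K U where "open U" "\<zeta> \<in> U" "U \<subseteq> V" "\<And>\<mu> x. \<mu> \<in> U \<Longrightarrow> x \<in> elems X \<Longrightarrow> nrm X (Rs \<mu> x) \<le> K * nrm X x"
proof -
  have \<zeta>0: "\<zeta> \<noteq> 0" using assms by force
  have "Re \<zeta> < cmod \<zeta>"
  proof (rule ccontr)
    assume "\<not> Re \<zeta> < cmod \<zeta>"
    hence "Re \<zeta> = cmod \<zeta>" using complex_Re_le_cmod[of \<zeta>] by simp
    hence "Im \<zeta> = 0" using cmod_power2[of \<zeta>] by simp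
    hence "\<zeta> = of_real (cmod \<zeta>)" using \<open>Re \<zeta> = cmod \<zeta>\<close> by (simp add: complex_eq_iff)
    hence "\<zeta> \<in> complex_of_real ` {0..}" by (intro image_eqI[of _ _ "cmod \<zeta>"]) auto
    thus False using assms by simp
  qed
  hence q: "max 0 (Re \<zeta> / cmod \<zeta>) < 1" using \<zeta>0 by simp
  \<comment> \<open>A number strictly between the cosine of the argument of \<zeta> and 1; the
    sector of half-angle arccos q then leaves \<zeta> outside.\<close>
  then obtain q where q: "max 0 (Re \<zeta> / cmod \<zeta>) < q" "q < 1" using dense by blast
  define \<theta> where "\<theta> = arccos q"
  have \<theta>: "0 < \<theta>" "\<theta> < pi" "cos \<theta> = q"
    using q arccos_lt_bounded[of q] by (auto simp: \<theta>_def)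
  obtain K where K: "K \<ge> 0" "\<And>\<zeta> h f. Re \<zeta> < cmod \<zeta> * cos \<theta> \<Longrightarrow> (h, f) \<in> resolvent X A \<zeta> \<Longrightarrow>
     cmod \<zeta> * nrm X f \<le> K * nrm X h"
    using sectorial_bound[OF \<theta>(1,2)] by blast
  define U where "U = {\<mu>. Re \<mu> < cmod \<mu> * cos \<theta>} \<inter> {\<mu>. cmod \<zeta> / 2 < cmod \<mu>}"
  have "U \<subseteq> V" using V_I by (auto simp: U_def)
  show ?thesis
  proof (rule that[of U "2 * K / cmod \<zeta>"])
    show "open U" unfolding U_def
      by (intro open_Int open_Collect_less continuous_intros)
    show "\<zeta> \<in> U" using \<zeta>0 q \<theta>(3) by (auto simp: U_def field_simps)
    show "U \<subseteq> V" by fact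
    fix \<mu> x assume \<mu>: "\<mu> \<in> U" and x: "x \<in> elems X"
    have "cmod \<mu> * nrm X (Rs \<mu> x) \<le> K * nrm X x"
      using \<mu> \<open>U \<subseteq> V\<close> x by (intro K(2) Rs_resolvent) (auto simp: U_def)
    moreover have "cmod \<zeta> / 2 * nrm X (Rs \<mu> x) \<le> cmod \<mu> * nrm X (Rs \<mu> x)"
      using \<mu> \<open>U \<subseteq> V\<close> x by (intro mult_right_mono nrm_nonneg Rs_in) (auto simp: U_def)
    ultimately have "cmod \<zeta> / 2 * nrm X (Rs \<mu> x) \<le> K * nrm X x" by linarith
    thus "nrm X (Rs \<mu> x) \<le> 2 * K / cmod \<zeta> * nrm X x"
      using \<zeta>0 by (simp add: field_simps)
  qed
qed

text \<open>The resolvent identity is used twice: it makes the difference quotient equal to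
  -l(R(\<mu>)y) with y = R(\<zeta>)x, and it shows that this converges as \<mu> tends to
  \<zeta>.\<close>

lemma Rs_derivative:
  assumes \<zeta>: "\<zeta> \<in> V" and x: "x \<in> elems X" and l: "bfun X l"
  shows "((\<lambda>\<mu>. l (Rs \<mu> x)) has_field_derivative - l (Rs \<zeta> (Rs \<zeta> x))) (at \<zeta>)"
proof -
  obtain K U where U: "open U" "\<zeta> \<in> U" "U \<subseteq> V"
    and K: "\<And>\<mu> x. \<mu> \<in> U \<Longrightarrow> x \<in> elems X \<Longrightarrow> nrm X (Rs \<mu> x) \<le> K * nrm X x"
    by (rule local_bound[OF \<zeta>]) (rule that)
  obtain C where C: "C \<ge> 0" "\<And>f. f \<in> elems X \<Longrightarrow> cmod (l f) \<le> C * nrm X f"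
    using bfun_bound[OF l] by blast
  define y where "y = Rs \<zeta> x"
  have y: "y \<in> elems X" "Rs \<zeta> y \<in> elems X" unfolding y_def by (intro Rs_in \<zeta> x)+
  have ev: "\<forall>\<^sub>F \<mu> in at \<zeta>. \<mu> \<in> U" using U by (intro eventually_at_in_open') auto
  have "((\<lambda>\<mu>. l (Rs \<mu> y) - l (Rs \<zeta> y)) \<longlongrightarrow> 0) (at \<zeta>)"
  proof (rule Lim_null_comparison)
    show "\<forall>\<^sub>F \<mu> in at \<zeta>. norm (l (Rs \<mu> y) - l (Rs \<zeta> y)) \<le> cmod (\<zeta> - \<mu>) * (C * (K * nrm X (Rs \<zeta> y)))"
      using ev
    proof eventually_elim
      case (elim \<mu>)
      have "l (Rs \<mu> y) - l (Rs \<zeta> y) = (\<zeta> - \<mu>) * l (Rs \<mu> (Rs \<zeta> y))"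
        by (rule resolvent_identity) (use elim U \<zeta> y l in auto)
      moreover have "cmod (l (Rs \<mu> (Rs \<zeta> y))) \<le> C * nrm X (Rs \<mu> (Rs \<zeta> y))"
        using elim U y by (intro C Rs_in) auto
      moreover have "C * nrm X (Rs \<mu> (Rs \<zeta> y)) \<le> C * (K * nrm X (Rs \<zeta> y))"
        using elim y C(1) by (intro mult_left_mono K) auto
      ultimately show ?case by (simp add: norm_mult mult_left_mono)
    qed
    have "((\<lambda>\<mu>. cmod (\<zeta> - \<mu>) * (C * (K * nrm X (Rs \<zeta> y)))) \<longlongrightarrow> cmod (\<zeta> - \<zeta>) * (C * (K * nrm X (Rs \<zeta> y)))) (at \<zeta>)"
      by (intro tendsto_intros)
    thus "((\<lambda>\<mu>. cmod (\<zeta> - \<mu>) * (C * (K * nrm X (Rs \<zeta> y)))) \<longlongrightarrow> 0) (at \<zeta>)" by simp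
  qed
  hence "((\<lambda>\<mu>. - (l (Rs \<mu> y) - l (Rs \<zeta> y)) - l (Rs \<zeta> y)) \<longlongrightarrow> - 0 - l (Rs \<zeta> y)) (at \<zeta>)"
    by (intro tendsto_intros)
  hence "((\<lambda>\<mu>. - l (Rs \<mu> y)) \<longlongrightarrow> - l (Rs \<zeta> y)) (at \<zeta>)" by simp
  moreover have "\<forall>\<^sub>F \<mu> in at \<zeta>. - l (Rs \<mu> y) = (l (Rs \<mu> x) - l (Rs \<zeta> x)) / (\<mu> - \<zeta>)"
    using ev eventually_neq_at_within[of \<zeta> \<zeta> UNIV]
  proof eventually_elim
    case (elim \<mu>)
    have "l (Rs \<mu> x) - l (Rs \<zeta> x) = (\<zeta> - \<mu>) * l (Rs \<mu> y)"
      unfolding y_def by (rule resolvent_identity) (use elim U \<zeta> x l in auto)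
    thus ?case using elim by (simp add: field_simps)
  qed
  ultimately show ?thesis
    unfolding has_field_derivative_iff y_def by (rule Lim_transform_eventually)
qed

lemma Rs_holomorphic:
  assumes "x \<in> elems X" "bfun X l"
  shows "(\<lambda>\<mu>. l (Rs \<mu> x)) holomorphic_on V"
  using Rs_derivative[OF _ assms] open_halfline_complement
  by (auto simp: holomorphic_on_open)

end

text \<open>The same decomposition into squares as for e^w - e^w0, with -1 in place of e^w0.\<close>

lemma cmod_one_plus_ge:
  assumes "cmod z * c \<le> Re z" "- 1 \<le> c" "c \<le> 1"
  shows "sqrt ((1 + c) / 2) * (1 + cmod z) \<le> cmod (1 + z)"
proof -
  have "(cmod (1 + z))\<^sup>2 = 1 + 2 * Re z + (cmod z)\<^sup>2"
    unfolding cmod_power2 by (simp add: power2_eq_square algebra_simps)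
  also have "\<dots> \<ge> 1 + 2 * (cmod z * c) + (cmod z)\<^sup>2"
    using assms by simp
  also have "1 + 2 * (cmod z * c) + (cmod z)\<^sup>2 = (1 + c) / 2 * (1 + cmod z)\<^sup>2 + (1 - c) / 2 * (1 - cmod z)\<^sup>2"
    by (simp add: power2_eq_square field_simps)
  finally have "(1 + c) / 2 * (1 + cmod z)\<^sup>2 \<le> (cmod (1 + z))\<^sup>2"
    using assms by (smt (verit) mult_nonneg_nonneg zero_le_power2 divide_nonneg_pos)
  hence "sqrt ((1 + c) / 2 * (1 + cmod z)\<^sup>2) \<le> cmod (1 + z)"
    by (intro real_le_lsqrt) auto
  moreover have "sqrt ((1 + c) / 2 * (1 + cmod z)\<^sup>2) = sqrt ((1 + c) / 2) * (1 + cmod z)"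
    by (subst real_sqrt_mult) auto
  ultimately show ?thesis by simp
qed

lemma sector_one_plus:
  assumes "0 < \<theta>" "\<theta> < pi"
  obtains \<kappa> where "\<kappa> > 0" "\<And>z. z \<in> sector \<theta> \<Longrightarrow> \<kappa> * (1 + cmod z) \<le> cmod (1 + z)"
proof (rule that[of "sqrt ((1 + cos \<theta>) / 2)"])
  have "cos pi < cos \<theta>" using assms by (intro cos_monotone_0_pi) auto
  thus "sqrt ((1 + cos \<theta>) / 2) > 0" by simp
  fix z assume "z \<in> sector \<theta>"
  hence "cmod z * cos \<theta> \<le> Re z"
    using closure_sector_subset[OF assms] closure_subset[of "sector \<theta>"] by auto
  thus "sqrt ((1 + cos \<theta>) / 2) * (1 + cmod z) \<le> cmod (1 + z)"
    by (intro cmod_one_plus_ge) auto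
qed

lemma decaying_regul_mult:
  assumes \<theta>: "0 < \<theta>" "\<theta> < pi" and F: "F holomorphic_on sector \<theta>" "bounded (F ` sector \<theta>)"
  shows "decaying \<theta> (\<lambda>z. regul z * F z)"
proof -
  obtain \<kappa> where \<kappa>: "\<kappa> > 0" "\<And>z. z \<in> sector \<theta> \<Longrightarrow> \<kappa> * (1 + cmod z) \<le> cmod (1 + z)"
    using sector_one_plus[OF \<theta>] by blast
  obtain B where B: "\<And>z. z \<in> sector \<theta> \<Longrightarrow> cmod (F z) \<le> B"
    using F(2) by (auto simp: bounded_iff)
  have ne: "1 + z \<noteq> 0" if "z \<in> sector \<theta>" for z
  proof
    assume "1 + z = 0"
    hence "\<kappa> * (1 + cmod z) \<le> 0" using \<kappa>(2)[OF that] by simp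
    thus False using \<kappa>(1) by (smt (verit) mult_pos_pos norm_ge_zero)
  qed
  have "cmod (regul z * F z) \<le> B / \<kappa>\<^sup>2 * (cmod z / (1 + cmod z)\<^sup>2)" if z: "z \<in> sector \<theta>" for z
  proof -
    have pos: "0 < \<kappa> * (1 + cmod z)" using \<kappa>(1) by (simp add: add_pos_nonneg)
    have "cmod (regul z) = cmod z / (cmod (1 + z))\<^sup>2"
      by (simp add: regul_def norm_divide norm_power)
    also have "\<dots> \<le> cmod z / (\<kappa> * (1 + cmod z))\<^sup>2"
      using \<kappa>(1) \<kappa>(2)[OF z] pos ne[OF z]
      by (intro divide_left_mono power_mono mult_pos_pos zero_less_power) (auto intro: add_pos_nonneg)
    finally have "cmod (regul z) * cmod (F z) \<le> cmod z / (\<kappa> * (1 + cmod z))\<^sup>2 * B"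
      by (intro mult_mono B z) auto
    thus ?thesis by (simp add: norm_mult power_mult_distrib mult_ac)
  qed
  moreover have "(\<lambda>z. regul z * F z) holomorphic_on sector \<theta>"
    unfolding regul_def using ne by (intro holomorphic_intros F) auto
  ultimately show ?thesis unfolding decaying_def by blast
qed

lemma decaying_Hinf: "0 < \<theta> \<Longrightarrow> \<theta> < pi \<Longrightarrow> F \<in> Hinf \<theta> \<Longrightarrow> decaying \<theta> (\<lambda>z. regul z * F z)"
  by (rule decaying_regul_mult) (auto simp: Hinf_def)

lemma decaying_regul: "0 < \<theta> \<Longrightarrow> \<theta> < pi \<Longrightarrow> decaying \<theta> regul"
  using decaying_regul_mult[of \<theta> "\<lambda>_. 1"] by (auto simp: bounded_iff)

lemma has_integral_in_cong:
  assumes "separated_fspace X" "has_integral_in X M F y" "y' \<in> elems X" "ndist X y y' = 0"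
  shows "has_integral_in X M F y'"
proof -
  interpret separated_fspace X by fact
  have y: "y \<in> elems X" using assms(2) by (simp add: has_integral_in_def)
  have *: "(\<lambda>j. ndist X (S j) y') \<longlonglongrightarrow> 0"
    if "(\<lambda>j. ndist X (S j) y) \<longlonglongrightarrow> 0" "\<And>j. S j \<in> elems X" for S :: "nat \<Rightarrow> _"
  proof (rule tendsto_sandwich[OF _ _ tendsto_const that(1)])
    show "\<forall>\<^sub>F j in sequentially. 0 \<le> ndist X (S j) y'"
      using that(2) assms(3) by (simp add: ndist_nonneg)
    show "\<forall>\<^sub>F j in sequentially. ndist X (S j) y' \<le> ndist X (S j) y"
      using ndist_triangle[OF that(2) y assms(3)] assms(4) by simp
  qed
  from assms(2) obtain n :: "nat \<Rightarrow> nat" and E v where y: "strongly_measurable M X F"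
    and E: "\<forall>j. \<forall>i<n j. E j i \<in> sets M \<and> emeasure M (E j i) < \<infinity> \<and> v j i \<in> elems X"
    and l1: "(\<lambda>j::nat. \<integral>\<^sup>+t. ennreal (ndist X (F t) (\<lambda>a. \<Sum>i<n j. indicator (E j i) t * v j i a)) \<partial>M) \<longlonglongrightarrow> 0"
    and l2: "(\<lambda>j. ndist X (\<lambda>a. \<Sum>i<n j. complex_of_real (measure M (E j i)) * v j i a) y) \<longlonglongrightarrow> 0"
    unfolding has_integral_in_def by blast
  have "(\<lambda>a. \<Sum>i<n j. complex_of_real (measure M (E j i)) * v j i a) \<in> elems X" for j
    by (rule sum_in, rule scale_in) (use E in auto)
  from *[OF l2 this] show ?thesis
    unfolding has_integral_in_def using y E l1 assms(3) by blast
qed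

context sectorial_operator
begin

text \<open>The scalar l(g(A)x): (2 pi i)^-1 times the integral of g(z) l(R(z)x) dz, with dz = e^w
  dw. It makes sense for every \<open>x\<close>, whether or not g(A)x has been found as an
  element.\<close>

definition J :: "real \<Rightarrow> (complex \<Rightarrow> complex) \<Rightarrow> (('a \<Rightarrow> complex) \<Rightarrow> complex) \<Rightarrow> ('a \<Rightarrow> complex) \<Rightarrow> complex" where
  "J \<theta> g l x = sector_int (\<theta> / 2) (\<lambda>w. g (exp w) * (exp w * l (Rs (exp w) x)))"

lemma exp_in_V: "0 < \<bar>Im w\<bar> \<Longrightarrow> \<bar>Im w\<bar> < 2 * pi \<Longrightarrow> exp w \<in> V"
  using exp_notin_halfline[of w] exp_notin_halfline[of "w + 2 * pi * \<i>"]
  by (auto simp: exp_add abs_if split: if_splits)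

text \<open>The condition on the cosine says that e^w is at angle at least \<omega> from the
  positive half-line, whichever branch of the argument \<open>Im w\<close> uses. Sectoriality is
  applied with half-angle \<omega>/2 in order to stay strictly outside the closed sector.\<close>

lemma Rs_exp_bound:
  assumes "0 < \<omega>" "\<omega> < pi" "x \<in> elems X" "bfun X l"
  obtains K where "K \<ge> 0" "\<And>w. cos (Im w) \<le> cos \<omega> \<Longrightarrow> cmod (exp w * l (Rs (exp w) x)) \<le> K"
proof -
  obtain C where C: "C \<ge> 0" "\<And>f. f \<in> elems X \<Longrightarrow> cmod (l f) \<le> C * nrm X f"
    using bfun_bound[OF assms(4)] by blast
  obtain K where K: "K \<ge> 0" "\<And>\<zeta> h f. Re \<zeta> < cmod \<zeta> * cos (\<omega> / 2) \<Longrightarrow> (h, f) \<in> resolvent X A \<zeta> \<Longrightarrow>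
     cmod \<zeta> * nrm X f \<le> K * nrm X h"
    using sectorial_bound[of "\<omega> / 2"] assms by auto
  show ?thesis
  proof (rule that[of "C * (K * nrm X x)"])
    fix w assume w: "cos (Im w) \<le> cos \<omega>"
    also have "cos \<omega> < cos (\<omega> / 2)" using assms by (intro cos_monotone_0_pi) auto
    finally have *: "Re (exp w) < cmod (exp w) * cos (\<omega> / 2)" by (simp add: Re_exp)
    hence V: "exp w \<in> V" by (rule V_I)
    have "cmod (exp w) * cmod (l (Rs (exp w) x)) \<le> cmod (exp w) * (C * nrm X (Rs (exp w) x))"
      by (intro mult_left_mono C Rs_in V assms) auto
    also have "\<dots> = C * (cmod (exp w) * nrm X (Rs (exp w) x))" by simp
    also have "\<dots> \<le> C * (K * nrm X x)"
      using C(1) by (intro mult_left_mono K(2)[OF *] Rs_resolvent V assms)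
    finally show "cmod (exp w * l (Rs (exp w) x)) \<le> C * (K * nrm X x)" by (simp add: norm_mult)
  qed (use C(1) K(1) nrm_nonneg[OF assms(3)] in auto)
qed

lemma Rs_line_continuous:
  assumes "0 < \<bar>y\<bar>" "\<bar>y\<bar> < 2 * pi" "x \<in> elems X" "bfun X l"
  shows "continuous_on UNIV (\<lambda>u. l (Rs (exp (Complex u y)) x))"
  by (rule continuous_on_compose2[OF holomorphic_on_imp_continuous_on[OF Rs_holomorphic[OF assms(3,4)]]])
     (use exp_in_V[of "Complex _ y"] assms in \<open>auto simp: Complex_eq intro!: continuous_intros\<close>)

lemma J_line_integrable:
  assumes \<theta>: "0 < \<theta>" "\<theta> < pi" and g: "decaying \<theta> g" and x: "x \<in> elems X" and l: "bfun X l"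
    and y: "y \<in> {- (\<theta> / 2), \<theta> / 2}"
  shows "integrable lborel (\<lambda>u. g (exp (Complex u y)) * (exp (Complex u y) * l (Rs (exp (Complex u y)) x)))"
proof -
  obtain K where K: "K \<ge> 0" "\<And>w. cos (Im w) \<le> cos (\<theta> / 2) \<Longrightarrow> cmod (exp w * l (Rs (exp w) x)) \<le> K"
    using Rs_exp_bound[of "\<theta> / 2" x l] assms by auto
  obtain C where C: "C \<ge> 0" "\<And>w. \<bar>Im w\<bar> < \<theta> \<Longrightarrow> cmod (g (exp w)) \<le> C * exp (- \<bar>Re w\<bar>)"
    using decaying_exp_bound[OF g] \<theta> by auto
  have y': "\<bar>y\<bar> < \<theta>" "\<bar>y\<bar> > 0" "cos y = cos (\<theta> / 2)" using y \<theta> by auto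
  show ?thesis
  proof (rule strip_integrable[of "\<lambda>w. g (exp w) * (exp w * l (Rs (exp w) x))"])
    show "continuous_on UNIV (\<lambda>u. g (exp (Complex u y)) * (exp (Complex u y) * l (Rs (exp (Complex u y)) x)))"
      using y' \<theta> by (intro continuous_intros continuous_decaying_line[OF g] Rs_line_continuous x l)
        (auto simp: Complex_eq intro!: continuous_intros)
    show "cmod (g (exp (Complex u y)) * (exp (Complex u y) * l (Rs (exp (Complex u y)) x))) \<le> (C * K) * exp (- \<bar>u\<bar>)" for u
    proof -
      have "cmod (g (exp (Complex u y)) * (exp (Complex u y) * l (Rs (exp (Complex u y)) x))) \<le> (C * exp (- \<bar>u\<bar>)) * K"
        unfolding norm_mult[of "g _"] using C(2)[of "Complex u y"] K(2)[of "Complex u y"] y' C(1) K(1)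
        by (intro mult_mono) auto
      thus ?thesis by (simp add: mult_ac)
    qed
  qed
qed

lemma J_lin:
  assumes "0 < \<theta>" "\<theta> < pi" "decaying \<theta> g" "x \<in> elems X" "y \<in> elems X" "bfun X l"
  shows "J \<theta> g l (\<lambda>a. c * x a + y a) = c * J \<theta> g l x + J \<theta> g l y"
proof -
  have "J \<theta> g l (\<lambda>a. c * x a + y a) = sector_int (\<theta> / 2) (\<lambda>w. c * (g (exp w) * (exp w * l (Rs (exp w) x)))
         + g (exp w) * (exp w * l (Rs (exp w) y)))"
    unfolding J_def
  proof (rule sector_int_cong)
    fix w assume "\<bar>Im w\<bar> = \<bar>\<theta> / 2\<bar>"
    hence "exp w \<in> V" using assms by (intro exp_in_V) auto
    from Rs_lin[OF this assms(4-6)]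
    show "g (exp w) * (exp w * l (Rs (exp w) (\<lambda>a. c * x a + y a))) = c * (g (exp w) * (exp w * l (Rs (exp w) x)))
         + g (exp w) * (exp w * l (Rs (exp w) y))"
      by (simp add: algebra_simps)
  qed
  also have "\<dots> = c * J \<theta> g l x + J \<theta> g l y"
    unfolding J_def sector_int_cmult[symmetric]
    by (rule sector_int_add;
        ((rule integrable_mult_right, rule J_line_integrable) | rule J_line_integrable))
       (use assms in auto)
  finally show ?thesis .
qed

lemma J_lin_fun:
  assumes "0 < \<theta>" "\<theta> < pi" "decaying \<theta> f" "decaying \<theta> g" "x \<in> elems X" "bfun X l"
  shows "J \<theta> (\<lambda>z. c * f z + g z) l x = c * J \<theta> f l x + J \<theta> g l x"
proof -
  have "J \<theta> (\<lambda>z. c * f z + g z) l x = sector_int (\<theta> / 2) (\<lambda>w. c * (f (exp w) * (exp w * l (Rs (exp w) x)))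
         + g (exp w) * (exp w * l (Rs (exp w) x)))"
    unfolding J_def by (simp add: algebra_simps)
  also have "\<dots> = c * J \<theta> f l x + J \<theta> g l x"
    unfolding J_def sector_int_cmult[symmetric]
    by (rule sector_int_add;
        ((rule integrable_mult_right, rule J_line_integrable) | rule J_line_integrable))
       (use assms in auto)
  finally show ?thesis .
qed

lemma J_cong:
  assumes "0 < \<theta>" "\<theta> < pi" "x \<in> elems X" "y \<in> elems X" "\<And>l. bfun X l \<Longrightarrow> l x = l y" "bfun X l"
  shows "J \<theta> g l x = J \<theta> g l y"
  unfolding J_def
proof (rule sector_int_cong)
  fix w assume "\<bar>Im w\<bar> = \<bar>\<theta> / 2\<bar>"
  hence "exp w \<in> V" using assms by (intro exp_in_V) auto
  from Rs_cong[OF this assms(3-6)]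
  show "g (exp w) * (exp w * l (Rs (exp w) x)) = g (exp w) * (exp w * l (Rs (exp w) y))" by simp
qed

text \<open>As R(-1) = -(1+A)^-1, the right side is (1+A)^-1 - (1+A)^-2 = A(1+A)^-2, that is
  \<rho>(A) expressed by resolvents alone.\<close>

lemma J_regul:
  assumes "0 < \<theta>" "\<theta> < pi" "x \<in> elems X" "bfun X l"
  shows "J \<theta> regul l x = - l (Rs (- 1) (Rs (- 1) x)) - l (Rs (- 1) x)"
proof -
  obtain K where K: "K \<ge> 0" "\<And>w. cos (Im w) \<le> cos (\<theta> / 2) \<Longrightarrow> cmod (exp w * l (Rs (exp w) x)) \<le> K"
    using Rs_exp_bound[of "\<theta> / 2" x l] assms by auto
  have "J \<theta> regul l x = deriv (\<lambda>\<mu>. l (Rs \<mu> x)) (- 1) - l (Rs (- 1) x)"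
    unfolding J_def
  proof (rule sector_int_regul[OF Rs_holomorphic])
    fix w assume "\<theta> / 2 \<le> Im w" "Im w \<le> 2 * pi - \<theta> / 2"
    hence "cos (Im w) \<le> cos (\<theta> / 2)"
      using assms by (intro cos_le_of_separated) auto
    thus "cmod (exp w * l (Rs (exp w) x)) \<le> K" by (rule K)
  qed (use assms in auto)
  moreover have "- 1 \<in> V" by (rule V_I[of _ 0]) auto
  ultimately show ?thesis
    using DERIV_imp_deriv[OF Rs_derivative[of "- 1" x l]] assms by simp
qed

text \<open>The hypothesis on \<open>v\<close> says that g(A)x exists as an element. Then l(R(z)v)
  is again a contour integral, by that hypothesis at the functional \<open>l\<close> composed with
  R(z), and the resolvent identity reduces the claim to \<open>sector_int_mult\<close>.\<close>

lemma J_mult: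
  assumes \<theta>: "0 < \<theta>" "\<theta> < pi" and f: "decaying \<theta> f" and g: "decaying \<theta> g"
    and x: "x \<in> elems X" and v: "v \<in> elems X" "\<And>l. bfun X l \<Longrightarrow> l v = J \<theta> g l x" and l: "bfun X l"
  shows "J \<theta> f l v = J \<theta> (\<lambda>z. f z * g z) l x"
proof -
  \<comment> \<open>The outer angle may be anything strictly between \<theta>/2 and \<theta>; it
    separates the two contours.\<close>
  define \<omega> \<omega>' where "\<omega> = \<theta> / 2" and "\<omega>' = 3 * \<theta> / 4"
  have \<omega>: "0 < \<omega>" "\<omega> < \<omega>'" "\<omega>' < \<theta>" "\<theta> \<le> pi" using \<theta> by (auto simp: \<omega>_def \<omega>'_def)
  have V: "exp w \<in> V" if "\<bar>Im w\<bar> = \<omega> \<or> \<bar>Im w\<bar> = \<omega>'" for w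
    using that \<omega> by (intro exp_in_V) auto
  obtain K where K: "K \<ge> 0" "\<And>w. cos (Im w) \<le> cos \<omega> \<Longrightarrow> cmod (exp w * l (Rs (exp w) v)) \<le> K"
    using Rs_exp_bound[of \<omega> v l] v l \<omega> by auto
  obtain K' where K': "K' \<ge> 0" "\<And>w. cos (Im w) \<le> cos \<omega> \<Longrightarrow> cmod (exp w * l (Rs (exp w) x)) \<le> K'"
    using Rs_exp_bound[of \<omega> x l] x l \<omega> by auto
  have "J \<theta> f l v = sector_int \<omega>' (\<lambda>w. f (exp w) * (exp w * l (Rs (exp w) v)))"
    unfolding J_def \<omega>_def[symmetric]
  proof (rule sector_int_independent[OF f \<omega> Rs_holomorphic[OF v(1) l]])
    fix w assume "\<omega> \<le> \<bar>Im w\<bar>" "\<bar>Im w\<bar> \<le> pi"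
    thus "cmod (exp w * l (Rs (exp w) v)) \<le> K"
      using \<omega> by (intro K(2) cos_le_of_separated) auto
  qed
  also have "\<dots> = sector_int \<omega>' (\<lambda>w. f (exp w) * (exp w * sector_int \<omega> (\<lambda>v. g (exp v) * (exp v *
            ((l (Rs (exp v) x) - l (Rs (exp w) x)) / (exp w - exp v))))))"
  proof (rule sector_int_cong)
    fix w assume "\<bar>Im w\<bar> = \<bar>\<omega>'\<bar>"
    hence w: "\<bar>Im w\<bar> = \<omega>'" using \<omega> by simp
    have "l (Rs (exp w) v) = J \<theta> g (\<lambda>x. l (Rs (exp w) x)) x"
      by (rule v(2), rule bfun_Rs) (use V[of w] w l in auto)
    also have "\<dots> = sector_int \<omega> (\<lambda>v. g (exp v) * (exp v *
            ((l (Rs (exp v) x) - l (Rs (exp w) x)) / (exp w - exp v))))"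
      unfolding J_def \<omega>_def[symmetric]
    proof (rule sector_int_cong)
      fix v assume "\<bar>Im v\<bar> = \<bar>\<omega>\<bar>"
      hence v: "\<bar>Im v\<bar> = \<omega>" using \<omega> by simp
      have "exp w \<noteq> exp v"
        by (rule exp_ratio_bound(2)[of "\<omega>' - \<omega>"]) (use v w \<omega> in linarith)+
      moreover have "l (Rs (exp w) x) - l (Rs (exp v) x) = (exp v - exp w) * l (Rs (exp w) (Rs (exp v) x))"
        by (rule resolvent_identity) (use V v w x l in auto)
      ultimately have "l (Rs (exp w) (Rs (exp v) x)) = (l (Rs (exp v) x) - l (Rs (exp w) x)) / (exp w - exp v)"
        by (simp add: field_simps)
      thus "g (exp v) * (exp v * l (Rs (exp w) (Rs (exp v) x))) = g (exp v) * (exp v *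
            ((l (Rs (exp v) x) - l (Rs (exp w) x)) / (exp w - exp v)))" by simp
    qed
    finally show "f (exp w) * (exp w * l (Rs (exp w) v)) = f (exp w) * (exp w *
      sector_int \<omega> (\<lambda>v. g (exp v) * (exp v * ((l (Rs (exp v) x) - l (Rs (exp w) x)) / (exp w - exp v)))))"
      by simp
  qed
  also have "\<dots> = sector_int \<omega> (\<lambda>v. f (exp v) * g (exp v) * (exp v * l (Rs (exp v) x)))"
  proof (rule sector_int_mult[OF f g \<omega>])
    fix y assume y: "y \<in> {-\<omega>, \<omega>}"
    show "continuous_on UNIV (\<lambda>u. l (Rs (exp (Complex u y)) x))"
      using y \<omega> by (intro Rs_line_continuous x l) auto
    show "cmod (exp (Complex u y) * l (Rs (exp (Complex u y)) x)) \<le> K'" for u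
      using y by (intro K') auto
  qed
  finally show ?thesis by (simp add: J_def \<omega>_def)
qed

text \<open>Links the vector-valued integral of the definition with \<open>J\<close>: a functional
  passes through the integral, it cannot see which representatives \<open>r\<close> selects, and t =
  e^u turns both rays into lines.\<close>

lemma cauchy_calc_weak:
  assumes \<theta>: "0 < \<theta>" "\<theta> < pi" and g: "decaying \<theta> g" and hy: "(h, y) \<in> cauchy_calc X A \<theta> g"
    and l: "bfun X l"
  shows "l y = J \<theta> g l h"
proof -
  define \<omega> where "\<omega> = \<theta> / 2"
  define \<psi> where "\<psi> \<zeta> = l (Rs \<zeta> h)" for \<zeta>
  from hy obtain r where h: "h \<in> elems X"
    and r: "\<And>t \<sigma>. t > 0 \<Longrightarrow> \<sigma> \<in> {-1, 1} \<Longrightarrow> (h, r (rcis t (\<sigma> * \<theta> / 2))) \<in> resolvent X A (rcis t (\<sigma> * \<theta> / 2))"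
    and int: "has_integral_in X (restrict_space lborel {0<..})
       (\<lambda>t a. (g (rcis t (-\<theta> / 2)) * r (rcis t (-\<theta> / 2)) a * cis (-\<theta> / 2)
               - g (rcis t (\<theta> / 2)) * r (rcis t (\<theta> / 2)) a * cis (\<theta> / 2)) / (2 * pi * \<i>)) y"
    unfolding cauchy_calc_def by blast
  define F where "F t a = (g (rcis t (-\<theta> / 2)) * r (rcis t (-\<theta> / 2)) a * cis (-\<theta> / 2)
               - g (rcis t (\<theta> / 2)) * r (rcis t (\<theta> / 2)) a * cis (\<theta> / 2)) / (2 * pi * \<i>)" for t a
  define f where "f t = (g (rcis t (-\<omega>)) * \<psi> (rcis t (-\<omega>)) * cis (-\<omega>)
               - g (rcis t \<omega>) * \<psi> (rcis t \<omega>) * cis \<omega>) / (2 * pi * \<i>)" for t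
  have rexp: "rcis t b = exp (Complex (ln t) b)" if "t > 0" for t b
    using that by (simp add: exp_eq_polar rcis_def exp_of_real)
  have inV: "rcis t b \<in> V" if "t > 0" "b \<in> {-\<omega>, \<omega>}" for t b
    unfolding rexp[OF that(1)] using that \<theta> by (intro exp_in_V) (auto simp: \<omega>_def)
  have insec: "rcis t b \<in> sector \<theta>" if "t > 0" "b \<in> {-\<omega>, \<omega>}" for t b
    unfolding rexp[OF that(1)] using that \<theta> by (intro exp_in_sector) (auto simp: \<omega>_def)
  have rr: "(h, r (rcis t b)) \<in> resolvent X A (rcis t b)" if "t > 0" "b \<in> {-\<omega>, \<omega>}" for t b
    using r[of t 1] r[of t "- 1"] that by (auto simp: \<omega>_def)
  have r_in: "r (rcis t b) \<in> elems X" if "t > 0" "b \<in> {-\<omega>, \<omega>}" for t b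
    using rr[OF that] by (simp add: resolvent_iff)
  have lr: "l (r (rcis t b)) = \<psi> (rcis t b)" if "t > 0" "b \<in> {-\<omega>, \<omega>}" for t b
    unfolding \<psi>_def by (rule Rs_unique[OF inV rr l]) (use that in auto)
  define a1 where "a1 t = (g (rcis t (-\<omega>)) * cis (-\<omega>))" for t
  define a2 where "a2 t = (g (rcis t \<omega>) * cis \<omega>)" for t
  have F_eq: "F t = (\<lambda>a. (a1 t * r (rcis t (-\<omega>)) a - a2 t * r (rcis t \<omega>) a) / (2 * pi * \<i>))" for t
    by (rule ext) (simp add: F_def a1_def a2_def \<omega>_def mult_ac)
  have F_in: "F t \<in> elems X" if "t > 0" for t
    unfolding F_eq using r_in[OF that] by (intro divide_in diff_in scale_in) auto
  have lF: "l (F t) = f t" if "t > 0" for t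
  proof -
    note [simp] = r_in[OF that, of \<omega>, simplified] r_in[OF that, of "- \<omega>", simplified]
    have "l (F t) = (a1 t * l (r (rcis t (-\<omega>))) - a2 t * l (r (rcis t \<omega>))) / (2 * pi * \<i>)"
      unfolding F_eq by (simp add: bfun_divide[OF l] bfun_diff[OF l] bfun_scale[OF l] diff_in scale_in)
    also have "\<dots> = f t"
      using lr[OF that, of \<omega>] lr[OF that, of "- \<omega>"] by (simp add: f_def a1_def a2_def mult_ac)
    finally show ?thesis .
  qed
  have contf: "continuous_on {0<..} f"
  proof -
    have "continuous_on {0<..} (\<lambda>t. g (rcis t b))" "continuous_on {0<..} (\<lambda>t. \<psi> (rcis t b))"
      if "b \<in> {-\<omega>, \<omega>}" for b
    proof -
      have cr: "continuous_on {0<..} (\<lambda>t. rcis t b)" by (simp add: rcis_def) (intro continuous_intros)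
      show "continuous_on {0<..} (\<lambda>t. g (rcis t b))"
        using g insec that unfolding decaying_def
        by (intro continuous_on_compose2[OF holomorphic_on_imp_continuous_on cr]) auto
      show "continuous_on {0<..} (\<lambda>t. \<psi> (rcis t b))"
        unfolding \<psi>_def using inV that
        by (intro continuous_on_compose2[OF holomorphic_on_imp_continuous_on[OF Rs_holomorphic[OF h l]] cr]) auto
    qed
    thus ?thesis unfolding f_def by (intro continuous_intros) auto
  qed
  have meas: "f \<in> borel_measurable (restrict_space lborel {0<..})"
    using borel_measurable_continuous_on_restrict[OF contf] by (simp add: measurable_restrict_space1 cong: measurable_cong_sets)
  have meas': "(\<lambda>t. l (F t)) \<in> borel_measurable (restrict_space lborel {0<..})"
    using meas by (rule measurable_cong[THEN iffD1, rotated]) (simp add: space_restrict_space lF)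
  have intF: "has_integral_in X (restrict_space lborel {0<..}) F y"
    using int by (simp add: F_def[abs_def])
  note hi = bfun_has_integral_in[OF l intF _ meas']
  have i1: "integrable (restrict_space lborel {0<..}) f"
    using hi(1) F_in by (subst Bochner_Integration.integrable_cong[OF refl, of _ _ "\<lambda>t. l (F t)"])
      (auto simp: space_restrict_space lF)
  have i2: "(\<integral>t. f t \<partial>restrict_space lborel {0<..}) = l y"
    using hi(2) F_in by (subst Bochner_Integration.integral_cong[OF refl, of _ _ "\<lambda>t. l (F t)"])
      (auto simp: space_restrict_space lF)
  define G where "G w = g (exp w) * (exp w * \<psi> (exp w))" for w
  have iG: "integrable lborel (\<lambda>u. G (Complex u b))" if "b \<in> {-\<omega>, \<omega>}" for b
    unfolding G_def \<psi>_def using that by (intro J_line_integrable[OF \<theta> g h l]) (simp add: \<omega>_def)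
  have fG: "of_real (exp u) * f (exp u) = (G (Complex u (-\<omega>)) - G (Complex u \<omega>)) / (2 * pi * \<i>)" for u :: real
  proof -
    have "exp (Complex u b) = rcis (exp u) b" for b by (simp add: rexp)
    thus ?thesis by (simp add: f_def G_def rcis_def right_diff_distrib diff_divide_distrib mult_ac)
  qed
  have "l y = (\<integral>u. of_real (exp u) * f (exp u) \<partial>lborel)"
    unfolding i2[symmetric]
    by (rule lborel_integral_exp_substitution[OF contf i1]) (use iG in \<open>simp add: fG\<close>)
  also have "\<dots> = sector_int \<omega> G"
    unfolding fG sector_int_def using iG by simp
  finally show ?thesis by (simp add: J_def G_def[abs_def] \<psi>_def \<omega>_def)
qed

end

section \<open>The bounded holomorphic calculus\<close>

lemma (in separated_fspace) nrm_eqI: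
  "f \<in> elems X \<Longrightarrow> g \<in> elems X \<Longrightarrow> (\<And>l. bfun X l \<Longrightarrow> l f = l g) \<Longrightarrow> nrm X f = nrm X g"
  by (rule nrm_cong) (simp_all add: ndist_eq_0_iff)

context sectorial_operator
begin

abbreviation Z :: "('a \<Rightarrow> complex) set" where "Z \<equiv> cl_range X A"

lemma Z_in: "x \<in> Z \<Longrightarrow> x \<in> elems X"
  by (simp add: cl_range_def closure_in_def)

lemma Z_approx: "x \<in> Z \<Longrightarrow> e > 0 \<Longrightarrow> \<exists>u s. (u, s) \<in> A \<and> ndist X x s < e"
  unfolding cl_range_def closure_in_def by blast

lemma Z_I:
  "x \<in> elems X \<Longrightarrow> (\<And>e. e > 0 \<Longrightarrow> \<exists>u s. (u, s) \<in> A \<and> ndist X x s < e) \<Longrightarrow> x \<in> Z"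
  unfolding cl_range_def closure_in_def by fast

lemma Z_limit:
  assumes "y \<in> elems X" "\<And>e. e > 0 \<Longrightarrow> \<exists>x\<in>Z. ndist X y x < e"
  shows "y \<in> Z"
proof (rule Z_I[OF assms(1)])
  fix e :: real assume "e > 0"
  then obtain x where x: "x \<in> Z" "ndist X y x < e / 2" using assms(2)[of "e / 2"] by auto
  then obtain u s where s: "(u, s) \<in> A" "ndist X x s < e / 2" using Z_approx[of x "e / 2"] \<open>e > 0\<close> by auto
  have "ndist X y s \<le> ndist X y x + ndist X x s"
    by (rule ndist_triangle) (use assms(1) x(1) s(1) Z_in graph_in in auto)
  thus "\<exists>u s. (u, s) \<in> A \<and> ndist X y s < e" using s x by (intro exI[of _ u] exI[of _ s]) auto
qed

lemma range_Z: "(u, s) \<in> A \<Longrightarrow> x \<in> elems X \<Longrightarrow> (\<And>l. bfun X l \<Longrightarrow> l x = l s) \<Longrightarrow> x \<in> Z"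
  using ndist_eq_0_iff[of x s] graph_in by (intro Z_I) metis+

lemma Z_cong: "x \<in> Z \<Longrightarrow> y \<in> elems X \<Longrightarrow> (\<And>l. bfun X l \<Longrightarrow> l y = l x) \<Longrightarrow> y \<in> Z"
  using ndist_eq_0_iff[of y x] Z_in by (intro Z_limit) metis+

lemma Z_lin:
  assumes x: "x \<in> Z" and y: "y \<in> Z"
  shows "(\<lambda>a. c * x a + y a) \<in> Z"
proof (rule Z_I)
  fix e :: real assume e: "e > 0"
  define k where "k = cmod c + 1"
  define d where "d = e / (2 * k)"
  have k: "k > 0" by (simp add: k_def add_nonneg_pos)
  have d: "d > 0" using e k by (simp add: d_def)
  obtain u s where s: "(u, s) \<in> A" "ndist X x s < d" using Z_approx[OF x d] by blast
  obtain u' s' where s': "(u', s') \<in> A" "ndist X y s' < e / 2" using Z_approx[OF y, of "e / 2"] e by auto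
  note [simp] = graph_in[OF s(1)] graph_in[OF s'(1)] Z_in[OF x] Z_in[OF y]
  have "ndist X (\<lambda>a. c * x a + y a) (\<lambda>a. c * s a + s' a) = nrm X (\<lambda>a. c * (x a - s a) + (y a - s' a))"
    by (simp add: ndist_def algebra_simps)
  also have "\<dots> \<le> nrm X (\<lambda>a. c * (x a - s a)) + nrm X (\<lambda>a. y a - s' a)"
    by (rule nrm_add) (rule scale_in[OF diff_in] diff_in, simp, simp)+
  also have "nrm X (\<lambda>a. c * (x a - s a)) = cmod c * ndist X x s"
    unfolding ndist_def by (rule nrm_scale) (simp add: diff_in)
  also have "\<dots> \<le> k * d"
    using s(2) d ndist_nonneg[of x s] by (intro mult_mono) (auto simp: k_def)
  also have "\<dots> = e / 2"
    using k by (simp add: d_def)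
  also have "nrm X (\<lambda>a. y a - s' a) < e / 2" using s'(2) by (simp add: ndist_def)
  finally have "ndist X (\<lambda>a. c * x a + y a) (\<lambda>a. c * s a + s' a) < e" by simp
  thus "\<exists>u s. (u, s) \<in> A \<and> ndist X (\<lambda>a. c * x a + y a) s < e"
    using graph_lin[OF s(1) s'(1)] by blast
qed (use Z_in x y in \<open>auto intro: lin_in\<close>)

lemma Z_diff: "x \<in> Z \<Longrightarrow> y \<in> Z \<Longrightarrow> (\<lambda>a. x a - y a) \<in> Z"
  using Z_lin[of y x "- 1"] by simp

text \<open>At \<zeta> = -\<epsilon> the operator \<zeta>R(\<zeta>) fixes the kernel, while on s =
  Au it gives \<zeta>(\<zeta>R(\<zeta>)u - u), which is O(\<epsilon>). Sectoriality bounds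
  \<zeta>R(\<zeta>) by a constant \<open>K\<close>, so an \<open>x\<close> in the kernel has norm at
  most \<open>K\<close> times its distance to any such s.\<close>

lemma ker_Z:
  assumes x: "x \<in> Z" "x \<in> ker_op X A"
  shows "nrm X x = 0"
proof -
  obtain g where g: "(x, g) \<in> A" "nrm X g = 0" using x(2) by (auto simp: ker_op_def)
  note [simp] = Z_in[OF x(1)] graph_in[OF g(1)]
  obtain K where K: "K \<ge> 0" "\<And>\<zeta> h f. Re \<zeta> < cmod \<zeta> * cos (pi / 2) \<Longrightarrow> (h, f) \<in> resolvent X A \<zeta> \<Longrightarrow>
     cmod \<zeta> * nrm X f \<le> K * nrm X h"
    using sectorial_bound[of "pi / 2"] by auto
  have *: "nrm X x \<le> K * ndist X x s" if s: "(u, s) \<in> A" for u s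
  proof (rule field_le_epsilon)
    fix e :: real assume e: "e > 0"
    note [simp] = graph_in[OF s]
    \<comment> \<open>Chosen so that \<epsilon> times \<open>(K + 1) * nrm X u\<close> is at most e;
      the added ones keep the denominator positive.\<close>
    define \<epsilon> where "\<epsilon> = e / ((K + 1) * (nrm X u + 1))"
    have \<epsilon>: "\<epsilon> > 0" using e K(1) nrm_nonneg[of u] by (simp add: \<epsilon>_def)
    have small: "\<epsilon> * ((K + 1) * nrm X u) \<le> e"
    proof -
      have "\<epsilon> * ((K + 1) * nrm X u) \<le> \<epsilon> * ((K + 1) * (nrm X u + 1))"
        using \<epsilon> K(1) by (intro mult_left_mono) auto
      also have "\<dots> = e" using K(1) nrm_nonneg[of u] by (simp add: \<epsilon>_def)
      finally show ?thesis .
    qed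
    define \<zeta> where "\<zeta> = - complex_of_real \<epsilon>"
    have \<zeta>: "Re \<zeta> < cmod \<zeta> * cos (pi / 2)" "\<zeta> \<in> V" "cmod \<zeta> = \<epsilon>"
      using \<epsilon> V_I[of \<zeta> "pi / 2"] by (auto simp: \<zeta>_def)
    define R where "R = Rs \<zeta> u"
    obtain gu where gu: "(R, gu) \<in> A" "\<And>l. bfun X l \<Longrightarrow> \<zeta> * l R - l gu = l u"
      using Rs_resolvent[OF \<zeta>(2), of u] by (auto simp: resolvent_iff R_def)
    note [simp] = graph_in[OF gu(1)]
    have 1: "(x, (\<lambda>a. (1 / \<zeta>) * x a)) \<in> resolvent X A \<zeta>"
      unfolding resolvent_iff
    proof (intro conjI exI allI impI)
      show "((\<lambda>a. (1 / \<zeta>) * x a), (\<lambda>a. (1 / \<zeta>) * g a)) \<in> A" by (rule graph_scale[OF g(1)])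
      fix l assume l: "bfun X l"
      show "\<zeta> * l (\<lambda>a. (1 / \<zeta>) * x a) - l (\<lambda>a. (1 / \<zeta>) * g a) = l x"
        unfolding bfun_scale[OF l, of x "1 / \<zeta>", simplified] bfun_scale[OF l \<open>g \<in> elems X\<close>, of "1 / \<zeta>"]
        using bfun_null[OF l _ g(2)] \<epsilon> bfun_scale[OF l \<open>x \<in> elems X\<close>, of "1 / \<zeta>"] by (simp add: \<zeta>_def)
    qed (auto intro: scale_in divide_in)
    have 2: "(s, (\<lambda>a. \<zeta> * R a + (- 1) * u a)) \<in> resolvent X A \<zeta>"
      unfolding resolvent_iff
    proof (intro conjI exI allI impI)
      show "((\<lambda>a. \<zeta> * R a + (- 1) * u a), (\<lambda>a. \<zeta> * gu a + (- 1) * s a)) \<in> A"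
        by (rule graph_lin[OF gu(1) graph_scale[OF s]])
      fix l assume l: "bfun X l"
      have "l (\<lambda>a. \<zeta> * R a + (- 1) * u a) = \<zeta> * l R - l u" "l (\<lambda>a. \<zeta> * gu a + (- 1) * s a) = \<zeta> * l gu - l s"
        by (simp_all add: bfun_diff[OF l] bfun_scale[OF l] scale_in)
      moreover have "\<zeta> * (\<zeta> * l R - l u) - (\<zeta> * l gu - l s) = \<zeta> * (\<zeta> * l R - l gu - l u) + l s"
        by (simp add: algebra_simps)
      ultimately show "\<zeta> * l (\<lambda>a. \<zeta> * R a + (- 1) * u a) - l (\<lambda>a. \<zeta> * gu a + (- 1) * s a) = l s"
        using gu(2)[OF l] by simp
    qed (simp, rule add_in[OF scale_in scale_in], simp, simp)
    define y where "y = (\<lambda>a. x a - s a)"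
    have [simp]: "y \<in> elems X" by (simp add: y_def diff_in)
    define r where "r = Rs \<zeta> y"
    have r: "(y, r) \<in> resolvent X A \<zeta>" "r \<in> elems X"
      unfolding r_def by (rule Rs_resolvent[OF \<zeta>(2)], simp) (rule Rs_in[OF \<zeta>(2)], simp)
    define q where "q = (\<lambda>a. \<zeta> * R a + (- 1) * u a)"
    have [simp]: "q \<in> elems X"
      unfolding q_def by (rule add_in[OF scale_in scale_in]) simp_all
    have eq: "l x = l (\<lambda>a. \<zeta> * r a + \<zeta> * q a)" if l: "bfun X l" for l
    proof -
      have "l r = l (Rs \<zeta> x) - l (Rs \<zeta> s)"
        using Rs_lin[OF \<zeta>(2), of s x l "- 1"] l by (simp add: r_def y_def)
      also have "l (Rs \<zeta> x) = (1 / \<zeta>) * l x"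
        using Rs_unique[OF \<zeta>(2) 1 l] bfun_scale[OF l \<open>x \<in> elems X\<close>, of "1 / \<zeta>"] by simp
      also have "l (Rs \<zeta> s) = l q"
        using Rs_unique[OF \<zeta>(2) 2 l] by (simp add: q_def)
      finally have "l r = (1 / \<zeta>) * l x - l q" .
      moreover have "\<zeta> \<noteq> 0" using \<epsilon> by (simp add: \<zeta>_def)
      ultimately have "\<zeta> * l r + \<zeta> * l q = l x" by (simp add: right_diff_distrib)
      thus ?thesis using r(2) by (simp add: bfun_lin[OF l] bfun_scale[OF l] scale_in)
    qed
    have "nrm X x = nrm X (\<lambda>a. \<zeta> * r a + \<zeta> * q a)"
    proof (rule nrm_eqI)
      show "(\<lambda>a. \<zeta> * r a + \<zeta> * q a) \<in> elems X"
        by (rule add_in[OF scale_in scale_in]) (simp_all add: r(2))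
    qed (simp, rule eq)
    also have "\<dots> \<le> nrm X (\<lambda>a. \<zeta> * r a) + nrm X (\<lambda>a. \<zeta> * q a)"
      by (rule nrm_add) (rule scale_in, simp add: r(2))+
    also have "\<dots> = \<epsilon> * nrm X r + \<epsilon> * nrm X q"
      using r(2) by (simp add: nrm_scale \<zeta>(3))
    also have "\<epsilon> * nrm X r \<le> K * ndist X x s"
      using K(2)[OF \<zeta>(1) r(1)] by (simp add: \<zeta>(3) ndist_def y_def)
    also have "nrm X q \<le> (K + 1) * nrm X u"
    proof -
      have "nrm X q \<le> nrm X (\<lambda>a. \<zeta> * R a) + nrm X (\<lambda>a. (- 1) * u a)"
        unfolding q_def by (rule nrm_add) (auto intro: scale_in minus_in)
      also have "\<dots> = \<epsilon> * nrm X R + nrm X u"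
        by (simp add: nrm_scale \<zeta>(3) nrm_minus)
      also have "\<epsilon> * nrm X R \<le> K * nrm X u"
        using K(2)[OF \<zeta>(1), of u R] Rs_resolvent[OF \<zeta>(2), of u] by (simp add: \<zeta>(3) R_def)
      finally show ?thesis by (simp add: algebra_simps)
    qed
    hence "\<epsilon> * nrm X q \<le> e" using small \<epsilon> by (smt (verit) mult_left_mono)
    finally show "nrm X x \<le> K * ndist X x s + e" by simp
  qed
  have "nrm X x \<le> 0"
  proof (rule field_le_epsilon)
    fix e :: real assume e: "e > 0"
    have "e / (K + 1) > 0" using e K(1) by simp
    then obtain u s where s: "(u, s) \<in> A" "ndist X x s < e / (K + 1)" using Z_approx[OF x(1)] by blast
    have "nrm X x \<le> K * ndist X x s" by (rule *[OF s(1)])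
    also have "\<dots> \<le> (K + 1) * (e / (K + 1))"
      using s K(1) ndist_nonneg[of x s] graph_in[OF s(1)] by (intro mult_mono) auto
    also have "\<dots> = e" using K(1) by simp
    finally show "nrm X x \<le> 0 + e" by simp
  qed
  thus ?thesis using nrm_nonneg[of x] by simp
qed

text \<open>Let q = R(-1)x. If \<rho>(A)x = 0 then R(-1)q = -q, hence Aq = 0 and x = -q lies in the
  kernel; on the closure of the range that forces x to be null.\<close>

lemma J_regul_injective:
  assumes \<theta>: "0 < \<theta>" "\<theta> < pi" and x: "x \<in> Z" and 0: "\<And>l. bfun X l \<Longrightarrow> J \<theta> regul l x = 0"
  shows "nrm X x = 0"
proof -
  have V: "- 1 \<in> V" by (rule V_I[of _ 0]) auto
  note [simp] = Z_in[OF x]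
  define q k where "q = Rs (- 1) x" and "k = Rs (- 1) q"
  obtain g where g: "(q, g) \<in> A" "\<And>l. bfun X l \<Longrightarrow> - 1 * l q - l g = l x"
    using Rs_resolvent[OF V, of x] by (auto simp: resolvent_iff q_def)
  note [simp] = graph_in[OF g(1)]
  obtain h where h: "(k, h) \<in> A" "\<And>l. bfun X l \<Longrightarrow> - 1 * l k - l h = l q"
    using Rs_resolvent[OF V, of q] by (auto simp: resolvent_iff k_def)
  note [simp] = graph_in[OF h(1)]
  have kq: "l k = - l q" if l: "bfun X l" for l
  proof -
    have "- l k = l q"
      using 0[OF l] J_regul[OF \<theta> \<open>x \<in> elems X\<close> l] by (simp add: k_def q_def)
    thus ?thesis by (metis minus_minus)
  qed
  have "nrm X h = 0"
  proof (rule separating)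
    fix l assume l: "bfun X l"
    show "l h = 0" using h(2)[OF l] kq[OF l] by simp
  qed simp
  have q1: "(q, (\<lambda>a. (- 1) * h a)) \<in> A"
  proof (rule graph_cong[OF graph_scale[OF h(1), of "- 1"]])
    show "ndist X (\<lambda>a. - 1 * k a) q = 0"
      by (subst ndist_eq_0_iff) (auto simp: minus_in bfun_minus kq)
  qed (auto intro: minus_in simp: ndist_def nrm_zero)
  have "nrm X (\<lambda>a. g a - (- 1) * h a) = 0"
    using graph_null[OF graph_lin[OF q1 g(1), of "- 1"]] by (simp add: nrm_zero add.commute)
  hence g0: "l g = 0" if l: "bfun X l" for l
    using bfun_null[OF l, of "\<lambda>a. g a + h a"] bfun_null[OF l _ \<open>nrm X h = 0\<close>] add_in[of g h]
    by (simp add: bfun_add[OF l])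
  have xq: "l x = - l q" if l: "bfun X l" for l
    using g(2)[OF l] g0[OF l] by simp
  have "(x, (\<lambda>a. - 1 * g a)) \<in> A"
  proof (rule graph_cong[OF graph_scale[OF g(1), of "- 1"]])
    show "ndist X (\<lambda>a. - 1 * q a) x = 0"
      by (subst ndist_eq_0_iff) (auto simp: minus_in bfun_minus xq)
  qed (auto intro: minus_in simp: ndist_def nrm_zero)
  moreover have "nrm X (\<lambda>a. - 1 * g a) = 0"
    by (rule separating) (auto simp: minus_in bfun_minus g0)
  ultimately have "x \<in> ker_op X A" by (auto simp: ker_op_def)
  thus ?thesis by (rule ker_Z[OF x])
qed

text \<open>\<rho>(A)x = A R(-1)^2 x lies in the range itself.\<close>

lemma J_regul_in_Z:
  assumes \<theta>: "0 < \<theta>" "\<theta> < pi" and x: "x \<in> elems X" and v: "v \<in> elems X" "\<And>l. bfun X l \<Longrightarrow> l v = J \<theta> regul l x"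
  shows "v \<in> Z"
proof -
  have V: "- 1 \<in> V" by (rule V_I[of _ 0]) auto
  define q k where "q = Rs (- 1) x" and "k = Rs (- 1) q"
  have q: "q \<in> elems X" unfolding q_def by (rule Rs_in[OF V x])
  obtain h where h: "(k, h) \<in> A" "\<And>l. bfun X l \<Longrightarrow> - 1 * l k - l h = l q"
    using Rs_resolvent[OF V q] by (auto simp: resolvent_iff k_def)
  show ?thesis
  proof (rule range_Z[OF h(1) v(1)])
    fix l assume l: "bfun X l"
    have "l v = - l k - l q" using v(2)[OF l] J_regul[OF \<theta> x l] by (simp add: q_def k_def)
    thus "l v = l h" using h(2)[OF l] by (simp add: algebra_simps)
  qed
qed

end

locale hoermander_operator = sectorial_operator +
  fixes \<phi> :: "real \<Rightarrow> complex" and \<alpha> \<theta> :: real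
  assumes \<theta>: "0 < \<theta>" "\<theta> < pi"
    and calculus: "bounded_hoermander_calc X A \<phi> \<alpha> \<theta>"
begin

text \<open>\<open>W F x y\<close> expresses \<open>F(A)x = y\<close> on the closure of the range through functionals, as
  \<open>\<rho>(A)y = (\<rho>F)(A)x\<close> with the regulariser \<open>\<rho>\<close>.\<close>

definition W :: "(complex \<Rightarrow> complex) \<Rightarrow> ('a \<Rightarrow> complex) \<Rightarrow> ('a \<Rightarrow> complex) \<Rightarrow> bool" where
  "W F x y \<longleftrightarrow> x \<in> Z \<and> y \<in> Z \<and> (\<forall>l. bfun X l \<longrightarrow> J \<theta> regul l y = J \<theta> (\<lambda>z. regul z * F z) l x)"

abbreviation hnorm :: "(complex \<Rightarrow> complex) \<Rightarrow> real" where
  "hnorm F \<equiv> hoermander_norm \<phi> \<alpha> (\<lambda>t. F (complex_of_real t))"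

lemmas regul_decays = decaying_regul[OF \<theta>]
lemmas Hinf_decays = decaying_Hinf[OF \<theta>]

lemma W_in: "W F x y \<Longrightarrow> x \<in> elems X" "W F x y \<Longrightarrow> y \<in> elems X" "W F x y \<Longrightarrow> x \<in> Z" "W F x y \<Longrightarrow> y \<in> Z"
  by (auto simp: W_def Z_in)

lemma hol_calcE:
  assumes "(x, y) \<in> hol_calc X A \<theta> F" "F \<in> Hinf \<theta>"
  obtains x0 x1 y0 w where "W F x0 y0" "x1 \<in> ker_op X A" "x \<in> elems X" "y \<in> elems X"
    "\<And>l. bfun X l \<Longrightarrow> l x = l x0 + l x1" "\<And>l. bfun X l \<Longrightarrow> l y = l y0 + F 0 * l x1"
    "(x0, w) \<in> cauchy_calc X A \<theta> (\<lambda>z. regul z * F z)" "(y0, w) \<in> cauchy_calc X A \<theta> regul"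
proof -
  obtain x0 x1 y0 w where *: "x \<in> elems X" "y \<in> elems X" "x0 \<in> Z" "x1 \<in> ker_op X A" "y0 \<in> Z"
    "ndist X x (\<lambda>a. x0 a + x1 a) = 0" "ndist X y (\<lambda>a. y0 a + F 0 * x1 a) = 0"
    "(x0, w) \<in> cauchy_calc X A \<theta> (\<lambda>z. regul z * F z)" "(y0, w) \<in> cauchy_calc X A \<theta> regul"
    using assms(1) by (auto simp: hol_calc_def regularised_def)
  have x1: "x1 \<in> elems X" using *(4) graph_in by (auto simp: ker_op_def)
  note [simp] = *(1,2) Z_in[OF *(3)] Z_in[OF *(5)] x1
  have "J \<theta> regul l y0 = J \<theta> (\<lambda>z. regul z * F z) l x0" if l: "bfun X l" for l
    using cauchy_calc_weak[OF \<theta> Hinf_decays[OF assms(2)] *(8) l] cauchy_calc_weak[OF \<theta> regul_decays *(9) l]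
    by simp
  hence "W F x0 y0" using * by (simp add: W_def)
  moreover have "l x = l x0 + l x1" "l y = l y0 + F 0 * l x1" if l: "bfun X l" for l
  proof -
    have "l x = l (\<lambda>a. x0 a + x1 a)" "l y = l (\<lambda>a. y0 a + F 0 * x1 a)"
      using *(6,7) l by (auto simp: ndist_eq_0_iff add_in scale_in)
    thus "l x = l x0 + l x1" "l y = l y0 + F 0 * l x1"
      by (simp_all add: bfun_add[OF l] bfun_scale[OF l] scale_in)
  qed
  ultimately show ?thesis using * by (intro that)
qed

lemma cauchy_calc_in: "(x, w) \<in> cauchy_calc X A \<theta> g \<Longrightarrow> x \<in> elems X" "(x, w) \<in> cauchy_calc X A \<theta> g \<Longrightarrow> w \<in> elems X"
  unfolding cauchy_calc_def has_integral_in_def by blast+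

lemma cauchy_calc_cong:
  assumes "(x, w) \<in> cauchy_calc X A \<theta> g" "x' \<in> elems X" "w' \<in> elems X"
    "\<And>l. bfun X l \<Longrightarrow> l x = l x'" "\<And>l. bfun X l \<Longrightarrow> l w = l w'"
  shows "(x', w') \<in> cauchy_calc X A \<theta> g"
proof -
  from assms(1) obtain r where r: "x \<in> elems X"
     "\<forall>t>0. \<forall>\<sigma>\<in>{-1, 1}. (x, r (rcis t (\<sigma> * \<theta> / 2))) \<in> resolvent X A (rcis t (\<sigma> * \<theta> / 2))"
     "has_integral_in X (restrict_space lborel {0<..})
       (\<lambda>t a. (g (rcis t (-\<theta> / 2)) * r (rcis t (-\<theta> / 2)) a * cis (-\<theta> / 2)
               - g (rcis t (\<theta> / 2)) * r (rcis t (\<theta> / 2)) a * cis (\<theta> / 2)) / (2 * pi * \<i>)) w"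
    unfolding cauchy_calc_def by blast
  have 1: "(x', f) \<in> resolvent X A \<zeta>" if "(x, f) \<in> resolvent X A \<zeta>" for f \<zeta>
    using that assms(2,4) by (auto simp: resolvent_iff)
  have 2: "ndist X w w' = 0"
    using assms(3,5) r(3) by (subst ndist_eq_0_iff) (auto simp: has_integral_in_def)
  have sep: "separated_fspace X" by unfold_locales
  show ?thesis
    unfolding cauchy_calc_def using assms(2) 1 r(2) has_integral_in_cong[OF sep r(3) assms(3) 2]
    by blast
qed

lemma const_Hinf: "(\<lambda>_. c) \<in> Hinf \<theta>"
  by (auto simp: Hinf_def bounded_iff)

lemma calculus_bound:
  obtains C where "\<And>F x. F \<in> Hinf \<theta> \<Longrightarrow> x \<in> elems X \<Longrightarrow>
     \<exists>y. (x, y) \<in> hol_calc X A \<theta> F \<and> nrm X y \<le> C * hnorm F * nrm X x"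
  using calculus unfolding bounded_hoermander_calc_def by blast

text \<open>On the closure of the range the kernel part of the decomposition is null.\<close>

lemma W_exists_bounded:
  assumes F: "F \<in> Hinf \<theta>" and x: "x \<in> Z" and C: "\<exists>y. (x, y) \<in> hol_calc X A \<theta> F \<and> nrm X y \<le> C"
  obtains y w where "W F x y" "nrm X y \<le> C" "(x, w) \<in> cauchy_calc X A \<theta> (\<lambda>z. regul z * F z)"
proof -
  obtain y where y: "(x, y) \<in> hol_calc X A \<theta> F" "nrm X y \<le> C" using C by blast
  obtain x0 x1 y0 w where *: "W F x0 y0" "x1 \<in> ker_op X A" "x \<in> elems X" "y \<in> elems X"
    "\<And>l. bfun X l \<Longrightarrow> l x = l x0 + l x1" "\<And>l. bfun X l \<Longrightarrow> l y = l y0 + F 0 * l x1"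
    "(x0, w) \<in> cauchy_calc X A \<theta> (\<lambda>z. regul z * F z)" "(y0, w) \<in> cauchy_calc X A \<theta> regul"
    by (rule hol_calcE[OF y(1) F]) (rule that)
  have x1: "x1 \<in> elems X" using *(2) graph_in by (auto simp: ker_op_def)
  note [simp] = *(3,4) W_in[OF *(1)] x1
  \<comment> \<open>Functionals identify x1 with x - x0, a difference of two elements of the closure
    of the range.\<close>
  have "x1 \<in> Z"
    by (rule Z_cong[OF Z_diff[OF x W_in(3)[OF *(1)]]]) (auto simp: bfun_diff *(5))
  hence "nrm X x1 = 0" using *(2) by (intro ker_Z)
  hence l1: "l x1 = 0" if l: "bfun X l" for l using bfun_null[OF l] by simp
  have "W F x y0"
    using *(1) x J_cong[OF \<theta>, of x x0] by (auto simp: W_def *(5) l1)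
  moreover have "nrm X y = nrm X y0"
    by (rule nrm_eqI) (simp_all add: *(6) l1)
  moreover have "(x, w) \<in> cauchy_calc X A \<theta> (\<lambda>z. regul z * F z)"
    by (rule cauchy_calc_cong[OF *(7) _ cauchy_calc_in(2)[OF *(7)]]) (simp_all add: l1 *(5))
  ultimately show ?thesis using y(2) that by simp
qed

text \<open>A pair in the holomorphic calculus already carries a witness for its Cauchy integral.
  The calculus hypothesis thus turns the scalars \<open>J\<close> into values of functionals at a
  genuine element, as \<open>J_mult\<close> demands of its inner function.\<close>

lemma cauchy_exists:
  assumes F: "F \<in> Hinf \<theta>" and x: "x \<in> Z"
  obtains w where "(x, w) \<in> cauchy_calc X A \<theta> (\<lambda>z. regul z * F z)" "w \<in> elems X"
    "\<And>l. bfun X l \<Longrightarrow> l w = J \<theta> (\<lambda>z. regul z * F z) l x"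
proof -
  obtain C where "\<And>F x. F \<in> Hinf \<theta> \<Longrightarrow> x \<in> elems X \<Longrightarrow>
     \<exists>y. (x, y) \<in> hol_calc X A \<theta> F \<and> nrm X y \<le> C * hnorm F * nrm X x"
    using calculus_bound by blast
  from W_exists_bounded[OF F x this[OF F Z_in[OF x]]]
  obtain w where w: "(x, w) \<in> cauchy_calc X A \<theta> (\<lambda>z. regul z * F z)" by blast
  show ?thesis
    by (rule that[OF w cauchy_calc_in(2)[OF w] cauchy_calc_weak[OF \<theta> Hinf_decays[OF F] w]])
qed

lemma cauchy_regul_exists:
  assumes x: "x \<in> Z"
  obtains w where "(x, w) \<in> cauchy_calc X A \<theta> regul" "w \<in> Z"
    "\<And>l. bfun X l \<Longrightarrow> l w = J \<theta> regul l x"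
proof -
  obtain w where w: "(x, w) \<in> cauchy_calc X A \<theta> (\<lambda>z. regul z * 1)" "w \<in> elems X"
    "\<And>l. bfun X l \<Longrightarrow> l w = J \<theta> (\<lambda>z. regul z * 1) l x"
    using cauchy_exists[OF const_Hinf[of 1] x] by metis
  have "w \<in> Z"
    using J_regul_in_Z[OF \<theta> Z_in[OF x] w(2)] w(3) by simp
  thus ?thesis using that[of w] w by simp
qed

lemma W_unique:
  assumes "W F x y" "W F x y'" "bfun X l"
  shows "l y = l y'"
proof -
  have "nrm X (\<lambda>a. y a - y' a) = 0"
  proof (rule J_regul_injective[OF \<theta> Z_diff])
    fix l assume l: "bfun X l"
    show "J \<theta> regul l (\<lambda>a. y a - y' a) = 0"
      using J_lin[OF \<theta> regul_decays W_in(2)[OF assms(2)] W_in(2)[OF assms(1)] l, of "- 1"]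
        assms(1,2) l by (simp add: W_def)
  qed (use W_in assms in auto)
  thus ?thesis
    using bfun_null[OF assms(3), of "\<lambda>a. y a - y' a"] assms W_in by (simp add: bfun_diff diff_in)
qed

text \<open>Uniqueness transfers the bound from the value supplied by the calculus to every
  \<open>y\<close>. The absolute values keep the product monotone without a discussion of the signs
  of its factors.\<close>

lemma W_bound:
  obtains C where "C \<ge> 0" "\<And>F x y. F \<in> Hinf \<theta> \<Longrightarrow> W F x y \<Longrightarrow>
     nrm X y \<le> C * \<bar>hnorm F\<bar> * nrm X x"
proof -
  obtain C where C: "\<And>F x. F \<in> Hinf \<theta> \<Longrightarrow> x \<in> elems X \<Longrightarrow>
     \<exists>y. (x, y) \<in> hol_calc X A \<theta> F \<and> nrm X y \<le> C * hnorm F * nrm X x"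
    using calculus_bound by blast
  show ?thesis
  proof (rule that[of "\<bar>C\<bar>"])
    fix F x y assume F: "F \<in> Hinf \<theta>" and xy: "W F x y"
    obtain y' where y': "W F x y'" "nrm X y' \<le> C * hnorm F * nrm X x"
      using W_exists_bounded[OF F W_in(3)[OF xy] C[OF F W_in(1)[OF xy]]] by blast
    have "nrm X y = nrm X y'"
      by (rule nrm_eqI[OF W_in(2)[OF xy] W_in(2)[OF y'(1)] W_unique[OF xy y'(1)]])
    also note y'(2)
    also have "C * hnorm F * nrm X x \<le> \<bar>C\<bar> * \<bar>hnorm F\<bar> * nrm X x"
      using W_in(1)[OF xy] by (intro mult_right_mono nrm_nonneg) (auto simp flip: abs_mult)
    finally show "nrm X y \<le> \<bar>C\<bar> * \<bar>hnorm F\<bar> * nrm X x" .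
  qed auto
qed

lemma W_exists:
  assumes "F \<in> Hinf \<theta>" "x \<in> Z"
  obtains y where "W F x y"
proof -
  obtain C where C: "\<And>F x. F \<in> Hinf \<theta> \<Longrightarrow> x \<in> elems X \<Longrightarrow>
     \<exists>y. (x, y) \<in> hol_calc X A \<theta> F \<and> nrm X y \<le> C * hnorm F * nrm X x"
    using calculus_bound by blast
  from W_exists_bounded[OF assms C[OF assms(1) Z_in[OF assms(2)]]] that show ?thesis by blast
qed

lemma W_lin_fun:
  assumes "F \<in> Hinf \<theta>" "G \<in> Hinf \<theta>" "W F x y" "W G x z"
  shows "W (\<lambda>u. c * F u + G u) x (\<lambda>a. c * y a + z a)"
  unfolding W_def
proof (intro conjI allI impI)
  fix l assume l: "bfun X l"
  have "J \<theta> (\<lambda>u. c * (regul u * F u) + regul u * G u) l x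
       = c * J \<theta> (\<lambda>u. regul u * F u) l x + J \<theta> (\<lambda>u. regul u * G u) l x"
    by (rule J_lin_fun[OF \<theta> Hinf_decays Hinf_decays]) (use assms l W_in in auto)
  moreover have "J \<theta> regul l (\<lambda>a. c * y a + z a) = c * J \<theta> regul l y + J \<theta> regul l z"
    by (rule J_lin[OF \<theta> regul_decays]) (use assms l W_in in auto)
  ultimately show "J \<theta> regul l (\<lambda>a. c * y a + z a) = J \<theta> (\<lambda>z. regul z * (c * F z + G z)) l x"
    using assms(3,4) l by (simp add: W_def algebra_simps)
qed (use assms W_in Z_lin in auto)

lemma W_lin:
  assumes "F \<in> Hinf \<theta>" "W F x y" "W F x' y'"
  shows "W F (\<lambda>a. c * x a + x' a) (\<lambda>a. c * y a + y' a)"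
  unfolding W_def
proof (intro conjI allI impI)
  fix l assume l: "bfun X l"
  have "J \<theta> regul l (\<lambda>a. c * y a + y' a) = c * J \<theta> regul l y + J \<theta> regul l y'"
    by (rule J_lin[OF \<theta> regul_decays]) (use assms l W_in in auto)
  moreover have "J \<theta> (\<lambda>z. regul z * F z) l (\<lambda>a. c * x a + x' a)
     = c * J \<theta> (\<lambda>z. regul z * F z) l x + J \<theta> (\<lambda>z. regul z * F z) l x'"
    by (rule J_lin[OF \<theta> Hinf_decays]) (use assms l W_in in auto)
  ultimately show "J \<theta> regul l (\<lambda>a. c * y a + y' a) = J \<theta> (\<lambda>z. regul z * F z) l (\<lambda>a. c * x a + x' a)"
    using assms l by (simp add: W_def)
qed (use assms W_in Z_lin in auto)

lemma W_cong:
  assumes "W F x y" "x' \<in> elems X" "y' \<in> elems X" "\<And>l. bfun X l \<Longrightarrow> l x' = l x" "\<And>l. bfun X l \<Longrightarrow> l y' = l y"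
  shows "W F x' y'"
  unfolding W_def
proof (intro conjI allI impI)
  show "x' \<in> Z" "y' \<in> Z"
    by (rule Z_cong[OF W_in(3)[OF assms(1)] assms(2,4)], assumption)
       (rule Z_cong[OF W_in(4)[OF assms(1)] assms(3,5)], assumption)
  fix l assume l: "bfun X l"
  show "J \<theta> regul l y' = J \<theta> (\<lambda>z. regul z * F z) l x'"
    using J_cong[OF \<theta> assms(2) W_in(1)[OF assms(1)] assms(4) l]
      J_cong[OF \<theta> assms(3) W_in(2)[OF assms(1)] assms(5) l] assms(1) l
    by (simp add: W_def)
qed

text \<open>Apply f(A) to the common value \<rho>(A)y = (\<rho> F)(A)x and use multiplicativity on
  either side.\<close>

lemma J_mult_W:
  assumes f: "decaying \<theta> f" and F: "F \<in> Hinf \<theta>" and "W F x y" and l: "bfun X l"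
  shows "J \<theta> (\<lambda>z. f z * regul z) l y = J \<theta> (\<lambda>z. f z * (regul z * F z)) l x"
proof -
  note [simp] = W_in[OF assms(3)]
  obtain w where w: "w \<in> elems X" "\<And>l. bfun X l \<Longrightarrow> l w = J \<theta> (\<lambda>z. regul z * F z) l x"
    using cauchy_exists[OF F W_in(3)[OF assms(3)]] by metis
  have w': "l w = J \<theta> regul l y" if "bfun X l" for l
    using w(2)[OF that] assms(3) that by (simp add: W_def)
  have "J \<theta> f l w = J \<theta> (\<lambda>z. f z * (regul z * F z)) l x"
    by (rule J_mult[OF \<theta> f Hinf_decays[OF F] _ w l]) auto
  moreover have "J \<theta> f l w = J \<theta> (\<lambda>z. f z * regul z) l y"
    by (rule J_mult[OF \<theta> f regul_decays _ w(1) w' l]) auto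
  ultimately show ?thesis by simp
qed

text \<open>Let z' be the value of the product symbol at x. Then \<rho>(A)^2 z = \<rho>(A)(\<rho>
  G)(A)y = (\<rho> G)(A)\<rho>(A)y = (\<rho> G)(A)(\<rho> F)(A)x = \<rho>(A)^2 z', where commuting
  scalar factors under the integral replaces commuting operators. Injectivity of \<rho>(A) is then
  used twice.\<close>

lemma W_mult:
  assumes F: "F \<in> Hinf \<theta>" and G: "G \<in> Hinf \<theta>" and FG: "(\<lambda>z. G z * F z) \<in> Hinf \<theta>"
    and xy: "W F x y" and yz: "W G y z"
  shows "W (\<lambda>z. G z * F z) x z"
proof -
  obtain z' where z': "W (\<lambda>z. G z * F z) x z'" using W_exists[OF FG W_in(3)[OF xy]] by blast
  note [simp] = W_in[OF xy] W_in[OF yz] W_in[OF z']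
  have 1: "J \<theta> (\<lambda>z. regul z * regul z) l z = J \<theta> (\<lambda>z. regul z * regul z) l z'" if l: "bfun X l" for l
  proof -
    have "J \<theta> (\<lambda>z. regul z * regul z) l z = J \<theta> (\<lambda>z. regul z * (regul z * G z)) l y"
      by (rule J_mult_W[OF regul_decays G yz l])
    also have "\<dots> = J \<theta> (\<lambda>z. (regul z * G z) * regul z) l y" by (simp add: mult_ac)
    also have "\<dots> = J \<theta> (\<lambda>z. (regul z * G z) * (regul z * F z)) l x"
      by (rule J_mult_W[OF Hinf_decays[OF G] F xy l])
    also have "\<dots> = J \<theta> (\<lambda>z. regul z * (regul z * (G z * F z))) l x" by (simp add: mult_ac)
    also have "\<dots> = J \<theta> (\<lambda>z. regul z * regul z) l z'"
      by (rule J_mult_W[OF regul_decays FG z' l, symmetric])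
    finally show ?thesis .
  qed
  define d where "d = (\<lambda>a. z a - z' a)"
  have d: "d \<in> Z" unfolding d_def by (rule Z_diff) auto
  obtain w where w: "w \<in> Z" "\<And>l. bfun X l \<Longrightarrow> l w = J \<theta> regul l d"
    using cauchy_regul_exists[OF d] by metis
  have rr: "decaying \<theta> (\<lambda>z. regul z * regul z)"
  proof -
    have "regul holomorphic_on sector \<theta>" "bounded (regul ` sector \<theta>)"
    proof -
      show "regul holomorphic_on sector \<theta>" using regul_decays by (simp add: decaying_def)
      obtain C where C: "\<And>z. z \<in> sector \<theta> \<Longrightarrow> cmod (regul z) \<le> C * (cmod z / (1 + cmod z)\<^sup>2)"
        using regul_decays by (auto simp: decaying_def)
      have "cmod (regul z) \<le> \<bar>C\<bar> * 1" if "z \<in> sector \<theta>" for z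
      proof -
        have "cmod z / (1 + cmod z)\<^sup>2 \<le> 1"
        proof -
          have "cmod z \<le> (1 + cmod z)\<^sup>2" by (simp add: power2_eq_square algebra_simps)
          thus ?thesis by (intro divide_le_eq_1[THEN iffD2]) (auto intro!: zero_less_power add_pos_nonneg)
        qed
        hence "C * (cmod z / (1 + cmod z)\<^sup>2) \<le> \<bar>C\<bar> * 1" by (intro mult_mono) auto
        with C[OF that] show ?thesis by linarith
      qed
      thus "bounded (regul ` sector \<theta>)" unfolding bounded_iff by auto
    qed
    thus ?thesis by (rule decaying_regul_mult[OF \<theta>])
  qed
  have "nrm X w = 0"
  proof (rule J_regul_injective[OF \<theta> w(1)])
    fix l assume l: "bfun X l"
    have "J \<theta> regul l w = J \<theta> (\<lambda>z. regul z * regul z) l d"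
      by (rule J_mult[OF \<theta> regul_decays regul_decays Z_in[OF d] Z_in[OF w(1)] w(2) l])
    also have "\<dots> = 0"
      using J_lin[OF \<theta> rr W_in(2)[OF z'] W_in(2)[OF yz] l, of "- 1"] 1[OF l] by (simp add: d_def)
    finally show "J \<theta> regul l w = 0" .
  qed
  hence "J \<theta> regul l d = 0" if "bfun X l" for l
    using w(2)[OF that] bfun_null[OF that Z_in[OF w(1)]] by simp
  hence "nrm X d = 0" by (rule J_regul_injective[OF \<theta> d])
  hence "l z = l z'" if l: "bfun X l" for l
    using bfun_null[OF l Z_in[OF d]] by (simp add: d_def bfun_diff[OF l])
  thus ?thesis by (intro W_cong[OF z']) auto
qed

lemma hol_calc_of_W:
  assumes F: "F \<in> Hinf \<theta>" and W: "W F x0 y0" and x1: "x1 \<in> ker_op X A"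
    and xy: "x \<in> elems X" "y \<in> elems X" "\<And>l. bfun X l \<Longrightarrow> l x = l x0 + l x1"
      "\<And>l. bfun X l \<Longrightarrow> l y = l y0 + F 0 * l x1"
  shows "(x, y) \<in> hol_calc X A \<theta> F"
proof -
  have x1': "x1 \<in> elems X" using x1 graph_in by (auto simp: ker_op_def)
  note [simp] = W_in[OF W] x1' xy(1,2)
  obtain w where w: "(x0, w) \<in> cauchy_calc X A \<theta> (\<lambda>z. regul z * F z)" "w \<in> elems X"
      "\<And>l. bfun X l \<Longrightarrow> l w = J \<theta> (\<lambda>z. regul z * F z) l x0"
    using cauchy_exists[OF F W_in(3)[OF W]] by metis
  obtain w' where w': "(y0, w') \<in> cauchy_calc X A \<theta> regul" "\<And>l. bfun X l \<Longrightarrow> l w' = J \<theta> regul l y0"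
    using cauchy_regul_exists[OF W_in(4)[OF W]] by metis
  have "(y0, w) \<in> cauchy_calc X A \<theta> regul"
    by (rule cauchy_calc_cong[OF w'(1)]) (use w w' W in \<open>auto simp: W_def\<close>)
  moreover have "ndist X x (\<lambda>a. x0 a + x1 a) = 0"
  proof (subst ndist_eq_0_iff, simp, rule add_in, simp, simp, intro allI impI)
    fix l assume l: "bfun X l"
    show "l x = l (\<lambda>a. x0 a + x1 a)" using xy(3)[OF l] by (simp add: bfun_add[OF l])
  qed
  moreover have "ndist X y (\<lambda>a. y0 a + F 0 * x1 a) = 0"
  proof (subst ndist_eq_0_iff, simp, rule add_in, simp, rule scale_in, simp, intro allI impI)
    fix l assume l: "bfun X l"
    show "l y = l (\<lambda>a. y0 a + F 0 * x1 a)"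
      using xy(4)[OF l] by (simp add: bfun_add[OF l] bfun_scale[OF l] scale_in)
  qed
  ultimately show ?thesis
    unfolding hol_calc_def regularised_def using w(1) x1 xy(1,2) W_in(3,4)[OF W] by blast
qed

end

section \<open>Elementary bounded holomorphic functions on sectors\<close>

lemma one_plus_notin_nonpos:
  assumes "z \<in> sector \<theta>" "\<theta> < pi"
  shows "1 + z \<notin> \<real>\<^sub>\<le>\<^sub>0" "z \<notin> \<real>\<^sub>\<le>\<^sub>0"
proof -
  have *: "False" if "z \<in> \<real>\<^sub>\<le>\<^sub>0"
  proof -
    from that assms have "Re z < 0" "Im z = 0"
      by (auto simp: complex_nonpos_Reals_iff sector_def complex_eq_iff less_le)
    hence "Arg z = pi" by (simp add: Arg_eq_pi)
    thus False using assms by (simp add: sector_def)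
  qed
  thus "z \<notin> \<real>\<^sub>\<le>\<^sub>0" by blast
  show "1 + z \<notin> \<real>\<^sub>\<le>\<^sub>0"
    using * by (auto simp: complex_nonpos_Reals_iff)
qed

lemma sector_one_plus_nz: "z \<in> sector \<theta> \<Longrightarrow> \<theta> < pi \<Longrightarrow> 1 + z \<noteq> 0"
  using one_plus_notin_nonpos[of z \<theta>] by auto

lemma HinfI:
  assumes "f holomorphic_on sector \<theta>" "\<And>z. z \<in> sector \<theta> \<Longrightarrow> cmod (f z) \<le> B" "(f \<longlongrightarrow> f 0) (at 0 within sector \<theta>)"
  shows "f \<in> Hinf \<theta>"
  using assms by (auto simp: Hinf_def bounded_iff)

lemma Hinf_bound:
  assumes "f \<in> Hinf \<theta>"
  obtains B where "B \<ge> 0" "\<And>z. z \<in> sector \<theta> \<Longrightarrow> cmod (f z) \<le> B"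
proof -
  from assms obtain B where "\<And>z. z \<in> sector \<theta> \<Longrightarrow> cmod (f z) \<le> B"
    by (auto simp: Hinf_def bounded_iff)
  thus ?thesis by (intro that[of "\<bar>B\<bar>"]) (auto intro: order.trans[OF _ abs_ge_self])
qed

lemma Hinf_mult: "f \<in> Hinf \<theta> \<Longrightarrow> g \<in> Hinf \<theta> \<Longrightarrow> (\<lambda>z. f z * g z) \<in> Hinf \<theta>"
proof -
  assume f: "f \<in> Hinf \<theta>" and g: "g \<in> Hinf \<theta>"
  obtain B where B: "B \<ge> 0" "\<And>z. z \<in> sector \<theta> \<Longrightarrow> cmod (f z) \<le> B" using Hinf_bound[OF f] by blast
  obtain C where C: "C \<ge> 0" "\<And>z. z \<in> sector \<theta> \<Longrightarrow> cmod (g z) \<le> C" using Hinf_bound[OF g] by blast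
  show ?thesis
    by (rule HinfI[of _ _ "B * C"])
       (use f g B C in \<open>auto simp: Hinf_def norm_mult intro!: holomorphic_intros tendsto_intros mult_mono\<close>)
qed

lemma Hinf_add: "f \<in> Hinf \<theta> \<Longrightarrow> g \<in> Hinf \<theta> \<Longrightarrow> (\<lambda>z. f z + g z) \<in> Hinf \<theta>"
proof -
  assume f: "f \<in> Hinf \<theta>" and g: "g \<in> Hinf \<theta>"
  obtain B where B: "B \<ge> 0" "\<And>z. z \<in> sector \<theta> \<Longrightarrow> cmod (f z) \<le> B" using Hinf_bound[OF f] by blast
  obtain C where C: "C \<ge> 0" "\<And>z. z \<in> sector \<theta> \<Longrightarrow> cmod (g z) \<le> C" using Hinf_bound[OF g] by blast
  show ?thesis
    by (rule HinfI[of _ _ "B + C"])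
       (use f g B C in \<open>auto simp: Hinf_def intro!: holomorphic_intros tendsto_intros norm_triangle_mono\<close>)
qed

lemma Hinf_const: "(\<lambda>_. c) \<in> Hinf \<theta>"
  by (rule HinfI[of _ _ "cmod c"]) auto

lemma Hinf_power: "f \<in> Hinf \<theta> \<Longrightarrow> (\<lambda>z. f z ^ n) \<in> Hinf \<theta>"
  by (induction n) (auto intro: Hinf_const Hinf_mult)

lemma Hinf_sum: "(\<And>i. i \<in> I \<Longrightarrow> f i \<in> Hinf \<theta>) \<Longrightarrow> (\<lambda>z. \<Sum>i\<in>I. f i z) \<in> Hinf \<theta>"
  by (induction I rule: infinite_finite_induct) (auto intro: Hinf_const Hinf_add)

lemma Hinf_inverse_one_plus:
  assumes "0 < \<theta>" "\<theta> < pi"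
  shows "(\<lambda>z. 1 / (1 + z)) \<in> Hinf \<theta>"
proof -
  obtain \<kappa> where \<kappa>: "\<kappa> > 0" "\<And>z. z \<in> sector \<theta> \<Longrightarrow> \<kappa> * (1 + cmod z) \<le> cmod (1 + z)"
    using sector_one_plus[OF assms] by blast
  show ?thesis
  proof (rule HinfI[of _ _ "1 / \<kappa>"])
    fix z assume z: "z \<in> sector \<theta>"
    have "\<kappa> * 1 \<le> \<kappa> * (1 + cmod z)" using \<kappa>(1) by (intro mult_left_mono) auto
    hence "\<kappa> \<le> cmod (1 + z)" using \<kappa>(2)[OF z] by linarith
    thus "cmod (1 / (1 + z)) \<le> 1 / \<kappa>"
      using \<kappa>(1) by (simp add: norm_divide frac_le)
  qed (use sector_one_plus_nz assms in \<open>auto intro!: holomorphic_intros tendsto_eq_intros\<close>)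
qed

lemma Hinf_quotient:
  assumes "0 < \<theta>" "\<theta> < pi"
  shows "(\<lambda>z. z / (1 + z)) \<in> Hinf \<theta>"
proof -
  obtain \<kappa> where \<kappa>: "\<kappa> > 0" "\<And>z. z \<in> sector \<theta> \<Longrightarrow> \<kappa> * (1 + cmod z) \<le> cmod (1 + z)"
    using sector_one_plus[OF assms] by blast
  show ?thesis
  proof (rule HinfI[of _ _ "1 / \<kappa>"])
    fix z assume z: "z \<in> sector \<theta>"
    have "\<kappa> * cmod z \<le> \<kappa> * (1 + cmod z)" using \<kappa>(1) by (intro mult_left_mono) auto
    hence "\<kappa> * cmod z \<le> cmod (1 + z)" using \<kappa>(2)[OF z] by linarith
    thus "cmod (z / (1 + z)) \<le> 1 / \<kappa>"
      using \<kappa>(1) sector_one_plus_nz[OF z assms(2)] by (simp add: norm_divide field_simps)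
  qed (use sector_one_plus_nz assms in \<open>auto intro!: holomorphic_intros tendsto_eq_intros\<close>)
qed

lemma Hinf_regul:
  assumes "0 < \<theta>" "\<theta> < pi"
  shows "regul \<in> Hinf \<theta>"
proof -
  have "(\<lambda>z. (z / (1 + z)) * (1 / (1 + z))) \<in> Hinf \<theta>"
    by (intro Hinf_mult Hinf_quotient Hinf_inverse_one_plus assms)
  thus ?thesis by (simp add: regul_def[abs_def] power2_eq_square)
qed

lemma Hinf_one_plus_powr:
  assumes "0 < \<theta>" "\<theta> < pi" "c \<le> 0"
  shows "(\<lambda>z. (1 + z) powr complex_of_real c) \<in> Hinf \<theta>"
proof -
  obtain \<kappa> where \<kappa>: "\<kappa> > 0" "\<And>z. z \<in> sector \<theta> \<Longrightarrow> \<kappa> * (1 + cmod z) \<le> cmod (1 + z)"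
    using sector_one_plus[OF assms(1,2)] by blast
  show ?thesis
  proof (rule HinfI[of _ _ "\<kappa> powr c"])
    fix z assume z: "z \<in> sector \<theta>"
    have "\<kappa> * 1 \<le> \<kappa> * (1 + cmod z)" using \<kappa>(1) by (intro mult_left_mono) auto
    hence *: "\<kappa> \<le> cmod (1 + z)" using \<kappa>(2)[OF z] by linarith
    have "cmod ((1 + z) powr complex_of_real c) = cmod (1 + z) powr c"
      by (simp add: norm_powr_real_powr')
    also have "\<dots> \<le> \<kappa> powr c" using * \<kappa>(1) assms(3) by (intro powr_mono2') auto
    finally show "cmod ((1 + z) powr complex_of_real c) \<le> \<kappa> powr c" .
  next
    show "(\<lambda>z. (1 + z) powr complex_of_real c) holomorphic_on sector \<theta>"
      using one_plus_notin_nonpos assms by (intro holomorphic_intros) auto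
    show "((\<lambda>z. (1 + z) powr complex_of_real c) \<longlongrightarrow> (1 + 0) powr complex_of_real c) (at 0 within sector \<theta>)"
      by (intro tendsto_powr_complex tendsto_intros) auto
  qed
qed

lemma Hinf_powr_quotient:
  assumes "0 < \<theta>" "\<theta> < pi" "c > 0"
  shows "(\<lambda>z. z powr complex_of_real c * (1 + z) powr complex_of_real (- c)) \<in> Hinf \<theta>"
proof -
  obtain \<kappa> where \<kappa>: "\<kappa> > 0" "\<And>z. z \<in> sector \<theta> \<Longrightarrow> \<kappa> * (1 + cmod z) \<le> cmod (1 + z)"
    using sector_one_plus[OF assms(1,2)] by blast
  show ?thesis
  proof (rule HinfI[of _ _ "(1 / \<kappa>) powr c"])
    fix z assume z: "z \<in> sector \<theta>"
    have nz: "cmod (1 + z) > 0" using sector_one_plus_nz[OF z assms(2)] by simp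
    have "\<kappa> * cmod z \<le> \<kappa> * (1 + cmod z)" using \<kappa>(1) by (intro mult_left_mono) auto
    hence "\<kappa> * cmod z \<le> cmod (1 + z)" using \<kappa>(2)[OF z] by linarith
    hence *: "cmod z / cmod (1 + z) \<le> 1 / \<kappa>" using \<kappa>(1) nz by (simp add: field_simps)
    have "cmod (z powr complex_of_real c * (1 + z) powr complex_of_real (- c))
       = cmod z powr c * cmod (1 + z) powr (- c)"
      by (simp add: norm_mult norm_powr_real_powr' del: of_real_minus)
    also have "\<dots> = (cmod z / cmod (1 + z)) powr c"
      using nz by (simp add: powr_divide powr_minus_divide)
    also have "\<dots> \<le> (1 / \<kappa>) powr c" using * assms(3) by (intro powr_mono2) auto
    finally show "cmod (z powr complex_of_real c * (1 + z) powr complex_of_real (- c)) \<le> (1 / \<kappa>) powr c" .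
  next
    show "(\<lambda>z. z powr complex_of_real c * (1 + z) powr complex_of_real (- c)) holomorphic_on sector \<theta>"
      using one_plus_notin_nonpos assms by (intro holomorphic_intros) auto
    have "((\<lambda>z. z powr complex_of_real c * (1 + z) powr complex_of_real (- c)) \<longlongrightarrow> 0 * (1 + 0) powr complex_of_real (- c)) (at 0 within sector \<theta>)"
      using assms by (intro tendsto_mult tendsto_powr_complex_0 tendsto_powr_complex tendsto_intros) auto
    thus "((\<lambda>z. z powr complex_of_real c * (1 + z) powr complex_of_real (- c)) \<longlongrightarrow> 0 powr complex_of_real c * (1 + 0) powr complex_of_real (- c)) (at 0 within sector \<theta>)"
      by simp
  qed
qed

text \<open>Since s + q = 1 for s = 1/(1+z) and q = z/(1+z), the expansion of (s + q)^(2N) has in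
  every term at least N factors s or more than N factors q. This partition of unity separates the
  behaviour at 0 from that at infinity.\<close>

lemma Hinf_Bezout:
  assumes "0 < \<theta>" "\<theta> < pi"
  obtains R1 R2 where "R1 \<in> Hinf \<theta>" "R2 \<in> Hinf \<theta>"
    "\<And>z. z \<in> sector \<theta> \<Longrightarrow> (1 / (1 + z)) ^ N * R1 z + (z / (1 + z)) ^ N * R2 z = 1"
proof -
  define s q where "s z = 1 / (1 + z)" and "q z = z / (1 + z)" for z :: complex
  define R1 where "R1 z = (\<Sum>j\<in>{N..2 * N}. of_nat (2 * N choose j) * (s z ^ (j - N) * q z ^ (2 * N - j)))" for z
  define R2 where "R2 z = (\<Sum>j\<in>{..<N}. of_nat (2 * N choose j) * (s z ^ j * q z ^ (N - j)))" for z
  have sq: "s \<in> Hinf \<theta>" "q \<in> Hinf \<theta>"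
    unfolding s_def[abs_def] q_def[abs_def] by (intro Hinf_inverse_one_plus Hinf_quotient assms)+
  show ?thesis
  proof (rule that[of R1 R2])
    show "R1 \<in> Hinf \<theta>" "R2 \<in> Hinf \<theta>"
      unfolding R1_def[abs_def] R2_def[abs_def] by (intro Hinf_sum Hinf_mult Hinf_const Hinf_power sq)+
    fix z assume z: "z \<in> sector \<theta>"
    have "s z + q z = (1 + z) / (1 + z)"
      unfolding s_def q_def by (rule add_divide_distrib[symmetric])
    hence "s z + q z = 1" using sector_one_plus_nz[OF z assms(2)] by simp
    hence "1 = (s z + q z) ^ (2 * N)" by simp
    also have "\<dots> = (\<Sum>j\<le>2 * N. of_nat (2 * N choose j) * s z ^ j * q z ^ (2 * N - j))"
      by (rule binomial_ring)
    also have "{..2 * N} = {..<N} \<union> {N..2 * N}" by auto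
    also have "(\<Sum>j\<in>{..<N} \<union> {N..2 * N}. of_nat (2 * N choose j) * s z ^ j * q z ^ (2 * N - j))
       = (\<Sum>j\<in>{..<N}. of_nat (2 * N choose j) * s z ^ j * q z ^ (2 * N - j))
         + (\<Sum>j\<in>{N..2 * N}. of_nat (2 * N choose j) * s z ^ j * q z ^ (2 * N - j))"
      by (rule sum.union_disjoint) auto
    also have "(\<Sum>j\<in>{..<N}. of_nat (2 * N choose j) * s z ^ j * q z ^ (2 * N - j)) = q z ^ N * R2 z"
      unfolding R2_def sum_distrib_left
    proof (rule sum.cong)
      fix j assume "j \<in> {..<N}"
      hence "2 * N - j = N + (N - j)" by auto
      thus "of_nat (2 * N choose j) * s z ^ j * q z ^ (2 * N - j) = q z ^ N * (of_nat (2 * N choose j) * (s z ^ j * q z ^ (N - j)))"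
        by (simp add: power_add)
    qed auto
    also have "(\<Sum>j\<in>{N..2 * N}. of_nat (2 * N choose j) * s z ^ j * q z ^ (2 * N - j)) = s z ^ N * R1 z"
      unfolding R1_def sum_distrib_left
    proof (rule sum.cong)
      fix j assume "j \<in> {N..2 * N}"
      hence "s z ^ j = s z ^ N * s z ^ (j - N)" by (simp flip: power_add)
      thus "of_nat (2 * N choose j) * s z ^ j * q z ^ (2 * N - j) = s z ^ N * (of_nat (2 * N choose j) * (s z ^ (j - N) * q z ^ (2 * N - j)))"
        by simp
    qed auto
    finally show "(1 / (1 + z)) ^ N * R1 z + (z / (1 + z)) ^ N * R2 z = 1"
      by (simp add: s_def q_def add.commute)
  qed
qed

section \<open>Fractional powers and limits of the holomorphic calculus\<close>

context hoermander_operator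
begin

lemma W_cong_fun:
  assumes "W F x y" "\<And>z. z \<in> sector \<theta> \<Longrightarrow> F z = G z"
  shows "W G x y"
proof -
  have "J \<theta> (\<lambda>z. regul z * F z) l x = J \<theta> (\<lambda>z. regul z * G z) l x" for l
    unfolding J_def using \<theta> by (intro sector_int_cong) (simp add: assms(2) exp_in_sector)
  thus ?thesis using assms(1) by (simp add: W_def)
qed

lemma ker_in: "x \<in> ker_op X A \<Longrightarrow> x \<in> elems X"
  using graph_in by (auto simp: ker_op_def)

text \<open>The inclusion rests on a decomposition (1+z)^\<delta> = a(z) + b(z) z^\<delta> with
  bounded \<open>a\<close> and \<open>b\<close>, so that (1+A)^\<delta> f is a(A)f + b(A)A^\<delta>
  f on the closure of the range and f on the kernel. All of it is carried out after multiplication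
  by (1+z)^-k, as the extended calculus prescribes.\<close>

lemma domain_one_plus_frac_pow:
  assumes f: "f \<in> Domain (frac_pow X A \<theta> \<delta>)"
  obtains g where "(f, g) \<in> one_plus_frac_pow X A \<theta> \<delta>"
proof -
  from f obtain y k w where F1: "(\<lambda>z. z powr complex_of_real \<delta> / (1 + z) ^ k) \<in> Hinf \<theta>"
    and fw: "(f, w) \<in> hol_calc X A \<theta> (\<lambda>z. z powr complex_of_real \<delta> / (1 + z) ^ k)"
    and yw: "(y, w) \<in> hol_calc X A \<theta> (\<lambda>z. 1 / (1 + z) ^ k)"
    by (auto simp: frac_pow_def ext_hol_calc_def)
  define F where "F z = z powr complex_of_real \<delta> / (1 + z) ^ k" for z
  define S where "S z = 1 / (1 + z) ^ k" for z :: complex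
  have FH: "F \<in> Hinf \<theta>" using F1 by (simp add: F_def[abs_def])
  have SH: "S \<in> Hinf \<theta>"
    using Hinf_power[OF Hinf_inverse_one_plus[OF \<theta>], of k] by (simp add: S_def[abs_def] power_one_over)
  have fw': "(f, w) \<in> hol_calc X A \<theta> F" and yw': "(y, w) \<in> hol_calc X A \<theta> S"
    using fw yw by (simp_all add: F_def[abs_def] S_def[abs_def])
  obtain f0 f1 w0 fw where f: "W F f0 w0" "f1 \<in> ker_op X A" "f \<in> elems X" "w \<in> elems X"
    "\<And>l. bfun X l \<Longrightarrow> l f = l f0 + l f1" "\<And>l. bfun X l \<Longrightarrow> l w = l w0 + F 0 * l f1"
    "(f0, fw) \<in> cauchy_calc X A \<theta> (\<lambda>z. regul z * F z)" "(w0, fw) \<in> cauchy_calc X A \<theta> regul"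
    by (rule hol_calcE[OF fw' FH]) (rule that)
  obtain y0 y1 w0' yw where y: "W S y0 w0'" "y1 \<in> ker_op X A" "y \<in> elems X"
    "\<And>l. bfun X l \<Longrightarrow> l y = l y0 + l y1" "\<And>l. bfun X l \<Longrightarrow> l w = l w0' + S 0 * l y1"
    "(y0, yw) \<in> cauchy_calc X A \<theta> (\<lambda>z. regul z * S z)" "(w0', yw) \<in> cauchy_calc X A \<theta> regul"
    by (rule hol_calcE[OF yw' SH]) (rule that)
  have F0: "F 0 = 0" and S0: "S 0 = 1" by (auto simp: F_def S_def)
  note [simp] = f(3,4) y(3) W_in[OF f(1)] W_in[OF y(1)] ker_in[OF f(2)] ker_in[OF y(2)]
  \<comment> \<open>At 0 the symbol \<open>F\<close> vanishes and \<open>S\<close> is 1, so the two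
    decompositions of \<open>w\<close> identify the kernel part of \<open>y\<close> with a
    difference of elements of the closure of the range.\<close>
  have "y1 \<in> Z"
  proof (rule Z_cong[OF Z_diff[of w0 w0']])
    fix l assume l: "bfun X l"
    show "l y1 = l (\<lambda>a. w0 a - w0' a)"
      using f(6)[OF l] y(5)[OF l] by (simp add: F0 S0 bfun_diff[OF l] eq_diff_eq add.commute)
  qed auto
  hence "nrm X y1 = 0" using y(2) by (rule ker_Z)
  hence w0: "l w0 = l w0'" if l: "bfun X l" for l
    using f(6)[OF l] y(5)[OF l] bfun_null[OF l, of y1] by (simp add: F0)
  \<comment> \<open>Any N beyond |\<delta>| makes the exponent c = N - \<delta> positive; then
    (1+z)^-c and z^c (1+z)^-c are bounded on the sector.\<close>
  obtain N :: nat where N: "real N > \<bar>\<delta>\<bar>" using reals_Archimedean2 by blast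
  obtain R1 R2 where R: "R1 \<in> Hinf \<theta>" "R2 \<in> Hinf \<theta>"
    "\<And>z. z \<in> sector \<theta> \<Longrightarrow> (1 / (1 + z)) ^ N * R1 z + (z / (1 + z)) ^ N * R2 z = 1"
    using Hinf_Bezout[OF \<theta>] by blast
  define c where "c = real N - \<delta>"
  have c: "c > 0" using N by (simp add: c_def)
  define a where "a z = (1 + z) powr complex_of_real (- c) * R1 z" for z
  define b where "b z = (z powr complex_of_real c * (1 + z) powr complex_of_real (- c)) * R2 z" for z
  define G where "G z = (1 + z) powr complex_of_real \<delta> / (1 + z) ^ k" for z
  have aH: "a \<in> Hinf \<theta>"
    unfolding a_def[abs_def] by (rule Hinf_mult[OF Hinf_one_plus_powr R(1)]) (use \<theta> c in auto)
  have bH: "b \<in> Hinf \<theta>"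
    unfolding b_def[abs_def] by (rule Hinf_mult[OF Hinf_powr_quotient R(2)]) (use \<theta> c in auto)
  have eq: "S z * a z + b z * F z = G z" if z: "z \<in> sector \<theta>" for z
  proof -
    have nz: "1 + z \<noteq> 0" "z \<noteq> 0" using sector_one_plus_nz[OF z \<theta>(2)] z by (auto simp: sector_def)
    have 1: "(1 + z) powr complex_of_real (- c) = (1 + z) powr complex_of_real \<delta> * (1 / (1 + z)) ^ N"
    proof -
      have "complex_of_real (- c) = complex_of_real \<delta> - of_nat N" by (simp add: c_def)
      thus ?thesis using nz by (simp add: powr_diff powr_nat' power_one_over)
    qed
    have 2: "z powr complex_of_real c * z powr complex_of_real \<delta> = z ^ N"
    proof -
      have "z powr complex_of_real c * z powr complex_of_real \<delta> = z powr (of_nat N)"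
        by (simp add: c_def flip: powr_add)
      thus ?thesis using nz by (simp add: powr_nat')
    qed
    have "S z * a z + b z * F z = (1 + z) powr complex_of_real (- c) * S z *
        (R1 z + (z powr complex_of_real c * z powr complex_of_real \<delta>) * R2 z)"
      by (simp add: a_def b_def F_def S_def divide_inverse algebra_simps)
    also have "\<dots> = (1 + z) powr complex_of_real \<delta> * S z * ((1 / (1 + z)) ^ N * R1 z + (z / (1 + z)) ^ N * R2 z)"
      unfolding 1 2 by (simp add: power_divide algebra_simps add_divide_distrib)
    also have "\<dots> = G z" unfolding R(3)[OF z] by (simp add: G_def S_def)
    finally show ?thesis .
  qed
  \<comment> \<open>If \<delta> > k, boundedness of \<open>G\<close> cannot be read off from its
    formula; it comes from the decomposition.\<close>
  have GH: "G \<in> Hinf \<theta>"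
  proof -
    have "(\<lambda>z. S z * a z + b z * F z) \<in> Hinf \<theta>" by (intro Hinf_add Hinf_mult aH bH FH SH)
    then obtain B where B: "\<And>z. z \<in> sector \<theta> \<Longrightarrow> cmod (S z * a z + b z * F z) \<le> B"
      by (rule Hinf_bound) blast
    show ?thesis
    proof (rule HinfI[of _ _ B])
      show "G holomorphic_on sector \<theta>"
        unfolding G_def using one_plus_notin_nonpos[OF _ \<theta>(2)] sector_one_plus_nz[OF _ \<theta>(2)]
        by (intro holomorphic_intros) auto
      have "(G \<longlongrightarrow> (1 + 0) powr complex_of_real \<delta> / (1 + 0) ^ k) (at 0 within sector \<theta>)"
        unfolding G_def by (intro tendsto_powr_complex tendsto_intros) auto
      thus "(G \<longlongrightarrow> G 0) (at 0 within sector \<theta>)" by (simp add: G_def)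
    qed (use B eq in auto)
  qed
  obtain p where p: "W a f0 p" using W_exists[OF aH, of f0] by auto
  obtain q where q: "W b y0 q" using W_exists[OF bH, of y0] by auto
  obtain p' where p': "W S p p'" using W_exists[OF SH W_in(4)[OF p]] by auto
  obtain q' where q': "W S q q'" using W_exists[OF SH W_in(4)[OF q]] by auto
  obtain t where t: "W b w0' t" using W_exists[OF bH, of w0'] by auto
  note [simp] = W_in[OF p] W_in[OF q] W_in[OF p'] W_in[OF q'] W_in[OF t]
  have 1: "W (\<lambda>z. S z * a z) f0 p'" by (rule W_mult[OF aH SH Hinf_mult[OF SH aH] p p'])
  have 2: "W (\<lambda>z. S z * b z) y0 q'" by (rule W_mult[OF bH SH Hinf_mult[OF SH bH] q q'])
  have 3: "W (\<lambda>z. b z * S z) y0 t" by (rule W_mult[OF SH bH Hinf_mult[OF bH SH] y(1) t])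
  have tq: "l t = l q'" if l: "bfun X l" for l
    using W_unique[OF 3 _ l, of q'] 2 by (simp add: mult.commute)
  have 4: "W F f0 w0'" by (rule W_cong[OF f(1)]) (auto simp: w0)
  have 5: "W (\<lambda>z. b z * F z) f0 t" by (rule W_mult[OF FH bH Hinf_mult[OF bH FH] 4 t])
  have 6: "W (\<lambda>z. b z * F z) f0 q'" by (rule W_cong[OF 5]) (auto simp: tq)
  have 7: "W G f0 (\<lambda>a. p' a + q' a)"
  proof (rule W_cong_fun)
    show "W (\<lambda>z. 1 * (S z * a z) + b z * F z) f0 (\<lambda>a. p' a + q' a)"
      using W_lin_fun[OF Hinf_mult[OF SH aH] Hinf_mult[OF bH FH] 1 6, of 1] by simp
  qed (simp add: eq)
  have 8: "W S (\<lambda>a. p a + q a) (\<lambda>a. p' a + q' a)"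
    using W_lin[OF SH p' q', of 1] by simp
  \<comment> \<open>The candidate for (1+A)^\<delta> f is \<open>y2\<close>: it is a(A)f0 + b(A)y0
    with the kernel part of f added back unchanged, because \<open>G\<close> and \<open>S\<close>
    both equal 1 at 0. Its image under (1+A)^-k is \<open>w2\<close>.\<close>
  define w2 where "w2 = (\<lambda>a. (p' a + q' a) + f1 a)"
  define y2 where "y2 = (\<lambda>a. (p a + q a) + f1 a)"
  have [simp]: "w2 \<in> elems X" "y2 \<in> elems X" unfolding w2_def y2_def by (auto intro!: add_in)
  have G0: "G 0 = 1" by (simp add: G_def)
  have "(f, w2) \<in> hol_calc X A \<theta> G"
  proof (rule hol_calc_of_W[OF GH 7 f(2)])
    fix l assume l: "bfun X l"
    show "l w2 = l (\<lambda>a. p' a + q' a) + G 0 * l f1"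
      unfolding w2_def by (subst bfun_add[OF l]) (auto simp: G0 add_in)
  qed (auto simp: f(5))
  moreover have "(y2, w2) \<in> hol_calc X A \<theta> S"
  proof (rule hol_calc_of_W[OF SH 8 f(2)])
    fix l assume l: "bfun X l"
    show "l w2 = l (\<lambda>a. p' a + q' a) + S 0 * l f1"
      unfolding w2_def by (subst bfun_add[OF l]) (auto simp: S0 add_in)
    show "l y2 = l (\<lambda>a. p a + q a) + l f1"
      unfolding y2_def by (subst bfun_add[OF l]) (auto simp: add_in)
  qed auto
  ultimately have "(f, y2) \<in> one_plus_frac_pow X A \<theta> \<delta>"
    unfolding one_plus_frac_pow_def ext_hol_calc_def using GH
    by (auto simp: G_def[abs_def] S_def[abs_def])
  thus ?thesis by (rule that)
qed

text \<open>Reduces a Hoermander multiplier to holomorphic approximants. Convergence in the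
  Hoermander norm is asked only after multiplication by \<rho>, as in the definition;
  correspondingly v n = \<rho>(A) u n tends to \<rho>(A) y0, because \<rho>(A) is bounded. The
  kernel part is carried along with the factor m(0).\<close>

lemma hoermander_calc_limit:
  assumes x1: "x1 \<in> ker_op X A" and xy: "x \<in> elems X" "y \<in> elems X" "y0 \<in> elems X"
    "\<And>l. bfun X l \<Longrightarrow> l x = l x0 + l x1" "\<And>l. bfun X l \<Longrightarrow> l y = l y0 + m 0 * l x1"
    and F: "\<And>n::nat. F n \<in> Hinf \<theta>" "\<And>n. W (F n) x0 (u n)" and lim: "(\<lambda>n. ndist X (u n) y0) \<longlonglongrightarrow> 0"
    and m: "m \<in> hoermander \<phi> \<alpha>"
    and mlim: "(\<lambda>n. hoermander_norm \<phi> \<alpha> (\<lambda>t. regul (complex_of_real t) * F n (complex_of_real t)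
                - regul (complex_of_real t) * m t)) \<longlonglongrightarrow> 0"
  shows "(x, y) \<in> hoermander_calc X A \<phi> \<alpha> \<theta> m"
proof -
  have RH: "regul \<in> Hinf \<theta>" by (rule Hinf_regul[OF \<theta>])
  note [simp] = W_in[OF F(2)] xy(1-3) ker_in[OF x1]
  have y0Z: "y0 \<in> Z"
  proof (rule Z_limit[OF xy(3)])
    fix e :: real assume "e > 0"
    from order_tendstoD(2)[OF lim this] obtain n where "ndist X (u n) y0 < e"
      by (auto simp: eventually_sequentially)
    thus "\<exists>x\<in>Z. ndist X y0 x < e" by (intro bexI[of _ "u n"]) (auto simp: ndist_commute)
  qed
  obtain w where w: "(y0, w) \<in> cauchy_calc X A \<theta> regul" "w \<in> Z" "\<And>l. bfun X l \<Longrightarrow> l w = J \<theta> regul l y0"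
    using cauchy_regul_exists[OF y0Z] by metis
  have wW: "W regul y0 w"
    unfolding W_def using w(2) y0Z J_mult[OF \<theta> regul_decays regul_decays xy(3) Z_in[OF w(2)] w(3)] by auto
  have "\<exists>v. W regul (u n) v" for n using W_exists[OF RH W_in(4)[OF F(2)]] by blast
  then obtain v where v: "\<And>n. W regul (u n) (v n)" by metis
  note [simp] = W_in[OF v] Z_in[OF w(2)]
  have 1: "(\<lambda>z. regul z * F n z) \<in> Hinf \<theta>" for n by (intro Hinf_mult RH F)
  have 2: "W (\<lambda>z. regul z * F n z) x0 (v n)" for n
    by (rule W_mult[OF F(1) RH 1 F(2) v])
  have ker0: "(\<lambda>_. 0) \<in> ker_op X A"
    using linear by (auto simp: ker_op_def linear_op_def nrm_zero)
  have 3: "(x0, v n) \<in> hol_calc X A \<theta> (\<lambda>z. regul z * F n z)" for n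
    by (rule hol_calc_of_W[OF 1 2 ker0]) (auto simp: bfun_zero)
  obtain C where C: "C \<ge> 0" "\<And>F x y. F \<in> Hinf \<theta> \<Longrightarrow> W F x y \<Longrightarrow>
     nrm X y \<le> C * \<bar>hnorm F\<bar> * nrm X x"
    using W_bound by blast
  have "(\<lambda>n. ndist X (v n) w) \<longlonglongrightarrow> 0"
  proof (rule tendsto_sandwich[OF _ _ tendsto_const])
    show "\<forall>\<^sub>F n in sequentially. 0 \<le> ndist X (v n) w" by (simp add: ndist_nonneg)
    have "ndist X (v n) w \<le> C * \<bar>hnorm regul\<bar> * ndist X (u n) y0" for n
      using C(2)[OF RH W_lin[OF RH wW v, of "- 1"]] by (simp add: ndist_def)
    thus "\<forall>\<^sub>F n in sequentially. ndist X (v n) w \<le> C * \<bar>hnorm regul\<bar> * ndist X (u n) y0" by simp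
    show "(\<lambda>n. C * \<bar>hnorm regul\<bar> * ndist X (u n) y0) \<longlonglongrightarrow> 0"
      using tendsto_mult_right_zero[OF lim] by simp
  qed
  hence 4: "(x0, w) \<in> limit_calc X A \<phi> \<alpha> \<theta> (\<lambda>t. regul (complex_of_real t) * m t)"
    unfolding limit_calc_def mem_Collect_eq prod.case
    by (intro conjI exI[of _ "\<lambda>n z. regul z * F n z"] exI[of _ v] allI 1 3 mlim Z_in[OF w(2)])
  have x0: "x0 \<in> Z" "x0 \<in> elems X" using W_in[OF F(2)[of 0]] by auto
  have 5: "ndist X x (\<lambda>a. x0 a + x1 a) = 0"
    using x0 by (subst ndist_eq_0_iff) (auto simp: add_in xy(4) bfun_add)
  have 6: "ndist X y (\<lambda>a. y0 a + m 0 * x1 a) = 0"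
  proof (subst ndist_eq_0_iff, simp, rule add_in, simp, rule scale_in, simp, intro allI impI)
    fix l assume l: "bfun X l"
    show "l y = l (\<lambda>a. y0 a + m 0 * x1 a)"
      using xy(5)[OF l] by (simp add: bfun_add[OF l] bfun_scale[OF l] scale_in)
  qed
  show ?thesis
    unfolding hoermander_calc_def regularised_def using m xy(1,2) x0(1) x1 y0Z 5 6 4 w(1) by blast
qed

end

section \<open>Sobolev estimates for holomorphic symbols\<close>

lemma nn_integral_Cauchy_kernel_le:
  assumes "Q > 0"
  shows "(\<integral>\<^sup>+\<xi>. ennreal (Q / (Q\<^sup>2 + \<xi>\<^sup>2)) \<partial>lborel) \<le> ennreal pi"
proof -
  define f where "f \<xi> = Q / (Q\<^sup>2 + \<xi>\<^sup>2)" for \<xi> :: real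
  have [measurable]: "f \<in> borel_measurable borel"
    unfolding f_def by measurable
  have pos: "Q\<^sup>2 + \<xi>\<^sup>2 > 0" for \<xi> :: real using assms by (simp add: add_pos_nonneg)
  have half: "(\<integral>\<^sup>+\<xi>. ennreal (f \<xi>) * indicator {0..} \<xi> \<partial>lborel) = ennreal (pi / 2 - arctan (0 / Q))"
  proof (rule nn_integral_FTC_atLeast)
    show "((\<lambda>\<xi>. arctan (\<xi> / Q)) has_real_derivative f \<xi>) (at \<xi>)" for \<xi>
    proof -
      have "((\<lambda>\<xi>. arctan (\<xi> / Q)) has_real_derivative (1 / Q) * inverse (1 + (\<xi> / Q)\<^sup>2)) (at \<xi>)"
        using assms by (auto intro!: derivative_eq_intros)
      moreover have "(1 / Q) * inverse (1 + (\<xi> / Q)\<^sup>2) = f \<xi>"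
        using assms pos[of \<xi>] by (simp add: f_def field_simps power2_eq_square)
      ultimately show ?thesis by simp
    qed
    show "0 \<le> f \<xi>" for \<xi> using assms by (simp add: f_def)
    show "((\<lambda>\<xi>. arctan (\<xi> / Q)) \<longlongrightarrow> pi / 2) at_top"
      using assms by real_asymp
  qed measurable
  have "(\<integral>\<^sup>+\<xi>. ennreal (f \<xi>) * indicator {..0} \<xi> \<partial>lborel)
      = ennreal \<bar>- 1\<bar> * (\<integral>\<^sup>+\<xi>. ennreal (f (0 + (- 1) * \<xi>)) * indicator {..0} (0 + (- 1) * \<xi>) \<partial>lborel)"
    by (rule nn_integral_real_affine) auto
  also have "\<dots> = (\<integral>\<^sup>+\<xi>. ennreal (f \<xi>) * indicator {0..} \<xi> \<partial>lborel)"
    by (auto intro!: nn_integral_cong simp: f_def indicator_def)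
  finally have half': "(\<integral>\<^sup>+\<xi>. ennreal (f \<xi>) * indicator {..0} \<xi> \<partial>lborel) = ennreal (pi / 2)"
    using half by simp
  have "(\<integral>\<^sup>+\<xi>. ennreal (f \<xi>) \<partial>lborel)
     \<le> (\<integral>\<^sup>+\<xi>. ennreal (f \<xi>) * indicator {0..} \<xi> + ennreal (f \<xi>) * indicator {..0} \<xi> \<partial>lborel)"
    by (intro nn_integral_mono) (auto simp: indicator_def)
  also have "\<dots> = ennreal (pi / 2) + ennreal (pi / 2)"
    using half half' by (subst nn_integral_add) auto
  also have "\<dots> = ennreal pi" by (simp flip: ennreal_plus)
  finally show ?thesis by (simp add: f_def)
qed

lemma integral_norm_le_interval:
  fixes f :: "real \<Rightarrow> complex"
  assumes "a \<le> b" "\<And>x. cmod (f x) \<le> K * indicator {a..b} x"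
  shows "cmod (\<integral>x. f x \<partial>lborel) \<le> K * (b - a)"
proof (cases "integrable lborel f")
  case True
  have "cmod (\<integral>x. f x \<partial>lborel) \<le> (\<integral>x. cmod (f x) \<partial>lborel)" by (rule integral_norm_bound)
  also have "\<dots> \<le> (\<integral>x. K * indicator {a..b} x \<partial>lborel)"
    using True assms by (intro integral_mono) auto
  also have "\<dots> = K * (b - a)" using assms by simp
  finally show ?thesis .
next
  \<comment> \<open>A function that is not integrable has Bochner integral 0, so the bound
    persists.\<close>
  case False
  have "0 \<le> K" using order.trans[OF norm_ge_zero assms(2)[of a]] assms(1) by simp
  thus ?thesis using False assms by (simp add: not_integrable_integral_eq)
qed

lemma fourier_le:
  assumes "a \<le> b" "\<And>x. cmod (g x) \<le> K * indicator {a..b} x"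
  shows "cmod (fourier g \<xi>) \<le> K * (b - a)"
  unfolding fourier_def by (rule integral_norm_le_interval) (use assms in \<open>auto simp: norm_mult\<close>)

lemma integrable_compact_support:
  fixes g :: "real \<Rightarrow> complex"
  assumes "continuous_on {c..d} g" "\<And>x. x \<notin> {c..d} \<Longrightarrow> g x = 0"
  shows "integrable lborel g"
proof -
  have "set_integrable lborel {c..d} g" by (rule borel_integrable_atLeastAtMost'[OF assms(1)])
  moreover have "(\<lambda>x. indicator {c..d} x *\<^sub>R g x) = g" using assms(2) by (auto simp: indicator_def)
  ultimately show ?thesis by (simp add: set_integrable_def)
qed

lemma fourier_derivative:
  assumes "c \<le> d" and g: "\<And>x. x \<in> {c..d} \<Longrightarrow> (g has_vector_derivative g' x) (at x)"
    and g': "continuous_on {c..d} g'"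
    and 0: "g c = 0" "g d = 0" "\<And>x. x \<notin> {c..d} \<Longrightarrow> g x = 0" "\<And>x. x \<notin> {c..d} \<Longrightarrow> g' x = 0"
  shows "fourier g' \<xi> = \<i> * \<xi> * fourier g \<xi>"
proof -
  define e where "e x = cis (- (x * \<xi>))" for x
  have de: "(e has_vector_derivative - \<i> * \<xi> * e x) (at x)" for x
  proof -
    have "((\<lambda>z. exp (- \<i> * (z * \<xi>))) has_field_derivative - \<i> * \<xi> * exp (- \<i> * (x * \<xi>))) (at (of_real x))"
      by (auto intro!: derivative_eq_intros)
    from has_vector_derivative_real_field[OF this] show ?thesis
      by (simp add: e_def[abs_def] cis_conv_exp)
  qed
  have ce: "continuous_on A e" for A
    using de by (intro continuous_at_imp_continuous_on) (auto intro: has_vector_derivative_continuous)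
  have cg: "continuous_on {c..d} g"
    using g by (intro continuous_at_imp_continuous_on ballI) (rule has_vector_derivative_continuous)
  define h where "h x = g' x * e x - \<i> * \<xi> * (g x * e x)" for x
  have "(\<integral>x. indicator {c..d} x *\<^sub>R h x \<partial>lborel) = g d * e d - g c * e c"
  proof (rule integral_FTC_Icc[OF \<open>c \<le> d\<close>])
    fix x assume "c \<le> x" "x \<le> d"
    hence "((\<lambda>x. g x * e x) has_vector_derivative (g x * (- \<i> * \<xi> * e x) + g' x * e x)) (at x within {c..d})"
      by (intro has_vector_derivative_mult has_vector_derivative_at_within[OF g] has_vector_derivative_at_within[OF de]) auto
    thus "((\<lambda>x. g x * e x) has_vector_derivative h x) (at x within {c..d})"
      by (simp add: h_def algebra_simps)
  qed (auto simp: h_def intro!: continuous_intros g' cg ce)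
  moreover have "(\<lambda>x. indicator {c..d} x *\<^sub>R h x) = h"
    using 0 by (auto simp: h_def indicator_def)
  ultimately have "(\<integral>x. h x \<partial>lborel) = 0" using 0 by simp
  moreover have "integrable lborel (\<lambda>x. g' x * e x)" "integrable lborel (\<lambda>x. g x * e x)"
    by (rule integrable_compact_support[of c d]; use 0 in \<open>auto intro!: continuous_intros g' cg ce\<close>)+
  ultimately show ?thesis
    by (simp add: h_def fourier_def e_def)
qed

text \<open>Integration by parts against a dilated symbol: each derivative of \<open>\<phi>(x)m(Rx)\<close> costs a factor
  \<open>1 + R\<close>.\<close>

lemma fourier_symbol_decay:
  fixes a b \<gamma> :: real and D :: "nat \<Rightarrow> real \<Rightarrow> complex" and c :: "nat \<Rightarrow> real"
  assumes ab: "0 < a" "a < b" and \<gamma>: "0 \<le> \<gamma>"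
  shows "\<lbrakk>\<And>k x. (D k has_vector_derivative D (Suc k) x) (at x); \<And>k x. x \<notin> {a..b} \<Longrightarrow> D k x = 0;
      \<And>j. 0 \<le> c j\<rbrakk> \<Longrightarrow>
    \<exists>C\<ge>0. \<forall>M B R \<xi>. (\<forall>j::nat. \<forall>x>0. (M j has_vector_derivative M (Suc j) x) (at x)) \<longrightarrow>
      (\<forall>j. \<forall>x>0. cmod (M j x) \<le> c j * B * (1 + x) powr (- \<gamma>)) \<longrightarrow> 0 \<le> B \<longrightarrow> 0 < R \<longrightarrow>
      \<bar>\<xi>\<bar> ^ K * cmod (fourier (\<lambda>x. D 0 x * M 0 (R * x)) \<xi>) \<le> C * B * (1 + R) powr (- \<gamma>) * (1 + R) ^ K"
proof (induction K arbitrary: D c)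
  case 0
  note D = "0.prems"(1,2) and c = "0.prems"(3)
  have "continuous_on {a..b} (D 0)"
    using D(1) by (intro continuous_at_imp_continuous_on) (auto intro: has_vector_derivative_continuous)
  hence "bounded (D 0 ` {a..b})" by (intro compact_imp_bounded compact_continuous_image) auto
  then obtain L where L: "\<And>x. x \<in> {a..b} \<Longrightarrow> cmod (D 0 x) \<le> L" unfolding bounded_iff by blast
  have L0: "L \<ge> 0" using order.trans[OF norm_ge_zero L[of a]] ab by simp
  \<comment> \<open>For x >= a one has 1 + Rx >= q (1 + R), which moves the weight from Rx to
    R.\<close>
  define q where "q = min 1 a"
  have q: "q > 0" "q \<le> 1" "q \<le> a" using ab by (auto simp: q_def)
  define C where "C = L * c 0 * q powr (- \<gamma>) * (b - a)"
  show ?case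
  proof (intro exI[of _ C] conjI allI impI)
    show "C \<ge> 0" using L0 c ab by (simp add: C_def)
    fix M B R \<xi> assume M: "\<forall>j::nat. \<forall>x>0. (M j has_vector_derivative M (Suc j) x) (at x)"
      and Mb: "\<forall>j. \<forall>x>0. cmod (M j x) \<le> c j * B * (1 + x) powr (- \<gamma>)" and B: "0 \<le> (B::real)" and R: "0 < (R::real)"
    have "cmod (fourier (\<lambda>x. D 0 x * M 0 (R * x)) \<xi>) \<le> (L * (c 0 * B * (q powr (- \<gamma>) * (1 + R) powr (- \<gamma>)))) * (b - a)"
    proof (rule fourier_le)
      fix x
      show "cmod (D 0 x * M 0 (R * x)) \<le> (L * (c 0 * B * (q powr (- \<gamma>) * (1 + R) powr (- \<gamma>)))) * indicator {a..b} x"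
      proof (cases "x \<in> {a..b}")
        case True
        hence x: "x > 0" "x \<ge> q" using ab q by auto
        have "cmod (M 0 (R * x)) \<le> c 0 * B * (1 + R * x) powr (- \<gamma>)" using Mb R x by simp
        also have "(1 + R * x) powr (- \<gamma>) \<le> (q * (1 + R)) powr (- \<gamma>)"
        proof (rule powr_mono2')
          have "R * q \<le> R * x" using x R by (intro mult_left_mono) auto
          thus "q * (1 + R) \<le> 1 + R * x" using q by (simp add: algebra_simps)
        qed (use \<gamma> q R in auto)
        also have "(q * (1 + R)) powr (- \<gamma>) = q powr (- \<gamma>) * (1 + R) powr (- \<gamma>)"
          by (simp add: powr_mult)
        finally have "cmod (M 0 (R * x)) \<le> c 0 * B * (q powr (- \<gamma>) * (1 + R) powr (- \<gamma>))"
          using c B by (simp add: mult_left_mono)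
        thus ?thesis using True L[OF True] L0 by (simp add: norm_mult mult_mono)
      qed (use D(2) in auto)
    qed (use ab in auto)
    thus "\<bar>\<xi>\<bar> ^ 0 * cmod (fourier (\<lambda>x. D 0 x * M 0 (R * x)) \<xi>) \<le> C * B * (1 + R) powr (- \<gamma>) * (1 + R) ^ 0"
      by (simp add: C_def mult_ac)
  qed
next
  case (Suc K)
  \<comment> \<open>Differentiating the product gives one term with the derivative on the cut-off
    and one, with a factor R, with the derivative on the symbol. Both have the original form for
    shifted sequences, which is why \<open>D\<close>, \<open>M\<close> and \<open>c\<close> comprise
    all orders.\<close>
  note D = Suc.prems(1,2) and c = Suc.prems(3)
  obtain C1 where C1: "C1 \<ge> 0" "\<And>M B R \<xi>. (\<forall>j::nat. \<forall>x>0. (M j has_vector_derivative M (Suc j) x) (at x)) \<Longrightarrow>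
      (\<forall>j. \<forall>x>0. cmod (M j x) \<le> c j * B * (1 + x) powr (- \<gamma>)) \<Longrightarrow> 0 \<le> B \<Longrightarrow> 0 < R \<Longrightarrow>
      \<bar>\<xi>\<bar> ^ K * cmod (fourier (\<lambda>x. D (Suc 0) x * M 0 (R * x)) \<xi>) \<le> C1 * B * (1 + R) powr (- \<gamma>) * (1 + R) ^ K"
    using Suc.IH[of "\<lambda>k. D (Suc k)" c] D c by blast
  obtain C2 where C2: "C2 \<ge> 0" "\<And>M B R \<xi>. (\<forall>j::nat. \<forall>x>0. (M j has_vector_derivative M (Suc j) x) (at x)) \<Longrightarrow>
      (\<forall>j. \<forall>x>0. cmod (M j x) \<le> c (Suc j) * B * (1 + x) powr (- \<gamma>)) \<Longrightarrow> 0 \<le> B \<Longrightarrow> 0 < R \<Longrightarrow>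
      \<bar>\<xi>\<bar> ^ K * cmod (fourier (\<lambda>x. D 0 x * M 0 (R * x)) \<xi>) \<le> C2 * B * (1 + R) powr (- \<gamma>) * (1 + R) ^ K"
    using Suc.IH[of D "\<lambda>j. c (Suc j)"] D c by blast
  show ?case
  proof (intro exI[of _ "C1 + C2"] conjI allI impI)
    show "0 \<le> C1 + C2" using C1(1) C2(1) by simp
    fix M B R \<xi> assume M: "\<forall>j::nat. \<forall>x>0. (M j has_vector_derivative M (Suc j) x) (at x)"
      and Mb: "\<forall>j. \<forall>x>0. cmod (M j x) \<le> c j * B * (1 + x) powr (- \<gamma>)" and B: "0 \<le> (B::real)" and R: "0 < (R::real)"
    define g where "g x = D 0 x * M 0 (R * x)" for x
    define g1 where "g1 x = D (Suc 0) x * M 0 (R * x)" for x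
    define g2 where "g2 x = D 0 x * M (Suc 0) (R * x)" for x
    have cD: "continuous_on A (D k)" for A k
      using D(1) by (intro continuous_at_imp_continuous_on) (auto intro: has_vector_derivative_continuous)
    \<comment> \<open>The interval is enlarged so that the cut-off vanishes at both ends; it still
      lies in the positive half-line, where the symbol is differentiable.\<close>
    have cM: "continuous_on {a/2..b+1} (\<lambda>x. M k (R * x))" for k
    proof -
      have "continuous_on {0<..} (M k)"
        using M by (intro continuous_at_imp_continuous_on) (auto intro: has_vector_derivative_continuous)
      show ?thesis
      proof (rule continuous_on_compose2[OF \<open>continuous_on {0<..} (M k)\<close>])
        show "(\<lambda>x. R * x) ` {a/2..b+1} \<subseteq> {0<..}"
          using ab R by (force intro: mult_pos_pos)
      qed (intro continuous_intros)
    qed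
    have int: "integrable lborel (\<lambda>x. g1 x * cis (- (x * \<xi>)))" "integrable lborel (\<lambda>x. g2 x * cis (- (x * \<xi>)))"
      by (rule integrable_compact_support[of "a/2" "b+1"];
          use D(2) ab in \<open>auto simp: g1_def g2_def intro!: continuous_intros cD cM\<close>)+
    have "fourier (\<lambda>x. g1 x + R * g2 x) \<xi> = \<i> * \<xi> * fourier g \<xi>"
    proof (rule fourier_derivative[of "a/2" "b+1"])
      fix x assume x: "x \<in> {a/2..b+1}"
      hence "R * x > 0" using ab R by auto
      hence "(M 0 has_vector_derivative M (Suc 0) (R * x)) (at (R * x))" using M by blast
      moreover have "((\<lambda>x. R * x) has_vector_derivative R) (at x)"
        using DERIV_cmult_Id[of R x] by (simp add: has_real_derivative_iff_has_vector_derivative)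
      ultimately have "((\<lambda>x. M 0 (R * x)) has_vector_derivative R *\<^sub>R M (Suc 0) (R * x)) (at x)"
        using vector_diff_chain_at[of "\<lambda>x. R * x" R x "M 0" "M (Suc 0) (R * x)"] by (simp add: o_def)
      from has_vector_derivative_mult[OF D(1)[of 0 x] this]
      show "(g has_vector_derivative g1 x + R * g2 x) (at x)"
        by (simp add: g_def[abs_def] g1_def g2_def scaleR_conv_of_real algebra_simps)
    qed (use D(2) ab in \<open>auto simp: g_def g1_def g2_def intro!: continuous_intros cD cM\<close>)
    moreover have "fourier (\<lambda>x. g1 x + R * g2 x) \<xi> = fourier g1 \<xi> + R * fourier g2 \<xi>"
      using int unfolding fourier_def by (simp add: distrib_right mult.assoc)
    ultimately have "cmod (\<i> * \<xi> * fourier g \<xi>) = cmod (fourier g1 \<xi> + R * fourier g2 \<xi>)" by simp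
    hence "\<bar>\<xi>\<bar> * cmod (fourier g \<xi>) \<le> cmod (fourier g1 \<xi>) + R * cmod (fourier g2 \<xi>)"
      using norm_triangle_ineq[of "fourier g1 \<xi>" "R * fourier g2 \<xi>"] R by (simp add: norm_mult)
    hence "\<bar>\<xi>\<bar> ^ K * (\<bar>\<xi>\<bar> * cmod (fourier g \<xi>)) \<le> \<bar>\<xi>\<bar> ^ K * (cmod (fourier g1 \<xi>) + R * cmod (fourier g2 \<xi>))"
      by (intro mult_left_mono) auto
    also have "\<dots> = \<bar>\<xi>\<bar> ^ K * cmod (fourier g1 \<xi>) + R * (\<bar>\<xi>\<bar> ^ K * cmod (fourier g2 \<xi>))"
      by (simp add: algebra_simps)
    also have "\<bar>\<xi>\<bar> ^ K * cmod (fourier g1 \<xi>) \<le> C1 * B * (1 + R) powr (- \<gamma>) * (1 + R) ^ K"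
      unfolding g1_def by (rule C1(2)[OF M Mb B R])
    also have "\<bar>\<xi>\<bar> ^ K * cmod (fourier g2 \<xi>) \<le> C2 * B * (1 + R) powr (- \<gamma>) * (1 + R) ^ K"
      unfolding g2_def by (rule C2(2)[of "\<lambda>j. M (Suc j)" B R \<xi>]) (use M Mb B R in auto)
    also have "R * (C2 * B * (1 + R) powr (- \<gamma>) * (1 + R) ^ K) \<le> (1 + R) * (C2 * B * (1 + R) powr (- \<gamma>) * (1 + R) ^ K)"
      using R C2(1) B by (intro mult_right_mono) auto
    also have "C1 * B * (1 + R) powr (- \<gamma>) * (1 + R) ^ K \<le> (1 + R) * (C1 * B * (1 + R) powr (- \<gamma>) * (1 + R) ^ K)"
      using R C1(1) B mult_right_mono[of 1 "1 + R" "C1 * B * (1 + R) powr (- \<gamma>) * (1 + R) ^ K"] by simp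
    finally have "\<bar>\<xi>\<bar> ^ K * (\<bar>\<xi>\<bar> * cmod (fourier g \<xi>)) \<le> (1 + R) * (C1 * B * (1 + R) powr (- \<gamma>) * (1 + R) ^ K)
        + (1 + R) * (C2 * B * (1 + R) powr (- \<gamma>) * (1 + R) ^ K)" using R by simp
    thus "\<bar>\<xi>\<bar> ^ Suc K * cmod (fourier (\<lambda>x. D 0 x * M 0 (R * x)) \<xi>)
        \<le> (C1 + C2) * B * (1 + R) powr (- \<gamma>) * (1 + R) ^ Suc K"
      by (simp add: g_def[abs_def] algebra_simps)
  qed
qed

lemma test_function_derivatives:
  assumes "test_function \<phi>"
  obtains D a b where "D 0 = \<phi>" "\<And>(k::nat) x. (D k has_vector_derivative D (Suc k) x) (at x)"
    "0 < a" "a < b" "\<And>k x. x \<notin> {a..b} \<Longrightarrow> D k x = 0"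
proof -
  from assms obtain D a b where D: "D 0 = \<phi>" "\<And>(k::nat) x. (D k has_vector_derivative D (Suc k) x) (at x)"
    and ab: "0 < a" "a < b" "\<And>x. x \<notin> {a..b} \<Longrightarrow> \<phi> x = 0"
    unfolding test_function_def by metis
  have "x \<notin> {a..b} \<Longrightarrow> D k x = 0" for k x
  proof (induction k arbitrary: x)
    case 0 thus ?case using D ab by simp
  next
    case (Suc k)
    have "open (- {a..b})" by (intro open_Compl) auto
    have "(D k has_vector_derivative 0) (at x)"
      by (rule has_vector_derivative_transform_within_open[of "\<lambda>_. 0" _ _ "- {a..b}"])
         (use Suc \<open>open (- {a..b})\<close> in auto)
    with D(2)[of k x] show ?case by (rule vector_derivative_unique_at)
  qed
  with D ab show ?thesis using that by blast
qed

text \<open>With Q = 1 + R, decay of the orders 0 and K gives |F|^2 <= q^2 (2Q^2/(Q^2+\<xi>^2))^K.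
  In the Sobolev integral this leaves the Cauchy kernel Q/(Q^2+\<xi>^2), of integral at most pi,
  times the power 2(\<alpha>+1) - 2\<gamma> - 1 of Q. The exponent is at most 0 exactly when
  \<gamma> >= \<alpha> + 1/2, and then the bound is uniform in the dilation.\<close>

lemma sobolev_symbol_bound:
  assumes \<phi>: "test_function \<phi>" and \<alpha>: "1 / 2 < \<alpha>" "\<alpha> + 1 / 2 \<le> \<gamma>" and c: "\<And>j. 0 \<le> c j"
  shows "\<exists>C\<ge>0. \<forall>M B R. (\<forall>j::nat. \<forall>x>0. (M j has_vector_derivative M (Suc j) x) (at x)) \<longrightarrow>
      (\<forall>j. \<forall>x>0. cmod (M j x) \<le> c j * B * (1 + x) powr (- \<gamma>)) \<longrightarrow> 0 \<le> B \<longrightarrow> 0 < R \<longrightarrow>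
      sobolev_sq \<alpha> (\<lambda>x. \<phi> x * M 0 (R * x)) \<le> ennreal (C * B\<^sup>2)"
proof -
  obtain D a b where D: "D 0 = \<phi>" "\<And>(k::nat) x. (D k has_vector_derivative D (Suc k) x) (at x)"
    and ab: "0 < a" "a < b" and D0: "\<And>k x. x \<notin> {a..b} \<Longrightarrow> D k x = 0"
    using test_function_derivatives[OF \<phi>] by blast
  have \<gamma>: "0 \<le> \<gamma>" using \<alpha> by simp
  \<comment> \<open>This makes the exponent \<alpha> + 1 - K nonpositive, so that Q^2 + \<xi>^2 may
    be replaced in that power by its lower bound Q^2.\<close>
  obtain K :: nat where K: "real K \<ge> \<alpha> + 1" using real_arch_simple by blast
  obtain C0 where C0: "C0 \<ge> 0" "\<And>M B R \<xi>. (\<forall>j::nat. \<forall>x>0. (M j has_vector_derivative M (Suc j) x) (at x)) \<Longrightarrow>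
      (\<forall>j. \<forall>x>0. cmod (M j x) \<le> c j * B * (1 + x) powr (- \<gamma>)) \<Longrightarrow> 0 \<le> B \<Longrightarrow> 0 < R \<Longrightarrow>
      \<bar>\<xi>\<bar> ^ 0 * cmod (fourier (\<lambda>x. D 0 x * M 0 (R * x)) \<xi>) \<le> C0 * B * (1 + R) powr (- \<gamma>) * (1 + R) ^ 0"
    using fourier_symbol_decay[where D = D and c = c and K = 0, OF ab \<gamma> D(2) D0 c] by blast
  obtain C1 where C1: "C1 \<ge> 0" "\<And>M B R \<xi>. (\<forall>j::nat. \<forall>x>0. (M j has_vector_derivative M (Suc j) x) (at x)) \<Longrightarrow>
      (\<forall>j. \<forall>x>0. cmod (M j x) \<le> c j * B * (1 + x) powr (- \<gamma>)) \<Longrightarrow> 0 \<le> B \<Longrightarrow> 0 < R \<Longrightarrow>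
      \<bar>\<xi>\<bar> ^ K * cmod (fourier (\<lambda>x. D 0 x * M 0 (R * x)) \<xi>) \<le> C1 * B * (1 + R) powr (- \<gamma>) * (1 + R) ^ K"
    using fourier_symbol_decay[where D = D and c = c and K = K, OF ab \<gamma> D(2) D0 c] by blast
  define E where "E = max C0 C1"
  have E: "E \<ge> 0" "C0 \<le> E" "C1 \<le> E" using C0(1) by (auto simp: E_def)
  show ?thesis
  proof (intro exI[of _ "E\<^sup>2 * 2 ^ K * pi"] conjI allI impI)
    show "0 \<le> E\<^sup>2 * 2 ^ K * pi" using pi_ge_zero by simp
    fix M B R assume M: "\<forall>j::nat. \<forall>x>0. (M j has_vector_derivative M (Suc j) x) (at x)"
      and Mb: "\<forall>j. \<forall>x>0. cmod (M j x) \<le> c j * B * (1 + x) powr (- \<gamma>)" and B: "0 \<le> (B::real)" and R: "0 < (R::real)"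
    define Q where "Q = 1 + R"
    have Q: "Q > 1" "Q > 0" using R by (auto simp: Q_def)
    define F where "F \<xi> = cmod (fourier (\<lambda>x. \<phi> x * M 0 (R * x)) \<xi>)" for \<xi>
    define q where "q = E * B * Q powr (- \<gamma>)"
    have q0: "q \<ge> 0" using E B by (simp add: q_def)
    have F0: "F \<xi> \<le> q" for \<xi>
    proof -
      have "F \<xi> \<le> C0 * B * Q powr (- \<gamma>)" using C0(2)[OF M Mb B R, of \<xi>] by (simp add: F_def D(1) Q_def)
      also have "\<dots> \<le> q" unfolding q_def using E B by (intro mult_right_mono) auto
      finally show ?thesis .
    qed
    have F1: "\<bar>\<xi>\<bar> ^ K * F \<xi> \<le> q * Q ^ K" for \<xi>
    proof -
      have "\<bar>\<xi>\<bar> ^ K * F \<xi> \<le> C1 * B * Q powr (- \<gamma>) * Q ^ K" using C1(2)[OF M Mb B R, of \<xi>] by (simp add: F_def D(1) Q_def)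
      also have "\<dots> \<le> q * Q ^ K" unfolding q_def using E B Q by (intro mult_right_mono) auto
      finally show ?thesis .
    qed
    \<comment> \<open>Order 0 is used for |\<xi>| <= Q and order K beyond; the larger of Q^2 and
      \<xi>^2 is at least half of their sum, whence the factor 2.\<close>
    have Fsq: "(F \<xi>)\<^sup>2 \<le> q\<^sup>2 * (2 * Q\<^sup>2 / (Q\<^sup>2 + \<xi>\<^sup>2)) ^ K" for \<xi>
    proof -
      have pos: "Q\<^sup>2 + \<xi>\<^sup>2 > 0" using Q by (simp add: add_pos_nonneg)
      have Fnn: "F \<xi> \<ge> 0" by (simp add: F_def)
      show ?thesis
      proof (cases "\<bar>\<xi>\<bar> \<le> Q")
        case True
        hence "\<xi>\<^sup>2 \<le> Q\<^sup>2" by (simp add: abs_le_square_iff[symmetric] Q(2) less_imp_le abs_of_pos)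
        hence "1 \<le> 2 * Q\<^sup>2 / (Q\<^sup>2 + \<xi>\<^sup>2)" using pos by (simp add: le_divide_eq)
        hence "1 \<le> (2 * Q\<^sup>2 / (Q\<^sup>2 + \<xi>\<^sup>2)) ^ K" by (rule one_le_power)
        moreover have "(F \<xi>)\<^sup>2 \<le> q\<^sup>2" using F0 Fnn by (intro power_mono)
        ultimately show ?thesis using mult_mono[of "(F \<xi>)\<^sup>2" "q\<^sup>2" 1] by simp
      next
        case False
        hence x: "\<bar>\<xi>\<bar> > Q" by simp
        hence sq: "Q\<^sup>2 \<le> \<xi>\<^sup>2" using Q by (metis abs_le_square_iff abs_of_pos less_imp_le)
        have x2: "\<xi>\<^sup>2 > 0" using x Q by auto
        have "F \<xi> \<le> q * Q ^ K / \<bar>\<xi>\<bar> ^ K" using F1[of \<xi>] x Q by (simp add: pos_le_divide_eq mult.commute)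
        hence "(F \<xi>)\<^sup>2 \<le> (q * Q ^ K / \<bar>\<xi>\<bar> ^ K)\<^sup>2" using Fnn by (intro power_mono)
        also have "\<dots> = q\<^sup>2 * (Q\<^sup>2 / \<xi>\<^sup>2) ^ K"
        proof -
          have "(Q ^ K)\<^sup>2 = (Q\<^sup>2) ^ K" "(\<bar>\<xi>\<bar> ^ K)\<^sup>2 = (\<xi>\<^sup>2) ^ K"
            by (metis power_mult mult.commute) (metis power_mult mult.commute power2_abs)
          thus ?thesis by (simp only: power_divide power_mult_distrib) simp
        qed
        also have "\<dots> \<le> q\<^sup>2 * (2 * Q\<^sup>2 / (Q\<^sup>2 + \<xi>\<^sup>2)) ^ K"
        proof (intro mult_left_mono power_mono)
          have "Q\<^sup>2 * (Q\<^sup>2 + \<xi>\<^sup>2) \<le> Q\<^sup>2 * (2 * \<xi>\<^sup>2)" using sq by (intro mult_left_mono) auto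
          thus "Q\<^sup>2 / \<xi>\<^sup>2 \<le> 2 * Q\<^sup>2 / (Q\<^sup>2 + \<xi>\<^sup>2)" using pos x2 by (simp add: divide_simps mult_ac)
        qed auto
        finally show ?thesis .
      qed
    qed
    have integrand: "(1 + \<xi>\<^sup>2) powr \<alpha> * (F \<xi>)\<^sup>2 \<le> E\<^sup>2 * 2 ^ K * B\<^sup>2 * (Q / (Q\<^sup>2 + \<xi>\<^sup>2))" for \<xi>
    proof -
      define P where "P = Q\<^sup>2 + \<xi>\<^sup>2"
      have P: "P > 0" "P \<ge> Q\<^sup>2" "1 + \<xi>\<^sup>2 \<le> P" using Q by (auto simp: P_def add_pos_nonneg one_le_power)
      have "(1 + \<xi>\<^sup>2) powr \<alpha> * (F \<xi>)\<^sup>2 \<le> P powr \<alpha> * (q\<^sup>2 * (2 * Q\<^sup>2 / P) ^ K)"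
        using \<alpha> P Fsq[of \<xi>] unfolding P_def[symmetric] by (intro mult_mono powr_mono2) auto
      also have "\<dots> = q\<^sup>2 * 2 ^ K * (Q\<^sup>2) ^ K * (P powr \<alpha> / P ^ K)"
        by (simp add: power_mult_distrib power_divide)
      also have "P powr \<alpha> / P ^ K = P powr (\<alpha> - real K)"
        using P by (simp add: powr_diff powr_realpow)
      also have "\<dots> = P powr (- 1) * P powr (\<alpha> + 1 - real K)" by (subst powr_add[symmetric]) simp
      also have "\<dots> \<le> P powr (- 1) * (Q\<^sup>2) powr (\<alpha> + 1 - real K)"
        using P K Q by (intro mult_left_mono powr_mono2') auto
      also have "q\<^sup>2 * 2 ^ K * (Q\<^sup>2) ^ K * (P powr (- 1) * (Q\<^sup>2) powr (\<alpha> + 1 - real K))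
          = E\<^sup>2 * 2 ^ K * B\<^sup>2 * ((Q powr (- \<gamma>))\<^sup>2 * (Q\<^sup>2) powr (\<alpha> + 1)) / P"
      proof -
        have "(Q\<^sup>2) powr (\<alpha> + 1 - real K) = (Q\<^sup>2) powr (\<alpha> + 1) / (Q\<^sup>2) ^ K"
          using Q by (simp add: powr_diff powr_realpow)
        thus ?thesis using Q P by (simp add: q_def power_mult_distrib powr_minus divide_inverse)
      qed
      also have "(Q powr (- \<gamma>))\<^sup>2 * (Q\<^sup>2) powr (\<alpha> + 1) \<le> Q"
      proof -
        have "(Q powr (- \<gamma>))\<^sup>2 * (Q\<^sup>2) powr (\<alpha> + 1) = Q powr (2 * (\<alpha> + 1) - 2 * \<gamma>)"
          using Q by (simp add: power2_eq_square powr_mult flip: powr_add)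
        also have "\<dots> \<le> Q powr 1" using Q \<alpha> by (intro powr_mono) auto
        finally show ?thesis using Q by simp
      qed
      finally have "(1 + \<xi>\<^sup>2) powr \<alpha> * (F \<xi>)\<^sup>2 \<le> E\<^sup>2 * 2 ^ K * B\<^sup>2 * Q / P"
        using P by (simp add: mult_left_mono divide_right_mono)
      thus ?thesis by (simp add: P_def)
    qed
    have "sobolev_sq \<alpha> (\<lambda>x. \<phi> x * M 0 (R * x)) \<le> (\<integral>\<^sup>+\<xi>. ennreal (E\<^sup>2 * 2 ^ K * B\<^sup>2) * ennreal (Q / (Q\<^sup>2 + \<xi>\<^sup>2)) \<partial>lborel)"
      unfolding sobolev_sq_def F_def[symmetric]
      by (intro nn_integral_mono) (use integrand Q in \<open>auto simp flip: ennreal_mult intro!: ennreal_leI\<close>)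
    also have "\<dots> = ennreal (E\<^sup>2 * 2 ^ K * B\<^sup>2) * (\<integral>\<^sup>+\<xi>. ennreal (Q / (Q\<^sup>2 + \<xi>\<^sup>2)) \<partial>lborel)"
      by (rule nn_integral_cmult) measurable
    also have "\<dots> \<le> ennreal (E\<^sup>2 * 2 ^ K * B\<^sup>2) * ennreal pi"
      by (intro mult_left_mono nn_integral_Cauchy_kernel_le Q) auto
    also have "\<dots> = ennreal (E\<^sup>2 * 2 ^ K * pi * B\<^sup>2)"
      by (simp add: mult_ac flip: ennreal_mult')
    finally show "sobolev_sq \<alpha> (\<lambda>x. \<phi> x * M 0 (R * x)) \<le> ennreal (E\<^sup>2 * 2 ^ K * pi * B\<^sup>2)" .
  qed
qed

text \<open>Discs of radius 1/3 about points of the positive half-line fit inside, 1 + z keeps real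
  part above 1/2, and |Im z| is bounded, so that e^(itz) stays bounded for bounded t.\<close>

definition half_strip :: "complex set" where
  "half_strip = {z. - (1 / 2) < Re z \<and> \<bar>Im z\<bar> < 1 / 2}"

lemma open_half_strip: "open half_strip"
  unfolding half_strip_def
  by (intro open_Collect_conj open_Collect_less continuous_intros)

text \<open>The weight \<open>(1 + |z|)\<^sup>-\<^sup>\<gamma>\<close> on a neighbourhood of the half-line controls, by Cauchy's estimates,
  all derivatives at once.\<close>

lemma sobolev_strip_bound:
  assumes \<phi>: "test_function \<phi>" and \<alpha>: "1 / 2 < \<alpha>" "\<alpha> + 1 / 2 \<le> \<gamma>"
  obtains C where "C \<ge> 0" "\<And>m B R. m holomorphic_on half_strip \<Longrightarrow>
      (\<And>z. z \<in> half_strip \<Longrightarrow> cmod (m z) \<le> B * (1 + cmod z) powr (- \<gamma>)) \<Longrightarrow> 0 \<le> B \<Longrightarrow> 0 < R \<Longrightarrow>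
      sobolev_sq \<alpha> (\<lambda>x. \<phi> x * m (complex_of_real (R * x))) \<le> ennreal (C * B\<^sup>2)"
proof -
  have \<gamma>: "0 \<le> \<gamma>" using \<alpha> by simp
  \<comment> \<open>Cauchy's inequality on discs of radius 1/3 gives j! and 3^j; the factor
    2^\<gamma> pays for replacing 1 + |z| on the disc by (1 + x)/2.\<close>
  define c where "c j = fact j * 2 powr \<gamma> * 3 ^ j" for j :: nat
  have c: "0 \<le> c j" for j by (simp add: c_def)
  obtain C where C: "C \<ge> 0" "\<And>M B R. (\<forall>j::nat. \<forall>x>0. (M j has_vector_derivative M (Suc j) x) (at x)) \<Longrightarrow>
      (\<forall>j. \<forall>x>0. cmod (M j x) \<le> c j * B * (1 + x) powr (- \<gamma>)) \<Longrightarrow> 0 \<le> B \<Longrightarrow> 0 < R \<Longrightarrow>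
      sobolev_sq \<alpha> (\<lambda>x. \<phi> x * M 0 (R * x)) \<le> ennreal (C * B\<^sup>2)"
    using sobolev_symbol_bound[of \<phi> \<alpha> \<gamma> c, OF \<phi> \<alpha> c] by blast
  show ?thesis
  proof (rule that[OF C(1)])
    fix m B R assume m: "m holomorphic_on half_strip"
      and mb: "\<And>z. z \<in> half_strip \<Longrightarrow> cmod (m z) \<le> B * (1 + cmod z) powr (- \<gamma>)" and B: "0 \<le> (B::real)" and R: "0 < (R::real)"
    define M where "M j x = (deriv ^^ j) m (complex_of_real x)" for j x
    have "sobolev_sq \<alpha> (\<lambda>x. \<phi> x * M 0 (R * x)) \<le> ennreal (C * B\<^sup>2)"
    proof (rule C(2)[OF _ _ B R]; intro allI impI)
      fix j :: nat and x :: real assume x: "0 < x"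
      have xin: "complex_of_real x \<in> half_strip" using x by (simp add: half_strip_def)
      have "((deriv ^^ j) m has_field_derivative (deriv ^^ Suc j) m (of_real x)) (at (of_real x))"
        using holomorphic_derivI[OF holomorphic_higher_deriv[OF m open_half_strip] open_half_strip xin] by simp
      thus "(M j has_vector_derivative M (Suc j) x) (at x)"
        unfolding M_def by (rule has_vector_derivative_real_field)
      have sub: "cball (complex_of_real x) (1 / 3) \<subseteq> half_strip"
      proof
        fix z assume "z \<in> cball (complex_of_real x) (1 / 3)"
        hence "cmod (complex_of_real x - z) \<le> 1 / 3" by (simp add: dist_norm)
        thus "z \<in> half_strip"
          using x abs_Re_le_cmod[of "complex_of_real x - z"] abs_Im_le_cmod[of "complex_of_real x - z"]
          by (auto simp: half_strip_def)
      qed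
      have "cmod ((deriv ^^ j) m (of_real x)) \<le> fact j * (B * (2 powr \<gamma> * (1 + x) powr (- \<gamma>))) / (1 / 3) ^ j"
      proof (rule Cauchy_inequality)
        show "m holomorphic_on ball (complex_of_real x) (1 / 3)"
          by (rule holomorphic_on_subset[OF m]) (use sub in auto)
        show "continuous_on (cball (complex_of_real x) (1 / 3)) m"
          by (rule continuous_on_subset[OF holomorphic_on_imp_continuous_on[OF m] sub])
        fix z assume z: "cmod (complex_of_real x - z) = 1 / 3"
        hence "z \<in> half_strip" using sub by (auto simp: dist_norm)
        hence "cmod (m z) \<le> B * (1 + cmod z) powr (- \<gamma>)" by (rule mb)
        also have "\<dots> \<le> B * ((1 + x) / 2) powr (- \<gamma>)"
        proof (intro mult_left_mono powr_mono2' B)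
          have "x - 1 / 3 \<le> cmod z" using norm_triangle_ineq2[of "complex_of_real x" z] z x by simp
          thus "(1 + x) / 2 \<le> 1 + cmod z" using x by simp
        qed (use x \<gamma> in auto)
        also have "((1 + x) / 2) powr (- \<gamma>) = 2 powr \<gamma> * (1 + x) powr (- \<gamma>)"
          using x by (simp add: powr_divide powr_minus divide_simps)
        finally show "cmod (m z) \<le> B * (2 powr \<gamma> * (1 + x) powr (- \<gamma>))" .
      qed auto
      thus "cmod (M j x) \<le> c j * B * (1 + x) powr (- \<gamma>)"
        by (simp add: M_def c_def power_one_over mult_ac)
    qed
    thus "sobolev_sq \<alpha> (\<lambda>x. \<phi> x * m (complex_of_real (R * x))) \<le> ennreal (C * B\<^sup>2)"
      by (simp add: M_def)
  qed
qed

text \<open>The function \<open>f\<close> is tied to \<open>m\<close> on the closed half-line only: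
  the cut-off is supported in the open half-line, so other values do not enter the norm.\<close>

lemma hoermander_strip_bound:
  assumes \<phi>: "test_function \<phi>" and \<alpha>: "1 / 2 < \<alpha>" "\<alpha> + 1 / 2 \<le> \<gamma>"
  obtains C where "C \<ge> 0" "\<And>m f B. m holomorphic_on half_strip \<Longrightarrow>
      (\<And>z. z \<in> half_strip \<Longrightarrow> cmod (m z) \<le> B * (1 + cmod z) powr (- \<gamma>)) \<Longrightarrow> 0 \<le> B \<Longrightarrow>
      (\<And>x. x \<ge> 0 \<Longrightarrow> f x = m (complex_of_real x)) \<Longrightarrow>
      f \<in> hoermander \<phi> \<alpha> \<and> 0 \<le> hoermander_norm \<phi> \<alpha> f \<and> hoermander_norm \<phi> \<alpha> f \<le> C * B"
proof -
  obtain C where C: "C \<ge> 0" "\<And>m B R. m holomorphic_on half_strip \<Longrightarrow>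
      (\<And>z. z \<in> half_strip \<Longrightarrow> cmod (m z) \<le> B * (1 + cmod z) powr (- \<gamma>)) \<Longrightarrow> 0 \<le> B \<Longrightarrow> 0 < R \<Longrightarrow>
      sobolev_sq \<alpha> (\<lambda>x. \<phi> x * m (complex_of_real (R * x))) \<le> ennreal (C * B\<^sup>2)"
    using sobolev_strip_bound[OF assms] by blast
  obtain a b where ab: "0 < a" "\<And>x. x \<notin> {a..b} \<Longrightarrow> \<phi> x = 0"
    using \<phi> by (auto simp: test_function_def)
  show ?thesis
  \<comment> \<open>The 1 accounts for |f(0)|, the root for the squared Sobolev norms.\<close>
  proof (rule that[of "1 + sqrt C"])
    fix m :: "complex \<Rightarrow> complex" and f :: "real \<Rightarrow> complex" and B :: real
    assume m: "m holomorphic_on half_strip" "\<And>z. z \<in> half_strip \<Longrightarrow> cmod (m z) \<le> B * (1 + cmod z) powr (- \<gamma>)" "0 \<le> B"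
      and f: "\<And>x. x \<ge> 0 \<Longrightarrow> f x = m (complex_of_real x)"
    have fm: "(\<lambda>x. \<phi> x * f (R * x)) = (\<lambda>x. \<phi> x * m (complex_of_real (R * x)))" if "R > 0" for R
    proof
      fix x show "\<phi> x * f (R * x) = \<phi> x * m (complex_of_real (R * x))"
        using ab f[of "R * x"] that by (cases "x \<in> {a..b}") auto
    qed
    have sob: "sobolev_sq \<alpha> (\<lambda>x. \<phi> x * f (R * x)) \<le> ennreal (C * B\<^sup>2)" if "R > 0" for R
      unfolding fm[OF that] by (rule C(2)[OF m that])
    have bnd: "cmod (f x) \<le> B" if "x \<ge> 0" for x
    proof -
      have "cmod (f x) \<le> B * (1 + x) powr (- \<gamma>)"
        using m(2)[of "complex_of_real x"] that f[OF that] by (simp add: half_strip_def)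
      also have "\<dots> \<le> B * 1"
        using that \<alpha> m(3) powr_mono2'[of "- \<gamma>" 1 "1 + x"] by (intro mult_left_mono) auto
      finally show ?thesis by simp
    qed
    have "continuous_on {0<..} (\<lambda>x. m (complex_of_real x))"
      by (rule continuous_on_compose2[OF holomorphic_on_imp_continuous_on[OF m(1)]])
         (auto simp: half_strip_def intro!: continuous_intros)
    hence cont: "continuous_on {0<..} f"
      by (rule continuous_on_eq) (simp add: f)
    have "f \<in> hoermander \<phi> \<alpha>"
    proof -
      have "bounded (f ` {0..})" unfolding bounded_iff using bnd by auto
      thus ?thesis unfolding hoermander_def using cont sob by blast
    qed
    moreover have s: "sqrt (enn2real (sobolev_sq \<alpha> (\<lambda>x. \<phi> x * f (R * x)))) \<le> sqrt C * B" if "R > 0" for R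
    proof -
      have "enn2real (sobolev_sq \<alpha> (\<lambda>x. \<phi> x * f (R * x))) \<le> C * B\<^sup>2"
        using sob[OF that] C(1) by (intro enn2real_leI) auto
      hence "sqrt (enn2real (sobolev_sq \<alpha> (\<lambda>x. \<phi> x * f (R * x)))) \<le> sqrt (C * B\<^sup>2)" by simp
      thus ?thesis using m(3) by (simp add: real_sqrt_mult)
    qed
    moreover have "0 \<le> (SUP R\<in>{0<..}. sqrt (enn2real (sobolev_sq \<alpha> (\<lambda>x. \<phi> x * f (R * x)))))"
    proof (rule cSUP_upper2[of _ _ 1])
      show "bdd_above ((\<lambda>R. sqrt (enn2real (sobolev_sq \<alpha> (\<lambda>x. \<phi> x * f (R * x))))) ` {0<..})"
        using s by (auto intro!: bdd_aboveI[of _ "sqrt C * B"])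
    qed auto
    moreover have "(SUP R\<in>{0<..}. sqrt (enn2real (sobolev_sq \<alpha> (\<lambda>x. \<phi> x * f (R * x))))) \<le> sqrt C * B"
      using s by (intro cSUP_least) auto
    ultimately show "f \<in> hoermander \<phi> \<alpha> \<and> 0 \<le> hoermander_norm \<phi> \<alpha> f \<and> hoermander_norm \<phi> \<alpha> f \<le> (1 + sqrt C) * B"
      using bnd[of 0] unfolding hoermander_norm_def by (auto simp: algebra_simps)
  qed (use C(1) in auto)
qed

section \<open>Koethe spaces\<close>

text \<open>Convexity of t^p with weights a/(a+b) and b/(a+b): when a and b are the norms of two
  functions, integrating this is Minkowski's inequality.\<close>

lemma powr_convex_ineq:
  fixes u v a b p :: real
  assumes "0 \<le> u" "0 \<le> v" "0 < a" "0 < b" "1 \<le> p"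
  shows "(u + v) powr p \<le> (a + b) powr p * (a / (a + b) * (u / a) powr p + b / (a + b) * (v / b) powr p)"
proof -
  define s where "s = b / (a + b)"
  have s: "0 < s" "s < 1" using assms by (auto simp: s_def)
  have small: "t powr p \<le> t" if "0 < t" "t < 1" for t :: real
    using that assms powr_mono'[of 1 p t] by simp
  have conv: "((1 - s) * x + s * y) powr p \<le> (1 - s) * x powr p + s * y powr p" if "0 \<le> x" "0 \<le> y" for x y
  proof -
    consider "x = 0" | "y = 0" | "0 < x" "0 < y" using \<open>0 \<le> x\<close> \<open>0 \<le> y\<close> by linarith
    thus ?thesis
    proof cases
      case 1
      thus ?thesis using small[of s] s by (simp add: powr_mult mult_right_mono)
    next
      case 2
      thus ?thesis using small[of "1 - s"] s by (simp add: powr_mult mult_right_mono)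
    next
      case 3
      thus ?thesis
        using convex_onD[OF powr_convex[OF \<open>1 \<le> p\<close>], of s x y] s by simp
    qed
  qed
  have "((1 - b / (a + b)) * (u / a) + (b / (a + b)) * (v / b)) powr p
     \<le> (1 - b / (a + b)) * (u / a) powr p + b / (a + b) * (v / b) powr p"
    using conv[of "u / a" "v / b"] assms unfolding s_def by (meson divide_nonneg_pos)
  moreover have "1 - b / (a + b) = a / (a + b)" using assms by (simp add: field_simps)
  ultimately have *: "(a / (a + b) * (u / a) + b / (a + b) * (v / b)) powr p
     \<le> a / (a + b) * (u / a) powr p + b / (a + b) * (v / b) powr p" by simp
  have "u + v = (a + b) * (a / (a + b) * (u / a) + b / (a + b) * (v / b))"
    using assms by (simp add: distrib_left)
  hence "(u + v) powr p = (a + b) powr p * (a / (a + b) * (u / a) + b / (a + b) * (v / b)) powr p"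
    by (metis powr_mult)
  also have "\<dots> \<le> (a + b) powr p * (a / (a + b) * (u / a) powr p + b / (a + b) * (v / b) powr p)"
    using * by (intro mult_left_mono) auto
  finally show ?thesis .
qed

text \<open>The norms enter as upper bounds \<open>a\<close> and \<open>b\<close>, so infinite
  integrals do not arise. Slightly larger, hence positive, numbers serve as weights in the convexity
  inequality and are then lowered to \<open>a\<close> and \<open>b\<close>.\<close>

lemma nn_Minkowski:
  fixes u v :: "'x \<Rightarrow> real"
  assumes p: "1 \<le> p" and [measurable]: "u \<in> borel_measurable M" "v \<in> borel_measurable M"
    and nn: "\<And>x. 0 \<le> u x" "\<And>x. 0 \<le> v x" and ab: "0 \<le> a" "0 \<le> b"
    and u: "(\<integral>\<^sup>+x. ennreal (u x powr p) \<partial>M) \<le> ennreal (a powr p)"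
    and v: "(\<integral>\<^sup>+x. ennreal (v x powr p) \<partial>M) \<le> ennreal (b powr p)"
  shows "(\<integral>\<^sup>+x. ennreal ((u x + v x) powr p) \<partial>M) \<le> ennreal ((a + b) powr p)"
proof -
  have *: "(\<integral>\<^sup>+x. ennreal ((u x + v x) powr p) \<partial>M) \<le> ennreal ((a' + b') powr p)"
    if a': "a < a'" and b': "b < b'" for a' b'
  proof -
    have pos: "0 < a'" "0 < b'" using that ab by auto
    define ca cb where "ca = (a' + b') powr p * (a' / (a' + b')) / a' powr p"
      and "cb = (a' + b') powr p * (b' / (a' + b')) / b' powr p"
    have c0: "0 \<le> ca" "0 \<le> cb" using pos by (auto simp: ca_def cb_def)
    have "(\<integral>\<^sup>+x. ennreal ((u x + v x) powr p) \<partial>M) \<le> (\<integral>\<^sup>+x. ennreal ca * ennreal (u x powr p) + ennreal cb * ennreal (v x powr p) \<partial>M)"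
    proof (rule nn_integral_mono)
      fix x
      have "(u x + v x) powr p \<le> (a' + b') powr p * (a' / (a' + b') * (u x / a') powr p + b' / (a' + b') * (v x / b') powr p)"
        by (intro powr_convex_ineq nn pos p)
      also have "\<dots> = ca * u x powr p + cb * v x powr p"
        using nn pos by (simp add: ca_def cb_def powr_divide distrib_left mult_ac)
      finally show "ennreal ((u x + v x) powr p) \<le> ennreal ca * ennreal (u x powr p) + ennreal cb * ennreal (v x powr p)"
        using c0 by (simp flip: ennreal_mult ennreal_plus add: ennreal_leI)
    qed
    also have "\<dots> = ennreal ca * (\<integral>\<^sup>+x. ennreal (u x powr p) \<partial>M) + ennreal cb * (\<integral>\<^sup>+x. ennreal (v x powr p) \<partial>M)"
      by (simp add: nn_integral_add nn_integral_cmult)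
    also have "\<dots> \<le> ennreal ca * ennreal (a' powr p) + ennreal cb * ennreal (b' powr p)"
    proof (intro add_mono mult_left_mono)
      show "(\<integral>\<^sup>+x. ennreal (u x powr p) \<partial>M) \<le> ennreal (a' powr p)"
        using u a' ab p by (elim order.trans) (intro ennreal_leI powr_mono2, auto)
      show "(\<integral>\<^sup>+x. ennreal (v x powr p) \<partial>M) \<le> ennreal (b' powr p)"
        using v b' ab p by (elim order.trans) (intro ennreal_leI powr_mono2, auto)
    qed auto
    also have "\<dots> = ennreal (ca * a' powr p + cb * b' powr p)"
      using c0 by (simp flip: ennreal_mult ennreal_plus)
    also have "ca * a' powr p + cb * b' powr p = (a' + b') powr p * (a' / (a' + b') + b' / (a' + b'))"
      using pos by (simp add: ca_def cb_def distrib_left)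
    also have "a' / (a' + b') + b' / (a' + b') = 1" using pos by (simp flip: add_divide_distrib)
    finally show ?thesis by simp
  qed
  have lim: "(\<lambda>n. ennreal ((a + 1 / real (Suc n) + (b + 1 / real (Suc n))) powr p)) \<longlonglongrightarrow> ennreal ((a + 0 + (b + 0)) powr p)"
    using p ab by (intro tendsto_ennrealI tendsto_powr' tendsto_intros LIMSEQ_Suc[OF lim_1_over_n]) auto
  have le: "(\<integral>\<^sup>+x. ennreal ((u x + v x) powr p) \<partial>M) \<le> ennreal ((a + 1 / real (Suc n) + (b + 1 / real (Suc n))) powr p)" for n
    by (rule *) auto
  have "(\<integral>\<^sup>+x. ennreal ((u x + v x) powr p) \<partial>M) \<le> ennreal ((a + 0 + (b + 0)) powr p)"
    by (rule LIMSEQ_le_const[OF lim]) (intro exI[of _ 0] allI impI le)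
  thus ?thesis by simp
qed

lemma nn_Minkowski_sum:
  fixes u :: "nat \<Rightarrow> 'x \<Rightarrow> real"
  assumes p: "1 \<le> p" and [measurable]: "\<And>n. u n \<in> borel_measurable M"
    and nn: "\<And>n x. 0 \<le> u n x" and a: "\<And>n. 0 \<le> a n"
    and u: "\<And>n. (\<integral>\<^sup>+x. ennreal (u n x powr p) \<partial>M) \<le> ennreal (a n powr p)"
  shows "(\<integral>\<^sup>+x. ennreal ((\<Sum>n<k. u n x) powr p) \<partial>M) \<le> ennreal ((\<Sum>n<k. a n) powr p)"
proof (induction k)
  case (Suc k)
  have "(\<integral>\<^sup>+x. ennreal (((\<Sum>n<k. u n x) + u k x) powr p) \<partial>M) \<le> ennreal (((\<Sum>n<k. a n) + a k) powr p)"
    by (rule nn_Minkowski[OF p _ _ _ _ _ _ Suc u]) (auto intro: sum_nonneg nn a)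
  thus ?case by simp
qed auto

text \<open>Monotone convergence applies to the p-th powers of the partial sums, and a finite
  integral of their supremum bounds the partial sums at almost every point.\<close>

lemma nn_Minkowski_series:
  fixes u :: "nat \<Rightarrow> 'x \<Rightarrow> real"
  assumes p: "1 \<le> p" and [measurable]: "\<And>n. u n \<in> borel_measurable M"
    and nn: "\<And>n x. 0 \<le> u n x" and a: "\<And>n. 0 \<le> a n" "summable a"
    and u: "\<And>n. (\<integral>\<^sup>+x. ennreal (u n x powr p) \<partial>M) \<le> ennreal (a n powr p)"
  shows "AE x in M. summable (\<lambda>n. u n x)"
    "(\<integral>\<^sup>+x. ennreal ((\<Sum>n. u n x) powr p) \<partial>M) \<le> ennreal ((\<Sum>n. a n) powr p)"
proof -
  define S where "S k x = ennreal ((\<Sum>n<k. u n x) powr p)" for k x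
  have [measurable]: "S k \<in> borel_measurable M" for k
    unfolding S_def[abs_def] by measurable
  have inc: "incseq S"
    unfolding incseq_def le_fun_def S_def using nn p
    by (auto intro!: ennreal_leI powr_mono2 sum_mono2 sum_nonneg)
  have "(\<integral>\<^sup>+x. (SUP k. S k x) \<partial>M) = (SUP k. \<integral>\<^sup>+x. S k x \<partial>M)"
    by (rule nn_integral_monotone_convergence_SUP[OF inc]) measurable
  also have "\<dots> \<le> ennreal ((\<Sum>n. a n) powr p)"
  proof (rule SUP_least)
    fix k
    have "(\<integral>\<^sup>+x. S k x \<partial>M) \<le> ennreal ((\<Sum>n<k. a n) powr p)"
      unfolding S_def by (rule nn_Minkowski_sum[OF p _ nn a(1) u]) measurable
    also have "\<dots> \<le> ennreal ((\<Sum>n. a n) powr p)"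
      using a p by (intro ennreal_leI powr_mono2 sum_le_suminf sum_nonneg) auto
    finally show "(\<integral>\<^sup>+x. S k x \<partial>M) \<le> ennreal ((\<Sum>n. a n) powr p)" .
  qed
  finally have fin: "(\<integral>\<^sup>+x. (SUP k. S k x) \<partial>M) \<le> ennreal ((\<Sum>n. a n) powr p)" .
  have "AE x in M. (SUP k. S k x) \<noteq> \<infinity>"
    by (rule nn_integral_PInf_AE) (use fin in \<open>auto simp: top_unique intro: order.strict_trans1\<close>)
  thus sm: "AE x in M. summable (\<lambda>n. u n x)"
  proof eventually_elim
    case (elim x)
    then obtain r where r: "r \<ge> 0" "(SUP k. S k x) = ennreal r" by (cases "SUP k. S k x") auto
    have "(\<Sum>n<k. u n x) \<le> r powr (1 / p)" for k
    proof -
      have "S k x \<le> ennreal r" unfolding r(2)[symmetric] by (rule SUP_upper) simp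
      hence "(\<Sum>n<k. u n x) powr p \<le> r" unfolding S_def using r(1) by (simp add: ennreal_le_iff)
      hence "((\<Sum>n<k. u n x) powr p) powr (1 / p) \<le> r powr (1 / p)" using p by (intro powr_mono2) auto
      thus ?thesis using p nn by (simp add: powr_powr sum_nonneg)
    qed
    thus ?case by (intro summableI_nonneg_bounded nn)
  qed
  have "(\<integral>\<^sup>+x. ennreal ((\<Sum>n. u n x) powr p) \<partial>M) \<le> (\<integral>\<^sup>+x. (SUP k. S k x) \<partial>M)"
  proof (rule nn_integral_mono_AE)
    show "AE x in M. ennreal ((\<Sum>n. u n x) powr p) \<le> (SUP k. S k x)"
      using sm
    proof eventually_elim
      case (elim x)
      have "(\<lambda>k. S k x) \<longlonglongrightarrow> ennreal ((\<Sum>n. u n x) powr p)"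
        unfolding S_def using p elim nn
        by (intro tendsto_ennrealI tendsto_powr' summable_LIMSEQ tendsto_const)
             (auto intro: sum_nonneg always_eventually)
      thus ?case by (rule LIMSEQ_le_const2) (auto intro!: SUP_upper exI[of _ 0])
    qed
  qed
  thus "(\<integral>\<^sup>+x. ennreal ((\<Sum>n. u n x) powr p) \<partial>M) \<le> ennreal ((\<Sum>n. a n) powr p)"
    using fin by (rule order.trans)
qed

locale koethe =
  fixes N :: "'w measure" and Y :: "'w fspace"
  assumes N: "sigma_finite_measure N" and koethe: "koethe_space N Y"
begin

lemmas banach_facts = koethe[unfolded koethe_space_def, THEN conjunct1, unfolded banach_fspace_def]
lemmas lattice_facts = koethe[unfolded koethe_space_def, THEN conjunct2]

lemma Y_zero: "(\<lambda>_. 0) \<in> elems Y"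
  by (rule banach_facts[THEN conjunct1])

lemma Y_add: "f \<in> elems Y \<Longrightarrow> g \<in> elems Y \<Longrightarrow> (\<lambda>a. f a + g a) \<in> elems Y"
  and Y_nrm_add: "f \<in> elems Y \<Longrightarrow> g \<in> elems Y \<Longrightarrow> nrm Y (\<lambda>a. f a + g a) \<le> nrm Y f + nrm Y g"
  using banach_facts[THEN conjunct2, THEN conjunct1] by blast+

lemma Y_scale: "f \<in> elems Y \<Longrightarrow> (\<lambda>a. c * f a) \<in> elems Y"
  and Y_nrm_scale: "f \<in> elems Y \<Longrightarrow> nrm Y (\<lambda>a. c * f a) = cmod c * nrm Y f"
  using banach_facts[THEN conjunct2, THEN conjunct2, THEN conjunct1] by blast+

lemma Y_nrm_nonneg: "f \<in> elems Y \<Longrightarrow> 0 \<le> nrm Y f"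
  using banach_facts[THEN conjunct2, THEN conjunct2, THEN conjunct2, THEN conjunct1] by blast

lemma Y_complete:
  assumes "\<And>n::nat. F n \<in> elems Y" "\<And>e. e > 0 \<Longrightarrow> \<exists>n0. \<forall>m\<ge>n0. \<forall>n\<ge>n0. ndist Y (F m) (F n) < e"
  shows "\<exists>f\<in>elems Y. (\<lambda>n. ndist Y (F n) f) \<longlonglongrightarrow> 0"
  using banach_facts[THEN conjunct2, THEN conjunct2, THEN conjunct2, THEN conjunct2, rule_format, of F] assms
  by blast

lemma Y_measurable: "f \<in> elems Y \<Longrightarrow> f \<in> borel_measurable N"
  and Y_integrable: "f \<in> elems Y \<Longrightarrow> B \<in> sets N \<Longrightarrow> emeasure N B < \<infinity> \<Longrightarrow> set_integrable N B f"
  and Y_null_AE: "f \<in> elems Y \<Longrightarrow> nrm Y f = 0 \<Longrightarrow> AE w in N. f w = 0"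
  using lattice_facts[THEN conjunct1] by blast+

lemma Y_ideal: "f \<in> borel_measurable N \<Longrightarrow> g \<in> elems Y \<Longrightarrow> AE w in N. cmod (f w) \<le> cmod (g w) \<Longrightarrow>
        f \<in> elems Y \<and> nrm Y f \<le> nrm Y g"
  using lattice_facts[THEN conjunct2, THEN conjunct1] by blast

lemma Y_Fatou:
  fixes F :: "nat \<Rightarrow> 'w \<Rightarrow> real" and f :: "'w \<Rightarrow> real"
  assumes "f \<in> borel_measurable N" "\<And>k. (\<lambda>w. complex_of_real (F k w)) \<in> elems Y"
    "AE w in N. (\<forall>k. 0 \<le> F k w \<and> F k w \<le> F (Suc k) w) \<and> (\<lambda>k. F k w) \<longlonglongrightarrow> f w"
    "bdd_above (range (\<lambda>k. nrm Y (\<lambda>w. complex_of_real (F k w))))"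
  shows "(\<lambda>w. complex_of_real (f w)) \<in> elems Y"
    "(\<lambda>k. nrm Y (\<lambda>w. complex_of_real (F k w))) \<longlonglongrightarrow> nrm Y (\<lambda>w. complex_of_real (f w))"
  using lattice_facts[THEN conjunct2, THEN conjunct2, THEN conjunct2, rule_format,
      OF assms(1) assms(2) assms(3) assms(4)] by simp_all

lemma Y_diff: "f \<in> elems Y \<Longrightarrow> g \<in> elems Y \<Longrightarrow> (\<lambda>a. f a - g a) \<in> elems Y"
  using Y_add[OF _ Y_scale[of g "- 1"], of f] by simp

lemma Y_sum: "(\<And>i. i \<in> I \<Longrightarrow> f i \<in> elems Y) \<Longrightarrow> (\<lambda>a. \<Sum>i\<in>I. f i a) \<in> elems Y"
  by (induction I rule: infinite_finite_induct) (auto intro: Y_zero Y_add)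

lemma Y_nrm_zero: "nrm Y (\<lambda>_. 0) = 0"
  using Y_nrm_scale[OF Y_zero, of 0] by simp

lemma Y_nrm_sum:
  assumes "\<And>i. i \<in> I \<Longrightarrow> f i \<in> elems Y"
  shows "nrm Y (\<lambda>a. \<Sum>i\<in>I. f i a) \<le> (\<Sum>i\<in>I. nrm Y (f i))"
  using assms
proof (induction I rule: infinite_finite_induct)
  case (insert i I)
  thus ?case using Y_nrm_add[of "f i" "\<lambda>a. \<Sum>i\<in>I. f i a"] Y_sum[of I f] by fastforce
qed (simp_all add: Y_nrm_zero)

lemma Y_AE_null: "f \<in> borel_measurable N \<Longrightarrow> AE w in N. f w = 0 \<Longrightarrow> f \<in> elems Y \<and> nrm Y f = 0"
  using Y_ideal[OF _ Y_zero, of f] Y_nrm_nonneg[of f] by (auto simp: Y_nrm_zero)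

lemma Y_cong_AE:
  assumes "f \<in> elems Y" "g \<in> borel_measurable N" "AE w in N. g w = f w"
  shows "g \<in> elems Y" "nrm Y g = nrm Y f" "ndist Y g f = 0"
proof -
  note [measurable] = assms(2) Y_measurable[OF assms(1)]
  have 1: "g \<in> elems Y \<and> nrm Y g \<le> nrm Y f"
    by (rule Y_ideal[OF assms(2,1)]) (use assms(3) in auto)
  moreover have "AE w in N. cmod (f w) \<le> cmod (g w)"
    using assms(3) by eventually_elim simp
  ultimately have "nrm Y f \<le> nrm Y g"
    using Y_ideal[OF Y_measurable[OF assms(1)], of g] by blast
  with 1 show "g \<in> elems Y" "nrm Y g = nrm Y f" by auto
  show "ndist Y g f = 0"
    unfolding ndist_def using assms(3) by (intro conjunct2[OF Y_AE_null]) auto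
qed

lemma Y_modulus: "f \<in> elems Y \<Longrightarrow> (\<lambda>w. complex_of_real (cmod (f w))) \<in> elems Y"
  "f \<in> elems Y \<Longrightarrow> nrm Y (\<lambda>w. complex_of_real (cmod (f w))) = nrm Y f"
proof -
  assume f: "f \<in> elems Y"
  note [measurable] = Y_measurable[OF f]
  have 1: "(\<lambda>w. complex_of_real (cmod (f w))) \<in> elems Y \<and> nrm Y (\<lambda>w. complex_of_real (cmod (f w))) \<le> nrm Y f"
    by (rule Y_ideal[OF _ f]) auto
  moreover have "nrm Y f \<le> nrm Y (\<lambda>w. complex_of_real (cmod (f w)))"
    using Y_ideal[OF Y_measurable[OF f] conjunct1[OF 1]] by auto
  ultimately show "(\<lambda>w. complex_of_real (cmod (f w))) \<in> elems Y"
    "nrm Y (\<lambda>w. complex_of_real (cmod (f w))) = nrm Y f" by auto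
qed

lemma Y_nrm_triangle: "f \<in> elems Y \<Longrightarrow> g \<in> elems Y \<Longrightarrow> nrm Y f \<le> ndist Y f g + nrm Y g"
  unfolding ndist_def using Y_nrm_add[of "\<lambda>a. f a - g a" g] by (simp add: Y_diff)

lemma Y_ndist_commute: "f \<in> elems Y \<Longrightarrow> g \<in> elems Y \<Longrightarrow> ndist Y f g = ndist Y g f"
  unfolding ndist_def using Y_nrm_scale[OF Y_diff[of f g], of "- 1"] by simp

lemma Y_ndist_triangle:
  "f \<in> elems Y \<Longrightarrow> g \<in> elems Y \<Longrightarrow> h \<in> elems Y \<Longrightarrow> ndist Y f h \<le> ndist Y f g + ndist Y g h"
  unfolding ndist_def using Y_nrm_add[of "\<lambda>a. f a - g a" "\<lambda>a. g a - h a"] by (simp add: Y_diff)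

lemma Y_ndist_nonneg: "f \<in> elems Y \<Longrightarrow> g \<in> elems Y \<Longrightarrow> 0 \<le> ndist Y f g"
  unfolding ndist_def by (intro Y_nrm_nonneg Y_diff)

text \<open>Local integrability is automatically quantitative: otherwise a sum of suitably normalised
  positive functions would be an element that is not integrable.\<close>

lemma Y_integral_bound:
  assumes B: "B \<in> sets N" "emeasure N B < \<infinity>"
  obtains C where "C \<ge> 0" "\<And>f. f \<in> elems Y \<Longrightarrow> (\<integral>\<^sup>+w. ennreal (cmod (f w)) * indicator B w \<partial>N) \<le> ennreal (C * nrm Y f)"
proof -
  define I where "I f = (\<integral>\<^sup>+w. ennreal (cmod (f w)) * indicator B w \<partial>N)" for f :: "'w \<Rightarrow> complex"
  have fin: "I f < \<infinity>" if "f \<in> elems Y" for f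
  proof -
    have "integrable N (\<lambda>w. indicator B w *\<^sub>R f w)"
      using Y_integrable[OF that B] by (simp add: set_integrable_def)
    hence "(\<integral>\<^sup>+w. ennreal (norm (indicator B w *\<^sub>R f w)) \<partial>N) < \<infinity>"
      by (simp add: integrable_iff_bounded)
    also have "(\<integral>\<^sup>+w. ennreal (norm (indicator B w *\<^sub>R f w)) \<partial>N) = I f"
      unfolding I_def by (intro nn_integral_cong) (auto simp: indicator_def)
    finally show ?thesis .
  qed
  have "\<exists>C\<ge>0. \<forall>f\<in>elems Y. I f \<le> ennreal (C * nrm Y f)"
  proof (rule ccontr)
    assume "\<not> ?thesis"
    \<comment> \<open>Failure at the constant 4^n leaves room for both requirements: after
      normalisation by \<open>c n\<close> the norms are 2^-n and the integrals over \<open>B\<close>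
      at least 2^n.\<close>
    hence "\<exists>f\<in>elems Y. ennreal (4 ^ n * nrm Y f) < I f" for n :: nat
      by (metis linorder_not_le zero_le_numeral zero_le_power)
    then obtain f where f: "\<And>n. f n \<in> elems Y" "\<And>n. ennreal (4 ^ n * nrm Y (f n)) < I (f n)" by metis
    note [measurable] = Y_measurable[OF f(1)] B(1)
    have pos: "nrm Y (f n) > 0" for n
    proof (rule ccontr)
      assume "\<not> nrm Y (f n) > 0"
      hence "nrm Y (f n) = 0" using Y_nrm_nonneg[OF f(1)[of n]] by simp
      hence "AE w in N. f n w = 0" by (rule Y_null_AE[OF f(1)])
      hence "I (f n) = 0" unfolding I_def by (subst nn_integral_0_iff_AE) auto
      thus False using f(2)[of n] by simp
    qed
    define c where "c n = 1 / (2 ^ n * nrm Y (f n))" for n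
    have c: "c n > 0" for n using pos by (simp add: c_def)
    define g where "g n w = complex_of_real (c n) * complex_of_real (cmod (f n w))" for n w
    have g: "g n \<in> elems Y" for n
      unfolding g_def[abs_def] by (intro Y_scale Y_modulus f)
    have g_nrm: "nrm Y (g n) = 1 / 2 ^ n" for n
    proof -
      have "nrm Y (g n) = cmod (complex_of_real (c n)) * nrm Y (f n)"
        unfolding g_def[abs_def] Y_nrm_scale[OF Y_modulus(1)[OF f(1)]] Y_modulus(2)[OF f(1)] ..
      also have "\<dots> = c n * nrm Y (f n)" using c[of n] by (simp only: norm_of_real abs_of_pos)
      also have "\<dots> = 1 / 2 ^ n" using pos[of n] by (simp add: c_def)
      finally show ?thesis .
    qed
    have g_I: "I (g n) \<ge> ennreal (2 ^ n)" for n
    proof -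
      have "(4::real) ^ n = 2 ^ n * 2 ^ n" by (simp flip: power_mult_distrib)
      hence "ennreal (2 ^ n) = ennreal (c n) * ennreal (4 ^ n * nrm Y (f n))"
        using c[of n] pos[of n] by (subst ennreal_mult[symmetric]) (auto simp: c_def)
      also have "\<dots> \<le> ennreal (c n) * I (f n)" using f(2)[of n] by (intro mult_left_mono) auto
      also have "\<dots> = (\<integral>\<^sup>+w. ennreal (c n) * (ennreal (cmod (f n w)) * indicator B w) \<partial>N)"
        unfolding I_def by (rule nn_integral_cmult[symmetric]) measurable
      also have "\<dots> = I (g n)"
        unfolding I_def g_def using c[of n]
        by (intro nn_integral_cong) (auto simp: norm_mult ennreal_mult' mult_ac)
      finally show ?thesis .
    qed
    define S where "S k w = (\<Sum>n<k. g n w)" for k w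
    have S: "S k \<in> elems Y" for k unfolding S_def[abs_def] by (intro Y_sum g)
    have S_diff: "ndist Y (S m) (S k) \<le> 2 / 2 ^ k" if "k \<le> m" for k m
    proof -
      have "ndist Y (S m) (S k) = nrm Y (\<lambda>w. \<Sum>n\<in>{k..<m}. g n w)"
        unfolding ndist_def S_def using that
        by (intro arg_cong[of _ _ "nrm Y"] ext) (simp add: sum_diff_nat_ivl[of 0 k m, unfolded atLeast0LessThan])
      also have "\<dots> \<le> (\<Sum>n\<in>{k..<m}. nrm Y (g n))" by (rule Y_nrm_sum[OF g])
      also have "\<dots> = (\<Sum>n\<in>{k..<m}. (1 / 2) ^ n)" by (simp add: g_nrm power_one_over)
      also have "\<dots> \<le> 2 / 2 ^ k"
      proof -
        have "(\<Sum>n\<in>{k..<m}. (1 / 2) ^ n) = 2 / 2 ^ k - 2 / (2 ^ m :: real)"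
          using that
        proof (induction m rule: dec_induct)
          case (step n)
          hence "(\<Sum>n\<in>{k..<Suc n}. (1 / 2) ^ n) = 2 / 2 ^ k - 2 / (2 ^ n :: real) + (1 / 2) ^ n" by simp
          thus ?case by (simp add: power_one_over)
        qed simp
        thus ?thesis by simp
      qed
      finally show ?thesis .
    qed
    have "\<exists>T\<in>elems Y. (\<lambda>n. ndist Y (S n) T) \<longlonglongrightarrow> 0"
    proof (rule Y_complete[OF S])
      fix e :: real assume "e > 0"
      have "(\<lambda>k. 2 / 2 ^ k :: real) \<longlonglongrightarrow> 0" by real_asymp
      from order_tendstoD(2)[OF this \<open>e > 0\<close>] obtain n0 where n0: "\<And>k. k \<ge> n0 \<Longrightarrow> 2 / 2 ^ k < e"
        by (auto simp: eventually_sequentially)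
      have "ndist Y (S m) (S n) < e" if "m \<ge> n0" "n \<ge> n0" for m n
        using S_diff[of n m] S_diff[of m n] n0[OF that(1)] n0[OF that(2)] Y_ndist_commute[OF S S, of m n]
        by (cases "n \<le> m") auto
      thus "\<exists>n0. \<forall>m\<ge>n0. \<forall>n\<ge>n0. ndist Y (S m) (S n) < e" by blast
    qed
    then obtain T where T: "T \<in> elems Y" "(\<lambda>n. ndist Y (S n) T) \<longlonglongrightarrow> 0" by blast
    note [measurable] = Y_measurable[OF T(1)] Y_measurable[OF g] Y_measurable[OF S]
    \<comment> \<open>For k > n the positive part of |g n| - |T| is dominated by |S k - T|, because
      S k is a sum of nonnegative terms that include g n. The norm of S k - T tends to 0, so T
      dominates g n.\<close>
    have dom: "AE w in N. cmod (g n w) \<le> cmod (T w)" for n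
    proof -
      define h where "h w = complex_of_real (max 0 (cmod (g n w) - cmod (T w)))" for w
      have [measurable]: "h \<in> borel_measurable N" unfolding h_def[abs_def] by measurable
      have hk: "h \<in> elems Y \<and> nrm Y h \<le> ndist Y (S k) T" if "k > n" for k
        unfolding ndist_def
      proof (rule Y_ideal[OF _ Y_diff[OF S T(1)]], measurable, rule AE_I2)
        fix w
        have "g m w = complex_of_real (c m * cmod (f m w))" for m by (simp add: g_def)
        hence "S k w = complex_of_real (\<Sum>m<k. c m * cmod (f m w))" by (simp add: S_def)
        moreover have "c n * cmod (f n w) \<le> (\<Sum>m<k. c m * cmod (f m w))"
          using that c[THEN less_imp_le] by (intro member_le_sum) (auto intro!: mult_nonneg_nonneg)
        moreover have "cmod (g n w) = c n * cmod (f n w)"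
          using c[of n] by (simp add: g_def norm_mult)
        ultimately have "cmod (g n w) \<le> cmod (S k w)"
          using abs_ge_self[of "\<Sum>m<k. c m * cmod (f m w)"] by (simp only: norm_of_real)
        thus "cmod (h w) \<le> cmod (S k w - T w)"
          using norm_triangle_ineq2[of "S k w" "T w"] by (auto simp: h_def)
      qed
      have "nrm Y h \<le> 0"
        by (rule LIMSEQ_le_const[OF T(2)]) (use hk in \<open>auto intro!: exI[of _ "Suc n"]\<close>)
      hence "nrm Y h = 0" using Y_nrm_nonneg[of h] hk[of "Suc n"] by auto
      hence "AE w in N. h w = 0" using hk[of "Suc n"] by (intro Y_null_AE) auto
      thus ?thesis by eventually_elim (auto simp: h_def max_def split: if_splits)
    qed
    have "ennreal (2 ^ n) \<le> I T" for n
    proof -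
      have "I (g n) \<le> I T"
        unfolding I_def using dom[of n] by (intro nn_integral_mono_AE) (auto elim!: eventually_mono intro!: mult_right_mono ennreal_leI)
      thus ?thesis using g_I[of n] by (rule order.trans[rotated])
    qed
    moreover obtain r where r: "I T = ennreal r" "r \<ge> 0" using fin[OF T(1)] by (cases "I T") auto
    ultimately have "2 ^ n \<le> r" for n :: nat by (simp add: ennreal_le_iff)
    moreover obtain n :: nat where "r < 2 ^ n" using real_arch_pow[of 2 r] by auto
    ultimately show False by (meson not_le)
  qed
  thus ?thesis using that by (auto simp: I_def)
qed

text \<open>Integrability over sets of finite measure gives pointwise summability, the Fatou
  property extends the triangle inequality to infinitely many terms, and the ideal property passes
  the bound on to any function below the sum of moduli.\<close>

lemma Y_series:
  assumes g: "\<And>n::nat. g n \<in> elems Y" and s: "summable (\<lambda>n. nrm Y (g n))"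
  shows "AE w in N. summable (\<lambda>n. cmod (g n w))"
    "\<And>f. f \<in> borel_measurable N \<Longrightarrow> AE w in N. cmod (f w) \<le> (\<Sum>n. cmod (g n w)) \<Longrightarrow>
       f \<in> elems Y \<and> nrm Y f \<le> (\<Sum>n. nrm Y (g n))"
proof -
  note [measurable] = Y_measurable[OF g]
  obtain B :: "nat \<Rightarrow> 'w set" where B: "range B \<subseteq> sets N" "(\<Union>i. B i) = space N" "\<And>i. emeasure N (B i) \<noteq> \<infinity>"
    using sigma_finite_measure.sigma_finite[OF N] by metis
  have B': "B i \<in> sets N" "emeasure N (B i) < \<infinity>" for i
    using B(1) B(3)[of i] by (auto simp: less_top)
  note [measurable] = B'(1)
  have "AE w in N. w \<in> B i \<longrightarrow> summable (\<lambda>n. cmod (g n w))" for i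
  proof -
    obtain C where C: "C \<ge> 0" "\<And>f. f \<in> elems Y \<Longrightarrow>
        (\<integral>\<^sup>+w. ennreal (cmod (f w)) * indicator (B i) w \<partial>N) \<le> ennreal (C * nrm Y f)"
      using Y_integral_bound[OF B'] by blast
    have "(\<integral>\<^sup>+w. (\<Sum>n. ennreal (cmod (g n w)) * indicator (B i) w) \<partial>N)
        = (\<Sum>n. \<integral>\<^sup>+w. ennreal (cmod (g n w)) * indicator (B i) w \<partial>N)"
      by (rule nn_integral_suminf) measurable
    also have "\<dots> \<le> (\<Sum>n. ennreal (C * nrm Y (g n)))" by (intro suminf_le C(2) g) auto
    also have "\<dots> = ennreal (\<Sum>n. C * nrm Y (g n))"
      using C(1) s Y_nrm_nonneg[OF g] by (intro suminf_ennreal2 summable_mult) auto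
    finally have "(\<integral>\<^sup>+w. (\<Sum>n. ennreal (cmod (g n w)) * indicator (B i) w) \<partial>N) \<noteq> \<infinity>"
      by (auto simp: top_unique)
    hence "AE w in N. (\<Sum>n. ennreal (cmod (g n w)) * indicator (B i) w) \<noteq> \<infinity>"
      by (intro nn_integral_PInf_AE) auto
    thus ?thesis
    proof eventually_elim
      case (elim w)
      show ?case
      proof
        assume "w \<in> B i"
        hence "(\<Sum>n. ennreal (cmod (g n w))) \<noteq> \<top>" using elim by simp
        thus "summable (\<lambda>n. cmod (g n w))" by (intro summable_suminf_not_top) auto
      qed
    qed
  qed
  hence "AE w in N. \<forall>i. w \<in> B i \<longrightarrow> summable (\<lambda>n. cmod (g n w))"
    by (subst AE_all_countable) blast
  thus sm: "AE w in N. summable (\<lambda>n. cmod (g n w))"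
    using AE_space by eventually_elim (use B(2) in blast)
  fix f assume f: "f \<in> borel_measurable N" "AE w in N. cmod (f w) \<le> (\<Sum>n. cmod (g n w))"
  define F where "F k w = (\<Sum>n<k. cmod (g n w))" for k w
  define G where "G w = (\<Sum>n. cmod (g n w))" for w
  have F: "(\<lambda>w. complex_of_real (F k w)) \<in> elems Y" "nrm Y (\<lambda>w. complex_of_real (F k w)) \<le> (\<Sum>n. nrm Y (g n))" for k
  proof -
    have eq: "(\<lambda>w. complex_of_real (F k w)) = (\<lambda>w. \<Sum>n<k. complex_of_real (cmod (g n w)))"
      by (simp add: F_def)
    show "(\<lambda>w. complex_of_real (F k w)) \<in> elems Y" unfolding eq by (intro Y_sum Y_modulus g)
    have "nrm Y (\<lambda>w. complex_of_real (F k w)) \<le> (\<Sum>n<k. nrm Y (\<lambda>w. complex_of_real (cmod (g n w))))"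
      unfolding eq by (intro Y_nrm_sum Y_modulus g)
    also have "\<dots> = (\<Sum>n<k. nrm Y (g n))" by (simp add: Y_modulus(2)[OF g])
    also have "\<dots> \<le> (\<Sum>n. nrm Y (g n))" by (intro sum_le_suminf s) (auto intro: Y_nrm_nonneg g)
    finally show "nrm Y (\<lambda>w. complex_of_real (F k w)) \<le> (\<Sum>n. nrm Y (g n))" .
  qed
  have G_meas [measurable]: "G \<in> borel_measurable N" unfolding G_def[abs_def] by measurable
  have ae: "AE w in N. (\<forall>k. 0 \<le> F k w \<and> F k w \<le> F (Suc k) w) \<and> (\<lambda>k. F k w) \<longlonglongrightarrow> G w"
    using sm by eventually_elim (auto simp: F_def G_def sum_nonneg intro: summable_LIMSEQ)
  have bdd: "bdd_above (range (\<lambda>k. nrm Y (\<lambda>w. complex_of_real (F k w))))"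
    using F(2) by (auto intro!: bdd_aboveI)
  note G = Y_Fatou[OF G_meas F(1) ae bdd]
  have "nrm Y (\<lambda>w. complex_of_real (G w)) \<le> (\<Sum>n. nrm Y (g n))"
    by (rule LIMSEQ_le_const2[OF G(2)]) (use F(2) in auto)
  moreover have "f \<in> elems Y \<and> nrm Y f \<le> nrm Y (\<lambda>w. complex_of_real (G w))"
  proof (rule Y_ideal[OF f(1) G(1)])
    show "AE w in N. cmod (f w) \<le> cmod (complex_of_real (G w))"
      using f(2) by eventually_elim (simp add: G_def)
  qed
  ultimately show "f \<in> elems Y \<and> nrm Y f \<le> (\<Sum>n. nrm Y (g n))" by auto
qed

end

section \<open>Strong measurability and \<open>L\<^sup>p(Y)\<close>\<close>

context koethe
begin

lemma simple_funE:
  assumes "simple_fun M Y s"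
  obtains n :: nat and E v where "\<And>i. i < n \<Longrightarrow> E i \<in> sets M" "\<And>i. i < n \<Longrightarrow> emeasure M (E i) < \<infinity>"
    "\<And>i. i < n \<Longrightarrow> v i \<in> elems Y" "s = (\<lambda>t a. \<Sum>i<n. indicator (E i) t * v i a)"
  using assms unfolding simple_fun_def
  apply (elim exE conjE)
  subgoal for n E v by (rule that[of n E v]) blast+
  done

lemma simple_fun_in: "simple_fun M Y s \<Longrightarrow> s t \<in> elems Y"
  by (erule simple_funE) (auto intro!: Y_sum Y_scale)

lemma simple_fun_lin:
  assumes "simple_fun M Y s" "simple_fun M Y s'"
  shows "simple_fun M Y (\<lambda>t a. c * s t a + s' t a)"
proof -
  obtain n :: nat and E v where 1: "\<And>i. i < n \<Longrightarrow> E i \<in> sets M" "\<And>i. i < n \<Longrightarrow> emeasure M (E i) < \<infinity>"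
    "\<And>i. i < n \<Longrightarrow> v i \<in> elems Y" and s: "s = (\<lambda>t a. \<Sum>i<n. indicator (E i) t * v i a)"
    using assms(1) by (rule simple_funE) (rule that)
  obtain n' :: nat and E' v' where 2: "\<And>i. i < n' \<Longrightarrow> E' i \<in> sets M" "\<And>i. i < n' \<Longrightarrow> emeasure M (E' i) < \<infinity>"
    "\<And>i. i < n' \<Longrightarrow> v' i \<in> elems Y" and s': "s' = (\<lambda>t a. \<Sum>i<n'. indicator (E' i) t * v' i a)"
    using assms(2) by (rule simple_funE) (rule that)
  define E2 where "E2 i = (if i < n then E i else E' (i - n))" for i
  define v2 where "v2 i = (if i < n then (\<lambda>a. c * v i a) else v' (i - n))" for i
  have "(\<Sum>i<n + n'. indicator (E2 i) t * v2 i a) = c * s t a + s' t a" for t a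
  proof -
    have "(\<Sum>i<n + n'. indicator (E2 i) t * v2 i a)
        = (\<Sum>i<n. indicator (E2 i) t * v2 i a) + (\<Sum>i<n'. indicator (E2 (n + i)) t * v2 (n + i) a)"
      by (induction n') (auto simp: add.assoc)
    also have "\<dots> = (\<Sum>i<n. c * (indicator (E i) t * v i a)) + (\<Sum>i<n'. indicator (E' i) t * v' i a)"
      by (simp add: E2_def v2_def mult_ac)
    finally show ?thesis by (simp only: s s' sum_distrib_left)
  qed
  moreover have "\<forall>i<n + n'. E2 i \<in> sets M \<and> emeasure M (E2 i) < \<infinity> \<and> v2 i \<in> elems Y"
    using 1 2 by (auto simp: E2_def v2_def intro: Y_scale)
  ultimately show ?thesis
    unfolding simple_fun_def by (intro exI[of _ "n + n'"] exI[of _ E2] exI[of _ v2]) (auto simp: fun_eq_iff)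
qed

lemma simple_fun_zero: "simple_fun M Y (\<lambda>t a. 0)"
  unfolding simple_fun_def by (intro exI[of _ 0]) auto

text \<open>The sets of a simple function may overlap, so its values cannot be listed set by set.
  Splitting by membership in the last set changes only the constant part, hence the induction over
  an arbitrary offset \<open>u\<close>.\<close>

lemma simple_fun_nrm_measurable:
  assumes "simple_fun M Y s"
  shows "(\<lambda>t. nrm Y (s t)) \<in> borel_measurable M"
proof -
  obtain n :: nat and E v where E: "\<And>i. i < n \<Longrightarrow> E i \<in> sets M" "\<And>i. i < n \<Longrightarrow> emeasure M (E i) < \<infinity>"
    "\<And>i. i < n \<Longrightarrow> v i \<in> elems Y" and s: "s = (\<lambda>t a. \<Sum>i<n. indicator (E i) t * v i a)"
    using assms by (rule simple_funE) (rule that)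
  have "(\<lambda>t. nrm Y (\<lambda>a. u a + (\<Sum>i<k. indicator (E i) t * v i a))) \<in> borel_measurable M" if "k \<le> n" for k u
    using that
  proof (induction k arbitrary: u)
    case (Suc k)
    have [measurable]: "E k \<in> sets M" using E Suc.prems by simp
    have "(\<lambda>t. nrm Y (\<lambda>a. u a + (\<Sum>i<Suc k. indicator (E i) t * v i a)))
       = (\<lambda>t. if t \<in> E k then nrm Y (\<lambda>a. (u a + v k a) + (\<Sum>i<k. indicator (E i) t * v i a))
               else nrm Y (\<lambda>a. u a + (\<Sum>i<k. indicator (E i) t * v i a)))"
    proof
      fix t
      show "nrm Y (\<lambda>a. u a + (\<Sum>i<Suc k. indicator (E i) t * v i a))
         = (if t \<in> E k then nrm Y (\<lambda>a. (u a + v k a) + (\<Sum>i<k. indicator (E i) t * v i a))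
               else nrm Y (\<lambda>a. u a + (\<Sum>i<k. indicator (E i) t * v i a)))"
        by (cases "t \<in> E k")
           (simp_all only: sum.lessThan_Suc indicator_simps mult_1 mult_zero_left add_0_right if_True if_False
              add.assoc add.commute[of "v k _"] not_False_eq_True)
    qed
    also have "\<dots> \<in> borel_measurable M"
      using Suc.prems by (intro measurable_If Suc.IH) auto
    finally show ?case .
  next
    case 0
    show ?case by (simp only: sum.lessThan_Suc lessThan_0 sum.empty borel_measurable_const)
  qed
  from this[OF order.refl, of "\<lambda>_. 0"] show ?thesis by (simp only: s add_0_left)
qed

lemma simple_fun_ndist_measurable:
  assumes "simple_fun M Y s" "simple_fun M Y s'"
  shows "(\<lambda>t. ndist Y (s t) (s' t)) \<in> borel_measurable M"
proof -
  have 1: "simple_fun M Y (\<lambda>t a. - 1 * s' t a + s t a)"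
    by (rule simple_fun_lin[OF assms(2,1)])
  have eq: "(\<lambda>a. - 1 * s' t a + s t a) = (\<lambda>a. s t a - s' t a)" for t
    by auto
  show ?thesis
    using simple_fun_nrm_measurable[OF 1] unfolding eq ndist_def .
qed

lemma strongly_measurableE:
  assumes "strongly_measurable M Y F"
  obtains s where "\<And>n::nat. simple_fun M Y (s n)" "AE t in M. F t \<in> elems Y"
    "AE t in M. (\<lambda>n. ndist Y (s n t) (F t)) \<longlonglongrightarrow> 0"
  using assms unfolding strongly_measurable_def
  apply (elim exE conjE)
  subgoal for s by (rule that[of s]) simp_all
  done

lemma nrm_tendsto:
  assumes "\<And>n. s n \<in> elems Y" "f \<in> elems Y" "(\<lambda>n. ndist Y (s n) f) \<longlonglongrightarrow> 0"
  shows "(\<lambda>n. nrm Y (s n)) \<longlonglongrightarrow> nrm Y f"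
proof (rule Lim_transform2[OF tendsto_const], rule Lim_null_comparison[OF _ assms(3)])
  show "\<forall>\<^sub>F n in sequentially. norm (nrm Y f - nrm Y (s n)) \<le> ndist Y (s n) f"
    using Y_nrm_triangle[OF assms(1,2)] Y_nrm_triangle[OF assms(2,1)] Y_ndist_commute[OF assms(1,2)]
    by (intro always_eventually allI) (simp add: abs_le_iff diff_le_eq)
qed

text \<open>The values \<open>F t\<close> are controlled only almost everywhere, so a measurable
  nonnegative version of their norm is produced, as a limit of norms of simple functions.\<close>

lemma strongly_measurable_nrm:
  assumes "strongly_measurable M Y F"
  obtains u where "u \<in> borel_measurable M" "\<And>t. 0 \<le> u t" "AE t in M. u t = nrm Y (F t)"
proof -
  obtain s where s: "\<And>n::nat. simple_fun M Y (s n)" "AE t in M. F t \<in> elems Y"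
    "AE t in M. (\<lambda>n. ndist Y (s n t) (F t)) \<longlonglongrightarrow> 0"
    by (rule strongly_measurableE[OF assms]) (rule that)
  note [measurable] = simple_fun_nrm_measurable[OF s(1)]
  show ?thesis
  proof (rule that[of "\<lambda>t. max 0 (lim (\<lambda>n. nrm Y (s n t)))"])
    show "AE t in M. max 0 (lim (\<lambda>n. nrm Y (s n t))) = nrm Y (F t)"
      using s(2,3)
    proof eventually_elim
      case (elim t)
      hence "(\<lambda>n. nrm Y (s n t)) \<longlonglongrightarrow> nrm Y (F t)"
        by (intro nrm_tendsto simple_fun_in[OF s(1)])
      thus ?case using Y_nrm_nonneg[OF elim(1)] by (simp add: limI)
    qed
  qed (auto intro!: borel_measurable_lim_metric)
qed

lemma strongly_measurable_lin:
  assumes "strongly_measurable M Y F" "strongly_measurable M Y G"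
  shows "strongly_measurable M Y (\<lambda>t a. c * F t a + G t a)"
proof -
  obtain s where s: "\<And>n::nat. simple_fun M Y (s n)" "AE t in M. F t \<in> elems Y"
    "AE t in M. (\<lambda>n. ndist Y (s n t) (F t)) \<longlonglongrightarrow> 0"
    by (rule strongly_measurableE[OF assms(1)]) (rule that)
  obtain s' where s': "\<And>n::nat. simple_fun M Y (s' n)" "AE t in M. G t \<in> elems Y"
    "AE t in M. (\<lambda>n. ndist Y (s' n t) (G t)) \<longlonglongrightarrow> 0"
    by (rule strongly_measurableE[OF assms(2)]) (rule that)
  have "AE t in M. (\<lambda>a. c * F t a + G t a) \<in> elems Y"
    using s(2) s'(2) by eventually_elim (intro Y_add Y_scale)
  moreover have "AE t in M. (\<lambda>n. ndist Y (\<lambda>a. c * s n t a + s' n t a) (\<lambda>a. c * F t a + G t a)) \<longlonglongrightarrow> 0"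
    using s(2,3) s'(2,3)
  proof eventually_elim
    case (elim t)
    have "(\<lambda>n. cmod c * ndist Y (s n t) (F t) + ndist Y (s' n t) (G t)) \<longlonglongrightarrow> cmod c * 0 + 0"
      by (intro tendsto_intros elim)
    hence lim: "(\<lambda>n. cmod c * ndist Y (s n t) (F t) + ndist Y (s' n t) (G t)) \<longlonglongrightarrow> 0" by simp
    have le: "ndist Y (\<lambda>a. c * s n t a + s' n t a) (\<lambda>a. c * F t a + G t a)
          \<le> cmod c * ndist Y (s n t) (F t) + ndist Y (s' n t) (G t)" for n
      using Y_nrm_add[OF Y_scale[OF Y_diff[OF simple_fun_in[OF s(1)] elim(1)], of c] Y_diff[OF simple_fun_in[OF s'(1)] elim(3)]]
        Y_nrm_scale[OF Y_diff[OF simple_fun_in[OF s(1)] elim(1)]]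
      by (simp add: ndist_def algebra_simps)
    have nn: "0 \<le> ndist Y (\<lambda>a. c * s n t a + s' n t a) (\<lambda>a. c * F t a + G t a)" for n
      by (intro Y_ndist_nonneg Y_add Y_scale elim simple_fun_in[OF s(1)] simple_fun_in[OF s'(1)])
    show ?case
      by (rule tendsto_sandwich[OF _ _ tendsto_const lim]) (use le nn in auto)
  qed
  ultimately show ?thesis
    unfolding strongly_measurable_def using simple_fun_lin[OF s(1) s'(1)]
    by (intro conjI exI[of _ "\<lambda>n t a. c * s n t a + s' n t a"]) auto
qed

lemma strongly_measurable_cong:
  assumes "strongly_measurable M Y F" "AE t in M. G t \<in> elems Y \<and> ndist Y (G t) (F t) = 0"
  shows "strongly_measurable M Y G"
proof -
  obtain s where s: "\<And>n::nat. simple_fun M Y (s n)" "AE t in M. F t \<in> elems Y"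
    "AE t in M. (\<lambda>n. ndist Y (s n t) (F t)) \<longlonglongrightarrow> 0"
    by (rule strongly_measurableE[OF assms(1)]) (rule that)
  have "AE t in M. (\<lambda>n. ndist Y (s n t) (G t)) \<longlonglongrightarrow> 0"
    using s(2,3) assms(2)
  proof eventually_elim
    case (elim t)
    show ?case
    proof (rule tendsto_sandwich[OF _ _ tendsto_const elim(2)])
      show "\<forall>\<^sub>F n in sequentially. 0 \<le> ndist Y (s n t) (G t)"
        using elim by (intro always_eventually allI Y_ndist_nonneg simple_fun_in[OF s(1)]) auto
      show "\<forall>\<^sub>F n in sequentially. ndist Y (s n t) (G t) \<le> ndist Y (s n t) (F t)"
        using elim Y_ndist_triangle[OF simple_fun_in[OF s(1)] elim(1), of "G t"] Y_ndist_commute[of "F t" "G t"]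
        by (intro always_eventually allI) auto
    qed
  qed
  thus ?thesis unfolding strongly_measurable_def using assms(2) s(1) by auto
qed

text \<open>A weight turns almost everywhere convergence into convergence of integrals, which yields a
  diagonal sequence.\<close>

lemma strongly_measurable_limit:
  assumes M: "sigma_finite_measure M" and F: "\<And>k::nat. strongly_measurable M Y (F k)"
    and G: "AE t in M. G t \<in> elems Y" "AE t in M. (\<lambda>k. ndist Y (F k t) (G t)) \<longlonglongrightarrow> 0"
  shows "strongly_measurable M Y G"
proof -
  have ex: "\<exists>s. (\<forall>n::nat. simple_fun M Y (s n)) \<and> (AE t in M. F k t \<in> elems Y) \<and>
    (AE t in M. (\<lambda>n. ndist Y (s n t) (F k t)) \<longlonglongrightarrow> 0)" for k
    using F[of k] unfolding strongly_measurable_def by blast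
  from choice[OF allI[OF ex]] obtain s where s0: "\<forall>k. (\<forall>n::nat. simple_fun M Y (s k n)) \<and> (AE t in M. F k t \<in> elems Y) \<and>
    (AE t in M. (\<lambda>n. ndist Y (s k n t) (F k t)) \<longlonglongrightarrow> 0)" ..
  have s: "simple_fun M Y (s k n)" and Fin: "AE t in M. F k t \<in> elems Y"
    and lim: "AE t in M. (\<lambda>n. ndist Y (s k n t) (F k t)) \<longlonglongrightarrow> 0" for k n
    using s0[THEN spec, of k] by simp_all
  obtain h where h [measurable]: "h \<in> borel_measurable M" "integral\<^sup>N M h \<noteq> \<infinity>"
    "\<And>t. t \<in> space M \<Longrightarrow> 0 < h t" "\<And>t. t \<in> space M \<Longrightarrow> h t < \<infinity>"
    using sigma_finite_measure.Ex_finite_integrable_function[OF M] by blast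
  \<comment> \<open>A measurable version of the distance from \<open>s k n t\<close> to
    \<open>F k t\<close>, obtained by letting the second simple function run to its limit.\<close>
  define d where "d k n t = max 0 (lim (\<lambda>m. ndist Y (s k n t) (s k m t)))" for k n t
  have d_meas [measurable]: "d k n \<in> borel_measurable M" for k n
  proof -
    note [measurable] = simple_fun_ndist_measurable[OF s s]
    show ?thesis unfolding d_def[abs_def]
      by (intro borel_measurable_max borel_measurable_lim_metric) auto
  qed
  have d_eq: "AE t in M. d k n t = ndist Y (s k n t) (F k t)" for k n
    using Fin[of k] lim[of k]
  proof eventually_elim
    case (elim t)
    have "(\<lambda>m. nrm Y (\<lambda>a. s k n t a - s k m t a)) \<longlonglongrightarrow> nrm Y (\<lambda>a. s k n t a - F k t a)"
    proof (rule nrm_tendsto)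
      have "ndist Y (\<lambda>a. s k n t a - s k m t a) (\<lambda>a. s k n t a - F k t a) = ndist Y (F k t) (s k m t)" for m
        by (simp add: ndist_def)
      also have "\<dots> m = ndist Y (s k m t) (F k t)" for m
        by (rule Y_ndist_commute[OF elim(1) simple_fun_in[OF s]])
      finally show "(\<lambda>m. ndist Y (\<lambda>a. s k n t a - s k m t a) (\<lambda>a. s k n t a - F k t a)) \<longlonglongrightarrow> 0"
        using elim(2) by simp
    qed (intro Y_diff simple_fun_in[OF s] elim)+
    thus ?case
      using Y_nrm_nonneg[OF Y_diff[OF simple_fun_in[OF s] elim(1)]] by (simp add: d_def ndist_def limI)
  qed
  define I where "I k n = (\<integral>\<^sup>+t. h t * ennreal (min 1 (d k n t)) \<partial>M)" for k n
  have I_lim: "I k \<longlonglongrightarrow> 0" for k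
  proof -
    have "(\<lambda>n. \<integral>\<^sup>+t. h t * ennreal (min 1 (d k n t)) \<partial>M) \<longlonglongrightarrow> (\<integral>\<^sup>+t. 0 \<partial>M)"
    proof (rule nn_integral_dominated_convergence)
      show "AE t in M. h t * ennreal (min 1 (d k n t)) \<le> h t" for n
      proof (rule AE_I2)
        fix t
        have "h t * ennreal (min 1 (d k n t)) \<le> h t * ennreal 1" by (intro mult_left_mono ennreal_leI) auto
        thus "h t * ennreal (min 1 (d k n t)) \<le> h t" by simp
      qed
      show "AE t in M. (\<lambda>n. h t * ennreal (min 1 (d k n t))) \<longlonglongrightarrow> 0"
      proof -
        have "AE t in M. \<forall>n. d k n t = ndist Y (s k n t) (F k t)"
          using d_eq[of k] by (subst AE_all_countable) blast
        with lim[of k] AE_space show ?thesis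
        proof eventually_elim
          case (elim t)
          have "(\<lambda>n. min 1 (d k n t)) \<longlonglongrightarrow> min 1 0" using elim by (intro tendsto_min tendsto_const) simp
          hence "(\<lambda>n. h t * ennreal (min 1 (d k n t))) \<longlonglongrightarrow> h t * ennreal (min 1 0)"
            using h(4)[OF elim(2)] by (intro ennreal_tendsto_cmult tendsto_ennrealI) auto
          thus ?case by simp
        qed
      qed
      show "integral\<^sup>N M h < \<infinity>" using h(2) by (simp add: less_top)
    qed measurable
    thus ?thesis by (simp add: I_def[abs_def])
  qed
  have "\<exists>n. I k n < ennreal ((1 / 2) ^ k)" for k
    using order_tendstoD(2)[OF I_lim[of k], of "ennreal ((1 / 2) ^ k)"] by (auto simp: eventually_sequentially)
  then obtain n where n: "\<And>k. I k (n k) < ennreal ((1 / 2) ^ k)" by metis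
  have "(\<integral>\<^sup>+t. (\<Sum>k. h t * ennreal (min 1 (d k (n k) t))) \<partial>M) = (\<Sum>k. I k (n k))"
    unfolding I_def by (rule nn_integral_suminf) measurable
  also have "\<dots> \<le> (\<Sum>k. ennreal ((1 / 2) ^ k))"
    by (intro suminf_le) (auto intro: less_imp_le n)
  also have "\<dots> = ennreal (\<Sum>k. (1 / 2) ^ k)"
    by (rule suminf_ennreal2) (auto intro: summable_geometric)
  finally have "(\<integral>\<^sup>+t. (\<Sum>k. h t * ennreal (min 1 (d k (n k) t))) \<partial>M) \<noteq> \<infinity>"
    by (auto simp: top_unique)
  hence "AE t in M. (\<Sum>k. h t * ennreal (min 1 (d k (n k) t))) \<noteq> \<infinity>"
    by (intro nn_integral_PInf_AE) auto
  moreover have "AE t in M. \<forall>k. d k (n k) t = ndist Y (s k (n k) t) (F k t)"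
    using d_eq by (subst AE_all_countable) blast
  moreover have "AE t in M. \<forall>k. F k t \<in> elems Y"
    using Fin by (subst AE_all_countable) blast
  ultimately have "AE t in M. (\<lambda>k. ndist Y (s k (n k) t) (G t)) \<longlonglongrightarrow> 0"
    using G AE_space
  proof eventually_elim
    case (elim t)
    have ht: "0 < h t" "h t < \<infinity>" using h elim(6) by auto
    have dnn: "0 \<le> d k (n k) t" for k by (simp add: d_def)
    have "(\<Sum>k. h t * ennreal (min 1 (d k (n k) t))) = h t * (\<Sum>k. ennreal (min 1 (d k (n k) t)))"
      by simp
    hence "(\<Sum>k. ennreal (min 1 (d k (n k) t))) \<noteq> \<top>"
      using elim(1) ht by (auto simp: ennreal_mult_eq_top_iff)
    hence "summable (\<lambda>k. min 1 (d k (n k) t))"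
      using dnn by (intro summable_suminf_not_top) auto
    hence m0: "(\<lambda>k. min 1 (d k (n k) t)) \<longlonglongrightarrow> 0" by (rule summable_LIMSEQ_zero)
    have "(\<lambda>k. d k (n k) t) \<longlonglongrightarrow> 0"
    proof (rule Lim_transform_eventually[OF m0])
      have "\<forall>\<^sub>F k in sequentially. min 1 (d k (n k) t) < 1" by (rule order_tendstoD(2)[OF m0]) simp
      thus "\<forall>\<^sub>F k in sequentially. min 1 (d k (n k) t) = d k (n k) t"
        by eventually_elim (auto simp: min_def split: if_splits)
    qed
    hence "(\<lambda>k. ndist Y (s k (n k) t) (F k t) + ndist Y (F k t) (G t)) \<longlonglongrightarrow> 0 + 0"
      using elim(2,5) by (intro tendsto_add) simp_all
    hence lim': "(\<lambda>k. ndist Y (s k (n k) t) (F k t) + ndist Y (F k t) (G t)) \<longlonglongrightarrow> 0" by simp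
    show ?case
      by (rule tendsto_sandwich[OF _ _ tendsto_const lim'])
         (intro always_eventually allI Y_ndist_nonneg Y_ndist_triangle simple_fun_in[OF s] elim(4) elim(3)[rule_format])+
  qed
  thus ?thesis
    unfolding strongly_measurable_def using G(1) s by (intro conjI exI[of _ "\<lambda>k. s k (n k)"]) auto
qed

end

section \<open>Norm, completeness and functionals of \<open>L^p(Y)\<close>\<close>

locale Lp_koethe = koethe N Y for N :: "'w measure" and Y +
  fixes M :: "'x measure" and p :: real
  assumes M: "sigma_finite_measure M" and p: "1 < p"
begin

abbreviation X :: "('x \<times> 'w) fspace" where "X \<equiv> Lp_bochner M N Y p"

lemma p_ge: "1 \<le> p" using p by simp

lemma X_elems: "f \<in> elems X \<longleftrightarrow> f \<in> borel_measurable (M \<Otimes>\<^sub>M N) \<and> strongly_measurable M Y (\<lambda>x w. f (x, w)) \<and>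
    (\<integral>\<^sup>+x. ennreal (nrm Y (\<lambda>w. f (x, w)) powr p) \<partial>M) < \<infinity>"
  by (simp add: Lp_bochner_def)

lemma X_nrm: "nrm X f = enn2real (\<integral>\<^sup>+x. ennreal (nrm Y (\<lambda>w. f (x, w)) powr p) \<partial>M) powr (1 / p)"
  by (simp add: Lp_bochner_def)

lemma X_nrm_nonneg: "0 \<le> nrm X f"
  by (simp add: X_nrm)

lemma X_measurable: "f \<in> elems X \<Longrightarrow> f \<in> borel_measurable (M \<Otimes>\<^sub>M N)"
  and X_strongly: "f \<in> elems X \<Longrightarrow> strongly_measurable M Y (\<lambda>x w. f (x, w))"
  by (auto simp: X_elems)

lemma X_section: "f \<in> elems X \<Longrightarrow> AE x in M. (\<lambda>w. f (x, w)) \<in> elems Y"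
  using X_strongly unfolding strongly_measurable_def by blast

lemma X_integral: "f \<in> elems X \<Longrightarrow>
    (\<integral>\<^sup>+x. ennreal (nrm Y (\<lambda>w. f (x, w)) powr p) \<partial>M) = ennreal (nrm X f powr p)"
  using p by (simp add: X_elems X_nrm powr_powr less_top)

lemma section_measurable:
  "f \<in> borel_measurable (M \<Otimes>\<^sub>M N) \<Longrightarrow> x \<in> space M \<Longrightarrow> (\<lambda>w. f (x, w)) \<in> borel_measurable N"
  by (rule measurable_compose[OF measurable_Pair1'])

lemma X_norm_function:
  assumes "f \<in> elems X"
  obtains u where "u \<in> borel_measurable M" "\<And>x. 0 \<le> u x" "AE x in M. u x = nrm Y (\<lambda>w. f (x, w))"
    "(\<integral>\<^sup>+x. ennreal (u x powr p) \<partial>M) = ennreal (nrm X f powr p)"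
proof -
  obtain u where u: "u \<in> borel_measurable M" "\<And>x. 0 \<le> u x" "AE x in M. u x = nrm Y (\<lambda>w. f (x, w))"
    by (rule strongly_measurable_nrm[OF X_strongly[OF assms]]) (rule that)
  have "(\<integral>\<^sup>+x. ennreal (u x powr p) \<partial>M) = (\<integral>\<^sup>+x. ennreal (nrm Y (\<lambda>w. f (x, w)) powr p) \<partial>M)"
    using u(3) by (intro nn_integral_cong_AE) (auto elim!: eventually_mono)
  thus ?thesis using that[OF u] X_integral[OF assms] by simp
qed

lemma X_I:
  assumes f: "f \<in> borel_measurable (M \<Otimes>\<^sub>M N)" "strongly_measurable M Y (\<lambda>x w. f (x, w))"
    and c: "0 \<le> c" "(\<integral>\<^sup>+x. ennreal (v x powr p) \<partial>M) \<le> ennreal (c powr p)"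
    and v: "AE x in M. nrm Y (\<lambda>w. f (x, w)) \<le> v x"
  shows "f \<in> elems X \<and> nrm X f \<le> c"
proof -
  have "AE x in M. (\<lambda>w. f (x, w)) \<in> elems Y" using f(2) by (simp add: strongly_measurable_def)
  hence "(\<integral>\<^sup>+x. ennreal (nrm Y (\<lambda>w. f (x, w)) powr p) \<partial>M) \<le> (\<integral>\<^sup>+x. ennreal (v x powr p) \<partial>M)"
    using v p by (intro nn_integral_mono_AE)
      (auto elim!: eventually_elim2 intro!: ennreal_leI powr_mono2 Y_nrm_nonneg)
  hence le: "(\<integral>\<^sup>+x. ennreal (nrm Y (\<lambda>w. f (x, w)) powr p) \<partial>M) \<le> ennreal (c powr p)"
    using c(2) by (rule order.trans)
  hence "f \<in> elems X" using f by (auto simp: X_elems intro: order.strict_trans1)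
  moreover have "enn2real (\<integral>\<^sup>+x. ennreal (nrm Y (\<lambda>w. f (x, w)) powr p) \<partial>M) \<le> c powr p"
    by (rule enn2real_leI[OF _ le]) simp
  hence "nrm X f \<le> (c powr p) powr (1 / p)"
    unfolding X_nrm using p by (intro powr_mono2) auto
  ultimately show ?thesis using c(1) p by (simp add: powr_powr)
qed

lemma X_zero: "(\<lambda>_. 0) \<in> elems X"
proof -
  have "strongly_measurable M Y (\<lambda>x w. 0)"
    unfolding strongly_measurable_def using simple_fun_zero Y_zero
    by (intro conjI exI[of _ "\<lambda>n t a. 0"]) (auto simp: ndist_def Y_nrm_zero)
  thus ?thesis using X_I[of "\<lambda>_. 0" 0 "\<lambda>_. 0"] by (auto simp: Y_nrm_zero)
qed

lemma X_scale:
  assumes f: "f \<in> elems X"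
  shows "(\<lambda>a. c * f a) \<in> elems X" "nrm X (\<lambda>a. c * f a) = cmod c * nrm X f"
proof -
  note [measurable] = X_measurable[OF f]
  have le: "(\<lambda>a. c * g a) \<in> elems X \<and> nrm X (\<lambda>a. c * g a) \<le> cmod c * nrm X g" if g: "g \<in> elems X" for g c
  proof -
    note [measurable] = X_measurable[OF g]
    obtain u where u: "u \<in> borel_measurable M" "\<And>x. 0 \<le> u x" "AE x in M. u x = nrm Y (\<lambda>w. g (x, w))"
      "(\<integral>\<^sup>+x. ennreal (u x powr p) \<partial>M) = ennreal (nrm X g powr p)"
      by (rule X_norm_function[OF g]) (rule that)
    note [measurable] = u(1)
    show ?thesis
    proof (rule X_I)
      show "strongly_measurable M Y (\<lambda>x w. c * g (x, w))"
        using strongly_measurable_lin[OF X_strongly[OF g] X_strongly[OF X_zero], of c] by simp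
      have "(\<integral>\<^sup>+x. ennreal ((cmod c * u x) powr p) \<partial>M) = (\<integral>\<^sup>+x. ennreal (cmod c powr p) * ennreal (u x powr p) \<partial>M)"
        by (simp add: powr_mult ennreal_mult)
      also have "\<dots> = ennreal (cmod c powr p) * ennreal (nrm X g powr p)"
        by (simp add: nn_integral_cmult u(4))
      finally show "(\<integral>\<^sup>+x. ennreal ((cmod c * u x) powr p) \<partial>M) \<le> ennreal ((cmod c * nrm X g) powr p)"
        by (simp add: powr_mult ennreal_mult)
      show "AE x in M. nrm Y (\<lambda>w. c * g (x, w)) \<le> cmod c * u x"
        using u(3) X_section[OF g] by eventually_elim (simp add: Y_nrm_scale)
    qed (use X_nrm_nonneg in auto)
  qed
  show 1: "(\<lambda>a. c * f a) \<in> elems X" using le[OF f] by blast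
  show "nrm X (\<lambda>a. c * f a) = cmod c * nrm X f"
  proof (cases "c = 0")
    case True
    thus ?thesis using le[OF f, of 0] X_nrm_nonneg[of "\<lambda>_. 0"] by simp
  next
    case False
    have "nrm X f \<le> cmod (1 / c) * nrm X (\<lambda>a. c * f a)"
      using le[OF 1, of "1 / c"] False by simp
    hence "cmod c * nrm X f \<le> nrm X (\<lambda>a. c * f a)"
      using False by (simp add: norm_divide field_simps)
    thus ?thesis using le[OF f, of c] by simp
  qed
qed

lemma X_add:
  assumes f: "f \<in> elems X" and g: "g \<in> elems X"
  shows "(\<lambda>a. f a + g a) \<in> elems X \<and> nrm X (\<lambda>a. f a + g a) \<le> nrm X f + nrm X g"
proof -
  note [measurable] = X_measurable[OF f] X_measurable[OF g]
  obtain u where u: "u \<in> borel_measurable M" "\<And>x. 0 \<le> u x" "AE x in M. u x = nrm Y (\<lambda>w. f (x, w))"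
    "(\<integral>\<^sup>+x. ennreal (u x powr p) \<partial>M) = ennreal (nrm X f powr p)"
    by (rule X_norm_function[OF f]) (rule that)
  obtain v where v: "v \<in> borel_measurable M" "\<And>x. 0 \<le> v x" "AE x in M. v x = nrm Y (\<lambda>w. g (x, w))"
    "(\<integral>\<^sup>+x. ennreal (v x powr p) \<partial>M) = ennreal (nrm X g powr p)"
    by (rule X_norm_function[OF g]) (rule that)
  show ?thesis
  proof (rule X_I)
    show "strongly_measurable M Y (\<lambda>x w. f (x, w) + g (x, w))"
      using strongly_measurable_lin[OF X_strongly[OF f] X_strongly[OF g], of 1] by simp
    show "(\<integral>\<^sup>+x. ennreal ((u x + v x) powr p) \<partial>M) \<le> ennreal ((nrm X f + nrm X g) powr p)"
      by (rule nn_Minkowski[OF p_ge u(1) v(1) u(2) v(2)]) (auto simp: u(4) v(4) X_nrm_nonneg)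
    show "AE x in M. nrm Y (\<lambda>w. f (x, w) + g (x, w)) \<le> u x + v x"
      using u(3) v(3) X_section[OF f] X_section[OF g] by eventually_elim (simp add: Y_nrm_add)
  qed (auto simp: X_nrm_nonneg)
qed

lemma pair: "pair_sigma_finite M N"
  using M N by (simp add: pair_sigma_finite_def)

lemma X_cong_AE:
  assumes f: "f \<in> elems X" and [measurable]: "g \<in> borel_measurable (M \<Otimes>\<^sub>M N)" and ae: "AE z in M \<Otimes>\<^sub>M N. g z = f z"
  shows "g \<in> elems X" "ndist X g f = 0"
proof -
  note [measurable] = X_measurable[OF f]
  have "AE x in M. AE w in N. g (x, w) = f (x, w)"
    using pair_sigma_finite.AE_pair[OF pair ae] .
  hence 1: "AE x in M. (\<lambda>w. g (x, w)) \<in> elems Y \<and> ndist Y (\<lambda>w. g (x, w)) (\<lambda>w. f (x, w)) = 0"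
    using X_section[OF f] AE_space by eventually_elim (simp add: Y_cong_AE section_measurable)
  have g: "g \<in> elems X"
  proof -
    obtain u where u: "u \<in> borel_measurable M" "\<And>x. 0 \<le> u x" "AE x in M. u x = nrm Y (\<lambda>w. f (x, w))"
      "(\<integral>\<^sup>+x. ennreal (u x powr p) \<partial>M) = ennreal (nrm X f powr p)"
      by (rule X_norm_function[OF f]) (rule that)
    have "AE x in M. nrm Y (\<lambda>w. g (x, w)) \<le> u x"
      using 1 u(3) X_section[OF f]
    proof eventually_elim
      case (elim x)
      thus ?case using Y_nrm_triangle[of "\<lambda>w. g (x, w)" "\<lambda>w. f (x, w)"] by simp
    qed
    from X_I[OF _ strongly_measurable_cong[OF X_strongly[OF f] 1] _ _ this, of "nrm X f"] show ?thesis
      by (simp add: u(4) X_nrm_nonneg)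
  qed
  thus "g \<in> elems X" .
  have "(\<lambda>a. g a + - 1 * f a) \<in> elems X" by (intro conjunct1[OF X_add] g X_scale f)
  hence d: "(\<lambda>a. g a - f a) \<in> elems X" by simp
  have "AE x in M. nrm Y (\<lambda>w. g (x, w) - f (x, w)) \<le> 0"
    using 1 by eventually_elim (simp add: ndist_def)
  from X_I[OF X_measurable[OF d] X_strongly[OF d] _ _ this, of 0]
  have "nrm X (\<lambda>a. g a - f a) \<le> 0" by simp
  thus "ndist X g f = 0" using X_nrm_nonneg[of "\<lambda>a. g a - f a"] by (simp add: ndist_def)
qed

text \<open>Minkowski's inequality for the fibre norms reduces summability in \<open>L^p(Y)\<close>
  to summability in Y for almost every x, and from there to almost every point of the product. The
  last clause is the bound by which remainders of series are estimated.\<close>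

lemma X_series:
  assumes g: "\<And>n::nat. g n \<in> elems X" and s: "summable (\<lambda>n. nrm X (g n))"
  shows "AE x in M. (\<forall>n. (\<lambda>w. g n (x, w)) \<in> elems Y) \<and> summable (\<lambda>n. nrm Y (\<lambda>w. g n (x, w)))"
    "AE z in M \<Otimes>\<^sub>M N. summable (\<lambda>n. cmod (g n z))"
    "\<And>f. f \<in> borel_measurable (M \<Otimes>\<^sub>M N) \<Longrightarrow> strongly_measurable M Y (\<lambda>x w. f (x, w)) \<Longrightarrow>
       AE x in M. nrm Y (\<lambda>w. f (x, w)) \<le> (\<Sum>n. nrm Y (\<lambda>w. g n (x, w))) \<Longrightarrow>
       f \<in> elems X \<and> nrm X f \<le> (\<Sum>n. nrm X (g n))"
proof -
  have "\<exists>u. u \<in> borel_measurable M \<and> (\<forall>x. 0 \<le> u x) \<and> (AE x in M. u x = nrm Y (\<lambda>w. g n (x, w))) \<and>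
    (\<integral>\<^sup>+x. ennreal (u x powr p) \<partial>M) = ennreal (nrm X (g n) powr p)" for n
    by (rule X_norm_function[OF g[of n]]) blast
  from choice[OF allI[OF this]] obtain u where u0: "\<forall>n. u n \<in> borel_measurable M \<and> (\<forall>x. 0 \<le> u n x) \<and>
    (AE x in M. u n x = nrm Y (\<lambda>w. g n (x, w))) \<and>
    (\<integral>\<^sup>+x. ennreal (u n x powr p) \<partial>M) = ennreal (nrm X (g n) powr p)" ..
  have u: "u n \<in> borel_measurable M" "0 \<le> u n x" "AE x in M. u n x = nrm Y (\<lambda>w. g n (x, w))"
    "(\<integral>\<^sup>+x. ennreal (u n x powr p) \<partial>M) \<le> ennreal (nrm X (g n) powr p)" for n x
    using u0[THEN spec, of n] by simp_all
  note mink = nn_Minkowski_series[OF p_ge u(1,2) X_nrm_nonneg s u(4)]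
  have ueq: "AE x in M. \<forall>n. u n x = nrm Y (\<lambda>w. g n (x, w))"
    using u(3) by (subst AE_all_countable) blast
  have sec: "AE x in M. \<forall>n. (\<lambda>w. g n (x, w)) \<in> elems Y"
    using X_section[OF g] by (subst AE_all_countable) blast
  show 1: "AE x in M. (\<forall>n. (\<lambda>w. g n (x, w)) \<in> elems Y) \<and> summable (\<lambda>n. nrm Y (\<lambda>w. g n (x, w)))"
    using mink(1) ueq sec by eventually_elim simp
  note [measurable] = X_measurable[OF g]
  have "AE x in M. AE w in N. summable (\<lambda>n. cmod (g n (x, w)))"
    using 1 by eventually_elim (rule Y_series(1), auto)
  \<comment> \<open>Passing from almost every fibre to almost every point of the product requires a
    measurable set; summability is therefore expressed as finiteness of an extended nonnegative
    sum.\<close>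
  moreover have "{z \<in> space (M \<Otimes>\<^sub>M N). summable (\<lambda>n. cmod (g n z))} \<in> sets (M \<Otimes>\<^sub>M N)"
  proof -
    have "summable (\<lambda>n. cmod (g n z)) \<longleftrightarrow> (\<Sum>n. ennreal (cmod (g n z))) \<noteq> \<top>" for z
    proof
      assume *: "summable (\<lambda>n. cmod (g n z))"
      show "(\<Sum>n. ennreal (cmod (g n z))) \<noteq> \<top>"
        by (simp add: suminf_ennreal2[OF _ *])
    next
      assume "(\<Sum>n. ennreal (cmod (g n z))) \<noteq> \<top>"
      thus "summable (\<lambda>n. cmod (g n z))" by (intro summable_suminf_not_top) auto
    qed
    thus ?thesis by simp
  qed
  ultimately show "AE z in M \<Otimes>\<^sub>M N. summable (\<lambda>n. cmod (g n z))"
    by (intro pair_sigma_finite.AE_pair_measure[OF pair]) auto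
  fix f assume f: "f \<in> borel_measurable (M \<Otimes>\<^sub>M N)" "strongly_measurable M Y (\<lambda>x w. f (x, w))"
    "AE x in M. nrm Y (\<lambda>w. f (x, w)) \<le> (\<Sum>n. nrm Y (\<lambda>w. g n (x, w)))"
  show "f \<in> elems X \<and> nrm X f \<le> (\<Sum>n. nrm X (g n))"
  proof (rule X_I[OF f(1,2) _ mink(2)])
    show "AE x in M. nrm Y (\<lambda>w. f (x, w)) \<le> (\<Sum>n. u n x)"
      using f(3) ueq by eventually_elim simp
  qed (intro suminf_nonneg s X_nrm_nonneg)
qed

text \<open>The sum is formed pointwise on the product, which makes it jointly measurable at once;
  strong measurability follows because the partial sums converge in Y for almost every x.\<close>

lemma X_complete_series:
  assumes g: "\<And>n::nat. g n \<in> elems X" and s: "summable (\<lambda>n. nrm X (g n))"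
  shows "\<exists>f\<in>elems X. (\<lambda>k. ndist X (\<lambda>z. \<Sum>n<k. g n z) f) \<longlonglongrightarrow> 0"
proof -
  note [measurable] = X_measurable[OF g]
  have [measurable]: "(\<lambda>z. \<Sum>n<k. g n z) \<in> borel_measurable (M \<Otimes>\<^sub>M N)" for k by measurable
  define f where "f z = lim (\<lambda>k. \<Sum>n<k. g n z)" for z
  have f_meas [measurable]: "f \<in> borel_measurable (M \<Otimes>\<^sub>M N)"
    unfolding f_def[abs_def] by (intro borel_measurable_lim_metric) measurable
  have S_in: "(\<lambda>z. \<Sum>n<k. g n z) \<in> elems X" for k
  proof (induction k)
    case (Suc k)
    thus ?case using X_add[OF Suc g[of k]] by simp
  qed (simp add: X_zero)
  have tail: "AE x in M. (\<forall>n. (\<lambda>w. g n (x, w)) \<in> elems Y) \<and> summable (\<lambda>n. nrm Y (\<lambda>w. g n (x, w))) \<and>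
     (\<forall>k. (\<lambda>w. f (x, w) - (\<Sum>n<k. g n (x, w))) \<in> elems Y \<and>
      nrm Y (\<lambda>w. f (x, w) - (\<Sum>n<k. g n (x, w))) \<le> (\<Sum>n. nrm Y (\<lambda>w. g (n + k) (x, w))))"
    using X_series(1)[OF g s] AE_space
  proof eventually_elim
    case (elim x)
    have gY: "(\<lambda>w. g n (x, w)) \<in> elems Y" for n using elim by blast
    have sY: "summable (\<lambda>n. nrm Y (\<lambda>w. g n (x, w)))" using elim by blast
    have "(\<lambda>w. f (x, w) - (\<Sum>n<k. g n (x, w))) \<in> elems Y \<and>
      nrm Y (\<lambda>w. f (x, w) - (\<Sum>n<k. g n (x, w))) \<le> (\<Sum>n. nrm Y (\<lambda>w. g (n + k) (x, w)))" for k
    proof (rule Y_series(2))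
      show "summable (\<lambda>n. nrm Y (\<lambda>w. g (n + k) (x, w)))" using sY by (rule summable_ignore_initial_segment)
      show "(\<lambda>w. f (x, w) - (\<Sum>n<k. g n (x, w))) \<in> borel_measurable N"
        using elim(2) by measurable
      show "AE w in N. cmod (f (x, w) - (\<Sum>n<k. g n (x, w))) \<le> (\<Sum>n. cmod (g (n + k) (x, w)))"
        using Y_series(1)[OF gY sY]
      proof eventually_elim
        case (elim w)
        have "summable (\<lambda>n. g n (x, w))" using elim by (rule summable_norm_cancel)
        hence "f (x, w) = (\<Sum>n. g n (x, w))"
          unfolding f_def using summable_LIMSEQ limI by blast
        also have "\<dots> = (\<Sum>n. g (n + k) (x, w)) + (\<Sum>n<k. g n (x, w))"
          by (rule suminf_split_initial_segment) fact
        finally have "f (x, w) - (\<Sum>n<k. g n (x, w)) = (\<Sum>n. g (n + k) (x, w))" by simp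
        thus ?case
          using summable_norm[OF summable_ignore_initial_segment[OF elim, of k]] by simp
      qed
    qed (rule gY)
    thus ?case using gY sY by blast
  qed
  have sm: "strongly_measurable M Y (\<lambda>x w. f (x, w))"
  proof (rule strongly_measurable_limit[OF M X_strongly[OF S_in]])
    show "AE x in M. (\<lambda>w. f (x, w)) \<in> elems Y"
      using tail
    proof eventually_elim
      case (elim x)
      from elim have "(\<lambda>w. f (x, w) - (\<Sum>n<0. g n (x, w))) \<in> elems Y" by blast
      thus ?case by simp
    qed
    show "AE x in M. (\<lambda>k. ndist Y (\<lambda>w. \<Sum>n<k. g n (x, w)) (\<lambda>w. f (x, w))) \<longlonglongrightarrow> 0"
      using tail
    proof eventually_elim
      case (elim x)
      have fS: "(\<lambda>w. f (x, w) - (\<Sum>n<k. g n (x, w))) \<in> elems Y"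
        "nrm Y (\<lambda>w. f (x, w) - (\<Sum>n<k. g n (x, w))) \<le> (\<Sum>n. nrm Y (\<lambda>w. g (n + k) (x, w)))" for k
        using elim by blast+
      have eq: "ndist Y (\<lambda>w. \<Sum>n<k. g n (x, w)) (\<lambda>w. f (x, w)) = nrm Y (\<lambda>w. f (x, w) - (\<Sum>n<k. g n (x, w)))" for k
        unfolding ndist_def using Y_nrm_scale[OF fS(1)[of k], of "- 1"] by simp
      have lim: "(\<lambda>k. \<Sum>n. nrm Y (\<lambda>w. g (n + k) (x, w))) \<longlonglongrightarrow> 0"
        using elim by (intro suminf_exist_split2) blast
      show ?case
        unfolding eq
        by (rule tendsto_sandwich[OF _ _ tendsto_const lim]) (use fS Y_nrm_nonneg in auto)
    qed
  qed
  have d: "(\<lambda>z. f z - (\<Sum>n<k. g n z)) \<in> elems X \<and> nrm X (\<lambda>z. f z - (\<Sum>n<k. g n z)) \<le> (\<Sum>n. nrm X (g (n + k)))" for k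
  proof (rule X_series(3)[OF g summable_ignore_initial_segment[OF s]])
    show "strongly_measurable M Y (\<lambda>x w. f (x, w) - (\<Sum>n<k. g n (x, w)))"
      using strongly_measurable_lin[OF X_strongly[OF S_in] sm, of "- 1" k] by simp
    show "AE x in M. nrm Y (\<lambda>w. f (x, w) - (\<Sum>n<k. g n (x, w))) \<le> (\<Sum>n. nrm Y (\<lambda>w. g (n + k) (x, w)))"
      using tail by eventually_elim blast
  qed measurable
  have f: "f \<in> elems X" using d[of 0] by simp
  have eq: "ndist X (\<lambda>z. \<Sum>n<k. g n z) f = nrm X (\<lambda>z. f z - (\<Sum>n<k. g n z))" for k
    unfolding ndist_def using X_scale(2)[OF conjunct1[OF d[of k]], of "- 1"] by simp
  have lim: "(\<lambda>k. \<Sum>n. nrm X (g (n + k))) \<longlonglongrightarrow> 0" by (rule suminf_exist_split2[OF s])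
  have "(\<lambda>k. ndist X (\<lambda>z. \<Sum>n<k. g n z) f) \<longlonglongrightarrow> 0"
    unfolding eq
    by (rule tendsto_sandwich[OF _ _ tendsto_const lim]) (use d X_nrm_nonneg in auto)
  thus ?thesis using f by blast
qed

text \<open>On a set of finite measure t <= 1 + t^p replaces Hoelder's inequality. The resulting
  bound is not homogeneous; \<open>bfun_local_integral\<close> repairs this by scaling.\<close>

lemma X_local_integral:
  assumes E: "E \<in> sets M" "emeasure M E < \<infinity>" and B: "B \<in> sets N" "emeasure N B < \<infinity>"
  obtains C where "C \<ge> 0" "\<And>f. f \<in> elems X \<Longrightarrow>
     (\<integral>\<^sup>+z. ennreal (cmod (f z)) * indicator (E \<times> B) z \<partial>(M \<Otimes>\<^sub>M N)) \<le> ennreal (C * (1 + nrm X f powr p))"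
proof -
  obtain C where C: "C \<ge> 0" "\<And>f. f \<in> elems Y \<Longrightarrow> (\<integral>\<^sup>+w. ennreal (cmod (f w)) * indicator B w \<partial>N) \<le> ennreal (C * nrm Y f)"
    by (rule Y_integral_bound[OF B]) (rule that)
  note [measurable] = E(1) B(1)
  define m where "m = measure M E"
  have m: "emeasure M E = ennreal m" "m \<ge> 0" using E(2) by (auto simp: m_def emeasure_eq_ennreal_measure less_top)
  show ?thesis
  proof (rule that[of "C * (m + 1)"])
    fix f assume f: "f \<in> elems X"
    note [measurable] = X_measurable[OF f]
    obtain u where u: "u \<in> borel_measurable M" "\<And>x. 0 \<le> u x" "AE x in M. u x = nrm Y (\<lambda>w. f (x, w))"
      "(\<integral>\<^sup>+x. ennreal (u x powr p) \<partial>M) = ennreal (nrm X f powr p)"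
      by (rule X_norm_function[OF f]) (rule that)
    note [measurable] = u(1)
    have "(\<integral>\<^sup>+z. ennreal (cmod (f z)) * indicator (E \<times> B) z \<partial>(M \<Otimes>\<^sub>M N))
        = (\<integral>\<^sup>+x. \<integral>\<^sup>+w. ennreal (cmod (f (x, w))) * indicator (E \<times> B) (x, w) \<partial>N \<partial>M)"
      by (rule sigma_finite_measure.nn_integral_fst[OF N, symmetric]) measurable
    also have "\<dots> \<le> (\<integral>\<^sup>+x. ennreal C * (indicator E x + ennreal (u x powr p)) \<partial>M)"
    proof (rule nn_integral_mono_AE)
      show "AE x in M. (\<integral>\<^sup>+w. ennreal (cmod (f (x, w))) * indicator (E \<times> B) (x, w) \<partial>N)
              \<le> ennreal C * (indicator E x + ennreal (u x powr p))"
        using X_section[OF f] u(3)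
      proof eventually_elim
        case (elim x)
        show ?case
        proof (cases "x \<in> E")
          case True
          have "(\<integral>\<^sup>+w. ennreal (cmod (f (x, w))) * indicator (E \<times> B) (x, w) \<partial>N)
             = (\<integral>\<^sup>+w. ennreal (cmod (f (x, w))) * indicator B w \<partial>N)"
            using True by (simp add: indicator_times)
          also have "\<dots> \<le> ennreal (C * u x)" using C(2)[OF elim(1)] elim(2) by simp
          also have "\<dots> \<le> ennreal (C * (1 + u x powr p))"
          proof (intro ennreal_leI mult_left_mono C(1))
            show "u x \<le> 1 + u x powr p"
            proof (cases "u x \<le> 1")
              case False
              hence "u x powr 1 \<le> u x powr p" using p by (intro powr_mono) auto
              thus ?thesis using False by simp
            qed (simp add: add_increasing2)
          qed
          also have "\<dots> = ennreal C * (indicator E x + ennreal (u x powr p))"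
            using True C(1) by (simp add: ennreal_mult)
          finally show ?thesis .
        qed (simp add: indicator_times)
      qed
    qed
    also have "\<dots> = ennreal C * (emeasure M E + ennreal (nrm X f powr p))"
      by (simp add: nn_integral_cmult nn_integral_add u(4))
    also have "\<dots> = ennreal (C * (m + nrm X f powr p))"
      using C(1) m by (simp add: ennreal_mult)
    also have "\<dots> \<le> ennreal (C * (m + 1) * (1 + nrm X f powr p))"
      using C(1) m(2) by (intro ennreal_leI) (simp add: algebra_simps mult_left_mono)
    finally show "(\<integral>\<^sup>+z. ennreal (cmod (f z)) * indicator (E \<times> B) z \<partial>(M \<Otimes>\<^sub>M N))
         \<le> ennreal (C * (m + 1) * (1 + nrm X f powr p))" .
  qed (use C(1) m(2) in auto)
qed

text \<open>A linear functional with |l(f)| <= C(1 + ||f||^p) satisfies |l(f)| <= 2C||f||: scale f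
  to norm 1. If f is null, large multiples of it would violate the first bound unless l(f) =
  0.\<close>

lemma bfun_local_integral:
  assumes E: "E \<in> sets M" "emeasure M E < \<infinity>" and B: "B \<in> sets N" "emeasure N B < \<infinity>"
    and g [measurable]: "g \<in> borel_measurable (M \<Otimes>\<^sub>M N)" "\<And>z. cmod (g z) \<le> 1"
  shows "bfun X (\<lambda>f. \<integral>z. indicator (E \<times> B) z * g z * f z \<partial>(M \<Otimes>\<^sub>M N))" (is "bfun X ?l")
    "f \<in> elems X \<Longrightarrow> integrable (M \<Otimes>\<^sub>M N) (\<lambda>z. indicator (E \<times> B) z * g z * f z)"
proof -
  obtain C where C: "C \<ge> 0" "\<And>f. f \<in> elems X \<Longrightarrow>
     (\<integral>\<^sup>+z. ennreal (cmod (f z)) * indicator (E \<times> B) z \<partial>(M \<Otimes>\<^sub>M N)) \<le> ennreal (C * (1 + nrm X f powr p))"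
    by (rule X_local_integral[OF E B]) (rule that)
  note [measurable] = E(1) B(1)
  have nn: "(\<integral>\<^sup>+z. ennreal (cmod (indicator (E \<times> B) z * g z * f z)) \<partial>(M \<Otimes>\<^sub>M N)) \<le> ennreal (C * (1 + nrm X f powr p))"
    if f: "f \<in> elems X" for f
  proof -
    have "cmod (g z) * cmod (f z) \<le> cmod (f z)" for z
      using g(2)[of z] by (simp add: mult_left_le_one_le)
    hence "(\<integral>\<^sup>+z. ennreal (cmod (indicator (E \<times> B) z * g z * f z)) \<partial>(M \<Otimes>\<^sub>M N))
        \<le> (\<integral>\<^sup>+z. ennreal (cmod (f z)) * indicator (E \<times> B) z \<partial>(M \<Otimes>\<^sub>M N))"
      by (intro nn_integral_mono) (auto simp: indicator_def norm_mult intro!: ennreal_leI)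
    thus ?thesis using C(2)[OF f] by (rule order.trans)
  qed
  have int: "integrable (M \<Otimes>\<^sub>M N) (\<lambda>z. indicator (E \<times> B) z * g z * f z)" if f: "f \<in> elems X" for f
  proof (rule integrableI_bounded)
    note [measurable] = X_measurable[OF f]
    show "(\<lambda>z. indicator (E \<times> B) z * g z * f z) \<in> borel_measurable (M \<Otimes>\<^sub>M N)" by measurable
    show "(\<integral>\<^sup>+z. ennreal (cmod (indicator (E \<times> B) z * g z * f z)) \<partial>(M \<Otimes>\<^sub>M N)) < \<infinity>"
      using order.strict_trans1[OF nn[OF f]] by simp
  qed
  thus "f \<in> elems X \<Longrightarrow> integrable (M \<Otimes>\<^sub>M N) (\<lambda>z. indicator (E \<times> B) z * g z * f z)" .
  have lin: "?l (\<lambda>a. c * f a + f' a) = c * ?l f + ?l f'" if f: "f \<in> elems X" "f' \<in> elems X" for f f' c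
  proof -
    have "(\<lambda>z. indicator (E \<times> B) z * g z * (c * f z + f' z)) =
       (\<lambda>z. c * (indicator (E \<times> B) z * g z * f z) + indicator (E \<times> B) z * g z * f' z)"
      by (auto simp: algebra_simps)
    thus ?thesis using int[OF f(1)] int[OF f(2)] by (simp only: Bochner_Integration.integral_add integrable_mult_right integral_mult_right_zero)
  qed
  have bd: "cmod (?l f) \<le> C * (1 + nrm X f powr p)" if f: "f \<in> elems X" for f
  proof -
    have "ennreal (cmod (?l f)) \<le> (\<integral>\<^sup>+z. ennreal (cmod (indicator (E \<times> B) z * g z * f z)) \<partial>(M \<Otimes>\<^sub>M N))"
      by (rule integral_norm_bound_ennreal[OF int[OF f]])
    also note nn[OF f]
    finally show ?thesis using C(1) by (subst (asm) ennreal_le_iff) auto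
  qed
  have scale: "?l (\<lambda>a. c * f a) = c * ?l f" if "f \<in> elems X" for c f
    using lin[OF that X_zero, of c] by simp
  have "cmod (?l f) \<le> (2 * C) * nrm X f" if f: "f \<in> elems X" for f
  proof (cases "nrm X f = 0")
    case True
    have "cmod (?l f) \<le> 0"
    proof (rule ccontr)
      assume "\<not> cmod (?l f) \<le> 0"
      hence pos: "cmod (?l f) > 0" by simp
      define t where "t = (C + 1) / cmod (?l f)"
      have "cmod (?l (\<lambda>a. complex_of_real t * f a)) \<le> C * (1 + nrm X (\<lambda>a. complex_of_real t * f a) powr p)"
        by (intro bd X_scale f)
      hence "\<bar>t\<bar> * cmod (?l f) \<le> C"
        using p True f by (simp only: scale norm_mult norm_of_real X_scale(2)) simp
      thus False using C(1) pos by (simp add: t_def)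
    qed
    thus ?thesis using True by simp
  next
    case False
    hence pos: "nrm X f > 0" using X_nrm_nonneg[of f] by simp
    define t where "t = 1 / nrm X f"
    have t: "t > 0" "t * nrm X f = 1" using pos by (auto simp: t_def)
    have "cmod (?l (\<lambda>a. complex_of_real t * f a)) \<le> C * (1 + nrm X (\<lambda>a. complex_of_real t * f a) powr p)"
      by (intro bd X_scale f)
    also have "nrm X (\<lambda>a. complex_of_real t * f a) = 1" using t f by (simp add: X_scale(2))
    finally have "t * cmod (?l f) \<le> 2 * C" using t f by (simp only: scale norm_mult norm_of_real) simp
    thus ?thesis using pos by (simp add: t_def field_simps)
  qed
  thus "bfun X ?l" unfolding bfun_def using lin by blast
qed

text \<open>Testing against \<open>sgn f\<close> shows that these functionals separate points.\<close>

lemma X_separating: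
  assumes f: "f \<in> elems X" and l: "\<And>l. bfun X l \<Longrightarrow> l f = 0"
  shows "nrm X f = 0"
proof -
  note [measurable] = X_measurable[OF f]
  define g where "g z = cnj (sgn (f z))" for z
  have g [measurable]: "g \<in> borel_measurable (M \<Otimes>\<^sub>M N)"
  proof -
    have "(\<lambda>z. cnj (f z)) \<in> borel_measurable (M \<Otimes>\<^sub>M N)"
      by (rule borel_measurable_continuous_on[OF _ X_measurable[OF f]]) (intro continuous_intros)
    hence "(\<lambda>z. cnj (f z) / complex_of_real (cmod (f z))) \<in> borel_measurable (M \<Otimes>\<^sub>M N)" by measurable
    thus ?thesis by (simp add: g_def[abs_def] sgn_eq)
  qed
  have g1: "cmod (g z) \<le> 1" for z by (simp add: g_def norm_sgn)
  have gf: "g z * f z = complex_of_real (cmod (f z))" for z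
    by (simp add: g_def sgn_eq complex_norm_square[symmetric] mult.commute[of "cnj (f z)"] power2_eq_square)
  have ae: "AE z in M \<Otimes>\<^sub>M N. z \<in> E \<times> B \<longrightarrow> f z = 0"
    if E: "E \<in> sets M" "emeasure M E < \<infinity>" and B: "B \<in> sets N" "emeasure N B < \<infinity>" for E B
  proof -
    note [measurable] = E(1) B(1)
    have eq: "(\<lambda>z. indicator (E \<times> B) z * g z * f z) = (\<lambda>z. complex_of_real (indicator (E \<times> B) z * cmod (f z)))"
      by (auto simp: mult.assoc gf indicator_def)
    have "(\<integral>z. indicator (E \<times> B) z * g z * f z \<partial>(M \<Otimes>\<^sub>M N)) = 0"
      by (rule l[OF bfun_local_integral(1)[OF E B g g1]])
    hence "complex_of_real (\<integral>z. indicator (E \<times> B) z * cmod (f z) \<partial>(M \<Otimes>\<^sub>M N)) = 0"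
      unfolding eq by (simp only: integral_complex_of_real)
    hence "(\<integral>z. indicator (E \<times> B) z * cmod (f z) \<partial>(M \<Otimes>\<^sub>M N)) = 0" by (simp only: of_real_eq_0_iff)
    moreover have "integrable (M \<Otimes>\<^sub>M N) (\<lambda>z. indicator (E \<times> B) z * cmod (f z))"
      using bfun_local_integral(2)[OF E B g g1 f] unfolding eq by (simp only: complex_of_real_integrable_eq)
    ultimately have "AE z in M \<Otimes>\<^sub>M N. indicator (E \<times> B) z * cmod (f z) = 0"
      by (subst (asm) integral_nonneg_eq_0_iff_AE) auto
    thus ?thesis by eventually_elim (auto simp: indicator_def split: if_splits)
  qed
  obtain E :: "nat \<Rightarrow> 'x set" where E: "range E \<subseteq> sets M" "(\<Union>i. E i) = space M" "\<And>i. emeasure M (E i) \<noteq> \<infinity>"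
    by (rule sigma_finite_measure.sigma_finite[OF M]) (rule that)
  obtain B :: "nat \<Rightarrow> 'w set" where B: "range B \<subseteq> sets N" "(\<Union>i. B i) = space N" "\<And>i. emeasure N (B i) \<noteq> \<infinity>"
    by (rule sigma_finite_measure.sigma_finite[OF N]) (rule that)
  have "AE z in M \<Otimes>\<^sub>M N. z \<in> E i \<times> B j \<longrightarrow> f z = 0" for i j
    using E(1) B(1) E(3)[of i] B(3)[of j] by (intro ae) (auto simp: less_top)
  hence "AE z in M \<Otimes>\<^sub>M N. \<forall>i j. z \<in> E i \<times> B j \<longrightarrow> f z = 0"
    by (simp only: AE_all_countable) blast
  hence "AE z in M \<Otimes>\<^sub>M N. 0 = f z"
    using AE_space
  proof eventually_elim
    case (elim z)
    obtain x w where z: "z = (x, w)" by (cases z)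
    have "x \<in> space M" "w \<in> space N" using elim(2) by (auto simp: z space_pair_measure)
    then obtain i j where "x \<in> E i" "w \<in> B j" using E(2) B(2) by blast
    thus ?case using elim(1) z by auto
  qed
  from X_cong_AE[OF f _ this] have "ndist X (\<lambda>_. 0) f = 0" by simp
  thus ?thesis using X_scale(2)[OF f, of "- 1"] by (simp add: ndist_def)
qed

lemma X_separated_fspace: "separated_fspace X"
  by unfold_locales
     (use X_zero X_add X_scale X_nrm_nonneg X_separating in blast)+

end

section \<open>Continuous paths by dyadic interpolation\<close>

definition clamp01 :: "real \<Rightarrow> real" where
  "clamp01 x = min 1 (max 0 x)"

lemma clamp01_le: "x \<le> 0 \<Longrightarrow> clamp01 x = 0" and clamp01_ge: "1 \<le> x \<Longrightarrow> clamp01 x = 1"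
  and clamp01_mid: "0 \<le> x \<Longrightarrow> x \<le> 1 \<Longrightarrow> clamp01 x = x"
  by (auto simp: clamp01_def)

text \<open>Halving the mesh: the clamped coordinate of an interval is the mean of those of its
  halves, so the coarse interpolation can be rewritten on the fine mesh.\<close>

lemma clamp01_double: "clamp01 (2 * x) + clamp01 (2 * x - 1) = 2 * clamp01 x"
  and clamp01_diff: "\<bar>clamp01 (2 * x) - clamp01 x\<bar> \<le> 1"
  by (simp_all add: clamp01_def min_def max_def)

lemma continuous_clamp01: "continuous_on S (\<lambda>t. clamp01 (c * t - d))"
  unfolding clamp01_def by (intro continuous_intros)

text \<open>Piecewise linear interpolation, written as a sum of clamped increments so that continuity in \<open>t\<close>
  and the effect of halving the mesh can be read off termwise.\<close>

definition dyadic_interp :: "(real \<Rightarrow> complex) \<Rightarrow> nat \<Rightarrow> real \<Rightarrow> complex" where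
  "dyadic_interp a n t = a 0 + (\<Sum>j < nat \<lceil>2 ^ n * t\<rceil>.
     of_real (clamp01 (2 ^ n * t - real j)) * (a (real (Suc j) / 2 ^ n) - a (real j / 2 ^ n)))"

text \<open>Minus the second difference of step 2^-(n+1) over the j-th interval of mesh
  2^-n.\<close>

definition dyadic_bend :: "(real \<Rightarrow> complex) \<Rightarrow> nat \<Rightarrow> nat \<Rightarrow> complex" where
  "dyadic_bend a n j = 2 * a (real (2 * j + 1) / 2 ^ Suc n) - a (real j / 2 ^ n) - a (real (Suc j) / 2 ^ n)"

text \<open>Clamps belonging to intervals beyond t vanish, so one upper limit \<open>K\<close>
  serves all t in a bounded interval, whereas the limit in the definition depends on t.\<close>

lemma dyadic_interp_eq:
  assumes "2 ^ n * t \<le> real K"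
  shows "dyadic_interp a n t = a 0 + (\<Sum>j<K.
     of_real (clamp01 (2 ^ n * t - real j)) * (a (real (Suc j) / 2 ^ n) - a (real j / 2 ^ n)))"
proof -
  have K: "nat \<lceil>2 ^ n * t\<rceil> \<le> K" using assms by linarith
  have z: "clamp01 (2 ^ n * t - real j) = 0" if "j \<notin> {..<nat \<lceil>2 ^ n * t\<rceil>}" for j
  proof (rule clamp01_le)
    have "real (nat \<lceil>2 ^ n * t\<rceil>) \<le> real j" using that by (simp only: of_nat_le_iff lessThan_iff not_less)
    thus "2 ^ n * t - real j \<le> 0" using real_nat_ceiling_ge[of "2 ^ n * t"] by linarith
  qed
  show ?thesis unfolding dyadic_interp_def
  proof (intro arg_cong2[of _ _ _ _ "(+)"] refl sum.mono_neutral_left)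
    show "{..<nat \<lceil>2 ^ n * t\<rceil>} \<subseteq> {..<K}" using K by auto
    show "\<forall>j\<in>{..<K} - {..<nat \<lceil>2 ^ n * t\<rceil>}. complex_of_real (clamp01 (2 ^ n * t - real j)) *
        (a (real (Suc j) / 2 ^ n) - a (real j / 2 ^ n)) = 0"
    proof
      fix j assume "j \<in> {..<K} - {..<nat \<lceil>2 ^ n * t\<rceil>}"
      hence "clamp01 (2 ^ n * t - real j) = 0" by (intro z) blast
      thus "complex_of_real (clamp01 (2 ^ n * t - real j)) * (a (real (Suc j) / 2 ^ n) - a (real j / 2 ^ n)) = 0"
        by simp
    qed
  qed simp
qed

lemma continuous_dyadic_interp: "continuous_on {0..real K} (dyadic_interp a n)"
proof -
  have "2 ^ n * t \<le> real (2 ^ n * K)" if "t \<in> {0..real K}" for t using that by simp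
  hence "continuous_on {0..real K} (dyadic_interp a n) \<longleftrightarrow> continuous_on {0..real K} (\<lambda>t. a 0 + (\<Sum>j<2 ^ n * K.
     of_real (clamp01 (2 ^ n * t - real j)) * (a (real (Suc j) / 2 ^ n) - a (real j / 2 ^ n))))"
    by (intro continuous_on_cong refl dyadic_interp_eq)
  thus ?thesis by (simp add: continuous_intros continuous_clamp01)
qed

text \<open>One level of the Faber-Schauder expansion: clamp01(2x) - clamp01(x) is the tent of
  height 1/2 over [0,1], and its coefficient is twice the deviation of the midpoint value from the
  mean of the end values.\<close>

lemma dyadic_interp_step:
  assumes t: "0 \<le> t" "t \<le> real K"
  shows "dyadic_interp a (Suc n) t - dyadic_interp a n t =
    (\<Sum>j<K * 2 ^ n. of_real (clamp01 (2 * (2 ^ n * t - real j)) - clamp01 (2 ^ n * t - real j)) * dyadic_bend a n j)"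
proof -
  define L where "L = K * 2 ^ n"
  define c where "c i = complex_of_real (clamp01 (2 ^ Suc n * t - real i))" for i
  define d where "d i = a (real (Suc i) / 2 ^ Suc n) - a (real i / 2 ^ Suc n)" for i
  have L: "2 ^ n * t \<le> real L" "2 ^ Suc n * t \<le> real (2 * L)"
    using t by (simp_all add: L_def mult.commute)
  have dbl: "(\<Sum>i<2 * k. c i * d i) = (\<Sum>j<k. c (2 * j) * d (2 * j) + c (2 * j + 1) * d (2 * j + 1))" for k
    by (induction k) (simp_all add: algebra_simps)
  have half: "real (2 * j) / 2 ^ Suc n = real j / 2 ^ n" "real (Suc (2 * j + 1)) / 2 ^ Suc n = real (Suc j) / 2 ^ n" for j
    by (simp_all add: field_simps)
  have "c (2 * j) * d (2 * j) + c (2 * j + 1) * d (2 * j + 1)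
      - of_real (clamp01 (2 ^ n * t - real j)) * (a (real (Suc j) / 2 ^ n) - a (real j / 2 ^ n))
      = of_real (clamp01 (2 * (2 ^ n * t - real j)) - clamp01 (2 ^ n * t - real j)) * dyadic_bend a n j" for j
  proof -
    define x where "x = 2 ^ n * t - real j"
    define A1 where "A1 = a (real j / 2 ^ n)"
    define A2 where "A2 = a (real (2 * j + 1) / 2 ^ Suc n)"
    define A3 where "A3 = a (real (Suc j) / 2 ^ n)"
    have e: "2 ^ Suc n * t - real (2 * j) = 2 * x" "2 ^ Suc n * t - real (2 * j + 1) = 2 * x - 1"
      by (simp_all add: x_def algebra_simps)
    have d: "d (2 * j) = A2 - A1" "d (2 * j + 1) = A3 - A2"
      unfolding d_def half Suc_eq_plus1[of "2 * j"] by (simp_all only: A1_def A2_def A3_def)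
    have cl: "clamp01 (2 * x - 1) = 2 * clamp01 x - clamp01 (2 * x)" using clamp01_double[of x] by linarith
    have c: "c (2 * j) = of_real (clamp01 (2 * x))" "c (2 * j + 1) = of_real (2 * clamp01 x - clamp01 (2 * x))"
      unfolding c_def e cl by (rule refl)+
    show ?thesis
      unfolding c d dyadic_bend_def x_def[symmetric] A1_def[symmetric] A2_def[symmetric] A3_def[symmetric]
      by (simp add: algebra_simps)
  qed
  hence "(\<Sum>i<2 * L. c i * d i) - (\<Sum>j<L. of_real (clamp01 (2 ^ n * t - real j)) * (a (real (Suc j) / 2 ^ n) - a (real j / 2 ^ n)))
    = (\<Sum>j<L. of_real (clamp01 (2 * (2 ^ n * t - real j)) - clamp01 (2 ^ n * t - real j)) * dyadic_bend a n j)"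
    unfolding dbl sum_subtractf[symmetric] by (intro sum.cong refl)
  thus ?thesis
    unfolding dyadic_interp_eq[OF L(1)] dyadic_interp_eq[OF L(2)] c_def d_def L_def by simp
qed

text \<open>At each t at most one tent is nonzero, yet the whole sum over j is kept: it does not
  depend on t, so one majorant serves all times, and its norm in \<open>L^p(Y)\<close> is controlled
  by the triangle inequality.\<close>

lemma dyadic_interp_step_le:
  assumes t: "0 \<le> t" "t \<le> real K"
  shows "cmod (dyadic_interp a (Suc n) t - dyadic_interp a n t) \<le> (\<Sum>j<K * 2 ^ n. cmod (dyadic_bend a n j))"
  unfolding dyadic_interp_step[OF t]
proof (rule order.trans[OF norm_sum sum_mono])
  fix j
  have "cmod (of_real (clamp01 (2 * (2 ^ n * t - real j)) - clamp01 (2 ^ n * t - real j)) * dyadic_bend a n j)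
     = \<bar>clamp01 (2 * (2 ^ n * t - real j)) - clamp01 (2 ^ n * t - real j)\<bar> * cmod (dyadic_bend a n j)"
    by (simp only: norm_mult norm_of_real)
  also have "\<dots> \<le> 1 * cmod (dyadic_bend a n j)" by (intro mult_right_mono clamp01_diff) simp
  finally show "cmod (of_real (clamp01 (2 * (2 ^ n * t - real j)) - clamp01 (2 ^ n * t - real j)) * dyadic_bend a n j)
      \<le> cmod (dyadic_bend a n j)" by simp
qed

lemma dyadic_interp_floor:
  fixes t :: real and n :: nat
  assumes "0 \<le> t"
  defines "k \<equiv> nat \<lfloor>2 ^ n * t\<rfloor>"
  shows "dyadic_interp a n t = a (real k / 2 ^ n) + of_real (2 ^ n * t - real k) * (a (real (Suc k) / 2 ^ n) - a (real k / 2 ^ n))"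
    "real k / 2 ^ n \<le> t" "t \<le> real (Suc k) / 2 ^ n"
proof -
  have nn: "0 \<le> 2 ^ n * t" using assms(1) by simp
  have k: "real k \<le> 2 ^ n * t" "2 ^ n * t \<le> real (Suc k)"
    unfolding k_def using nn by linarith+
  show "real k / 2 ^ n \<le> t" "t \<le> real (Suc k) / 2 ^ n" using k by (simp_all add: field_simps)
  have 1: "clamp01 (2 ^ n * t - real j) = 1" if "j < k" for j
    using that k(1) by (intro clamp01_ge) linarith
  have "dyadic_interp a n t = a 0 + (\<Sum>j<k. (a (real (Suc j) / 2 ^ n) - a (real j / 2 ^ n)))
     + of_real (clamp01 (2 ^ n * t - real k)) * (a (real (Suc k) / 2 ^ n) - a (real k / 2 ^ n))"
    unfolding dyadic_interp_eq[OF k(2)] by (simp add: 1)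
  also have "(\<Sum>j<k. (a (real (Suc j) / 2 ^ n) - a (real j / 2 ^ n))) = a (real k / 2 ^ n) - a 0"
    using sum_lessThan_telescope[of "\<lambda>j. a (real j / 2 ^ n)" k] by simp
  also have "clamp01 (2 ^ n * t - real k) = 2 ^ n * t - real k" using k by (intro clamp01_mid) auto
  finally show "dyadic_interp a n t = a (real k / 2 ^ n) + of_real (2 ^ n * t - real k) * (a (real (Suc k) / 2 ^ n) - a (real k / 2 ^ n))"
    by simp
qed

definition dyadic_limit :: "(real \<Rightarrow> complex) \<Rightarrow> real \<Rightarrow> complex" where
  "dyadic_limit a t = lim (\<lambda>n. dyadic_interp a n t)"

lemma dyadic_limit_remainder:
  assumes s: "summable (\<lambda>n. \<Sum>j<K * 2 ^ n. cmod (dyadic_bend a n j))" and t: "0 \<le> t" "t \<le> real K"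
  shows "(\<lambda>n. dyadic_interp a n t) \<longlonglongrightarrow> dyadic_limit a t"
    "cmod (dyadic_limit a t - dyadic_interp a n t) \<le> (\<Sum>m. \<Sum>j<K * 2 ^ (m + n). cmod (dyadic_bend a (m + n) j))"
proof -
  define D where "D m = (\<Sum>j<K * 2 ^ m. cmod (dyadic_bend a m j))" for m
  define d where "d m = dyadic_interp a (Suc m) t - dyadic_interp a m t" for m
  have sD: "summable D" using s by (simp add: D_def[abs_def])
  have dD: "cmod (d m) \<le> D m" for m unfolding d_def D_def by (rule dyadic_interp_step_le[OF t])
  have sd: "summable (\<lambda>m. cmod (d m))" by (rule summable_comparison_test'[OF sD]) (use dD in auto)
  have tel: "(\<Sum>m<k. d m) = dyadic_interp a k t - dyadic_interp a 0 t" for k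
    unfolding d_def by (rule sum_lessThan_telescope)
  have "(\<lambda>k. \<Sum>m<k. d m) \<longlonglongrightarrow> suminf d"
    by (rule summable_LIMSEQ[OF summable_norm_cancel[OF sd]])
  hence "(\<lambda>k. (dyadic_interp a k t - dyadic_interp a 0 t) + dyadic_interp a 0 t) \<longlonglongrightarrow> suminf d + dyadic_interp a 0 t"
    unfolding tel by (intro tendsto_intros)
  hence conv: "(\<lambda>k. dyadic_interp a k t) \<longlonglongrightarrow> suminf d + dyadic_interp a 0 t" by simp
  hence lim: "dyadic_limit a t = suminf d + dyadic_interp a 0 t"
    unfolding dyadic_limit_def by (rule limI)
  show "(\<lambda>n. dyadic_interp a n t) \<longlonglongrightarrow> dyadic_limit a t" using conv by (simp add: lim)
  have "dyadic_limit a t - dyadic_interp a n t = suminf d - (\<Sum>m<n. d m)" by (simp add: lim tel)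
  also have "\<dots> = (\<Sum>m. d (m + n))"
    using suminf_split_initial_segment[OF summable_norm_cancel[OF sd], of n] by simp
  also have "cmod \<dots> \<le> (\<Sum>m. cmod (d (m + n)))"
    by (intro summable_norm summable_ignore_initial_segment[OF sd])
  also have "\<dots> \<le> (\<Sum>m. D (m + n))"
    by (intro suminf_le dD summable_ignore_initial_segment sd sD)
  finally show "cmod (dyadic_limit a t - dyadic_interp a n t) \<le> (\<Sum>m. \<Sum>j<K * 2 ^ (m + n). cmod (dyadic_bend a (m + n) j))"
    by (simp add: D_def)
qed

lemma continuous_dyadic_limit:
  assumes s: "\<And>K. summable (\<lambda>n. \<Sum>j<K * 2 ^ n. cmod (dyadic_bend a n j))"
  shows "continuous_on {0<..} (dyadic_limit a)"
proof (rule continuous_at_imp_continuous_on, rule ballI)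
  fix t :: real assume "t \<in> {0<..}"
  then obtain K :: nat where K: "0 < t" "t < real K" using reals_Archimedean2 by auto
  have lim: "(\<lambda>n. \<Sum>m. \<Sum>j<K * 2 ^ (m + n). cmod (dyadic_bend a (m + n) j)) \<longlonglongrightarrow> 0"
    by (rule suminf_exist_split2[OF s])
  have "uniform_limit {0..real K} (dyadic_interp a) (dyadic_limit a) sequentially"
  proof (rule uniform_limitI)
    fix e :: real assume "e > 0"
    with lim have "eventually (\<lambda>n. (\<Sum>m. \<Sum>j<K * 2 ^ (m + n). cmod (dyadic_bend a (m + n) j)) < e) sequentially"
      by (rule order_tendstoD)
    thus "\<forall>\<^sub>F n in sequentially. \<forall>x\<in>{0..real K}. dist (dyadic_interp a n x) (dyadic_limit a x) < e"
    proof eventually_elim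
      case (elim n)
      show ?case
      proof
        fix x assume "x \<in> {0..real K}"
        hence "cmod (dyadic_limit a x - dyadic_interp a n x) \<le> (\<Sum>m. \<Sum>j<K * 2 ^ (m + n). cmod (dyadic_bend a (m + n) j))"
          by (intro dyadic_limit_remainder(2) s) auto
        thus "dist (dyadic_interp a n x) (dyadic_limit a x) < e"
          using elim by (simp add: dist_norm norm_minus_commute)
      qed
    qed
  qed
  hence "continuous_on {0..real K} (dyadic_limit a)"
    by (rule uniform_limit_theorem[rotated]) (auto simp: continuous_dyadic_interp)
  hence "continuous_on {0<..<real K} (dyadic_limit a)" by (rule continuous_on_subset) auto
  thus "isCont (dyadic_limit a) t"
    by (rule continuous_on_interior) (use K in \<open>simp add: interior_open\<close>)
qed

text \<open>Pairing level and position into one index turns the bends into a single sequence, to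
  which the series lemma for \<open>L^p(Y)\<close> applies without grouping; positions out of range
  are filled with 0.\<close>

lemma summable_blocks:
  fixes b :: "nat \<Rightarrow> nat \<Rightarrow> real"
  assumes nn: "\<And>n j. 0 \<le> b n j"
  shows "summable (\<lambda>m. case prod_decode m of (n, j) \<Rightarrow> if j < K n then b n j else 0) \<longleftrightarrow>
    summable (\<lambda>n. \<Sum>j<K n. b n j)"
proof -
  have sum_iff: "summable f \<longleftrightarrow> (\<Sum>n. ennreal (f n)) \<noteq> \<top>" if "\<And>n. 0 \<le> f n" for f :: "nat \<Rightarrow> real"
  proof
    assume "summable f"
    thus "(\<Sum>n. ennreal (f n)) \<noteq> \<top>" using that by (simp add: suminf_ennreal2)
  qed (use that in \<open>auto intro: summable_suminf_not_top\<close>)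
  define f where "f = (\<lambda>(n::nat, j::nat). ennreal (if j < K n then b n j else 0))"
  have fin: "ennreal (\<Sum>j<K n. b n j) = (\<Sum>j. f (n, j))" for n
  proof -
    have "(\<Sum>j. f (n, j)) = (\<Sum>j<K n. f (n, j))"
      by (rule suminf_finite) (auto simp: f_def)
    also have "\<dots> = (\<Sum>j<K n. ennreal (b n j))" by (rule sum.cong) (auto simp: f_def)
    finally show ?thesis using nn by simp
  qed
  have "(\<Sum>m. f (prod_decode m)) = (\<Sum>n. ennreal (\<Sum>j<K n. b n j))"
    by (rule suminf_ennreal_2dimen[OF fin])
  moreover have "f (prod_decode m) = ennreal (case prod_decode m of (n, j) \<Rightarrow> if j < K n then b n j else 0)" for m
    by (simp add: f_def split: prod.split)
  ultimately have "(\<Sum>m. ennreal (case prod_decode m of (n, j) \<Rightarrow> if j < K n then b n j else 0)) = (\<Sum>n. ennreal (\<Sum>j<K n. b n j))"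
    by simp
  moreover have "0 \<le> (case prod_decode m of (n, j) \<Rightarrow> if j < K n then b n j else 0)" for m
    using nn by (simp split: prod.split)
  moreover have "0 \<le> (\<Sum>j<K n. b n j)" for n by (intro sum_nonneg nn)
  ultimately show ?thesis by (simp only: sum_iff)
qed

section \<open>Continuous versions of paths in \<open>L^p(Y)\<close>\<close>

context Lp_koethe
begin

context
  fixes u :: "real \<Rightarrow> 'x \<times> 'w \<Rightarrow> complex"
  assumes u: "\<And>t. 0 \<le> t \<Longrightarrow> u t \<in> elems X"
    and lip: "\<And>K::nat. \<exists>C\<ge>0. \<forall>s t. 0 \<le> s \<longrightarrow> s \<le> t \<longrightarrow> t \<le> real K \<longrightarrow> ndist X (u t) (u s) \<le> C * (t - s)"
    and bend: "\<And>K::nat. \<exists>C\<ge>0. \<forall>t h. 0 \<le> t \<longrightarrow> 0 < h \<longrightarrow> t + 2 * h \<le> real K \<longrightarrow>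
      nrm X (\<lambda>z. 2 * u (t + h) z - u t z - u (t + 2 * h) z) \<le> C * (h * sqrt h)"
begin

interpretation separated_fspace X by (rule X_separated_fspace)

lemma dyadic_bend_in: "(\<lambda>z. dyadic_bend (\<lambda>s. u s z) n j) \<in> elems X"
proof -
  have "(\<lambda>z. 2 * u t z - (u t' z + u t'' z)) \<in> elems X" if "0 \<le> t" "0 \<le> t'" "0 \<le> t''" for t t' t''
    using diff_in[OF scale_in[OF u[OF that(1)], of 2] add_in[OF u[OF that(2)] u[OF that(3)]]] .
  from this[of "real (2 * j + 1) / 2 ^ Suc n" "real j / 2 ^ n" "real (Suc j) / 2 ^ n"]
  show ?thesis by (simp add: dyadic_bend_def diff_diff_eq)
qed

lemma dyadic_interp_in: "(\<lambda>z. dyadic_interp (\<lambda>s. u s z) n t) \<in> elems X"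
  unfolding dyadic_interp_def
  by (intro add_in sum_in scale_in diff_in u) auto

text \<open>Level n has K 2^n bends of norm O(2^(-3n/2)), in total O(2^(-n/2)).\<close>

lemma summable_dyadic_bend: "summable (\<lambda>n. \<Sum>j<K * 2 ^ n. nrm X (\<lambda>z. dyadic_bend (\<lambda>s. u s z) n j))"
proof -
  obtain C where C: "C \<ge> 0" "\<And>t h. 0 \<le> t \<Longrightarrow> 0 < h \<Longrightarrow> t + 2 * h \<le> real K \<Longrightarrow>
      nrm X (\<lambda>z. 2 * u (t + h) z - u t z - u (t + 2 * h) z) \<le> C * (h * sqrt h)"
    using bend[of K] by blast
  have le: "(\<Sum>j<K * 2 ^ n. nrm X (\<lambda>z. dyadic_bend (\<lambda>s. u s z) n j)) \<le> real K * C * sqrt (1 / 2) ^ n" for n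
  proof -
    have "(\<Sum>j<K * 2 ^ n. nrm X (\<lambda>z. dyadic_bend (\<lambda>s. u s z) n j))
       \<le> (\<Sum>j<K * 2 ^ n. C * (1 / 2 ^ Suc n * sqrt (1 / 2 ^ Suc n)))"
    proof (rule sum_mono)
      fix j assume "j \<in> {..<K * 2 ^ n}"
      hence "real (Suc j) \<le> real (K * 2 ^ n)" by (subst of_nat_le_iff) simp
      hence j: "real (Suc j) / 2 ^ n \<le> real K" by (simp add: field_simps)
      have e: "real j / 2 ^ n + 1 / 2 ^ Suc n = real (2 * j + 1) / 2 ^ Suc n"
        "real j / 2 ^ n + 2 * (1 / 2 ^ Suc n) = real (Suc j) / 2 ^ n"
        by (simp_all add: field_simps)
      show "nrm X (\<lambda>z. dyadic_bend (\<lambda>s. u s z) n j) \<le> C * (1 / 2 ^ Suc n * sqrt (1 / 2 ^ Suc n))"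
        using C(2)[of "real j / 2 ^ n" "1 / 2 ^ Suc n"] j unfolding e dyadic_bend_def by simp
    qed
    also have "\<dots> = real K * C * ((1 / 2) * sqrt (1 / 2 ^ Suc n))" by (simp add: field_simps)
    also have "\<dots> \<le> real K * C * sqrt (1 / 2 ^ n)"
    proof (rule mult_left_mono)
      have "(1 / 2) * sqrt (1 / 2 ^ Suc n) \<le> 1 * sqrt (1 / 2 ^ n)"
        by (intro mult_mono real_sqrt_le_mono) (auto simp: field_simps)
      thus "(1 / 2) * sqrt (1 / 2 ^ Suc n) \<le> sqrt (1 / 2 ^ n)" by simp
    qed (use C(1) in auto)
    also have "sqrt (1 / 2 ^ n) = sqrt (1 / 2) ^ n"
      by (simp add: real_sqrt_power[symmetric] power_one_over)
    finally show ?thesis .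
  qed
  have "summable (\<lambda>n. real K * C * sqrt (1 / 2) ^ n)"
    by (intro summable_mult summable_geometric) (simp add: real_sqrt_lt_1_iff)
  thus ?thesis
  proof (rule summable_comparison_test')
    fix n
    have "0 \<le> (\<Sum>j<K * 2 ^ n. nrm X (\<lambda>z. dyadic_bend (\<lambda>s. u s z) n j))"
      by (intro sum_nonneg nrm_nonneg dyadic_bend_in)
    thus "norm (\<Sum>j<K * 2 ^ n. nrm X (\<lambda>z. dyadic_bend (\<lambda>s. u s z) n j)) \<le> real K * C * sqrt (1 / 2) ^ n"
      using le[of n] by (simp only: real_norm_def abs_of_nonneg)
  qed
qed

lemma AE_summable_dyadic_bend:
  shows "AE z in M \<Otimes>\<^sub>M N. \<forall>K. summable (\<lambda>n. \<Sum>j<K * 2 ^ n. cmod (dyadic_bend (\<lambda>s. u s z) n j))"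
    "AE x in M. \<forall>K. summable (\<lambda>n. \<Sum>j<K * 2 ^ n. nrm Y (\<lambda>w. dyadic_bend (\<lambda>s. u s (x, w)) n j))"
proof -
  define g where "g K m = (case prod_decode m of (n, j) \<Rightarrow>
      (\<lambda>z. if j < K * 2 ^ n then dyadic_bend (\<lambda>s. u s z) n j else 0))" for K m
  have gX: "g K m \<in> elems X" for K m
  proof (cases "prod_decode m")
    case (Pair n j)
    thus ?thesis by (cases "j < K * 2 ^ n") (simp_all add: g_def dyadic_bend_in zero_in)
  qed
  have nX: "nrm X (g K m) = (case prod_decode m of (n, j) \<Rightarrow>
       if j < K * 2 ^ n then nrm X (\<lambda>z. dyadic_bend (\<lambda>s. u s z) n j) else 0)" for K m
    by (simp add: g_def nrm_zero split: prod.split)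
  have s: "summable (\<lambda>m. nrm X (g K m))" for K
    unfolding nX by (subst summable_blocks) (auto intro: nrm_nonneg dyadic_bend_in summable_dyadic_bend)
  have "AE z in M \<Otimes>\<^sub>M N. \<forall>K. summable (\<lambda>m. cmod (g K m z))"
    using X_series(2)[OF gX s] by (subst AE_all_countable) blast
  thus "AE z in M \<Otimes>\<^sub>M N. \<forall>K. summable (\<lambda>n. \<Sum>j<K * 2 ^ n. cmod (dyadic_bend (\<lambda>s. u s z) n j))"
  proof eventually_elim
    case (elim z)
    have "cmod (g K m z) = (case prod_decode m of (n, j) \<Rightarrow>
       if j < K * 2 ^ n then cmod (dyadic_bend (\<lambda>s. u s z) n j) else 0)" for K m
      by (simp add: g_def split: prod.split)
    thus ?case using elim summable_blocks[of "\<lambda>n j. cmod (dyadic_bend (\<lambda>s. u s z) n j)"] by simp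
  qed
  have sec: "AE x in M. \<forall>n j. (\<lambda>w. dyadic_bend (\<lambda>s. u s (x, w)) n j) \<in> elems Y"
    using X_section[OF dyadic_bend_in] by (simp only: AE_all_countable) blast
  have "AE x in M. summable (\<lambda>m. nrm Y (\<lambda>w. g K m (x, w)))" for K
    using X_series(1)[OF gX s[of K]] by eventually_elim blast
  hence "AE x in M. \<forall>K. summable (\<lambda>m. nrm Y (\<lambda>w. g K m (x, w)))"
    by (subst AE_all_countable) blast
  thus "AE x in M. \<forall>K. summable (\<lambda>n. \<Sum>j<K * 2 ^ n. nrm Y (\<lambda>w. dyadic_bend (\<lambda>s. u s (x, w)) n j))"
    using sec
  proof eventually_elim
    case (elim x)
    have "nrm Y (\<lambda>w. g K m (x, w)) = (case prod_decode m of (n, j) \<Rightarrow>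
       if j < K * 2 ^ n then nrm Y (\<lambda>w. dyadic_bend (\<lambda>s. u s (x, w)) n j) else 0)" for K m
      by (simp add: g_def Y_nrm_zero split: prod.split)
    thus ?case using elim summable_blocks[of "\<lambda>n j. nrm Y (\<lambda>w. dyadic_bend (\<lambda>s. u s (x, w)) n j)"] Y_nrm_nonneg
      by simp
  qed
qed

lemma AE_continuous_dyadic_limit: "AE z in M \<Otimes>\<^sub>M N. continuous_on {0<..} (dyadic_limit (\<lambda>s. u s z))"
  using AE_summable_dyadic_bend(1) by eventually_elim (rule continuous_dyadic_limit, blast)

text \<open>By the Lipschitz bound the interpolation at a fixed t misses the path by O(2^-n) in
  norm; these errors are summable, so they tend to 0 almost everywhere. The exceptional set depends
  on t, which is why the limit has to replace the path as a representative.\<close>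

lemma AE_dyadic_limit_eq:
  assumes t: "0 \<le> t"
  shows "AE z in M \<Otimes>\<^sub>M N. dyadic_limit (\<lambda>s. u s z) t = u t z"
proof -
  \<comment> \<open>One unit beyond t leaves room for the right end of the dyadic interval that
    contains t, for every n.\<close>
  define K where "K = nat \<lceil>t\<rceil> + 1"
  have K: "t + 1 \<le> real K" unfolding K_def using t real_nat_ceiling_ge[of t] by simp
  obtain C where C: "C \<ge> 0" "\<And>s t. 0 \<le> s \<Longrightarrow> s \<le> t \<Longrightarrow> t \<le> real K \<Longrightarrow> ndist X (u t) (u s) \<le> C * (t - s)"
    using lip[of K] by blast
  define e where "e n z = dyadic_interp (\<lambda>s. u s z) n t - u t z" for n z
  have eX: "e n \<in> elems X" for n unfolding e_def[abs_def] by (intro diff_in dyadic_interp_in u t)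
  have le: "nrm X (e n) \<le> 2 * C * (1 / 2) ^ n" for n
  proof -
    define k where "k = nat \<lfloor>2 ^ n * t\<rfloor>"
    define a where "a = real k / 2 ^ n"
    define b where "b = real (Suc k) / 2 ^ n"
    define c where "c = 2 ^ n * t - real k"
    have fl: "dyadic_interp (\<lambda>s. u s z) n t = u a z + of_real c * (u b z - u a z)" for z
      unfolding a_def b_def c_def k_def by (rule dyadic_interp_floor(1)[OF t])
    have ab: "0 \<le> a" "a \<le> t" "t \<le> b" "b - a = (1 / 2) ^ n"
      using dyadic_interp_floor(2,3)[OF t, of n] unfolding a_def b_def k_def by (auto simp: field_simps)
    have bK: "b \<le> real K"
    proof -
      have "(1 / 2 :: real) ^ n \<le> 1" by (rule power_le_one) auto
      thus ?thesis using K ab by linarith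
    qed
    have c: "0 \<le> c" "c \<le> 1"
      using ab(2,3) by (auto simp: a_def b_def c_def field_simps)
    have uX: "u a \<in> elems X" "u b \<in> elems X" "u t \<in> elems X" using ab t by (auto intro!: u)
    have eq: "e n = (\<lambda>z. of_real c * (u b z - u a z) + - 1 * (u t z - u a z))"
      by (simp add: e_def fl algebra_simps fun_eq_iff)
    have "nrm X (e n) \<le> nrm X (\<lambda>z. of_real c * (u b z - u a z)) + nrm X (\<lambda>z. - 1 * (u t z - u a z))"
      unfolding eq by (intro nrm_add scale_in diff_in uX)
    also have "\<dots> = c * ndist X (u b) (u a) + ndist X (u t) (u a)"
      using c by (simp only: nrm_scale diff_in uX norm_of_real norm_minus_cancel norm_one) (simp add: ndist_def)
    also have "\<dots> \<le> 1 * (C * (b - a)) + C * (t - a)"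
      using c ab bK uX by (intro add_mono mult_mono C(2) ndist_nonneg) auto
    also have "\<dots> \<le> C * (1 / 2) ^ n + C * (1 / 2) ^ n"
      using C(1) ab by (intro add_mono mult_left_mono) auto
    finally show ?thesis by simp
  qed
  have "summable (\<lambda>n. 2 * C * (1 / 2) ^ n)" by (intro summable_mult summable_geometric) simp
  hence "summable (\<lambda>n. nrm X (e n))"
    by (rule summable_comparison_test'[of _ 0]) (use le eX nrm_nonneg in auto)
  from X_series(2)[OF eX this] show ?thesis
  proof eventually_elim
    case (elim z)
    hence "(\<lambda>n. e n z) \<longlonglongrightarrow> 0"
      by (rule summable_LIMSEQ_zero[OF summable_norm_cancel])
    hence "(\<lambda>n. e n z + u t z) \<longlonglongrightarrow> 0 + u t z" by (intro tendsto_intros)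
    thus ?case by (simp add: e_def dyadic_limit_def limI)
  qed
qed

lemma dyadic_limit_measurable: "(\<lambda>z. dyadic_limit (\<lambda>s. u s z) t) \<in> borel_measurable (M \<Otimes>\<^sub>M N)"
  unfolding dyadic_limit_def
  by (rule borel_measurable_lim_metric) (rule X_measurable[OF dyadic_interp_in])

lemma dyadic_limit_in:
  assumes "0 \<le> t"
  shows "(\<lambda>z. dyadic_limit (\<lambda>s. u s z) t) \<in> elems X" "ndist X (\<lambda>z. dyadic_limit (\<lambda>s. u s z) t) (u t) = 0"
  using X_cong_AE[OF u[OF assms] dyadic_limit_measurable AE_dyadic_limit_eq[OF assms]] by blast+

text \<open>Remainders are small in Y uniformly for t in [0,K], by the lattice bound with summable
  majorants, and each interpolation combines finitely many fixed elements of Y with continuous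
  coefficients; an e/3 argument joins the two.\<close>

lemma AE_section_continuous_dyadic_limit:
  "AE x in M. (\<forall>t\<ge>0. (\<lambda>w. dyadic_limit (\<lambda>s. u s (x, w)) t) \<in> elems Y) \<and>
     (\<forall>t>0. ((\<lambda>t'. ndist Y (\<lambda>w. dyadic_limit (\<lambda>s. u s (x, w)) t') (\<lambda>w. dyadic_limit (\<lambda>s. u s (x, w)) t)) \<longlongrightarrow> 0) (at t))"
proof -
  have secb: "AE x in M. \<forall>n j. (\<lambda>w. dyadic_bend (\<lambda>s. u s (x, w)) n j) \<in> elems Y"
    using X_section[OF dyadic_bend_in] by (simp only: AE_all_countable) blast
  \<comment> \<open>Sections have to lie in Y off a single null set; only dyadic times enter the
    interpolations, and these are countable.\<close>
  have secu: "AE x in M. \<forall>(n::nat) (j::nat). (\<lambda>w. u (real j / 2 ^ n) (x, w)) \<in> elems Y"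
    using X_section[OF u] by (simp only: AE_all_countable) (simp add: X_section u)
  show ?thesis
    using AE_summable_dyadic_bend(2) secb secu AE_space
  proof eventually_elim
    case (elim x)
    define a where "a w s = u s (x, w)" for w s
    define B where "B K m = (\<Sum>j<K * 2 ^ m. nrm Y (\<lambda>w. dyadic_bend (a w) m j))" for K m
    define D where "D K m w = (\<Sum>j<K * 2 ^ m. cmod (dyadic_bend (a w) m j))" for K m w
    have sB: "summable (B K)" for K using elim(1) by (simp add: B_def[abs_def] a_def[abs_def])
    have bY: "(\<lambda>w. dyadic_bend (a w) n j) \<in> elems Y" for n j using elim(2) by (simp add: a_def[abs_def])
    have uY: "(\<lambda>w. a w (real j / 2 ^ n)) \<in> elems Y" for j n using elim(3) by (simp add: a_def[abs_def])
    have dY: "(\<lambda>w. a w (real (Suc j) / 2 ^ n) - a w (real j / 2 ^ n)) \<in> elems Y" for j n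
      by (intro Y_diff uY)
    have iY: "(\<lambda>w. dyadic_interp (a w) n t) \<in> elems Y" for n t
      unfolding dyadic_interp_def using uY[of 0 n] by (intro Y_add Y_sum Y_scale dY) auto
    have DY: "(\<lambda>w. complex_of_real (D K m w)) \<in> elems Y" "nrm Y (\<lambda>w. complex_of_real (D K m w)) \<le> B K m" for K m
    proof -
      have e: "(\<lambda>w. complex_of_real (D K m w)) = (\<lambda>w. \<Sum>j<K * 2 ^ m. complex_of_real (cmod (dyadic_bend (a w) m j)))"
        by (simp add: D_def)
      show "(\<lambda>w. complex_of_real (D K m w)) \<in> elems Y" unfolding e by (intro Y_sum Y_modulus bY)
      have "nrm Y (\<lambda>w. complex_of_real (D K m w)) \<le> (\<Sum>j<K * 2 ^ m. nrm Y (\<lambda>w. complex_of_real (cmod (dyadic_bend (a w) m j))))"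
        unfolding e by (intro Y_nrm_sum Y_modulus bY)
      also have "\<dots> = B K m" unfolding B_def by (intro sum.cong refl Y_modulus(2) bY)
      finally show "nrm Y (\<lambda>w. complex_of_real (D K m w)) \<le> B K m" .
    qed
    have sD: "summable (\<lambda>m. nrm Y (\<lambda>w. complex_of_real (D K m w)))" for K
      by (rule summable_comparison_test'[OF sB, of 0]) (use DY Y_nrm_nonneg in auto)
    have D_nn: "0 \<le> D K m w" for K m w by (simp add: D_def sum_nonneg)
    have aeD: "AE w in N. summable (\<lambda>m. D K m w)" for K
      using Y_series(1)[OF DY(1) sD] by eventually_elim (use D_nn in simp)
    have mv: "(\<lambda>w. dyadic_limit (a w) t) \<in> borel_measurable N" for t
      unfolding a_def[abs_def] using section_measurable[OF dyadic_limit_measurable elim(4)] .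
    have rem: "(\<lambda>w. dyadic_limit (a w) t - dyadic_interp (a w) n t) \<in> elems Y \<and>
        nrm Y (\<lambda>w. dyadic_limit (a w) t - dyadic_interp (a w) n t) \<le> (\<Sum>m. B K (m + n))"
      if t: "0 \<le> t" "t \<le> real K" for t n K
    proof -
      note [measurable] = mv Y_measurable[OF iY]
      have "AE w in N. cmod (dyadic_limit (a w) t - dyadic_interp (a w) n t) \<le> (\<Sum>m. cmod (complex_of_real (D K (m + n) w)))"
        using aeD[of K]
      proof eventually_elim
        case (elim w)
        hence "cmod (dyadic_limit (a w) t - dyadic_interp (a w) n t) \<le> (\<Sum>m. D K (m + n) w)"
          unfolding D_def by (intro dyadic_limit_remainder(2) t)
        thus ?case using D_nn by (simp only: norm_of_real abs_of_nonneg)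
      qed
      hence 1: "(\<lambda>w. dyadic_limit (a w) t - dyadic_interp (a w) n t) \<in> elems Y \<and>
        nrm Y (\<lambda>w. dyadic_limit (a w) t - dyadic_interp (a w) n t) \<le> (\<Sum>m. nrm Y (\<lambda>w. complex_of_real (D K (m + n) w)))"
        by (intro Y_series(2)[OF DY(1) summable_ignore_initial_segment[OF sD]]) measurable
      have "(\<Sum>m. nrm Y (\<lambda>w. complex_of_real (D K (m + n) w))) \<le> (\<Sum>m. B K (m + n))"
        by (intro suminf_le DY(2) summable_ignore_initial_segment[OF sD] summable_ignore_initial_segment[OF sB])
      thus ?thesis using 1 by linarith
    qed
    have vY: "(\<lambda>w. dyadic_limit (a w) t) \<in> elems Y" if t: "0 \<le> t" for t
    proof -
      have "t \<le> real (nat \<lceil>t\<rceil>)" by (rule real_nat_ceiling_ge)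
      from Y_add[OF conjunct1[OF rem[OF t this, of 0]] iY[of 0 t]] show ?thesis by simp
    qed
    have ic: "((\<lambda>t'. ndist Y (\<lambda>w. dyadic_interp (a w) n t') (\<lambda>w. dyadic_interp (a w) n t)) \<longlongrightarrow> 0) (at t)"
      if t: "0 < t" "t < real K" for n t K
    proof -
      define c where "c j t' = clamp01 (2 ^ n * t' - real j)" for j t'
      define dd where "dd j w = a w (real (Suc j) / 2 ^ n) - a w (real j / 2 ^ n)" for j w
      have ddY: "dd j \<in> elems Y" for j unfolding dd_def[abs_def] by (rule dY)
      have cc: "((\<lambda>t'. c j t') \<longlongrightarrow> c j t) (at t)" for j
        using continuous_clamp01[of UNIV "2 ^ n" "real j"] by (simp add: c_def continuous_on_def)
      have "((\<lambda>t'. \<Sum>j<2 ^ n * K. \<bar>c j t' - c j t\<bar> * nrm Y (dd j)) \<longlongrightarrow> (\<Sum>j<2 ^ n * K. \<bar>c j t - c j t\<bar> * nrm Y (dd j))) (at t)"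
        by (intro tendsto_intros cc)
      hence lim: "((\<lambda>t'. \<Sum>j<2 ^ n * K. \<bar>c j t' - c j t\<bar> * nrm Y (dd j)) \<longlongrightarrow> 0) (at t)" by simp
      have "eventually (\<lambda>t'. t' < real K) (at t)"
        using order_tendstoD(2)[OF tendsto_ident_at t(2)] .
      hence bd: "eventually (\<lambda>t'. ndist Y (\<lambda>w. dyadic_interp (a w) n t') (\<lambda>w. dyadic_interp (a w) n t)
          \<le> (\<Sum>j<2 ^ n * K. \<bar>c j t' - c j t\<bar> * nrm Y (dd j))) (at t)"
      proof eventually_elim
        case (elim t')
        have K: "2 ^ n * t' \<le> real (2 ^ n * K)" "2 ^ n * t \<le> real (2 ^ n * K)" using elim t by auto
        have "(\<lambda>w. dyadic_interp (a w) n t' - dyadic_interp (a w) n t) =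
           (\<lambda>w. \<Sum>j<2 ^ n * K. of_real (c j t' - c j t) * dd j w)"
          unfolding dyadic_interp_eq[OF K(1)] dyadic_interp_eq[OF K(2)] c_def dd_def
          by (simp add: left_diff_distrib sum_subtractf)
        hence "ndist Y (\<lambda>w. dyadic_interp (a w) n t') (\<lambda>w. dyadic_interp (a w) n t)
           \<le> (\<Sum>j<2 ^ n * K. nrm Y (\<lambda>w. of_real (c j t' - c j t) * dd j w))"
          by (simp only: ndist_def) (intro Y_nrm_sum Y_scale ddY)
        also have "\<dots> = (\<Sum>j<2 ^ n * K. \<bar>c j t' - c j t\<bar> * nrm Y (dd j))"
          by (simp only: Y_nrm_scale[OF ddY] norm_of_real)
        finally show ?case .
      qed
      show ?thesis
        by (rule tendsto_sandwich[OF _ bd tendsto_const lim]) (simp add: Y_ndist_nonneg iY)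
    qed
    have "((\<lambda>t'. ndist Y (\<lambda>w. dyadic_limit (a w) t') (\<lambda>w. dyadic_limit (a w) t)) \<longlongrightarrow> 0) (at t)" if t: "0 < t" for t
    proof (rule tendstoI)
      fix e :: real assume e: "e > 0"
      obtain K :: nat where K: "t < real K" using reals_Archimedean2 by blast
      have "(\<lambda>n. \<Sum>m. B K (m + n)) \<longlonglongrightarrow> 0" by (rule suminf_exist_split2[OF sB])
      hence "eventually (\<lambda>n. (\<Sum>m. B K (m + n)) < e / 3) sequentially"
        by (rule order_tendstoD(2)) (use e in simp)
      then obtain n where n: "(\<Sum>m. B K (m + n)) < e / 3" by (auto simp: eventually_sequentially)
      have "eventually (\<lambda>t'. ndist Y (\<lambda>w. dyadic_interp (a w) n t') (\<lambda>w. dyadic_interp (a w) n t) < e / 3) (at t)"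
        by (rule order_tendstoD(2)[OF ic[OF t K]]) (use e in simp)
      moreover have "eventually (\<lambda>t'. t' < real K) (at t)"
        using order_tendstoD(2)[OF tendsto_ident_at K] .
      moreover have "eventually (\<lambda>t'. 0 < t') (at t)"
        using order_tendstoD(1)[OF tendsto_ident_at t] .
      ultimately show "eventually (\<lambda>t'. dist (ndist Y (\<lambda>w. dyadic_limit (a w) t') (\<lambda>w. dyadic_limit (a w) t)) 0 < e) (at t)"
      proof eventually_elim
        case (elim t')
        let ?v = "\<lambda>t w. dyadic_limit (a w) t" and ?i = "\<lambda>t w. dyadic_interp (a w) n t"
        have Y: "?v t' \<in> elems Y" "?v t \<in> elems Y" "?i t' \<in> elems Y" "?i t \<in> elems Y"
          using elim t by (auto intro!: vY iY)
        have "ndist Y (?v t') (?v t) \<le> ndist Y (?v t') (?i t') + ndist Y (?i t') (?v t)"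
          by (rule Y_ndist_triangle) (rule Y)+
        also have "ndist Y (?i t') (?v t) \<le> ndist Y (?i t') (?i t) + ndist Y (?i t) (?v t)"
          by (rule Y_ndist_triangle) (rule Y)+
        also have "ndist Y (?i t) (?v t) = ndist Y (?v t) (?i t)" by (rule Y_ndist_commute) (rule Y)+
        also have "ndist Y (?v t') (?i t') < e / 3"
          using rem[of t' K n] elim n by (simp add: ndist_def)
        also have "ndist Y (?v t) (?i t) < e / 3"
          using rem[of t K n] K t n by (simp add: ndist_def)
        finally show ?case using elim(1) Y by (simp add: Y_ndist_nonneg)
      qed
    qed
    thus ?case using vY by (simp add: a_def[abs_def])
  qed
qed

end

end

section \<open>Wave multipliers\<close>

lemma exp_diff_le:
  assumes "Re a \<le> K" "Re b \<le> K"
  shows "cmod (exp a - exp b) \<le> exp K * cmod (a - b)"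
proof (rule field_differentiable_bound[where S = "{z. Re z \<le> K}" and f' = exp])
  show "convex {z. Re z \<le> K}" by (rule convex_halfspace_Re_le)
qed (use assms in \<open>auto intro!: derivative_eq_intros\<close>)

lemma oscillation_diff:
  assumes w: "\<bar>Im w\<bar> \<le> 2" and st: "0 \<le> s" "s \<le> t" "t \<le> T"
  shows "cmod (exp (\<i> * of_real t * w) - exp (\<i> * of_real s * w)) \<le> exp (2 * T) * (cmod w * (t - s))"
proof -
  have "- Im w * r \<le> 2 * T" if "0 \<le> r" "r \<le> T" for r
    using mult_mono[of "- Im w" 2 r T] that w by auto
  hence "cmod (exp (\<i> * of_real t * w) - exp (\<i> * of_real s * w)) \<le> exp (2 * T) * cmod (\<i> * of_real t * w - \<i> * of_real s * w)"
    using st by (intro exp_diff_le) (auto simp: mult.commute)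
  also have "\<i> * of_real t * w - \<i> * of_real s * w = \<i> * of_real (t - s) * w" by (simp add: algebra_simps)
  also have "cmod (\<i> * of_real (t - s) * w) = cmod w * (t - s)" using st by (simp only: norm_mult norm_of_real) simp
  finally show ?thesis .
qed

lemma oscillation_norm:
  assumes "\<bar>Im w\<bar> \<le> 2" "0 \<le> t" "t \<le> T"
  shows "cmod (exp (\<i> * of_real t * w)) \<le> exp (2 * T)"
  using mult_mono[of "- Im w" 2 t T] assms by (auto simp: mult.commute)

text \<open>The second difference is -e^(itw) (e^(ihw) - 1)^2. With x = Rh the square is bounded by
  multiples of x^2 and of 1, hence of x^(3/2). The full x^2 would cost two powers of R, and 3/2
  suffices for the dyadic sums.\<close>

lemma oscillation_bend:
  assumes w: "\<bar>Im w\<bar> \<le> 2" "cmod w \<le> R" and t: "0 \<le> t" "0 < h" "t + 2 * h \<le> T"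
  shows "cmod (2 * exp (\<i> * of_real (t + h) * w) - exp (\<i> * of_real t * w) - exp (\<i> * of_real (t + 2 * h) * w))
    \<le> 4 * exp (6 * T) * (R * h * sqrt (R * h))"
proof -
  define q where "q = exp (\<i> * of_real h * w) - 1"
  define x where "x = R * h"
  have x: "x \<ge> 0" using w t order.trans[OF norm_ge_zero w(2)] by (simp add: x_def)
  have "exp (\<i> * of_real (t + h) * w) = exp (\<i> * of_real t * w) * exp (\<i> * of_real h * w)"
    "exp (\<i> * of_real (t + 2 * h) * w) = exp (\<i> * of_real t * w) * exp (\<i> * of_real h * w) * exp (\<i> * of_real h * w)"
    by (simp_all add: exp_add[symmetric] algebra_simps)
  hence eq: "2 * exp (\<i> * of_real (t + h) * w) - exp (\<i> * of_real t * w) - exp (\<i> * of_real (t + 2 * h) * w)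
     = - (exp (\<i> * of_real t * w) * q\<^sup>2)"
    by (simp add: q_def power2_eq_square algebra_simps)
  have "cmod q \<le> exp (2 * T) * (cmod w * h)"
    using oscillation_diff[of w 0 h T] w t by (simp add: q_def)
  also have "\<dots> \<le> exp (2 * T) * x"
    unfolding x_def using w t by (intro mult_left_mono mult_right_mono) auto
  finally have q1: "cmod q \<le> exp (2 * T) * x" .
  have "cmod q \<le> cmod (exp (\<i> * of_real h * w)) + 1"
    unfolding q_def using norm_triangle_ineq4[of "exp (\<i> * of_real h * w)" 1] by simp
  also have "\<dots> \<le> exp (2 * T) + exp (2 * T)"
    using oscillation_norm[of w h T] w t by (intro add_mono) auto
  finally have q2: "cmod q \<le> 2 * exp (2 * T)" by simp
  have "(cmod q)\<^sup>2 \<le> 4 * exp (4 * T) * (x * sqrt x)"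
  proof (cases "x \<le> 1")
    case True
    have "(cmod q)\<^sup>2 \<le> (exp (2 * T) * x)\<^sup>2" using q1 by (intro power_mono) auto
    also have "\<dots> = exp (4 * T) * (x * (sqrt x * sqrt x))"
      using x by (simp add: power2_eq_square exp_add[symmetric] algebra_simps)
    also have "\<dots> \<le> (4 * exp (4 * T)) * (x * (sqrt x * 1))"
      using x True by (intro mult_mono) auto
    finally show ?thesis by simp
  next
    case False
    hence "1 * 1 \<le> x * sqrt x" by (intro mult_mono) auto
    have "(cmod q)\<^sup>2 \<le> (2 * exp (2 * T))\<^sup>2" using q2 by (intro power_mono) auto
    also have "\<dots> = 4 * exp (4 * T) * 1" by (simp add: power2_eq_square exp_add[symmetric])
    also have "\<dots> \<le> 4 * exp (4 * T) * (x * sqrt x)" using \<open>1 * 1 \<le> x * sqrt x\<close> by (intro mult_left_mono) auto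
    finally show ?thesis .
  qed
  hence "cmod (exp (\<i> * of_real t * w)) * (cmod q)\<^sup>2 \<le> exp (2 * T) * (4 * exp (4 * T) * (x * sqrt x))"
    using w t by (intro mult_mono oscillation_norm) auto
  also have "\<dots> = 4 * exp (6 * T) * (x * sqrt x)" by (simp add: exp_add[symmetric])
  finally show ?thesis unfolding eq x_def by (simp add: norm_mult norm_power)
qed

text \<open>The difference is at most a multiple of min(|w - z|, 1), hence of the square root. For
  the truncations |w - z| is of order |z|^2/k, so the root costs a single power of |z|.\<close>

lemma oscillation_limit:
  assumes w: "\<bar>Im w\<bar> \<le> 2" "\<bar>Im z\<bar> \<le> 2" and t: "0 \<le> t"
  shows "cmod (exp (\<i> * of_real t * w) - exp (\<i> * of_real t * z)) \<le> 2 * (1 + t) * exp (2 * t) * sqrt (cmod (w - z))"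
proof (cases "cmod (w - z) \<le> 1")
  case True
  have "- Im w * t \<le> 2 * t" "- Im z * t \<le> 2 * t" using w t by (intro mult_right_mono; simp)+
  hence "cmod (exp (\<i> * of_real t * w) - exp (\<i> * of_real t * z)) \<le> exp (2 * t) * cmod (\<i> * of_real t * w - \<i> * of_real t * z)"
    by (intro exp_diff_le) (auto simp: mult.commute)
  also have "\<i> * of_real t * w - \<i> * of_real t * z = \<i> * of_real t * (w - z)" by (simp add: algebra_simps)
  also have "exp (2 * t) * cmod (\<i> * of_real t * (w - z)) = t * exp (2 * t) * (sqrt (cmod (w - z)) * sqrt (cmod (w - z)))"
    using t by (simp add: norm_mult)
  also have "\<dots> \<le> (2 * (1 + t) * exp (2 * t)) * (sqrt (cmod (w - z)) * 1)"
    using t True by (intro mult_mono) auto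
  finally show ?thesis by simp
next
  case False
  have "cmod (exp (\<i> * of_real t * w) - exp (\<i> * of_real t * z)) \<le> exp (2 * t) + exp (2 * t)"
    using oscillation_norm[of w t t] oscillation_norm[of z t t] w t
    by (intro order.trans[OF norm_triangle_ineq4 add_mono]) auto
  also have "\<dots> = 2 * 1 * exp (2 * t) * 1" by simp
  also have "\<dots> \<le> 2 * (1 + t) * exp (2 * t) * sqrt (cmod (w - z))"
    using t False by (intro mult_mono) auto
  finally show ?thesis .
qed

text \<open>The truncation \<open>z / (1 + z / k)\<close> of the identity: it is bounded on sectors, and on \<^const>\<open>half_strip\<close>
  its imaginary part is bounded uniformly in \<open>k\<close>.\<close>

definition trunc_id :: "real \<Rightarrow> complex \<Rightarrow> complex" where
  "trunc_id k z = of_real k * z / (of_real k + z)"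

lemma trunc_id_bounds:
  assumes z: "z \<in> half_strip" and k: "1 \<le> k"
  shows "of_real k + z \<noteq> 0" "\<bar>Im (trunc_id k z)\<bar> \<le> 2" "cmod (trunc_id k z) \<le> 2 * cmod z"
    "cmod (trunc_id k z - z) \<le> 2 * (cmod z)\<^sup>2 / k"
proof -
  define d where "d = cmod (of_real k + z)"
  have "k / 2 \<le> Re (of_real k + z)" using z k by (simp add: half_strip_def)
  hence d: "k / 2 \<le> d" unfolding d_def using complex_Re_le_cmod order.trans by blast
  hence dp: "d > 0" using k by linarith
  thus nz: "of_real k + z \<noteq> 0" by (auto simp: d_def)
  have sq: "(Re (of_real k + z))\<^sup>2 + (Im (of_real k + z))\<^sup>2 = d\<^sup>2" by (simp add: d_def cmod_power2)
  \<comment> \<open>In this form the imaginary part is k^2 Im z / |k + z|^2, and |k + z| >= k/2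
    bounds it independently of k.\<close>
  have "trunc_id k z = of_real k - of_real (k\<^sup>2) / (of_real k + z)"
    unfolding trunc_id_def using nz by (simp add: field_simps power2_eq_square)
  hence "Im (trunc_id k z) = k\<^sup>2 * Im z / d\<^sup>2"
    by (simp add: Im_divide sq[simplified])
  hence "\<bar>Im (trunc_id k z)\<bar> = (k / d)\<^sup>2 * \<bar>Im z\<bar>" by (simp add: abs_mult power_divide)
  also have "\<dots> \<le> 2\<^sup>2 * (1 / 2)"
    using d dp k z by (intro mult_mono power_mono) (auto simp: half_strip_def field_simps)
  finally show "\<bar>Im (trunc_id k z)\<bar> \<le> 2" by simp
  have "cmod (trunc_id k z) = (k / d) * cmod z" using k by (simp add: trunc_id_def norm_mult norm_divide d_def)
  also have "\<dots> \<le> 2 * cmod z" using d dp by (intro mult_right_mono) (auto simp: field_simps)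
  finally show "cmod (trunc_id k z) \<le> 2 * cmod z" .
  have "trunc_id k z - z = - (z\<^sup>2 / (of_real k + z))"
    unfolding trunc_id_def using nz by (simp add: field_simps power2_eq_square)
  hence "cmod (trunc_id k z - z) = (cmod z)\<^sup>2 / d" by (simp add: norm_divide norm_power d_def)
  also have "\<dots> \<le> (cmod z)\<^sup>2 / (k / 2)" using d k by (intro divide_left_mono) (auto intro: mult_pos_pos dp)
  finally show "cmod (trunc_id k z - z) \<le> 2 * (cmod z)\<^sup>2 / k" by (simp add: mult.commute)
qed

lemma half_strip_one_plus:
  assumes z: "z \<in> half_strip"
  shows "1 + z \<notin> \<real>\<^sub>\<le>\<^sub>0" "1 + cmod z \<le> 5 * cmod (1 + z)"
proof -
  have re: "1 / 2 < Re (1 + z)" using z by (simp add: half_strip_def)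
  thus "1 + z \<notin> \<real>\<^sub>\<le>\<^sub>0" by (auto simp: complex_nonpos_Reals_iff)
  \<comment> \<open>The constant 5 arises from 1 + |z| <= |1 + z| + 2 and 2 <= 4 |1 + z|.\<close>
  have "1 / 2 \<le> cmod (1 + z)" using re complex_Re_le_cmod[of "1 + z"] by linarith
  moreover have "cmod z \<le> cmod (1 + z) + 1" using norm_triangle_ineq4[of "1 + z" 1] by simp
  ultimately show "1 + cmod z \<le> 5 * cmod (1 + z)" by linarith
qed

lemma cmod_regul_le:
  assumes z: "z \<in> half_strip"
  shows "cmod (regul z) \<le> 25"
proof -
  have *: "0 < 1 + cmod z" "1 + cmod z \<le> 5 * cmod (1 + z)"
    using half_strip_one_plus(2)[OF z] by (auto intro: add_pos_nonneg)
  hence p: "cmod (1 + z) > 0" by linarith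
  have "cmod z \<le> 1 * (1 + cmod z)" by simp
  also have "\<dots> \<le> (1 + cmod z) * (1 + cmod z)" by (intro mult_right_mono) auto
  also have "\<dots> \<le> (5 * cmod (1 + z)) * (5 * cmod (1 + z))" using * by (intro mult_mono) auto
  finally have "cmod z / (cmod (1 + z) * cmod (1 + z)) \<le> 25" using p by (simp add: field_simps)
  thus ?thesis by (simp only: regul_def norm_divide norm_mult power2_eq_square)
qed

text \<open>The parameter \<open>w\<close> is the identity for the multiplier itself and a
  \<open>trunc_id\<close> for its holomorphic approximants.\<close>

definition wave :: "real \<Rightarrow> (complex \<Rightarrow> complex) \<Rightarrow> real \<Rightarrow> complex \<Rightarrow> complex" where
  "wave \<delta> w t z = (1 + z) powr of_real (- \<delta>) * exp (\<i> * of_real t * w z)"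

lemma wave_weight:
  assumes z: "z \<in> half_strip" and \<delta>: "0 \<le> \<delta>"
  shows "cmod ((1 + z) powr of_real (- \<delta>)) \<le> 5 powr \<delta> * (1 + cmod z) powr (- \<delta>)"
proof -
  have p: "0 < (1 + cmod z) / 5" by (auto intro: add_pos_nonneg)
  have "cmod ((1 + z) powr of_real (- \<delta>)) = cmod (1 + z) powr (- \<delta>)"
    by (simp add: norm_powr_real_powr' del: of_real_minus)
  also have "\<dots> \<le> ((1 + cmod z) / 5) powr (- \<delta>)"
    using half_strip_one_plus(2)[OF z] p \<delta> by (intro powr_mono2') auto
  also have "\<dots> = 5 powr \<delta> * (1 + cmod z) powr (- \<delta>)"
    by (subst powr_divide) (auto simp: powr_minus field_simps intro: add_nonneg_nonneg)
  finally show ?thesis .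
qed

text \<open>Growth of order s in the second factor is paid for by the weight, which leaves decay of
  order \<gamma>.\<close>

lemma wave_bound:
  assumes z: "z \<in> half_strip" and \<delta>: "0 \<le> \<delta>" "\<gamma> + s \<le> \<delta>"
    and X: "cmod X \<le> K * (1 + cmod z) powr s" "0 \<le> K"
  shows "cmod ((1 + z) powr of_real (- \<delta>) * X) \<le> 5 powr \<delta> * K * (1 + cmod z) powr (- \<gamma>)"
proof -
  have "cmod ((1 + z) powr of_real (- \<delta>) * X) \<le> (5 powr \<delta> * (1 + cmod z) powr (- \<delta>)) * (K * (1 + cmod z) powr s)"
    unfolding norm_mult using wave_weight[OF z \<delta>(1)] X by (intro mult_mono) auto
  also have "\<dots> = 5 powr \<delta> * K * (1 + cmod z) powr (s - \<delta>)"
    by (simp add: powr_diff powr_minus field_simps)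
  also have "\<dots> \<le> 5 powr \<delta> * K * (1 + cmod z) powr (- \<gamma>)"
    using X(2) \<delta> by (intro mult_left_mono powr_mono) auto
  finally show ?thesis .
qed

text \<open>First differences, second differences, boundedness and the truncation error cost the
  powers 1, 3/2, 0 and 1 of 1 + |z|. The largest of them dictates \<gamma> + 3/2 <=
  \<delta>.\<close>

lemma wave_estimates:
  assumes z: "z \<in> half_strip" and \<delta>: "0 \<le> \<delta>" "\<gamma> + 3 / 2 \<le> \<delta>" and w: "\<bar>Im (w z)\<bar> \<le> 2" "cmod (w z) \<le> 2 * cmod z"
  shows "0 \<le> s \<Longrightarrow> s \<le> t \<Longrightarrow> t \<le> T \<Longrightarrow>
      cmod (wave \<delta> w t z - wave \<delta> w s z) \<le> 5 powr \<delta> * (2 * exp (2 * T) * (t - s)) * (1 + cmod z) powr (- \<gamma>)"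
    "0 \<le> t \<Longrightarrow> 0 < h \<Longrightarrow> t + 2 * h \<le> T \<Longrightarrow>
      cmod (2 * wave \<delta> w (t + h) z - wave \<delta> w t z - wave \<delta> w (t + 2 * h) z)
        \<le> 5 powr \<delta> * (16 * exp (6 * T) * (h * sqrt h)) * (1 + cmod z) powr (- \<gamma>)"
    "0 \<le> t \<Longrightarrow> cmod (wave \<delta> w t z) \<le> 5 powr \<delta> * exp (2 * t) * (1 + cmod z) powr (- \<gamma>)"
    "0 \<le> t \<Longrightarrow> 1 \<le> k \<Longrightarrow> cmod (w z - z) \<le> 2 * (cmod z)\<^sup>2 / k \<Longrightarrow>
      cmod (wave \<delta> w t z - wave \<delta> (\<lambda>z. z) t z) \<le> 5 powr \<delta> * (4 * (1 + t) * exp (2 * t) / sqrt k) * (1 + cmod z) powr (- \<gamma>)"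
proof -
  define a where "a = 1 + cmod z"
  have a: "1 \<le> a" "cmod z \<le> a" by (auto simp: a_def)
  { assume st: "0 \<le> s" "s \<le> t" "t \<le> T"
    have "exp (2 * T) * (cmod (w z) * (t - s)) \<le> exp (2 * T) * ((2 * a) * (t - s))"
      using w(2) a st by (intro mult_left_mono mult_right_mono) auto
    also have "\<dots> = (2 * exp (2 * T) * (t - s)) * a powr 1" using a by simp
    finally have "cmod (exp (\<i> * of_real t * w z) - exp (\<i> * of_real s * w z)) \<le> (2 * exp (2 * T) * (t - s)) * a powr 1"
      by (rule order.trans[OF oscillation_diff[OF w(1) st]])
    from wave_bound[OF z \<delta>(1) _ this[unfolded a_def], of \<gamma>]
    show "cmod (wave \<delta> w t z - wave \<delta> w s z) \<le> 5 powr \<delta> * (2 * exp (2 * T) * (t - s)) * (1 + cmod z) powr (- \<gamma>)"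
      using \<delta> st by (simp add: wave_def right_diff_distrib) }
  { assume th: "0 \<le> t" "0 < h" "t + 2 * h \<le> T"
    have "(2 * a) * h * sqrt ((2 * a) * h) = (2 * sqrt 2) * (h * sqrt h) * (a * sqrt a)"
      by (simp add: real_sqrt_mult)
    also have "a * sqrt a = a powr (3 / 2)"
    proof -
      have "a * sqrt a = a powr 1 * a powr (1 / 2)" using a(1) by (simp add: powr_half_sqrt)
      also have "\<dots> = a powr (3 / 2)" by (subst powr_add[symmetric]) simp
      finally show ?thesis .
    qed
    also have "(2 * sqrt 2) * (h * sqrt h) * a powr (3 / 2) \<le> (2 * 2) * (h * sqrt h) * a powr (3 / 2)"
      using th by (intro mult_right_mono mult_left_mono) (auto intro: real_le_lsqrt)
    finally have sq: "(2 * a) * h * sqrt ((2 * a) * h) \<le> (2 * 2) * (h * sqrt h) * a powr (3 / 2)" .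
    have "cmod (w z) \<le> 2 * a" using w(2) a(2) by linarith
    note oscillation_bend[OF w(1) this th]
    also have "4 * exp (6 * T) * ((2 * a) * h * sqrt ((2 * a) * h)) \<le> 4 * exp (6 * T) * ((2 * 2) * (h * sqrt h) * a powr (3 / 2))"
      by (intro mult_left_mono sq) auto
    also have "\<dots> = (16 * exp (6 * T) * (h * sqrt h)) * a powr (3 / 2)" by simp
    finally have "cmod (2 * exp (\<i> * of_real (t + h) * w z) - exp (\<i> * of_real t * w z) - exp (\<i> * of_real (t + 2 * h) * w z))
      \<le> (16 * exp (6 * T) * (h * sqrt h)) * a powr (3 / 2)" .
    from wave_bound[OF z \<delta>(1) _ this[unfolded a_def], of \<gamma>]
    have "cmod ((1 + z) powr of_real (- \<delta>) * (2 * exp (\<i> * of_real (t + h) * w z) - exp (\<i> * of_real t * w z) - exp (\<i> * of_real (t + 2 * h) * w z)))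
       \<le> 5 powr \<delta> * (16 * exp (6 * T) * (h * sqrt h)) * (1 + cmod z) powr (- \<gamma>)"
      using \<delta> th by simp
    thus "cmod (2 * wave \<delta> w (t + h) z - wave \<delta> w t z - wave \<delta> w (t + 2 * h) z)
        \<le> 5 powr \<delta> * (16 * exp (6 * T) * (h * sqrt h)) * (1 + cmod z) powr (- \<gamma>)"
      by (simp only: wave_def right_diff_distrib mult.left_commute[of _ 2]) }
  { assume t: "0 \<le> t"
    have "cmod (exp (\<i> * of_real t * w z)) \<le> exp (2 * t) * a powr 0"
      using oscillation_norm[OF w(1) t order.refl] a by simp
    from wave_bound[OF z \<delta>(1) _ this[unfolded a_def], of \<gamma>]
    show "cmod (wave \<delta> w t z) \<le> 5 powr \<delta> * exp (2 * t) * (1 + cmod z) powr (- \<gamma>)"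
      using \<delta> by (simp add: wave_def) }
  { assume t: "0 \<le> t" and k: "1 \<le> k" "cmod (w z - z) \<le> 2 * (cmod z)\<^sup>2 / k"
    have "sqrt (cmod (w z - z)) \<le> sqrt (2 * (cmod z)\<^sup>2 / k)" using k(2) by (rule real_sqrt_le_mono)
    also have "\<dots> = sqrt 2 * cmod z / sqrt k" by (simp add: real_sqrt_mult real_sqrt_divide)
    also have "\<dots> \<le> 2 * a / sqrt k" using a k by (intro divide_right_mono mult_mono) (auto intro: real_le_lsqrt)
    finally have s: "sqrt (cmod (w z - z)) \<le> 2 * a / sqrt k" .
    have z2: "\<bar>Im z\<bar> \<le> 2" using z by (simp add: half_strip_def)
    have "cmod (exp (\<i> * of_real t * w z) - exp (\<i> * of_real t * z)) \<le> 2 * (1 + t) * exp (2 * t) * (2 * a / sqrt k)"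
      by (rule order.trans[OF oscillation_limit[OF w(1) z2 t] mult_left_mono[OF s]]) (use t in auto)
    also have "2 * (1 + t) * exp (2 * t) * (2 * a / sqrt k) = (4 * (1 + t) * exp (2 * t) / sqrt k) * a powr 1"
      using a by (simp add: divide_inverse algebra_simps)
    finally have "cmod (exp (\<i> * of_real t * w z) - exp (\<i> * of_real t * z)) \<le> (4 * (1 + t) * exp (2 * t) / sqrt k) * a powr 1" .
    from wave_bound[OF z \<delta>(1) _ this[unfolded a_def], of \<gamma>]
    show "cmod (wave \<delta> w t z - wave \<delta> (\<lambda>z. z) t z) \<le> 5 powr \<delta> * (4 * (1 + t) * exp (2 * t) / sqrt k) * (1 + cmod z) powr (- \<gamma>)"
      using \<delta> t k by (simp add: wave_def right_diff_distrib) }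
qed

lemma holomorphic_wave:
  assumes "w holomorphic_on half_strip"
  shows "wave \<delta> w t holomorphic_on half_strip"
  unfolding wave_def[abs_def] using assms half_strip_one_plus(1) by (intro holomorphic_intros) auto

lemma holomorphic_trunc_id: "1 \<le> k \<Longrightarrow> trunc_id k holomorphic_on half_strip"
  unfolding trunc_id_def[abs_def] using trunc_id_bounds(1) by (intro holomorphic_intros) auto

lemma Hinf_exp:
  assumes "f \<in> Hinf \<theta>"
  shows "(\<lambda>z. exp (f z)) \<in> Hinf \<theta>"
proof -
  obtain B where B: "\<And>z. z \<in> sector \<theta> \<Longrightarrow> cmod (f z) \<le> B" using Hinf_bound[OF assms] by blast
  show ?thesis
  proof (rule HinfI[of _ _ "exp B"])
    fix z assume "z \<in> sector \<theta>"
    from order.trans[OF complex_Re_le_cmod B[OF this]] show "cmod (exp (f z)) \<le> exp B" by simp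
  qed (use assms in \<open>auto simp: Hinf_def intro!: holomorphic_intros tendsto_intros\<close>)
qed

lemma Hinf_trunc_id:
  assumes \<theta>: "0 < \<theta>" "\<theta> < pi" and k: "1 \<le> k"
  shows "trunc_id k \<in> Hinf \<theta>"
proof -
  obtain \<kappa> where \<kappa>: "\<kappa> > 0" "\<And>z. z \<in> sector \<theta> \<Longrightarrow> \<kappa> * (1 + cmod z) \<le> cmod (1 + z)"
    using sector_one_plus[OF \<theta>] by blast
  have lo: "\<kappa> * (k + cmod z) \<le> cmod (of_real k + z)" if z: "z \<in> sector \<theta>" for z
  proof -
    have "z / of_real k \<in> sector \<theta>" using z k by (simp add: sector_def Arg_divide_of_real)
    from mult_left_mono[OF \<kappa>(2)[OF this], of k] k
    have "\<kappa> * (k + cmod z) \<le> cmod (of_real k) * cmod (1 + z / of_real k)"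
      by (simp add: norm_divide algebra_simps)
    also have "\<dots> = cmod (of_real k * (1 + z / of_real k))" by (simp only: norm_mult)
    also have "of_real k * (1 + z / of_real k) = of_real k + z" using k by (simp add: distrib_left)
    finally show ?thesis .
  qed
  have nz: "of_real k + z \<noteq> 0" if "z \<in> sector \<theta>" for z
  proof -
    have "0 < \<kappa> * (k + cmod z)" using \<kappa>(1) k by (intro mult_pos_pos add_pos_nonneg) auto
    thus ?thesis using lo[OF that] by auto
  qed
  show ?thesis
  proof (rule HinfI[of _ _ "k / \<kappa>"])
    fix z assume z: "z \<in> sector \<theta>"
    have "\<kappa> * cmod z \<le> \<kappa> * (k + cmod z)" using \<kappa>(1) k by (intro mult_left_mono) auto
    hence "\<kappa> * cmod z \<le> cmod (of_real k + z)" using lo[OF z] by linarith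
    hence "k * (\<kappa> * cmod z) \<le> k * cmod (of_real k + z)" using k by (intro mult_left_mono) auto
    thus "cmod (trunc_id k z) \<le> k / \<kappa>"
      using nz[OF z] \<kappa>(1) k by (simp add: trunc_id_def norm_divide norm_mult field_simps)
  next
    show "trunc_id k holomorphic_on sector \<theta>"
      unfolding trunc_id_def[abs_def] using nz by (intro holomorphic_intros) auto
    show "(trunc_id k \<longlongrightarrow> trunc_id k 0) (at 0 within sector \<theta>)"
      unfolding trunc_id_def[abs_def] using k by (auto intro!: tendsto_eq_intros)
  qed
qed

lemma Hinf_wave:
  assumes "0 < \<theta>" "\<theta> < pi" "1 \<le> k" "0 \<le> \<delta>"
  shows "wave \<delta> (trunc_id k) t \<in> Hinf \<theta>"
  unfolding wave_def[abs_def]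
  using assms by (intro Hinf_mult Hinf_exp Hinf_const Hinf_trunc_id Hinf_one_plus_powr) auto

context separated_fspace
begin

lemma ndist_tendsto_lin:
  assumes "\<And>n::nat. u n \<in> elems X" "\<And>n. v n \<in> elems X" "x \<in> elems X" "y \<in> elems X"
    and "(\<lambda>n. ndist X (u n) x) \<longlonglongrightarrow> 0" "(\<lambda>n. ndist X (v n) y) \<longlonglongrightarrow> 0"
  shows "(\<lambda>n. ndist X (\<lambda>a. c * u n a + v n a) (\<lambda>a. c * x a + y a)) \<longlonglongrightarrow> 0"
proof (rule tendsto_sandwich[OF _ _ tendsto_const])
  have "ndist X (\<lambda>a. c * u n a + v n a) (\<lambda>a. c * x a + y a) \<le> cmod c * ndist X (u n) x + ndist X (v n) y" for n
  proof -
    have "(\<lambda>a. c * u n a + v n a - (c * x a + y a)) = (\<lambda>a. c * (u n a - x a) + (v n a - y a))"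
      by (simp add: algebra_simps)
    thus ?thesis
      unfolding ndist_def using nrm_add[OF scale_in[OF diff_in[OF assms(1,3)], of c n] diff_in[OF assms(2,4), of n]]
      by (simp add: nrm_scale diff_in assms)
  qed
  thus "\<forall>\<^sub>F n in sequentially. ndist X (\<lambda>a. c * u n a + v n a) (\<lambda>a. c * x a + y a) \<le> cmod c * ndist X (u n) x + ndist X (v n) y"
    by simp
  have "(\<lambda>n. cmod c * ndist X (u n) x + ndist X (v n) y) \<longlonglongrightarrow> cmod c * 0 + 0"
    by (intro tendsto_intros assms)
  thus "(\<lambda>n. cmod c * ndist X (u n) x + ndist X (v n) y) \<longlonglongrightarrow> 0" by simp
qed (simp add: ndist_nonneg lin_in assms)

lemma nrm_le_of_tendsto:
  assumes "\<And>n::nat. u n \<in> elems X" "x \<in> elems X" "(\<lambda>n. ndist X (u n) x) \<longlonglongrightarrow> 0" "\<And>n. nrm X (u n) \<le> B"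
  shows "nrm X x \<le> B"
proof -
  have "nrm X x \<le> ndist X (u n) x + B" for n
    using nrm_triangle_ndist[OF assms(2) assms(1)[of n]] ndist_commute[OF assms(2) assms(1)[of n]] assms(4)[of n] by linarith
  moreover have "(\<lambda>n. ndist X (u n) x + B) \<longlonglongrightarrow> 0 + B" by (intro tendsto_intros assms)
  ultimately show ?thesis using LIMSEQ_le_const[of "\<lambda>n. ndist X (u n) x + B" "0 + B" "nrm X x"] by auto
qed

end

section \<open>The path \<open>exp(itA)f\<close> as a limit of truncated waves\<close>

context hoermander_operator
begin

text \<open>Chains the calculus bound with Cauchy's estimates, so that operator norms are read off
  from weighted suprema over the half strip, at the smallest decay \<alpha> + 1/2 that the Sobolev
  estimate permits.\<close>

lemma W_strip_bound:
  assumes "test_function \<phi>" "1 / 2 < \<alpha>"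
  obtains C where "C \<ge> 0" "\<And>F x y B. F \<in> Hinf \<theta> \<Longrightarrow> W F x y \<Longrightarrow> F holomorphic_on half_strip \<Longrightarrow>
    (\<And>z. z \<in> half_strip \<Longrightarrow> cmod (F z) \<le> B * (1 + cmod z) powr - (\<alpha> + 1 / 2)) \<Longrightarrow> 0 \<le> B \<Longrightarrow> nrm X y \<le> C * B * nrm X x"
proof -
  obtain C1 where C1: "C1 \<ge> 0" "\<And>F x y. F \<in> Hinf \<theta> \<Longrightarrow> W F x y \<Longrightarrow> nrm X y \<le> C1 * \<bar>hnorm F\<bar> * nrm X x"
    by (rule W_bound) (rule that)
  obtain C2 where C2: "C2 \<ge> 0" "\<And>m f B. m holomorphic_on half_strip \<Longrightarrow>
      (\<And>z. z \<in> half_strip \<Longrightarrow> cmod (m z) \<le> B * (1 + cmod z) powr - (\<alpha> + 1 / 2)) \<Longrightarrow> 0 \<le> B \<Longrightarrow>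
      (\<And>x. x \<ge> 0 \<Longrightarrow> f x = m (complex_of_real x)) \<Longrightarrow>
      f \<in> hoermander \<phi> \<alpha> \<and> 0 \<le> hoermander_norm \<phi> \<alpha> f \<and> hoermander_norm \<phi> \<alpha> f \<le> C2 * B"
    by (rule hoermander_strip_bound[OF assms order.refl]) (rule that, assumption, blast)
  show ?thesis
  proof (rule that[of "C1 * C2"])
    fix F x y B assume F: "F \<in> Hinf \<theta>" "W F x y" "F holomorphic_on half_strip"
      "\<And>z. z \<in> half_strip \<Longrightarrow> cmod (F z) \<le> B * (1 + cmod z) powr - (\<alpha> + 1 / 2)" "0 \<le> (B::real)"
    have "0 \<le> hnorm F \<and> hnorm F \<le> C2 * B" using C2(2)[OF F(3,4,5), of "\<lambda>x. F (complex_of_real x)"] by simp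
    hence "C1 * \<bar>hnorm F\<bar> * nrm X x \<le> C1 * (C2 * B) * nrm X x"
      using C1(1) W_in(1)[OF F(2)] by (intro mult_right_mono mult_left_mono nrm_nonneg) auto
    thus "nrm X y \<le> C1 * C2 * B * nrm X x" using C1(2)[OF F(1,2)] by simp
  qed (use C1 C2 in simp)
qed

text \<open>Membership in the graph is stated for every v equal to \<open>u t\<close> modulo null
  functions, so that a continuous version can be substituted afterwards. The limit is taken on the
  closure of the range; the kernel part \<open>g1\<close> of (1+A)^\<delta> f is added unchanged,
  since the multiplier equals 1 at 0.\<close>

lemma hoermander_path:
  assumes \<phi>: "test_function \<phi>" "1 / 2 < \<alpha>" and \<delta>: "\<alpha> + 2 \<le> \<delta>" and f: "f \<in> Domain (frac_pow X A \<theta> \<delta>)"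
    and complete: "\<And>g :: nat \<Rightarrow> 'a \<Rightarrow> complex. (\<And>n. g n \<in> elems X) \<Longrightarrow> summable (\<lambda>n. nrm X (g n)) \<Longrightarrow>
        \<exists>f\<in>elems X. (\<lambda>k. ndist X (\<lambda>a. \<Sum>n<k. g n a) f) \<longlonglongrightarrow> 0"
  obtains u C where "\<And>t. 0 \<le> t \<Longrightarrow> u t \<in> elems X"
    "\<And>t v. 0 \<le> t \<Longrightarrow> v \<in> elems X \<Longrightarrow> ndist X v (u t) = 0 \<Longrightarrow> (f, v) \<in> exp_itA X A \<phi> \<alpha> \<theta> \<delta> t"
    "\<And>T. 0 \<le> C T" "\<And>s t T. 0 \<le> s \<Longrightarrow> s \<le> t \<Longrightarrow> t \<le> T \<Longrightarrow> ndist X (u t) (u s) \<le> C T * (t - s)"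
    "\<And>t h T. 0 \<le> t \<Longrightarrow> 0 < h \<Longrightarrow> t + 2 * h \<le> T \<Longrightarrow>
      nrm X (\<lambda>a. 2 * u (t + h) a - u t a - u (t + 2 * h) a) \<le> C T * (h * sqrt h)"
proof -
  define \<gamma> where "\<gamma> = \<alpha> + 1 / 2"
  have \<gamma>\<delta>: "0 \<le> \<delta>" "\<gamma> + 3 / 2 \<le> \<delta>" using \<phi>(2) \<delta> by (auto simp: \<gamma>_def)
  obtain g where g: "(f, g) \<in> one_plus_frac_pow X A \<theta> \<delta>" by (rule domain_one_plus_frac_pow[OF f]) (rule that)
  obtain k :: nat and w where gw: "(g, w) \<in> hol_calc X A \<theta> (\<lambda>z. 1 / (1 + z) ^ k)"
    using g by (auto simp: one_plus_frac_pow_def ext_hol_calc_def)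
  have "(\<lambda>z. (1 / (1 + z)) ^ k) \<in> Hinf \<theta>" by (intro Hinf_power Hinf_inverse_one_plus \<theta>)
  hence "(\<lambda>z. 1 / (1 + z) ^ k) \<in> Hinf \<theta>" by (simp add: power_one_over)
  from hol_calcE[OF gw this] obtain g0 g1 where g01: "g0 \<in> Z" "g1 \<in> ker_op X A" "g \<in> elems X"
    "\<And>l. bfun X l \<Longrightarrow> l g = l g0 + l g1"
    using W_in(3) by metis
  have g1: "g1 \<in> elems X" by (rule ker_in[OF g01(2)])
  have g0n: "0 \<le> nrm X g0" by (intro nrm_nonneg Z_in g01(1))

  \<comment> \<open>The truncation error is O(k^(-1/2)), so k = 4^n yields the summable rate
    2^-n.\<close>
  define F where "F n t = wave \<delta> (trunc_id (4 ^ n)) t" for n :: nat and t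
  define m where "m t = wave \<delta> (\<lambda>z. z) t" for t
  have F_Hinf: "F n t \<in> Hinf \<theta>" for n t
    unfolding F_def using \<theta> \<gamma>\<delta> by (intro Hinf_wave) auto
  have F_hol: "F n t holomorphic_on half_strip" for n t
    unfolding F_def by (intro holomorphic_wave holomorphic_trunc_id) simp
  have m_hol: "m t holomorphic_on half_strip" for t
    unfolding m_def by (intro holomorphic_wave holomorphic_intros)
  note est = wave_estimates[where \<gamma> = \<gamma> and \<delta> = \<delta> and w = "trunc_id (4 ^ n)" for n, OF _ \<gamma>\<delta> trunc_id_bounds(2,3), folded F_def m_def]
  define y where "y n t = (SOME y. W (F n t) g0 y)" for n t
  have "\<exists>y. W (F n t) g0 y" for n t
    by (rule W_exists[OF F_Hinf g01(1)]) (rule exI)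
  hence y: "W (F n t) g0 (y n t)" for n t
    unfolding y_def by (rule someI_ex)
  note yX = W_in(2)[OF y]
  obtain C0 where C0': "C0 \<ge> 0" "\<And>F x y B. F \<in> Hinf \<theta> \<Longrightarrow> W F x y \<Longrightarrow> F holomorphic_on half_strip \<Longrightarrow>
    (\<And>z. z \<in> half_strip \<Longrightarrow> cmod (F z) \<le> B * (1 + cmod z) powr - (\<alpha> + 1 / 2)) \<Longrightarrow> 0 \<le> B \<Longrightarrow> nrm X y \<le> C0 * B * nrm X x"
    by (rule W_strip_bound[OF \<phi>]) (rule that, assumption, blast)
  note C0 = C0'[folded \<gamma>_def]

  have W_diff: "(\<lambda>z. c * G z + H z) \<in> Hinf \<theta>" if "G \<in> Hinf \<theta>" "H \<in> Hinf \<theta>" for c G H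
    using that by (intro Hinf_add Hinf_mult Hinf_const)
  have diff: "ndist X (y n t) (y n s) \<le> C0 * (5 powr \<delta> * (2 * exp (2 * T) * (t - s))) * nrm X g0"
    if st: "0 \<le> s" "s \<le> t" "t \<le> T" for n s t T
  proof -
    have "nrm X (\<lambda>a. - 1 * y n s a + y n t a) \<le> C0 * (5 powr \<delta> * (2 * exp (2 * T) * (t - s))) * nrm X g0"
    proof (rule C0(2)[OF W_diff[OF F_Hinf F_Hinf] W_lin_fun[OF F_Hinf F_Hinf y y]])
      fix z assume "z \<in> half_strip"
      from est(1)[OF this this _ this _ st] show "cmod (- 1 * F n s z + F n t z) \<le> 5 powr \<delta> * (2 * exp (2 * T) * (t - s)) * (1 + cmod z) powr - \<gamma>"
        by simp
    qed (use st in \<open>auto intro!: holomorphic_intros F_hol\<close>)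
    thus ?thesis by (simp add: ndist_def)
  qed
  have bend: "nrm X (\<lambda>a. 2 * y n (t + h) a - y n t a - y n (t + 2 * h) a) \<le> C0 * (5 powr \<delta> * (16 * exp (6 * T) * (h * sqrt h))) * nrm X g0"
    if th: "0 \<le> t" "0 < h" "t + 2 * h \<le> T" for n t h T
  proof -
    \<comment> \<open>The second difference is built by three linear combinations with one
      coefficient each, 2F being written as F + F.\<close>
    note F1 = W_diff[OF F_Hinf[of n "t + h"] F_Hinf[of n "t + h"], of 1]
      and W1 = W_lin_fun[OF F_Hinf[of n "t + h"] F_Hinf[of n "t + h"] y y, of 1]
    note F2 = W_diff[OF F_Hinf[of n "t + 2 * h"] F1, of "- 1"] and W2 = W_lin_fun[OF F_Hinf[of n "t + 2 * h"] F1 y W1, of "- 1"]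
    note F3 = W_diff[OF F_Hinf[of n t] F2, of "- 1"] and W3 = W_lin_fun[OF F_Hinf[of n t] F2 y W2, of "- 1"]
    have "nrm X (\<lambda>a. - 1 * y n t a + (- 1 * y n (t + 2 * h) a + (1 * y n (t + h) a + y n (t + h) a)))
        \<le> C0 * (5 powr \<delta> * (16 * exp (6 * T) * (h * sqrt h))) * nrm X g0"
    proof (rule C0(2)[OF F3 W3])
      fix z assume z: "z \<in> half_strip"
      have eq: "- 1 * F n t z + (- 1 * F n (t + 2 * h) z + (1 * F n (t + h) z + F n (t + h) z))
         = 2 * F n (t + h) z - F n t z - F n (t + 2 * h) z" by simp
      show "cmod (- 1 * F n t z + (- 1 * F n (t + 2 * h) z + (1 * F n (t + h) z + F n (t + h) z)))
          \<le> 5 powr \<delta> * (16 * exp (6 * T) * (h * sqrt h)) * (1 + cmod z) powr - \<gamma>"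
        unfolding eq by (rule est(2)[OF z z _ z _ th]) simp_all
    qed (use th in \<open>auto intro!: holomorphic_intros F_hol\<close>)
    moreover have "(\<lambda>a. - 1 * y n t a + (- 1 * y n (t + 2 * h) a + (1 * y n (t + h) a + y n (t + h) a)))
       = (\<lambda>a. 2 * y n (t + h) a - y n t a - y n (t + 2 * h) a)" by (simp add: fun_eq_iff)
    ultimately show ?thesis by simp
  qed

  define K where "K t = 5 powr \<delta> * (4 * (1 + t) * exp (2 * t))" for t :: real
  have K: "0 \<le> K t" if "0 \<le> t" for t using that by (simp add: K_def)
  have Fm: "cmod (F n t z - m t z) \<le> K t * (1 / 2) ^ n * (1 + cmod z) powr - \<gamma>" if t: "0 \<le> t" and z: "z \<in> half_strip" for n t z
  proof -
    have "sqrt (4 ^ n) = 2 ^ n" by (simp add: real_sqrt_power)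
    thus ?thesis
      using est(4)[OF z z _ z _ t _ trunc_id_bounds(4)[OF z], of n] by (simp add: K_def power_one_over)
  qed
  have "\<exists>yl\<in>elems X. (\<lambda>n. ndist X (y n t) yl) \<longlonglongrightarrow> 0" if t: "0 \<le> t" for t
  proof -
    define d where "d n a = y (Suc n) t a - y n t a" for n a
    have dX: "d n \<in> elems X" for n unfolding d_def[abs_def] by (intro diff_in yX)
    have dn: "nrm X (d n) \<le> C0 * (K t * 2) * nrm X g0 * (1 / 2) ^ n" for n
    proof -
      have "nrm X (\<lambda>a. - 1 * y n t a + y (Suc n) t a) \<le> C0 * (K t * 2 * (1 / 2) ^ n) * nrm X g0"
      proof (rule C0(2)[OF W_diff[OF F_Hinf F_Hinf] W_lin_fun[OF F_Hinf F_Hinf y y]])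
        fix z assume z: "z \<in> half_strip"
        have "- 1 * F n t z + F (Suc n) t z = (F (Suc n) t z - m t z) - (F n t z - m t z)" by simp
        hence "cmod (- 1 * F n t z + F (Suc n) t z) \<le> cmod (F (Suc n) t z - m t z) + cmod (F n t z - m t z)"
          by (simp only: norm_triangle_ineq4)
        also have "\<dots> \<le> K t * (1 / 2) ^ Suc n * (1 + cmod z) powr - \<gamma> + K t * (1 / 2) ^ n * (1 + cmod z) powr - \<gamma>"
          by (intro add_mono Fm t z)
        also have "\<dots> \<le> K t * (1 / 2) ^ n * (1 + cmod z) powr - \<gamma> + K t * (1 / 2) ^ n * (1 + cmod z) powr - \<gamma>"
          using K[OF t] by (intro add_mono mult_right_mono mult_left_mono power_decreasing) auto
        finally show "cmod (- 1 * F n t z + F (Suc n) t z) \<le> K t * 2 * (1 / 2) ^ n * (1 + cmod z) powr - \<gamma>" by simp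
      qed (use K[OF t] in \<open>auto intro!: holomorphic_intros F_hol\<close>)
      moreover have "(\<lambda>a. - 1 * y n t a + y (Suc n) t a) = d n" by (simp add: d_def[abs_def])
      ultimately show ?thesis by (simp add: mult_ac)
    qed
    have "summable (\<lambda>n. C0 * (K t * 2) * nrm X g0 * (1 / 2) ^ n)" by (intro summable_mult summable_geometric) simp
    hence "summable (\<lambda>n. nrm X (d n))"
      by (rule summable_comparison_test'[of _ 0]) (use dn dX nrm_nonneg in auto)
    from complete[OF dX this] obtain e where e: "e \<in> elems X" "(\<lambda>k. ndist X (\<lambda>a. \<Sum>n<k. d n a) e) \<longlonglongrightarrow> 0" by blast
    have "ndist X (\<lambda>a. \<Sum>n<k. d n a) e = ndist X (y k t) (\<lambda>a. y 0 t a + e a)" for k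
    proof -
      have "(\<Sum>n<k. d n a) = y k t a - y 0 t a" for a
        unfolding d_def by (rule sum_lessThan_telescope)
      thus ?thesis by (simp add: ndist_def diff_diff_eq)
    qed
    thus ?thesis using e add_in[OF yX[of 0 t] e(1)] by auto
  qed
  note limit_ex = this
  define yl where "yl t = (SOME e. e \<in> elems X \<and> (\<lambda>n. ndist X (y n t) e) \<longlonglongrightarrow> 0)" for t
  have "yl t \<in> elems X \<and> (\<lambda>n. ndist X (y n t) (yl t)) \<longlonglongrightarrow> 0" if t: "0 \<le> t" for t
    unfolding yl_def using limit_ex[OF t, unfolded Bex_def] by (rule someI_ex)
  hence yl: "\<And>t. 0 \<le> t \<Longrightarrow> yl t \<in> elems X" "\<And>t. 0 \<le> t \<Longrightarrow> (\<lambda>n. ndist X (y n t) (yl t)) \<longlonglongrightarrow> 0"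
    by blast+

  define u where "u t a = yl t a + g1 a" for t a
  have uX: "u t \<in> elems X" if "0 \<le> t" for t unfolding u_def[abs_def] by (intro add_in yl(1) that g1)
  \<comment> \<open>One constant for both estimates: 16 e^(6T) comes from the second differences, 2
    e^(2T) from the first.\<close>
  define D where "D T = C0 * (5 powr \<delta> * (16 * exp (6 * T) + 2 * exp (2 * T))) * nrm X g0" for T :: real
  have le: "C0 * (5 powr \<delta> * (b * r)) * nrm X g0 \<le> D T * r"
    if "b \<le> 16 * exp (6 * T) + 2 * exp (2 * T)" "0 \<le> r" for b r T
  proof -
    have "C0 * (5 powr \<delta> * (b * r)) * nrm X g0 \<le> C0 * (5 powr \<delta> * ((16 * exp (6 * T) + 2 * exp (2 * T)) * r)) * nrm X g0"
      using that C0(1) g0n by (intro mult_right_mono mult_left_mono) auto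
    thus ?thesis by (simp add: D_def mult_ac)
  qed
  show ?thesis
  proof (rule that[of u D])
    show "0 \<le> D T" for T using C0(1) g0n by (simp add: D_def)
  next
    fix s t T :: real assume st: "0 \<le> s" "s \<le> t" "t \<le> T"
    have t0: "0 \<le> t" using st by simp
    have "nrm X (\<lambda>a. - 1 * yl s a + yl t a) \<le> D T * (t - s)"
    proof (rule nrm_le_of_tendsto)
      show "(\<lambda>n. ndist X (\<lambda>a. - 1 * y n s a + y n t a) (\<lambda>a. - 1 * yl s a + yl t a)) \<longlonglongrightarrow> 0"
        by (intro ndist_tendsto_lin yX yl st(1) t0)
      fix n
      have "nrm X (\<lambda>a. - 1 * y n s a + y n t a) = ndist X (y n t) (y n s)" by (simp add: ndist_def)
      also have "\<dots> \<le> C0 * (5 powr \<delta> * (2 * exp (2 * T) * (t - s))) * nrm X g0" by (rule diff[OF st])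
      also have "\<dots> \<le> D T * (t - s)" using st by (intro le) auto
      finally show "nrm X (\<lambda>a. - 1 * y n s a + y n t a) \<le> D T * (t - s)" .
    qed (intro lin_in yX yl(1) st(1) t0)+
    thus "ndist X (u t) (u s) \<le> D T * (t - s)" by (simp add: ndist_def u_def)
  next
    fix t h T :: real assume th: "0 \<le> t" "0 < h" "t + 2 * h \<le> T"
    have nn: "0 \<le> t + h" "0 \<le> t + 2 * h" using th by auto
    have "nrm X (\<lambda>a. - 1 * yl t a + (- 1 * yl (t + 2 * h) a + (1 * yl (t + h) a + yl (t + h) a))) \<le> D T * (h * sqrt h)"
    proof (rule nrm_le_of_tendsto)
      show "(\<lambda>n. ndist X (\<lambda>a. - 1 * y n t a + (- 1 * y n (t + 2 * h) a + (1 * y n (t + h) a + y n (t + h) a)))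
         (\<lambda>a. - 1 * yl t a + (- 1 * yl (t + 2 * h) a + (1 * yl (t + h) a + yl (t + h) a)))) \<longlonglongrightarrow> 0"
        by (intro ndist_tendsto_lin lin_in yX yl th(1) nn)
      fix n
      have "nrm X (\<lambda>a. - 1 * y n t a + (- 1 * y n (t + 2 * h) a + (1 * y n (t + h) a + y n (t + h) a)))
         = nrm X (\<lambda>a. 2 * y n (t + h) a - y n t a - y n (t + 2 * h) a)"
        by (rule arg_cong[of _ _ "nrm X"]) (simp add: fun_eq_iff)
      also have "\<dots> \<le> C0 * (5 powr \<delta> * (16 * exp (6 * T) * (h * sqrt h))) * nrm X g0" by (rule bend[OF th])
      also have "\<dots> \<le> D T * (h * sqrt h)" using th by (intro le) auto
      finally show "nrm X (\<lambda>a. - 1 * y n t a + (- 1 * y n (t + 2 * h) a + (1 * y n (t + h) a + y n (t + h) a)))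
         \<le> D T * (h * sqrt h)" .
    qed (intro lin_in yX yl(1) th(1) nn)+
    \<comment> \<open>The kernel part cancels: 2 g1 - g1 - g1 = 0.\<close>
    moreover have "(\<lambda>a. - 1 * yl t a + (- 1 * yl (t + 2 * h) a + (1 * yl (t + h) a + yl (t + h) a)))
        = (\<lambda>a. 2 * u (t + h) a - u t a - u (t + 2 * h) a)" by (simp add: fun_eq_iff u_def)
    ultimately show "nrm X (\<lambda>a. 2 * u (t + h) a - u t a - u (t + 2 * h) a) \<le> D T * (h * sqrt h)" by simp
  next
    fix t v assume t: "(0::real) \<le> t" and v: "v \<in> elems X" "ndist X v (u t) = 0"
    define mm where "mm l = complex_of_real ((1 + l) powr (- \<delta>)) * cis (t * l)" for l
    \<comment> \<open>For l >= 0 the base 1 + l is positive, the complex power agrees with the real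
      one, and the two descriptions of the multiplier coincide.\<close>
    have mm: "mm l = m t (complex_of_real l)" if "0 \<le> l" for l
    proof -
      have "(1 + complex_of_real l) powr complex_of_real (- \<delta>) = complex_of_real ((1 + l) powr (- \<delta>))"
        using powr_of_real[of "1 + l" "- \<delta>"] that by simp
      thus ?thesis by (simp add: mm_def m_def wave_def cis_conv_exp mult.assoc)
    qed
    obtain C2 where C2': "C2 \<ge> 0" "\<And>m f B. m holomorphic_on half_strip \<Longrightarrow>
      (\<And>z. z \<in> half_strip \<Longrightarrow> cmod (m z) \<le> B * (1 + cmod z) powr - (\<alpha> + 1 / 2)) \<Longrightarrow> 0 \<le> B \<Longrightarrow>
      (\<And>x. x \<ge> 0 \<Longrightarrow> f x = m (complex_of_real x)) \<Longrightarrow>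
      f \<in> hoermander \<phi> \<alpha> \<and> 0 \<le> hoermander_norm \<phi> \<alpha> f \<and> hoermander_norm \<phi> \<alpha> f \<le> C2 * B"
      by (rule hoermander_strip_bound[OF \<phi> order.refl]) (rule that, assumption, blast)
    note C2 = C2'[folded \<gamma>_def]
    have "(g, v) \<in> hoermander_calc X A \<phi> \<alpha> \<theta> mm"
    proof (rule hoermander_calc_limit[OF g01(2,3) v(1) yl(1)[OF t] g01(4) _ F_Hinf y yl(2)[OF t]])
      fix l assume l: "bfun X l"
      have "l v = l (u t)" using v l uX[OF t] by (auto simp: ndist_eq_0_iff)
      also have "\<dots> = l (yl t) + l g1" unfolding u_def[abs_def] by (intro bfun_add l yl(1) t g1)
      finally show "l v = l (yl t) + mm 0 * l g1" by (simp add: mm_def)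
    next
      have "cmod (m t z) \<le> 5 powr \<delta> * exp (2 * t) * (1 + cmod z) powr - \<gamma>" if z: "z \<in> half_strip" for z
        unfolding m_def by (rule wave_estimates(3)[OF z \<gamma>\<delta> _ _ t]) (use z in \<open>auto simp: half_strip_def\<close>)
      from C2(2)[OF m_hol this _ mm] show "mm \<in> hoermander \<phi> \<alpha>" by simp
    next
      \<comment> \<open>Multiplication by \<rho>, bounded by 25 on the half strip, keeps the rate
        2^-n.\<close>
      let ?q = "\<lambda>n. hoermander_norm \<phi> \<alpha> (\<lambda>l. regul (complex_of_real l) * F n t (complex_of_real l) - regul (complex_of_real l) * mm l)"
      have q: "0 \<le> ?q n \<and> ?q n \<le> C2 * (25 * K t * (1 / 2) ^ n)" for n
      proof -
        have "(\<lambda>l. regul (complex_of_real l) * F n t (complex_of_real l) - regul (complex_of_real l) * mm l) \<in> hoermander \<phi> \<alpha> \<and>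
           0 \<le> ?q n \<and> ?q n \<le> C2 * (25 * K t * (1 / 2) ^ n)"
        proof (rule C2(2))
          show "(\<lambda>z. regul z * (F n t z - m t z)) holomorphic_on half_strip"
          proof -
            have "1 + z \<noteq> 0" if "z \<in> half_strip" for z using half_strip_one_plus(1)[OF that] by auto
            hence "regul holomorphic_on half_strip"
              unfolding regul_def[abs_def] by (intro holomorphic_intros) auto
            thus ?thesis by (intro holomorphic_intros F_hol m_hol)
          qed
          fix z assume z: "z \<in> half_strip"
          have "cmod (regul z * (F n t z - m t z)) \<le> 25 * (K t * (1 / 2) ^ n * (1 + cmod z) powr - \<gamma>)"
            unfolding norm_mult by (intro mult_mono cmod_regul_le Fm z t) auto
          thus "cmod (regul z * (F n t z - m t z)) \<le> 25 * K t * (1 / 2) ^ n * (1 + cmod z) powr - \<gamma>" by simp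
        qed (use K[OF t] in \<open>auto simp: mm right_diff_distrib\<close>)
        thus ?thesis by blast
      qed
      have "(\<lambda>n. C2 * (25 * K t * (1 / 2) ^ n)) \<longlonglongrightarrow> C2 * (25 * K t * 0)"
        by (intro tendsto_intros LIMSEQ_power_zero) simp
      hence lim: "(\<lambda>n. C2 * (25 * K t * (1 / 2) ^ n)) \<longlonglongrightarrow> 0" by simp
      show "?q \<longlonglongrightarrow> 0"
        by (rule tendsto_sandwich[OF _ _ tendsto_const lim]) (use q in auto)
    qed
    thus "(f, v) \<in> exp_itA X A \<phi> \<alpha> \<theta> \<delta> t"
      unfolding exp_itA_def mm_def[abs_def] using g by blast
  qed (rule uX)
qed

end

theorem theorem1p6:
  fixes M :: "'x measure" and N :: "'w measure" and Y :: "'w fspace"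
    and T :: "real \<Rightarrow> ('x \<Rightarrow> complex) \<Rightarrow> ('x \<Rightarrow> complex)"
    and A0 :: "'x graph" and X :: "('x \<times> 'w) fspace" and A :: "('x \<times> 'w) graph"
    and \<phi> :: "real \<Rightarrow> complex" and p \<alpha> \<theta> \<delta> r :: real and s :: ereal
    and f :: "'x \<times> 'w \<Rightarrow> complex"
  assumes "sigma_finite_measure M" and "sigma_finite_measure N"
    and "koethe_space N Y" and "UMD N Y"
    and "1 < p" and X: "X = Lp_bochner M N Y p"
    and "C0_semigroup (Lp M p) T" and "contractive (Lp M p) T"
    and "lattice_positive M (Lp M p) T"
    and A0: "A0 = neg_generator (Lp M p) T"
    and A: "A = tensor_id M N Y p A0"
    and "1/2 < \<alpha>" and "test_function \<phi>" and "0 < \<theta>" and "\<theta> < pi"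
    and "bounded_hoermander_calc X A \<phi> \<alpha> \<theta>"
    and "has_type X r" and "has_cotype X s"
    and "\<delta> > \<alpha> + max (1/2) (1 / r - real_of_ereal (1 / s)) + 3/2"
    and "f \<in> Domain (frac_pow X A \<theta> \<delta>)"
  shows "(\<exists>u. (\<forall>t>0. (f, u t) \<in> exp_itA X A \<phi> \<alpha> \<theta> \<delta> t) \<and>
              (AE z in M \<Otimes>\<^sub>M N. continuous_on {0<..} (\<lambda>t. u t z))) \<and>
         (\<exists>u. (\<forall>t>0. (f, u t) \<in> exp_itA X A \<phi> \<alpha> \<theta> \<delta> t) \<and>
              (AE x in M. (\<forall>t>0. (\<lambda>w. u t (x, w)) \<in> elems Y) \<and>
                 (\<forall>t>0. ((\<lambda>t'. ndist Y (\<lambda>w. u t' (x, w)) (\<lambda>w. u t (x, w))) \<longlongrightarrow> 0) (at t))))"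
proof -
  interpret L: Lp_koethe N Y M p
    by (intro Lp_koethe.intro koethe.intro Lp_koethe_axioms.intro) (fact assms)+
  have sep: "separated_fspace X" unfolding X by (rule L.X_separated_fspace)
  have zs: "zero_sectorial X A" using assms by (simp add: bounded_hoermander_calc_def)
  interpret H: hoermander_operator X A \<phi> \<alpha> \<theta>
    by (intro hoermander_operator.intro sectorial_operator.intro hoermander_operator_axioms.intro sectorial_operator_axioms.intro sep zs)
       (use assms in auto)
  \<comment> \<open>The maximum is at least 1/2, and 1/2 + 3/2 = 2.\<close>
  have \<delta>: "\<alpha> + 2 \<le> \<delta>"
    using assms max.cobounded1[of "1/2" "1 / r - real_of_ereal (1 / s)"] by linarith
  obtain u C where u: "\<And>t. 0 \<le> t \<Longrightarrow> u t \<in> elems X"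
    "\<And>t v. 0 \<le> t \<Longrightarrow> v \<in> elems X \<Longrightarrow> ndist X v (u t) = 0 \<Longrightarrow> (f, v) \<in> exp_itA X A \<phi> \<alpha> \<theta> \<delta> t"
    "\<And>T. 0 \<le> C T" "\<And>s t T. 0 \<le> s \<Longrightarrow> s \<le> t \<Longrightarrow> t \<le> T \<Longrightarrow> ndist X (u t) (u s) \<le> C T * (t - s)"
    "\<And>t h T. 0 \<le> t \<Longrightarrow> 0 < h \<Longrightarrow> t + 2 * h \<le> T \<Longrightarrow>
      nrm X (\<lambda>a. 2 * u (t + h) a - u t a - u (t + 2 * h) a) \<le> C T * (h * sqrt h)"
    by (rule H.hoermander_path[OF \<open>test_function \<phi>\<close> \<open>1/2 < \<alpha>\<close> \<delta> \<open>f \<in> Domain (frac_pow X A \<theta> \<delta>)\<close>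
          L.X_complete_series[folded X]]) (assumption+, rule that)
  have lip: "\<exists>C\<ge>0. \<forall>s t. 0 \<le> s \<longrightarrow> s \<le> t \<longrightarrow> t \<le> real K \<longrightarrow> ndist X (u t) (u s) \<le> C * (t - s)" for K
    using u(3,4) by blast
  have bend: "\<exists>C\<ge>0. \<forall>t h. 0 \<le> t \<longrightarrow> 0 < h \<longrightarrow> t + 2 * h \<le> real K \<longrightarrow>
      nrm X (\<lambda>z. 2 * u (t + h) z - u t z - u (t + 2 * h) z) \<le> C * (h * sqrt h)" for K
    using u(3,5) by blast
  note path = u(1)[unfolded X] lip[unfolded X] bend[unfolded X]
  \<comment> \<open>One choice of representatives for all times at once; it serves both
    assertions.\<close>
  define v where "v t z = dyadic_limit (\<lambda>s. u s z) t" for t z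
  have v: "(f, v t) \<in> exp_itA X A \<phi> \<alpha> \<theta> \<delta> t" if "0 < t" for t
    using that L.dyadic_limit_in[OF path, of t] unfolding v_def[abs_def] X[symmetric] by (intro u(2)) auto
  have cont: "AE z in M \<Otimes>\<^sub>M N. continuous_on {0<..} (\<lambda>t. v t z)"
    unfolding v_def by (rule L.AE_continuous_dyadic_limit[OF path])
  have section_cont: "AE x in M. (\<forall>t>0. (\<lambda>w. v t (x, w)) \<in> elems Y) \<and>
      (\<forall>t>0. ((\<lambda>t'. ndist Y (\<lambda>w. v t' (x, w)) (\<lambda>w. v t (x, w))) \<longlongrightarrow> 0) (at t))"
    unfolding v_def
    by (rule eventually_mono[OF L.AE_section_continuous_dyadic_limit[OF path]]) auto
  show ?thesis using v cont section_cont by blast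
qed

end
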